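(* Let $\mathcal G$ be a (not necessarily Hausdorff) étale groupoid with locally compact Hausdorff unit space $X=\mathcal G^{(0)}$, equipped with a Fell line bundle $\mathcal L$. Let $A=C_0(X)$ and let $B$ be either $C^*(\mathcal G,\mathcal L)$ or $C^*_{\mathrm{red}}(\mathcal G,\mathcal L)$. Then: (i) A point $x\in X$ is free relative to $(A,B)$ if and only if the isotropy group $\mathcal G(x)$ coincides with $\{x\}$. (ii) $(C_0(X),C^*(\mathcal G,\mathcal L))$ is a topologically free inclusion if and only if $\mathcal G$ is a topologically free groupoid. (iii) $(C_0(X),C^*_{\mathrm{red}}(\mathcal G,\mathcal L))$ is a topologically free inclusion if and only if $\mathcal G$ is a topologically free groupoid. (iv) If $x$ is a free point in $X$, then the localizing projection $E_x$ associated to $x$ is given by $E_x(f)=f(x)$ for all $f\in B$.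
   Context: GROUPOIDS. An étale groupoid is a topological groupoid $\mathcal G$ (not necessarily Hausdorff) whose unit space $X$ is locally compact Hausdorff and whose range map $r:\mathcal G\to X$ (hence also the source map $s$) is a local homeomorphism. $\mathcal G(x)=\{\gamma:s(\gamma)=r(\gamma)=x\}$; $\mathcal G$ is topologically free if $\{x\in X:\mathcal G(x)=\{x\}\}$ is dense in $X$. An open bisection is an open $U\subseteq\mathcal G$ on which $r$ and $s$ are injective. A Fell line bundle over $\mathcal G$ is a topological space $\mathcal L=\bigsqcup_{\gamma}\mathcal L_\gamma$ of one-dimensional complex Banach spaces, restricting to a continuous Banach bundle on every open bisection, with a continuous, bilinear, associative, submultiplicative multiplication $\mathcal L_{\gamma_1}\times\mathcal L_{\gamma_2}\to\mathcal L_{\gamma_1\gamma_2}$ (for composable pairs) and a continuous conjugate-linear, involutive, antimultiplicative adjoint $\mathcal L_\gamma\to\mathcal L_{\gamma^{-1}}$ with $\|\xi^*\xi\|=\|\xi\|^2$ and $\xi^*\xi\ge0$. For $x\in X$, $\mathcal L_x\cong\mathbb C$ canonically. For an open bisection $U$, $\mathscr C_c(U,\mathcal L)$ is the set of sections obtained by extending by zero the continuous compactly supported sections over $U$; $\mathscr C_c(\mathcal G,\mathcal L)$ is their linear span, a $*$-algebra with $(f*g)(\gamma)=\sum_{\gamma_1\gamma_2=\gamma}f(\gamma_1)g(\gamma_2)$, $f^*(\gamma)=f(\gamma^{-1})^*$. $C^*(\mathcal G,\mathcal L)$ is its completion in the largest C*-norm. $C^*_{\mathrm{red}}(\mathcal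 G,\mathcal L)$ is its completion in $\|f\|_{\mathrm{red}}=\sup_{x\in X}\|\pi_x(f)\|$, where $\pi_x$ acts on the square-summable sections of $\mathcal L$ over $\mathcal G_x=s^{-1}(x)$ by $(\pi_x(f)\xi)(\gamma)=\sum_{\gamma_1\gamma_2=\gamma}f(\gamma_1)\xi(\gamma_2)$. Both contain $C_0(X)$ as the closure of $C_c(X)$. Evaluation $f\mapsto f(\gamma)\in\mathcal L_\gamma$ on $\mathscr C_c(\mathcal G,\mathcal L)$ extends continuously to $C^*_{\mathrm{red}}(\mathcal G,\mathcal L)$, and to $C^*(\mathcal G,\mathcal L)$ through the canonical surjection $\Lambda:C^*(\mathcal G,\mathcal L)\to C^*_{\mathrm{red}}(\mathcal G,\mathcal L)$; this defines $f(x)$. INCLUSIONS. For $x\in X$, $\varphi_x$ is evaluation at $x$ on $A$ and $J_x=\ker\varphi_x$. $x$ is free relative to $(A,B)$ if $\varphi_x$ has a unique extension to a state of $B$. The (regular) inclusion $(A,B)$ is topologically free if the set of free points is dense in $X$. With products and sums of subspaces denoting closed linear spans, put $C_x=\{c\in B:cJ_x\subseteq J_xB,\ J_xc\subseteq BJ_x\}$, $H_x=J_xC_x=C_xJ_x=J_xBJ_x$ (an ideal of $C_x$), $B(x)=C_x/H_x$ (a unital C*-algebra), $L_x=J_xB+BJ_x$. The natural map $B(x)\to B/L_x$ is an isometric linear bijection and $E_x:B\to B(x)$ is the quotient map $B\to B/L_x$ followed by its inverse. When $x$ is free, $B(x)$ is one-dimensional and is identified with $\mathbb C$ via its unit. 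*)

theory Defs
  imports "HOL-Analysis.Analysis" "HOL-Algebra.FiniteProduct"
begin

section \<open>Complex vector spaces and *-algebras with explicit carrier\<close>

record 'a cvec = "'a partial_object" +
  vzero :: 'a
  vadd :: "'a \<Rightarrow> 'a \<Rightarrow> 'a"
  vsmul :: "complex \<Rightarrow> 'a \<Rightarrow> 'a"

record 'a star_alg = "'a cvec" +
  amul :: "'a \<Rightarrow> 'a \<Rightarrow> 'a"
  aadj :: "'a \<Rightarrow> 'a"

record 'a normed_star_alg = "'a star_alg" +
  anorm :: "'a \<Rightarrow> real"

definition vsub :: "('a, 'm) cvec_scheme \<Rightarrow> 'a \<Rightarrow> 'a \<Rightarrow> 'a" where
  "vsub V u v = vadd V u (vsmul V (-1) v)"

locale complex_vector_space =
  fixes V :: "('a, 'm) cvec_scheme"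
  assumes zero_closed: "vzero V \<in> carrier V"
    and add_closed: "\<lbrakk>u \<in> carrier V; v \<in> carrier V\<rbrakk> \<Longrightarrow> vadd V u v \<in> carrier V"
    and smul_closed: "v \<in> carrier V \<Longrightarrow> vsmul V c v \<in> carrier V"
    and add_assoc: "\<lbrakk>u \<in> carrier V; v \<in> carrier V; w \<in> carrier V\<rbrakk>
      \<Longrightarrow> vadd V (vadd V u v) w = vadd V u (vadd V v w)"
    and add_commute: "\<lbrakk>u \<in> carrier V; v \<in> carrier V\<rbrakk> \<Longrightarrow> vadd V u v = vadd V v u"
    and add_zero: "v \<in> carrier V \<Longrightarrow> vadd V v (vzero V) = v"
    and add_neg: "v \<in> carrier V \<Longrightarrow> \<exists>w\<in>carrier V. vadd V v w = vzero V"
    and smul_add: "\<lbrakk>u \<in> carrier V; v \<in> carrier V\<rbrakk>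
      \<Longrightarrow> vsmul V c (vadd V u v) = vadd V (vsmul V c u) (vsmul V c v)"
    and add_smul: "v \<in> carrier V \<Longrightarrow> vsmul V (c + d) v = vadd V (vsmul V c v) (vsmul V d v)"
    and smul_smul: "v \<in> carrier V \<Longrightarrow> vsmul V c (vsmul V d v) = vsmul V (c * d) v"
    and smul_one: "v \<in> carrier V \<Longrightarrow> vsmul V 1 v = v"

definition is_norm :: "('a, 'm) cvec_scheme \<Rightarrow> ('a \<Rightarrow> real) \<Rightarrow> bool" where
  "is_norm V N \<longleftrightarrow>
     (\<forall>v\<in>carrier V. 0 \<le> N v \<and> (N v = 0 \<longleftrightarrow> v = vzero V)) \<and>
     (\<forall>u\<in>carrier V. \<forall>v\<in>carrier V. N (vadd V u v) \<le> N u + N v) \<and>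
     (\<forall>c. \<forall>v\<in>carrier V. N (vsmul V c v) = cmod c * N v)"

definition one_dimensional :: "('a, 'm) cvec_scheme \<Rightarrow> bool" where
  "one_dimensional V \<longleftrightarrow>
     (\<exists>e\<in>carrier V. e \<noteq> vzero V \<and> (\<forall>v\<in>carrier V. \<exists>c. v = vsmul V c e))"

definition lin_subspace :: "('a, 'm) cvec_scheme \<Rightarrow> 'a set \<Rightarrow> bool" where
  "lin_subspace V W \<longleftrightarrow> W \<subseteq> carrier V \<and> vzero V \<in> W \<and>
     (\<forall>u\<in>W. \<forall>v\<in>W. vadd V u v \<in> W) \<and> (\<forall>c. \<forall>v\<in>W. vsmul V c v \<in> W)"

definition lin_span :: "('a, 'm) cvec_scheme \<Rightarrow> 'a set \<Rightarrow> 'a set" where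
  "lin_span V S = \<Inter>{W. lin_subspace V W \<and> S \<subseteq> W}"

definition is_cstar_norm :: "('a, 'm) star_alg_scheme \<Rightarrow> ('a \<Rightarrow> real) \<Rightarrow> bool" where
  "is_cstar_norm S N \<longleftrightarrow> is_norm S N \<and>
     (\<forall>a\<in>carrier S. \<forall>b\<in>carrier S. N (amul S a b) \<le> N a * N b) \<and>
     (\<forall>a\<in>carrier S. N (amul S (aadj S a) a) = (N a)\<^sup>2)"

definition alg_unit :: "('a, 'm) star_alg_scheme \<Rightarrow> 'a" where
  "alg_unit S = (THE u. u \<in> carrier S \<and> (\<forall>a\<in>carrier S. amul S u a = a \<and> amul S a u = a))"

text \<open>The identification of a one-dimensional unital algebra with the complex numbers:
  the inverse of \<open>c \<mapsto> c 1\<close>.\<close>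

definition scalar_of :: "('a, 'm) star_alg_scheme \<Rightarrow> 'a \<Rightarrow> complex" where
  "scalar_of S = the_inv (\<lambda>c. vsmul S c (alg_unit S))"


section \<open>Completion of a *-algebra in a C*-norm\<close>

definition cauchy_seqs :: "('a, 'm) star_alg_scheme \<Rightarrow> ('a \<Rightarrow> real) \<Rightarrow> (nat \<Rightarrow> 'a) set" where
  "cauchy_seqs S N = {f. (\<forall>n. f n \<in> carrier S) \<and>
     (\<forall>e>0. \<exists>M. \<forall>m\<ge>M. \<forall>n\<ge>M. N (vsub S (f m) (f n)) < e)}"

definition cauchy_class ::
    "('a, 'm) star_alg_scheme \<Rightarrow> ('a \<Rightarrow> real) \<Rightarrow> (nat \<Rightarrow> 'a) \<Rightarrow> (nat \<Rightarrow> 'a) set" where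
  "cauchy_class S N f =
     {g \<in> cauchy_seqs S N. (\<lambda>n. N (vsub S (f n) (g n))) \<longlonglongrightarrow> 0}"

definition representative :: "'a set \<Rightarrow> 'a" where
  "representative c = (SOME f. f \<in> c)"

definition completion ::
    "('a, 'm) star_alg_scheme \<Rightarrow> ('a \<Rightarrow> real) \<Rightarrow> (nat \<Rightarrow> 'a) set normed_star_alg" where
  "completion S N = \<lparr>
     carrier = cauchy_class S N ` cauchy_seqs S N,
     vzero = cauchy_class S N (\<lambda>n. vzero S),
     vadd = (\<lambda>a b. cauchy_class S N (\<lambda>n. vadd S (representative a n) (representative b n))),
     vsmul = (\<lambda>c a. cauchy_class S N (\<lambda>n. vsmul S c (representative a n))),
     amul = (\<lambda>a b. cauchy_class S N (\<lambda>n. amul S (representative a n) (representative b n))),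
     aadj = (\<lambda>a. cauchy_class S N (\<lambda>n. aadj S (representative a n))),
     anorm = (\<lambda>a. lim (\<lambda>n. N (representative a n)))\<rparr>"

definition completion_embed ::
    "('a, 'm) star_alg_scheme \<Rightarrow> ('a \<Rightarrow> real) \<Rightarrow> 'a \<Rightarrow> (nat \<Rightarrow> 'a) set" where
  "completion_embed S N f = cauchy_class S N (\<lambda>n. f)"


section \<open>Closed subspaces, states, and the localizing projection\<close>

definition norm_closure :: "('a, 'm) normed_star_alg_scheme \<Rightarrow> 'a set \<Rightarrow> 'a set" where
  "norm_closure B S = {b \<in> carrier B. \<forall>e>0. \<exists>s\<in>S. anorm B (vsub B b s) < e}"

definition closed_span :: "('a, 'm) normed_star_alg_scheme \<Rightarrow> 'a set \<Rightarrow> 'a set" where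
  "closed_span B S = norm_closure B (lin_span B S)"

definition prod_space ::
    "('a, 'm) normed_star_alg_scheme \<Rightarrow> 'a set \<Rightarrow> 'a set \<Rightarrow> 'a set" where
  "prod_space B S T = closed_span B {amul B a b | a b. a \<in> S \<and> b \<in> T}"

definition sum_space ::
    "('a, 'm) normed_star_alg_scheme \<Rightarrow> 'a set \<Rightarrow> 'a set \<Rightarrow> 'a set" where
  "sum_space B S T = closed_span B {vadd B a b | a b. a \<in> S \<and> b \<in> T}"

definition is_state :: "('a, 'm) normed_star_alg_scheme \<Rightarrow> ('a \<Rightarrow> complex) \<Rightarrow> bool" where
  "is_state B \<psi> \<longleftrightarrow>
     (\<forall>a\<in>carrier B. \<forall>b\<in>carrier B. \<psi> (vadd B a b) = \<psi> a + \<psi> b) \<and>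
     (\<forall>c. \<forall>a\<in>carrier B. \<psi> (vsmul B c a) = c * \<psi> a) \<and>
     (\<forall>a\<in>carrier B. \<psi> (amul B (aadj B a) a) \<in> \<real>\<^sub>\<ge>\<^sub>0) \<and>
     bdd_above {cmod (\<psi> a) | a. a \<in> carrier B \<and> anorm B a \<le> 1} \<and>
     Sup {cmod (\<psi> a) | a. a \<in> carrier B \<and> anorm B a \<le> 1} = 1"

text \<open>In an inclusion of \<open>A = C\<^sub>0(X)\<close> in \<open>B\<close>, the evaluation of \<open>A\<close> at a point \<open>x\<close> is
  passed as \<open>ev x\<close>. Only its values on \<open>A\<close> are used in the following three definitions;
  extensionality makes uniqueness mean uniqueness on \<open>B\<close>.\<close>

definition free_point ::
    "('a, 'm) normed_star_alg_scheme \<Rightarrow> 'a set \<Rightarrow> ('x \<Rightarrow> 'a \<Rightarrow> complex) \<Rightarrow> 'x \<Rightarrow> bool" where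
  "free_point B A ev x \<longleftrightarrow>
     (\<exists>!\<psi>. \<psi> \<in> extensional (carrier B) \<and> is_state B \<psi> \<and> (\<forall>a\<in>A. \<psi> a = ev x a))"

definition topologically_free_inclusion ::
    "'x topology \<Rightarrow> ('a, 'm) normed_star_alg_scheme \<Rightarrow> 'a set \<Rightarrow> ('x \<Rightarrow> 'a \<Rightarrow> complex) \<Rightarrow> bool" where
  "topologically_free_inclusion T B A ev \<longleftrightarrow>
     T closure_of {x \<in> topspace T. free_point B A ev x} = topspace T"

definition point_ideal :: "'a set \<Rightarrow> ('x \<Rightarrow> 'a \<Rightarrow> complex) \<Rightarrow> 'x \<Rightarrow> 'a set" where
  "point_ideal A ev x = {a \<in> A. ev x a = 0}"

definition loc_C :: "('a, 'm) normed_star_alg_scheme \<Rightarrow> 'a set \<Rightarrow> 'a set" where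
  "loc_C B J = {c \<in> carrier B. (\<forall>j\<in>J. amul B c j \<in> prod_space B J (carrier B)) \<and>
                               (\<forall>j\<in>J. amul B j c \<in> prod_space B (carrier B) J)}"

definition loc_H :: "('a, 'm) normed_star_alg_scheme \<Rightarrow> 'a set \<Rightarrow> 'a set" where
  "loc_H B J = prod_space B J (loc_C B J)"

definition loc_L :: "('a, 'm) normed_star_alg_scheme \<Rightarrow> 'a set \<Rightarrow> 'a set" where
  "loc_L B J = sum_space B (prod_space B J (carrier B)) (prod_space B (carrier B) J)"

definition coset :: "('a, 'm) cvec_scheme \<Rightarrow> 'a set \<Rightarrow> 'a \<Rightarrow> 'a set" where
  "coset B W b = {vadd B b w | w. w \<in> W}"

definition quotient_alg ::
    "('a, 'm) normed_star_alg_scheme \<Rightarrow> 'a set \<Rightarrow> 'a set \<Rightarrow> 'a set normed_star_alg" where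
  "quotient_alg B C H = \<lparr>
     carrier = coset B H ` C,
     vzero = coset B H (vzero B),
     vadd = (\<lambda>p q. coset B H (vadd B (representative p) (representative q))),
     vsmul = (\<lambda>c p. coset B H (vsmul B c (representative p))),
     amul = (\<lambda>p q. coset B H (amul B (representative p) (representative q))),
     aadj = (\<lambda>p. coset B H (aadj B (representative p))),
     anorm = (\<lambda>p. Inf (anorm B ` p))\<rparr>"

definition loc_alg :: "('a, 'm) normed_star_alg_scheme \<Rightarrow> 'a set \<Rightarrow> 'a set normed_star_alg" where
  "loc_alg B J = quotient_alg B (loc_C B J) (loc_H B J)"

definition loc_natural_map :: "('a, 'm) normed_star_alg_scheme \<Rightarrow> 'a set \<Rightarrow> 'a set \<Rightarrow> 'a set" where
  "loc_natural_map B J p = coset B (loc_L B J) (representative p)"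

definition localizing_projection ::
    "('a, 'm) normed_star_alg_scheme \<Rightarrow> 'a set \<Rightarrow> 'a \<Rightarrow> 'a set" where
  "localizing_projection B J b =
     the_inv_into (carrier (loc_alg B J)) (loc_natural_map B J) (coset B (loc_L B J) b)"


section \<open>Etale groupoids\<close>

text \<open>The set of arrows is \<open>topspace (gtop G)\<close>; units are identified with identity arrows.\<close>

record 'g groupoid =
  gtop :: "'g topology"
  src :: "'g \<Rightarrow> 'g"
  rng :: "'g \<Rightarrow> 'g"
  gmul :: "'g \<Rightarrow> 'g \<Rightarrow> 'g"
  ginv :: "'g \<Rightarrow> 'g"

definition arrows :: "'g groupoid \<Rightarrow> 'g set" where
  "arrows G = topspace (gtop G)"

definition units :: "'g groupoid \<Rightarrow> 'g set" where
  "units G = src G ` arrows G"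

definition unit_top :: "'g groupoid \<Rightarrow> 'g topology" where
  "unit_top G = subtopology (gtop G) (units G)"

definition local_homeomorphism :: "'a topology \<Rightarrow> 'b topology \<Rightarrow> ('a \<Rightarrow> 'b) \<Rightarrow> bool" where
  "local_homeomorphism T T' f \<longleftrightarrow> f ` topspace T \<subseteq> topspace T' \<and>
     (\<forall>x\<in>topspace T. \<exists>U. openin T U \<and> x \<in> U \<and> openin T' (f ` U) \<and>
        homeomorphic_map (subtopology T U) (subtopology T' (f ` U)) f)"

locale etale_groupoid =
  fixes G :: "'g groupoid"
  assumes src_closed: "a \<in> arrows G \<Longrightarrow> src G a \<in> arrows G"
    and rng_closed: "a \<in> arrows G \<Longrightarrow> rng G a \<in> arrows G"
    and src_src: "a \<in> arrows G \<Longrightarrow> src G (src G a) = src G a"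
    and rng_src: "a \<in> arrows G \<Longrightarrow> rng G (src G a) = src G a"
    and src_rng: "a \<in> arrows G \<Longrightarrow> src G (rng G a) = rng G a"
    and rng_rng: "a \<in> arrows G \<Longrightarrow> rng G (rng G a) = rng G a"
    and mul_closed: "\<lbrakk>a \<in> arrows G; b \<in> arrows G; src G a = rng G b\<rbrakk> \<Longrightarrow> gmul G a b \<in> arrows G"
    and src_mul: "\<lbrakk>a \<in> arrows G; b \<in> arrows G; src G a = rng G b\<rbrakk> \<Longrightarrow> src G (gmul G a b) = src G b"
    and rng_mul: "\<lbrakk>a \<in> arrows G; b \<in> arrows G; src G a = rng G b\<rbrakk> \<Longrightarrow> rng G (gmul G a b) = rng G a"
    and mul_assoc: "\<lbrakk>a \<in> arrows G; b \<in> arrows G; c \<in> arrows G; src G a = rng G b; src G b = rng G c\<rbrakk>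
      \<Longrightarrow> gmul G (gmul G a b) c = gmul G a (gmul G b c)"
    and mul_src: "a \<in> arrows G \<Longrightarrow> gmul G a (src G a) = a"
    and rng_mul_self: "a \<in> arrows G \<Longrightarrow> gmul G (rng G a) a = a"
    and inv_closed: "a \<in> arrows G \<Longrightarrow> ginv G a \<in> arrows G"
    and src_inv: "a \<in> arrows G \<Longrightarrow> src G (ginv G a) = rng G a"
    and rng_inv: "a \<in> arrows G \<Longrightarrow> rng G (ginv G a) = src G a"
    and mul_inv: "a \<in> arrows G \<Longrightarrow> gmul G a (ginv G a) = rng G a"
    and inv_mul: "a \<in> arrows G \<Longrightarrow> gmul G (ginv G a) a = src G a"
    and continuous_mul:
      "continuous_map (subtopology (prod_topology (gtop G) (gtop G)) {(a, b). src G a = rng G b})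
         (gtop G) (\<lambda>(a, b). gmul G a b)"
    and continuous_inv: "continuous_map (gtop G) (gtop G) (ginv G)"
    and Hausdorff_units: "Hausdorff_space (unit_top G)"
    and locally_compact_units: "locally_compact_space (unit_top G)"
    and local_homeo_rng: "local_homeomorphism (gtop G) (unit_top G) (rng G)"

definition isotropy :: "'g groupoid \<Rightarrow> 'g \<Rightarrow> 'g set" where
  "isotropy G x = {a \<in> arrows G. src G a = x \<and> rng G a = x}"

definition topologically_free_groupoid :: "'g groupoid \<Rightarrow> bool" where
  "topologically_free_groupoid G \<longleftrightarrow>
     unit_top G closure_of {x \<in> units G. isotropy G x = {x}} = units G"

definition open_bisection :: "'g groupoid \<Rightarrow> 'g set \<Rightarrow> bool" where
  "open_bisection G U \<longleftrightarrow> openin (gtop G) U \<and> inj_on (rng G) U \<and> inj_on (src G) U"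


section \<open>Fell line bundles\<close>

record ('g, 'l) fell_bundle =
  ltop :: "'l topology"
  proj :: "'l \<Rightarrow> 'g"
  lzero :: "'g \<Rightarrow> 'l"
  ladd :: "'l \<Rightarrow> 'l \<Rightarrow> 'l"
  lsmul :: "complex \<Rightarrow> 'l \<Rightarrow> 'l"
  lnorm :: "'l \<Rightarrow> real"
  lmul :: "'l \<Rightarrow> 'l \<Rightarrow> 'l"
  ladj :: "'l \<Rightarrow> 'l"

definition fib :: "('g, 'l) fell_bundle \<Rightarrow> 'g \<Rightarrow> 'l set" where
  "fib L a = {\<xi> \<in> topspace (ltop L). proj L \<xi> = a}"

text \<open>The product and adjoint recorded here are operations of the fibre only when \<open>a\<close> is a unit.\<close>

definition fibre :: "('g, 'l) fell_bundle \<Rightarrow> 'g \<Rightarrow> 'l star_alg" where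
  "fibre L a = \<lparr>carrier = fib L a, vzero = lzero L a, vadd = ladd L, vsmul = lsmul L,
                amul = lmul L, aadj = ladj L\<rparr>"

text \<open>Fell and Doran's axioms for the restriction of the bundle to \<open>U\<close>. When \<open>U\<close> is Hausdorff
  they force the restricted total space to be Hausdorff.\<close>

definition continuous_banach_bundle_on ::
    "'g topology \<Rightarrow> ('g, 'l) fell_bundle \<Rightarrow> 'g set \<Rightarrow> bool" where
  "continuous_banach_bundle_on T L U \<longleftrightarrow>
     (let E = subtopology (ltop L) {\<xi> \<in> topspace (ltop L). proj L \<xi> \<in> U}; TU = subtopology T U in
       continuous_map E TU (proj L) \<and> open_map E TU (proj L) \<and>
       proj L ` topspace E = topspace TU \<and>
       continuous_map E euclideanreal (lnorm L) \<and>
       continuous_map (subtopology (prod_topology E E) {(\<xi>, \<eta>). proj L \<xi> = proj L \<eta>}) E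
         (\<lambda>(\<xi>, \<eta>). ladd L \<xi> \<eta>) \<and>
       (\<forall>c. continuous_map E E (lsmul L c)) \<and>
       (\<forall>a\<in>topspace TU. \<forall>W. openin E W \<and> lzero L a \<in> W \<longrightarrow>
         (\<exists>V e. openin TU V \<and> a \<in> V \<and> e > 0 \<and>
            {\<xi> \<in> topspace E. proj L \<xi> \<in> V \<and> lnorm L \<xi> < e} \<subseteq> W)))"

text \<open>Completeness of the fibres is automatic, as they are one-dimensional. Positivity of
  \<open>\<xi>\<^sup>*\<xi>\<close> means positivity in the C*-algebra over the source: it is some \<open>\<eta>\<^sup>*\<eta>\<close> with \<open>\<eta>\<close> in that fibre.\<close>

locale fell_line_bundle =
  fixes G :: "'g groupoid" and L :: "('g, 'l) fell_bundle"
  assumes continuous_proj: "continuous_map (ltop L) (gtop G) (proj L)"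
    and fibre_vector_space: "a \<in> arrows G \<Longrightarrow> complex_vector_space (fibre L a)"
    and fibre_norm: "a \<in> arrows G \<Longrightarrow> is_norm (fibre L a) (lnorm L)"
    and fibre_line: "a \<in> arrows G \<Longrightarrow> one_dimensional (fibre L a)"
    and banach_bundle: "open_bisection G U \<Longrightarrow> continuous_banach_bundle_on (gtop G) L U"
    and lmul_closed: "\<lbrakk>a \<in> arrows G; b \<in> arrows G; src G a = rng G b; \<xi> \<in> fib L a; \<eta> \<in> fib L b\<rbrakk>
      \<Longrightarrow> lmul L \<xi> \<eta> \<in> fib L (gmul G a b)"
    and lmul_add_left: "\<lbrakk>a \<in> arrows G; b \<in> arrows G; src G a = rng G b;
        \<xi> \<in> fib L a; \<xi>' \<in> fib L a; \<eta> \<in> fib L b\<rbrakk>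
      \<Longrightarrow> lmul L (ladd L \<xi> \<xi>') \<eta> = ladd L (lmul L \<xi> \<eta>) (lmul L \<xi>' \<eta>)"
    and lmul_add_right: "\<lbrakk>a \<in> arrows G; b \<in> arrows G; src G a = rng G b;
        \<xi> \<in> fib L a; \<eta> \<in> fib L b; \<eta>' \<in> fib L b\<rbrakk>
      \<Longrightarrow> lmul L \<xi> (ladd L \<eta> \<eta>') = ladd L (lmul L \<xi> \<eta>) (lmul L \<xi> \<eta>')"
    and lmul_smul_left: "\<lbrakk>a \<in> arrows G; b \<in> arrows G; src G a = rng G b; \<xi> \<in> fib L a; \<eta> \<in> fib L b\<rbrakk>
      \<Longrightarrow> lmul L (lsmul L c \<xi>) \<eta> = lsmul L c (lmul L \<xi> \<eta>)"
    and lmul_smul_right: "\<lbrakk>a \<in> arrows G; b \<in> arrows G; src G a = rng G b; \<xi> \<in> fib L a; \<eta> \<in> fib L b\<rbrakk>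
      \<Longrightarrow> lmul L \<xi> (lsmul L c \<eta>) = lsmul L c (lmul L \<xi> \<eta>)"
    and lmul_assoc: "\<lbrakk>a \<in> arrows G; b \<in> arrows G; d \<in> arrows G; src G a = rng G b; src G b = rng G d;
        \<xi> \<in> fib L a; \<eta> \<in> fib L b; \<zeta> \<in> fib L d\<rbrakk>
      \<Longrightarrow> lmul L (lmul L \<xi> \<eta>) \<zeta> = lmul L \<xi> (lmul L \<eta> \<zeta>)"
    and lmul_norm: "\<lbrakk>a \<in> arrows G; b \<in> arrows G; src G a = rng G b; \<xi> \<in> fib L a; \<eta> \<in> fib L b\<rbrakk>
      \<Longrightarrow> lnorm L (lmul L \<xi> \<eta>) \<le> lnorm L \<xi> * lnorm L \<eta>"
    and continuous_lmul:
      "continuous_map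
         (subtopology (prod_topology (ltop L) (ltop L)) {(\<xi>, \<eta>). src G (proj L \<xi>) = rng G (proj L \<eta>)})
         (ltop L) (\<lambda>(\<xi>, \<eta>). lmul L \<xi> \<eta>)"
    and ladj_closed: "\<lbrakk>a \<in> arrows G; \<xi> \<in> fib L a\<rbrakk> \<Longrightarrow> ladj L \<xi> \<in> fib L (ginv G a)"
    and ladj_add: "\<lbrakk>a \<in> arrows G; \<xi> \<in> fib L a; \<eta> \<in> fib L a\<rbrakk>
      \<Longrightarrow> ladj L (ladd L \<xi> \<eta>) = ladd L (ladj L \<xi>) (ladj L \<eta>)"
    and ladj_smul: "\<lbrakk>a \<in> arrows G; \<xi> \<in> fib L a\<rbrakk>
      \<Longrightarrow> ladj L (lsmul L c \<xi>) = lsmul L (cnj c) (ladj L \<xi>)"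
    and ladj_ladj: "\<lbrakk>a \<in> arrows G; \<xi> \<in> fib L a\<rbrakk> \<Longrightarrow> ladj L (ladj L \<xi>) = \<xi>"
    and ladj_lmul: "\<lbrakk>a \<in> arrows G; b \<in> arrows G; src G a = rng G b; \<xi> \<in> fib L a; \<eta> \<in> fib L b\<rbrakk>
      \<Longrightarrow> ladj L (lmul L \<xi> \<eta>) = lmul L (ladj L \<eta>) (ladj L \<xi>)"
    and continuous_ladj: "continuous_map (ltop L) (ltop L) (ladj L)"
    and lnorm_cstar: "\<lbrakk>a \<in> arrows G; \<xi> \<in> fib L a\<rbrakk>
      \<Longrightarrow> lnorm L (lmul L (ladj L \<xi>) \<xi>) = (lnorm L \<xi>)\<^sup>2"
    and ladj_lmul_positive: "\<lbrakk>a \<in> arrows G; \<xi> \<in> fib L a\<rbrakk>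
      \<Longrightarrow> \<exists>\<eta>\<in>fib L (src G a). lmul L (ladj L \<xi>) \<xi> = lmul L (ladj L \<eta>) \<eta>"


section \<open>The convolution algebra and its C*-completions\<close>

text \<open>Sum in the fibre over \<open>a\<close> of a family with finitely many nonzero terms.\<close>

definition fibre_sum :: "('g, 'l) fell_bundle \<Rightarrow> 'g \<Rightarrow> ('i \<Rightarrow> 'l) \<Rightarrow> 'i set \<Rightarrow> 'l" where
  "fibre_sum L a h I =
     finprod \<lparr>carrier = fib L a, mult = ladd L, one = lzero L a\<rparr> h {i \<in> I. h i \<noteq> lzero L a}"

definition factorizations :: "'g groupoid \<Rightarrow> 'g \<Rightarrow> ('g \<times> 'g) set" where
  "factorizations G a =
     {(b, c). b \<in> arrows G \<and> c \<in> arrows G \<and> src G b = rng G c \<and> gmul G b c = a}"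

text \<open>Convolution and adjoint of arbitrary sections; the former is only meaningful when
  the sums are finite, as they are for the sections in \<open>Cc_alg\<close>.\<close>

definition section_alg :: "'g groupoid \<Rightarrow> ('g, 'l) fell_bundle \<Rightarrow> ('g \<Rightarrow> 'l) star_alg" where
  "section_alg G L = \<lparr>
     carrier = (\<Pi>\<^sub>E a\<in>arrows G. fib L a),
     vzero = restrict (lzero L) (arrows G),
     vadd = (\<lambda>f g. \<lambda>a\<in>arrows G. ladd L (f a) (g a)),
     vsmul = (\<lambda>c f. \<lambda>a\<in>arrows G. lsmul L c (f a)),
     amul = (\<lambda>f g. \<lambda>a\<in>arrows G. fibre_sum L a (\<lambda>(b, c). lmul L (f b) (g c)) (factorizations G a)),
     aadj = (\<lambda>f. \<lambda>a\<in>arrows G. ladj L (f (ginv G a)))\<rparr>"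

definition Cc_on :: "'g groupoid \<Rightarrow> ('g, 'l) fell_bundle \<Rightarrow> 'g set \<Rightarrow> ('g \<Rightarrow> 'l) set" where
  "Cc_on G L U = {f \<in> carrier (section_alg G L).
     continuous_map (subtopology (gtop G) U) (ltop L) f \<and>
     compactin (subtopology (gtop G) U)
       (subtopology (gtop G) U closure_of {a \<in> U. f a \<noteq> lzero L a}) \<and>
     (\<forall>a\<in>arrows G - U. f a = lzero L a)}"

definition Cc_alg :: "'g groupoid \<Rightarrow> ('g, 'l) fell_bundle \<Rightarrow> ('g \<Rightarrow> 'l) star_alg" where
  "Cc_alg G L = (section_alg G L)
     \<lparr>carrier := lin_span (section_alg G L) (\<Union>U\<in>Collect (open_bisection G). Cc_on G L U)\<rparr>"

definition src_fibre :: "'g groupoid \<Rightarrow> 'g \<Rightarrow> 'g set" where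
  "src_fibre G x = {a \<in> arrows G. src G a = x}"

definition l2_sections :: "'g groupoid \<Rightarrow> ('g, 'l) fell_bundle \<Rightarrow> 'g \<Rightarrow> ('g \<Rightarrow> 'l) set" where
  "l2_sections G L x = {\<xi> \<in> (\<Pi>\<^sub>E a\<in>src_fibre G x. fib L a).
     (\<lambda>a. (lnorm L (\<xi> a))\<^sup>2) summable_on src_fibre G x}"

definition l2_norm :: "'g groupoid \<Rightarrow> ('g, 'l) fell_bundle \<Rightarrow> 'g \<Rightarrow> ('g \<Rightarrow> 'l) \<Rightarrow> real" where
  "l2_norm G L x \<xi> = sqrt (\<Sum>\<^sub>\<infinity>a\<in>src_fibre G x. (lnorm L (\<xi> a))\<^sup>2)"

definition regular_rep ::
    "'g groupoid \<Rightarrow> ('g, 'l) fell_bundle \<Rightarrow> 'g \<Rightarrow> ('g \<Rightarrow> 'l) \<Rightarrow> ('g \<Rightarrow> 'l) \<Rightarrow> 'g \<Rightarrow> 'l" where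
  "regular_rep G L x f \<xi> =
     (\<lambda>a\<in>src_fibre G x. fibre_sum L a (\<lambda>(b, c). lmul L (f b) (\<xi> c)) (factorizations G a))"

definition regular_rep_norm ::
    "'g groupoid \<Rightarrow> ('g, 'l) fell_bundle \<Rightarrow> 'g \<Rightarrow> ('g \<Rightarrow> 'l) \<Rightarrow> real" where
  "regular_rep_norm G L x f =
     Sup {l2_norm G L x (regular_rep G L x f \<xi>) | \<xi>. \<xi> \<in> l2_sections G L x \<and> l2_norm G L x \<xi> \<le> 1}"

text \<open>Inserting \<open>0\<close> only matters for the empty groupoid.\<close>

definition red_norm :: "'g groupoid \<Rightarrow> ('g, 'l) fell_bundle \<Rightarrow> ('g \<Rightarrow> 'l) \<Rightarrow> real" where
  "red_norm G L f = Sup (insert 0 {regular_rep_norm G L x f | x. x \<in> units G})"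

text \<open>The pointwise supremum of all C*-norms is again a C*-norm, hence the largest one.\<close>

definition full_norm :: "'g groupoid \<Rightarrow> ('g, 'l) fell_bundle \<Rightarrow> ('g \<Rightarrow> 'l) \<Rightarrow> real" where
  "full_norm G L f = Sup {N f | N. is_cstar_norm (Cc_alg G L) N}"

type_synonym ('g, 'l) completed = "(nat \<Rightarrow> 'g \<Rightarrow> 'l) set"

definition full_cstar ::
    "'g groupoid \<Rightarrow> ('g, 'l) fell_bundle \<Rightarrow> ('g, 'l) completed normed_star_alg" where
  "full_cstar G L = completion (Cc_alg G L) (full_norm G L)"

definition red_cstar ::
    "'g groupoid \<Rightarrow> ('g, 'l) fell_bundle \<Rightarrow> ('g, 'l) completed normed_star_alg" where
  "red_cstar G L = completion (Cc_alg G L) (red_norm G L)"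

text \<open>The copies of \<open>C\<^sub>0(X)\<close>. The unit space is itself an open bisection, and \<open>C\<^sub>c(X)\<close> is
  \<open>Cc_on G L (units G)\<close> through the canonical identifications of the fibres over units
  with the complex numbers.\<close>

definition full_C0 :: "'g groupoid \<Rightarrow> ('g, 'l) fell_bundle \<Rightarrow> ('g, 'l) completed set" where
  "full_C0 G L = norm_closure (full_cstar G L)
     (completion_embed (Cc_alg G L) (full_norm G L) ` Cc_on G L (units G))"

definition red_C0 :: "'g groupoid \<Rightarrow> ('g, 'l) fell_bundle \<Rightarrow> ('g, 'l) completed set" where
  "red_C0 G L = norm_closure (red_cstar G L)
     (completion_embed (Cc_alg G L) (red_norm G L) ` Cc_on G L (units G))"

text \<open>The canonical surjection of the full onto the reduced algebra, induced by the identity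
  of \<open>Cc_alg G L\<close>.\<close>

definition Lambda ::
    "'g groupoid \<Rightarrow> ('g, 'l) fell_bundle \<Rightarrow> ('g, 'l) completed \<Rightarrow> ('g, 'l) completed" where
  "Lambda G L b = cauchy_class (Cc_alg G L) (red_norm G L) (representative b)"

text \<open>Continuous extension of the evaluation \<open>f \<mapsto> f(a)\<close> to the reduced algebra.\<close>

definition red_eval ::
    "'g groupoid \<Rightarrow> ('g, 'l) fell_bundle \<Rightarrow> 'g \<Rightarrow> ('g, 'l) completed \<Rightarrow> 'l" where
  "red_eval G L a b = (THE \<xi>. \<xi> \<in> fib L a \<and>
     (\<forall>f\<in>b. (\<lambda>n. lnorm L (vsub (fibre L a) (f n a) \<xi>)) \<longlonglongrightarrow> 0))"

text \<open>The value at a unit, as a complex number.\<close>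

definition red_value ::
    "'g groupoid \<Rightarrow> ('g, 'l) fell_bundle \<Rightarrow> 'g \<Rightarrow> ('g, 'l) completed \<Rightarrow> complex" where
  "red_value G L x b = scalar_of (fibre L x) (red_eval G L x b)"

definition full_value ::
    "'g groupoid \<Rightarrow> ('g, 'l) fell_bundle \<Rightarrow> 'g \<Rightarrow> ('g, 'l) completed \<Rightarrow> complex" where
  "full_value G L x b = red_value G L x (Lambda G L b)"

end

theory Submission
  imports Defs
begin

text \<open>Fix a unit \<open>x\<close>, and let \<open>J\<close> be the ideal of functions on the unit space \<open>X\<close> that vanish at \<open>x\<close>.
  Everything follows from a comparison of the algebra \<open>B\<close> with the closed span of \<open>JB\<close> and \<open>BJ\<close>.

  Suppose that the isotropy group of \<open>x\<close> is trivial. If \<open>f\<close> is a section over a bisection and \<open>a\<close> a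
  bump function at \<open>x\<close> with small support, then \<open>afa\<close> is a function on \<open>X\<close> (\<open>compress\<close>), because the
  bisection either consists of units near \<open>x\<close> or moves the support of \<open>a\<close> off itself. The
  difference \<open>f - afa\<close> is a sum of products with a factor in \<open>J\<close>. Hence \<open>f - f(x)e\<close> lies in \<open>JB + BJ\<close> for
  every function \<open>e\<close> with \<open>e(x) = 1\<close> (\<open>decompose\<close>). By the Cauchy-Schwarz inequality a state that
  extends evaluation at \<open>x\<close> vanishes on \<open>JB + BJ\<close>, so it is \<open>f \<mapsto> f(x)\<close> (\<open>state_unique\<close>), and \<open>x\<close> is free.
  The quotient of \<open>B\<close> by the closed span \<open>L\<close> of \<open>JB\<close> and \<open>BJ\<close> is therefore one-dimensional. An approximate unit
  of \<open>J\<close> shows that an element of \<open>C\<close> with value \<open>0\<close> at \<open>x\<close> already lies in \<open>H\<close> (\<open>C_ker_H\<close>). So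
  \<open>C/H\<close> and \<open>B/L\<close> are both identified with the complex numbers by evaluation at \<open>x\<close>, and the
  localizing projection is this evaluation (\<open>localizing_projection_value\<close>).

  Suppose now that \<open>\<gamma> \<noteq> x\<close> lies in the isotropy group of \<open>x\<close>. In the regular representation, the
  vector \<open>(\<delta>\<^sub>x + c \<delta>\<^sub>\<gamma>)/\<surd>2\<close> with \<open>|c| = 1\<close> defines a state that extends evaluation at \<open>x\<close>. Its
  value at a section that does not vanish at \<open>\<gamma>\<close> differs from the value of the section at \<open>x\<close>,
  for \<open>c = 1\<close> or for \<open>c = i\<close> (\<open>isotropy_vector\<close>). So \<open>x\<close> is not free. Hence the free points
  are the points with trivial isotropy, and the two notions of topological freeness compare closures of
  equal sets.

  The full and the reduced algebra are treated together, as completions in a C*-norm that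
  dominates the reduced norm. Three facts enter. First, choosing a unit vector in every fibre
  turns convolution by a section into an infinite matrix with finite rows and columns. The laws of
  a *-algebra are those of matrices, and the reduced norm is the least bound for all finite
  blocks, from which its C*-identity follows. Second, a function \<open>k\<close> with \<open>\<bar>k\<bar> \<le> 1\<close> is a mean of two unitary
  multipliers. It is therefore contractive in every C*-norm (\<open>fn_contractive_left\<close>), which bounds
  the norm of every section (\<open>gen_norm_le\<close>), so that the full norm is finite, and it makes the functions in \<open>J\<close> that
  are \<open>1\<close> on large compact sets an approximate unit. Third, the line bundle has a continuous section
  through every arrow that does not vanish there (\<open>local_section\<close>). It is the first Fourier
  coefficient, along the action of the circle on unit vectors, of a bump function.\<close>

section \<open>Arithmetic in vector spaces and normed *-algebras with explicit carrier\<close>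

context complex_vector_space
begin

abbreviation add (infixl "\<oplus>" 65) where "a \<oplus> b \<equiv> vadd V a b"
abbreviation sub (infixl "\<ominus>" 65) where "a \<ominus> b \<equiv> vsub V a b"
abbreviation sm (infixr "\<cdot>" 75) where "c \<cdot> a \<equiv> vsmul V c a"
abbreviation zero ("\<zero>") where "\<zero> \<equiv> vzero V"
abbreviation car where "car \<equiv> carrier V"

lemma zero_add: "v \<in> car \<Longrightarrow> \<zero> \<oplus> v = v"
  by (metis add_commute add_zero zero_closed)

lemma add_left_commute:
  "\<lbrakk>u \<in> car; v \<in> car; w \<in> car\<rbrakk> \<Longrightarrow> u \<oplus> (v \<oplus> w) = v \<oplus> (u \<oplus> w)"
  by (metis add_assoc add_commute)

lemma add_left_cancel:
  assumes "u \<in> car" "v \<in> car" "w \<in> car" "u \<oplus> v = u \<oplus> w" shows "v = w"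
proof -
  obtain z where z: "z \<in> car" "u \<oplus> z = \<zero>" using add_neg assms(1) by blast
  have zu: "z \<oplus> u = \<zero>" using z assms add_commute by metis
  have "v = (z \<oplus> u) \<oplus> v" using zu assms zero_add by simp
  also have "\<dots> = (z \<oplus> u) \<oplus> w" using assms z by (simp add: add_assoc)
  also have "\<dots> = w" using zu assms zero_add by simp
  finally show ?thesis .
qed

lemma smul_zero_scalar: assumes "v \<in> car" shows "0 \<cdot> v = \<zero>"
proof -
  have "0 \<cdot> v \<oplus> 0 \<cdot> v = 0 \<cdot> v \<oplus> \<zero>"
    using add_smul[OF assms, of 0 0] add_zero smul_closed assms by simp
  thus ?thesis using add_left_cancel smul_closed zero_closed assms by blast
qed

lemma smul_zero: "c \<cdot> \<zero> = \<zero>"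
  by (metis mult_zero_right smul_smul smul_zero_scalar zero_closed)

lemma sub_closed: "\<lbrakk>u \<in> car; v \<in> car\<rbrakk> \<Longrightarrow> u \<ominus> v \<in> car"
  by (simp add: vsub_def add_closed smul_closed)

lemma add_minus: assumes "v \<in> car" shows "v \<oplus> (-1) \<cdot> v = \<zero>"
  using add_smul[OF assms, of 1 "-1"] smul_zero_scalar smul_one assms by simp

lemma sub_self: "v \<in> car \<Longrightarrow> v \<ominus> v = \<zero>"
  by (simp add: vsub_def add_minus)

lemma sub_zero: "v \<in> car \<Longrightarrow> v \<ominus> \<zero> = v"
  by (simp add: vsub_def smul_zero add_zero)

lemma sub_add_cancel: "\<lbrakk>u \<in> car; v \<in> car\<rbrakk> \<Longrightarrow> (u \<ominus> v) \<oplus> v = u"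
  by (simp add: vsub_def add_assoc smul_closed add_commute[of "(-1) \<cdot> v" v] add_minus add_zero)

lemma add_sub_cancel: "\<lbrakk>u \<in> car; v \<in> car\<rbrakk> \<Longrightarrow> (u \<oplus> v) \<ominus> v = u"
  by (simp add: vsub_def add_assoc smul_closed add_minus add_zero)

lemma sub_eq_zero: "\<lbrakk>u \<in> car; v \<in> car\<rbrakk> \<Longrightarrow> u \<ominus> v = \<zero> \<longleftrightarrow> u = v"
  by (metis sub_add_cancel sub_self zero_add)

lemma add4: "\<lbrakk>a \<in> car; b \<in> car; c \<in> car; d \<in> car\<rbrakk>
   \<Longrightarrow> (a \<oplus> b) \<oplus> (c \<oplus> d) = (a \<oplus> c) \<oplus> (b \<oplus> d)"
  by (simp add: add_assoc add_closed add_left_commute)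

lemma add_sub_add: "\<lbrakk>a \<in> car; b \<in> car; c \<in> car; d \<in> car\<rbrakk>
   \<Longrightarrow> (a \<oplus> b) \<ominus> (c \<oplus> d) = (a \<ominus> c) \<oplus> (b \<ominus> d)"
  by (simp add: vsub_def smul_add add4 smul_closed)

lemma smul_sub: "\<lbrakk>a \<in> car; b \<in> car\<rbrakk> \<Longrightarrow> c \<cdot> a \<ominus> c \<cdot> b = c \<cdot> (a \<ominus> b)"
  by (simp add: vsub_def smul_add smul_closed smul_smul)

lemma sub_smul: "a \<in> car \<Longrightarrow> c \<cdot> a \<ominus> d \<cdot> a = (c - d) \<cdot> a"
  by (simp add: vsub_def smul_smul add_smul[symmetric])

lemma sub_swap: "\<lbrakk>a \<in> car; b \<in> car\<rbrakk> \<Longrightarrow> b \<ominus> a = (-1) \<cdot> (a \<ominus> b)"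
  by (simp add: vsub_def smul_add smul_closed smul_smul smul_one add_commute)

lemma sub_sub_cancel: assumes "a \<in> car" "b \<in> car" shows "a \<ominus> (a \<ominus> b) = b"
proof -
  have "a \<ominus> (a \<ominus> b) = a \<oplus> (b \<ominus> a)"
    using assms sub_swap[of a b] by (simp add: vsub_def)
  also have "\<dots> = b" using assms sub_add_cancel add_commute sub_closed by metis
  finally show ?thesis .
qed

lemma sub_trans: assumes "a \<in> car" "b \<in> car" "c \<in> car"
  shows "(a \<ominus> b) \<oplus> (b \<ominus> c) = a \<ominus> c"
proof -
  have "(a \<ominus> b) \<oplus> (b \<ominus> c) = ((a \<ominus> b) \<oplus> b) \<oplus> (-1) \<cdot> c"
    using assms by (simp add: vsub_def add_assoc add_closed smul_closed)
  thus ?thesis using assms by (simp add: sub_add_cancel) (simp add: vsub_def)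
qed

lemma lin_subspace_carrier: "lin_subspace V car"
  by (simp add: lin_subspace_def zero_closed add_closed smul_closed)

lemma lin_subspace_sub: "\<lbrakk>lin_subspace V W; a \<in> W; b \<in> W\<rbrakk> \<Longrightarrow> a \<ominus> b \<in> W"
  by (auto simp: lin_subspace_def vsub_def)

lemma lin_subspace_span: assumes "T \<subseteq> car" shows "lin_subspace V (lin_span V T)"
proof -
  have "lin_span V T \<subseteq> car"
    using lin_subspace_carrier assms unfolding lin_span_def by blast
  thus ?thesis unfolding lin_subspace_def by (auto simp: lin_span_def lin_subspace_def)
qed

lemma span_superset: "T \<subseteq> lin_span V T"
  by (auto simp: lin_span_def)

lemma span_minimal: "\<lbrakk>lin_subspace V W; T \<subseteq> W\<rbrakk> \<Longrightarrow> lin_span V T \<subseteq> W"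
  by (auto simp: lin_span_def)

lemma complex_vector_space_subspace:
  assumes "lin_subspace V W" shows "complex_vector_space (V\<lparr>carrier := W\<rparr>)"
proof -
  have W: "\<And>v. v \<in> W \<Longrightarrow> v \<in> car" "\<zero> \<in> W" "\<And>u v. \<lbrakk>u \<in> W; v \<in> W\<rbrakk> \<Longrightarrow> u \<oplus> v \<in> W"
    "\<And>c v. v \<in> W \<Longrightarrow> c \<cdot> v \<in> W" using assms by (auto simp: lin_subspace_def)
  have neg: "\<exists>w\<in>W. v \<oplus> w = \<zero>" if "v \<in> W" for v
    using W add_minus that by blast
  show ?thesis
    by unfold_locales (use W neg in \<open>auto simp: add_assoc add_zero smul_add add_smul smul_smul
        smul_one intro: add_commute\<close>)
qed

end

locale normed_star_algebra = complex_vector_space V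
  for V :: "('a, 'm) star_alg_scheme" +
  fixes N :: "'a \<Rightarrow> real"
  assumes mul_closed: "\<lbrakk>a \<in> carrier V; b \<in> carrier V\<rbrakk> \<Longrightarrow> amul V a b \<in> carrier V"
    and mul_add_left: "\<lbrakk>a \<in> carrier V; b \<in> carrier V; c \<in> carrier V\<rbrakk>
      \<Longrightarrow> amul V (vadd V a b) c = vadd V (amul V a c) (amul V b c)"
    and mul_add_right: "\<lbrakk>a \<in> carrier V; b \<in> carrier V; c \<in> carrier V\<rbrakk>
      \<Longrightarrow> amul V a (vadd V b c) = vadd V (amul V a b) (amul V a c)"
    and mul_smul_left: "\<lbrakk>a \<in> carrier V; b \<in> carrier V\<rbrakk>
      \<Longrightarrow> amul V (vsmul V z a) b = vsmul V z (amul V a b)"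
    and mul_smul_right: "\<lbrakk>a \<in> carrier V; b \<in> carrier V\<rbrakk>
      \<Longrightarrow> amul V a (vsmul V z b) = vsmul V z (amul V a b)"
    and mul_assoc: "\<lbrakk>a \<in> carrier V; b \<in> carrier V; c \<in> carrier V\<rbrakk>
      \<Longrightarrow> amul V (amul V a b) c = amul V a (amul V b c)"
    and adj_closed: "a \<in> carrier V \<Longrightarrow> aadj V a \<in> carrier V"
    and adj_add: "\<lbrakk>a \<in> carrier V; b \<in> carrier V\<rbrakk>
      \<Longrightarrow> aadj V (vadd V a b) = vadd V (aadj V a) (aadj V b)"
    and adj_smul: "a \<in> carrier V \<Longrightarrow> aadj V (vsmul V z a) = vsmul V (cnj z) (aadj V a)"
    and adj_adj: "a \<in> carrier V \<Longrightarrow> aadj V (aadj V a) = a"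
    and adj_mul: "\<lbrakk>a \<in> carrier V; b \<in> carrier V\<rbrakk>
      \<Longrightarrow> aadj V (amul V a b) = amul V (aadj V b) (aadj V a)"
    and norm: "is_norm V N"
    and norm_mul: "\<lbrakk>a \<in> carrier V; b \<in> carrier V\<rbrakk> \<Longrightarrow> N (amul V a b) \<le> N a * N b"
    and norm_adj: "a \<in> carrier V \<Longrightarrow> N (aadj V a) = N a"
begin

abbreviation mul (infixl "\<odot>" 70) where "a \<odot> b \<equiv> amul V a b"
abbreviation adj where "adj a \<equiv> aadj V a"

lemmas closed = zero_closed add_closed smul_closed sub_closed mul_closed adj_closed

lemma norm_nonneg: "a \<in> car \<Longrightarrow> 0 \<le> N a"
  and norm_eq_0: "a \<in> car \<Longrightarrow> N a = 0 \<longleftrightarrow> a = \<zero>"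
  and norm_add: "\<lbrakk>a \<in> car; b \<in> car\<rbrakk> \<Longrightarrow> N (a \<oplus> b) \<le> N a + N b"
  and norm_smul: "a \<in> car \<Longrightarrow> N (c \<cdot> a) = cmod c * N a"
  using norm by (auto simp: is_norm_def)

lemma norm_zero: "N \<zero> = 0" using norm_eq_0 zero_closed by blast

lemma norm_triangle: "\<lbrakk>a \<in> car; b \<in> car; c \<in> car\<rbrakk> \<Longrightarrow> N (a \<ominus> c) \<le> N (a \<ominus> b) + N (b \<ominus> c)"
  using norm_add[of "a \<ominus> b" "b \<ominus> c"] by (simp add: sub_trans sub_closed)

lemma norm_sub_swap: "\<lbrakk>a \<in> car; b \<in> car\<rbrakk> \<Longrightarrow> N (b \<ominus> a) = N (a \<ominus> b)"
  by (simp add: sub_swap[of a b] norm_smul sub_closed)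

lemma norm_sub_le: "\<lbrakk>a \<in> car; b \<in> car\<rbrakk> \<Longrightarrow> N (a \<ominus> b) \<le> N a + N b"
  using norm_add[of a "(-1) \<cdot> b"] by (simp add: vsub_def norm_smul smul_closed)

lemma norm_diff_le: "\<lbrakk>a \<in> car; b \<in> car\<rbrakk> \<Longrightarrow> \<bar>N a - N b\<bar> \<le> N (a \<ominus> b)"
  using norm_add[of "a \<ominus> b" b] norm_add[of "b \<ominus> a" a]
  by (simp add: sub_add_cancel sub_closed norm_sub_swap)

lemma norm_add_sub_add: "\<lbrakk>a \<in> car; b \<in> car; c \<in> car; d \<in> car\<rbrakk>
   \<Longrightarrow> N ((a \<oplus> b) \<ominus> (c \<oplus> d)) \<le> N (a \<ominus> c) + N (b \<ominus> d)"
  by (simp add: add_sub_add norm_add sub_closed)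

lemma mul_sub_left: "\<lbrakk>a \<in> car; b \<in> car; c \<in> car\<rbrakk> \<Longrightarrow> (a \<ominus> b) \<odot> c = a \<odot> c \<ominus> b \<odot> c"
  by (simp add: vsub_def mul_add_left closed mul_smul_left)

lemma mul_sub_right: "\<lbrakk>a \<in> car; b \<in> car; c \<in> car\<rbrakk> \<Longrightarrow> a \<odot> (b \<ominus> c) = a \<odot> b \<ominus> a \<odot> c"
  by (simp add: vsub_def mul_add_right closed mul_smul_right)

lemma adj_sub: "\<lbrakk>a \<in> car; b \<in> car\<rbrakk> \<Longrightarrow> adj (a \<ominus> b) = adj a \<ominus> adj b"
  by (simp add: vsub_def adj_add closed adj_smul)

lemma norm_mul_sub_mul: assumes "a \<in> car" "b \<in> car" "c \<in> car" "d \<in> car"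
  shows "N (a \<odot> b \<ominus> c \<odot> d) \<le> N (a \<ominus> c) * N b + N c * N (b \<ominus> d)"
proof -
  have "N (a \<odot> b \<ominus> c \<odot> d) \<le> N (a \<odot> b \<ominus> c \<odot> b) + N (c \<odot> b \<ominus> c \<odot> d)"
    using assms by (intro norm_triangle closed)
  also have "\<dots> = N ((a \<ominus> c) \<odot> b) + N (c \<odot> (b \<ominus> d))"
    using assms by (simp add: mul_sub_left mul_sub_right)
  also have "\<dots> \<le> N (a \<ominus> c) * N b + N c * N (b \<ominus> d)"
    using assms by (intro add_mono norm_mul closed)
  finally show ?thesis .
qed

end

text \<open>In a C*-norm the adjoint is isometric, because \<open>N(a)\<^sup>2 = N(a\<^sup>*a) \<le> N(a\<^sup>*) N(a)\<close>.\<close>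

lemma cstar_norm_adj:
  assumes N: "is_cstar_norm S N" and adj: "\<And>a. a \<in> carrier S \<Longrightarrow> aadj S a \<in> carrier S"
    "\<And>a. a \<in> carrier S \<Longrightarrow> aadj S (aadj S a) = a" and a: "a \<in> carrier S"
  shows "N (aadj S a) = N a"
proof -
  have le: "N b \<le> N (aadj S b)" if b: "b \<in> carrier S" for b
  proof (cases "N b = 0")
    case True thus ?thesis using N adj(1)[OF b] by (auto simp: is_cstar_norm_def is_norm_def)
  next
    case False
    hence p: "N b > 0" using N b unfolding is_cstar_norm_def is_norm_def by (metis less_eq_real_def)
    have "N b * N b \<le> N (aadj S b) * N b"
      using N b adj(1)[OF b] unfolding is_cstar_norm_def by (metis power2_eq_square)
    thus ?thesis using p by simp
  qed
  show ?thesis using le[OF a] le[OF adj(1)[OF a]] adj(2)[OF a] by simp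
qed

section \<open>Completions\<close>

context normed_star_algebra
begin

abbreviation seqs where "seqs \<equiv> cauchy_seqs V N"
abbreviation cls where "cls \<equiv> cauchy_class V N"
abbreviation compl where "compl \<equiv> completion V N"

lemma seqs_car: "f \<in> seqs \<Longrightarrow> f n \<in> car"
  by (simp add: cauchy_seqs_def)

lemma seqs_cauchy: "\<lbrakk>f \<in> seqs; e > 0\<rbrakk> \<Longrightarrow> \<exists>M. \<forall>m\<ge>M. \<forall>n\<ge>M. N (f m \<ominus> f n) < e"
  by (simp add: cauchy_seqs_def)

lemma seqs_norm_convergent: assumes f: "f \<in> seqs" shows "convergent (\<lambda>n. N (f n))"
proof -
  have "\<exists>M. \<forall>m\<ge>M. \<forall>n\<ge>M. dist (N (f m)) (N (f n)) < e" if "e > 0" for e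
    using seqs_cauchy[OF f that] norm_diff_le[OF seqs_car[OF f] seqs_car[OF f]]
    unfolding dist_real_def by (meson le_less_trans)
  hence "Cauchy (\<lambda>n. N (f n))" unfolding Cauchy_def by blast
  thus ?thesis by (rule Cauchy_convergent)
qed

lemma seqs_bounded: assumes f: "f \<in> seqs" shows "\<exists>K>0. \<forall>n. N (f n) \<le> K"
proof -
  have "Bseq (\<lambda>n. N (f n))" using seqs_norm_convergent[OF f] convergent_imp_Bseq by blast
  then obtain K where "K > 0" "\<forall>n. norm (N (f n)) \<le> K" by (rule BseqE)
  thus ?thesis using norm_nonneg seqs_car f by (auto simp: abs_of_nonneg)
qed

text \<open>That the algebraic operations preserve Cauchy sequences always comes down to this estimate.\<close>

lemma seqs_dominated:
  assumes f: "f \<in> seqs" and g: "g \<in> seqs" and h: "\<And>n. h n \<in> car"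
    and K: "\<And>m n. N (h m \<ominus> h n) \<le> K * N (f m \<ominus> f n) + K * N (g m \<ominus> g n)"
  shows "h \<in> seqs"
  unfolding cauchy_seqs_def
proof (intro CollectI conjI allI impI)
  fix e :: real assume e: "e > 0"
  define d where "d = e / 2 / (\<bar>K\<bar> + 1)"
  have K1: "\<bar>K\<bar> + 1 \<noteq> 0" by linarith
  have Kd: "(\<bar>K\<bar> + 1) * d = e / 2"
    unfolding d_def using K1 by (metis mult.commute nonzero_eq_divide_eq)
  have d: "d > 0" using e by (simp add: d_def)
  obtain M1 where M1: "\<forall>m\<ge>M1. \<forall>n\<ge>M1. N (f m \<ominus> f n) < d" using seqs_cauchy f d by blast
  obtain M2 where M2: "\<forall>m\<ge>M2. \<forall>n\<ge>M2. N (g m \<ominus> g n) < d" using seqs_cauchy g d by blast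
  have "N (h m \<ominus> h n) < e" if mn: "m \<ge> max M1 M2" "n \<ge> max M1 M2" for m n
  proof -
    have nn: "0 \<le> N (f m \<ominus> f n)" "0 \<le> N (g m \<ominus> g n)"
      using f g by (simp_all add: norm_nonneg closed seqs_car)
    have "N (h m \<ominus> h n) \<le> \<bar>K\<bar> * N (f m \<ominus> f n) + \<bar>K\<bar> * N (g m \<ominus> g n)"
      using K[of m n] nn mult_right_mono[of K "\<bar>K\<bar>"] by (smt (verit, best))
    also have "\<dots> \<le> \<bar>K\<bar> * d + \<bar>K\<bar> * d"
      using M1 M2 mn by (intro add_mono mult_left_mono) (auto simp: less_imp_le)
    also have "\<dots> < (\<bar>K\<bar> + 1) * d + (\<bar>K\<bar> + 1) * d" using d by (simp add: algebra_simps)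
    also have "\<dots> = e" using Kd by linarith
    finally show ?thesis .
  qed
  thus "\<exists>M. \<forall>m\<ge>M. \<forall>n\<ge>M. N (h m \<ominus> h n) < e" by blast
qed (use h in auto)

lemma seqs_const: "a \<in> car \<Longrightarrow> (\<lambda>n. a) \<in> seqs"
  by (auto simp: cauchy_seqs_def sub_self norm_zero)

lemma seqs_add: assumes f: "f \<in> seqs" and g: "g \<in> seqs" shows "(\<lambda>n. f n \<oplus> g n) \<in> seqs"
  using assms norm_add_sub_add[OF seqs_car[OF f] seqs_car[OF g] seqs_car[OF f] seqs_car[OF g]]
  by (intro seqs_dominated[where K=1, OF f g]) (simp_all add: closed seqs_car)

lemma seqs_smul: assumes f: "f \<in> seqs" shows "(\<lambda>n. c \<cdot> f n) \<in> seqs"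
proof (rule seqs_dominated[where K="cmod c", OF f f])
  fix m n
  have "0 \<le> cmod c * N (f m \<ominus> f n)" using f by (simp add: norm_nonneg closed seqs_car)
  thus "N (c \<cdot> f m \<ominus> c \<cdot> f n) \<le> cmod c * N (f m \<ominus> f n) + cmod c * N (f m \<ominus> f n)"
    using f by (simp add: smul_sub norm_smul closed seqs_car)
qed (use f in \<open>simp add: closed seqs_car\<close>)

lemma seqs_adj: assumes f: "f \<in> seqs" shows "(\<lambda>n. adj (f n)) \<in> seqs"
proof (rule seqs_dominated[where K=1, OF f f])
  fix m n
  have "0 \<le> N (f m \<ominus> f n)" using f by (simp add: norm_nonneg closed seqs_car)
  thus "N (adj (f m) \<ominus> adj (f n)) \<le> 1 * N (f m \<ominus> f n) + 1 * N (f m \<ominus> f n)"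
    using f by (simp add: adj_sub[symmetric] norm_adj closed seqs_car)
qed (use f in \<open>simp add: closed seqs_car\<close>)

lemma seqs_mul: assumes f: "f \<in> seqs" and g: "g \<in> seqs" shows "(\<lambda>n. f n \<odot> g n) \<in> seqs"
proof -
  obtain K1 where K1: "K1 > 0" "\<And>n. N (f n) \<le> K1" using seqs_bounded f by blast
  obtain K2 where K2: "K2 > 0" "\<And>n. N (g n) \<le> K2" using seqs_bounded g by blast
  show ?thesis
  proof (rule seqs_dominated[where K="max K1 K2", OF f g])
    fix m n
    have nn: "0 \<le> N (f m \<ominus> f n)" "0 \<le> N (g m \<ominus> g n)"
      using f g by (simp_all add: norm_nonneg closed seqs_car)
    have "N (f m \<odot> g m \<ominus> f n \<odot> g n) \<le> N (f m \<ominus> f n) * N (g m) + N (f n) * N (g m \<ominus> g n)"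
      using f g by (intro norm_mul_sub_mul seqs_car)
    also have "\<dots> \<le> N (f m \<ominus> f n) * max K1 K2 + max K1 K2 * N (g m \<ominus> g n)"
      using K1(2) K2(2) nn by (intro add_mono mult_left_mono mult_right_mono) (auto simp: le_max_iff_disj)
    finally show "N (f m \<odot> g m \<ominus> f n \<odot> g n)
        \<le> max K1 K2 * N (f m \<ominus> f n) + max K1 K2 * N (g m \<ominus> g n)" by (simp add: mult.commute)
  qed (use f g in \<open>simp add: closed seqs_car\<close>)
qed

lemma cls_eq:
  assumes f: "f \<in> seqs" and g: "g \<in> seqs"
  shows "cls f = cls g \<longleftrightarrow> (\<lambda>n. N (f n \<ominus> g n)) \<longlonglongrightarrow> 0"
proof
  assume "cls f = cls g"
  moreover have "g \<in> cls g" using g by (simp add: cauchy_class_def sub_self seqs_car norm_zero)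
  ultimately show "(\<lambda>n. N (f n \<ominus> g n)) \<longlonglongrightarrow> 0" by (auto simp: cauchy_class_def)
next
  have sub: "cls p \<subseteq> cls q" if p: "p \<in> seqs" and q: "q \<in> seqs" and lim: "(\<lambda>n. N (q n \<ominus> p n)) \<longlonglongrightarrow> 0" for p q
  proof
    fix h assume "h \<in> cls p"
    hence h: "h \<in> seqs" "(\<lambda>n. N (p n \<ominus> h n)) \<longlonglongrightarrow> 0" by (auto simp: cauchy_class_def)
    have "(\<lambda>n. N (q n \<ominus> h n)) \<longlonglongrightarrow> 0"
    proof (rule Lim_null_comparison[OF always_eventually])
      show "(\<lambda>n. N (q n \<ominus> p n) + N (p n \<ominus> h n)) \<longlonglongrightarrow> 0" using tendsto_add[OF lim h(2)] by simp
      show "\<forall>n. norm (N (q n \<ominus> h n)) \<le> N (q n \<ominus> p n) + N (p n \<ominus> h n)"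
        using p q h(1) by (simp add: norm_triangle norm_nonneg closed seqs_car)
    qed
    thus "h \<in> cls q" using h by (simp add: cauchy_class_def)
  qed
  assume l: "(\<lambda>n. N (f n \<ominus> g n)) \<longlonglongrightarrow> 0"
  hence l': "(\<lambda>n. N (g n \<ominus> f n)) \<longlonglongrightarrow> 0" using f g by (simp add: norm_sub_swap seqs_car)
  show "cls f = cls g" using sub[OF f g l'] sub[OF g f l] by blast
qed

lemma mem_cls: "f \<in> seqs \<Longrightarrow> f \<in> cls f"
  by (simp add: cauchy_class_def sub_self seqs_car norm_zero)

lemma representative_cls:
  assumes f: "f \<in> seqs"
  shows "representative (cls f) \<in> seqs" "(\<lambda>n. N (representative (cls f) n \<ominus> f n)) \<longlonglongrightarrow> 0"
proof -
  have "representative (cls f) \<in> cls f"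
    unfolding representative_def by (rule someI[of "\<lambda>g. g \<in> cls f"], rule mem_cls[OF f])
  thus r: "representative (cls f) \<in> seqs" and "(\<lambda>n. N (representative (cls f) n \<ominus> f n)) \<longlonglongrightarrow> 0"
    using norm_sub_swap f by (auto simp: cauchy_class_def seqs_car)
qed

lemma compl_carrier: "b \<in> carrier compl \<longleftrightarrow> (\<exists>f\<in>seqs. b = cls f)"
  by (auto simp: completion_def)

lemma compl_zero: "vzero compl = cls (\<lambda>n. \<zero>)"
  by (simp add: completion_def)

lemma compl_add: assumes f: "f \<in> seqs" and g: "g \<in> seqs"
  shows "vadd compl (cls f) (cls g) = cls (\<lambda>n. f n \<oplus> g n)"
proof -
  let ?f = "representative (cls f)" and ?g = "representative (cls g)"
  note rf = representative_cls[OF f] and rg = representative_cls[OF g]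
  have "(\<lambda>n. N ((?f n \<oplus> ?g n) \<ominus> (f n \<oplus> g n))) \<longlonglongrightarrow> 0"
  proof (rule Lim_null_comparison[OF always_eventually])
    show "(\<lambda>n. N (?f n \<ominus> f n) + N (?g n \<ominus> g n)) \<longlonglongrightarrow> 0" using tendsto_add[OF rf(2) rg(2)] by simp
    show "\<forall>n. norm (N ((?f n \<oplus> ?g n) \<ominus> (f n \<oplus> g n))) \<le> N (?f n \<ominus> f n) + N (?g n \<ominus> g n)"
      using f g rf(1) rg(1) by (simp add: norm_add_sub_add norm_nonneg closed seqs_car)
  qed
  hence "cls (\<lambda>n. ?f n \<oplus> ?g n) = cls (\<lambda>n. f n \<oplus> g n)"
    using cls_eq f g rf(1) rg(1) seqs_add by simp
  thus ?thesis by (simp add: completion_def)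
qed

lemma compl_smul: assumes f: "f \<in> seqs" shows "vsmul compl c (cls f) = cls (\<lambda>n. c \<cdot> f n)"
proof -
  let ?f = "representative (cls f)"
  note rf = representative_cls[OF f]
  have "(\<lambda>n. N (c \<cdot> ?f n \<ominus> c \<cdot> f n)) \<longlonglongrightarrow> 0"
    using tendsto_mult_left[OF rf(2), of "cmod c"] f rf(1) by (simp add: smul_sub norm_smul closed seqs_car)
  hence "cls (\<lambda>n. c \<cdot> ?f n) = cls (\<lambda>n. c \<cdot> f n)"
    using cls_eq f rf(1) seqs_smul by simp
  thus ?thesis by (simp add: completion_def)
qed

lemma compl_adj: assumes f: "f \<in> seqs" shows "aadj compl (cls f) = cls (\<lambda>n. adj (f n))"
proof -
  let ?f = "representative (cls f)"
  note rf = representative_cls[OF f]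
  have "(\<lambda>n. N (adj (?f n) \<ominus> adj (f n))) \<longlonglongrightarrow> 0"
    using rf f by (simp add: adj_sub[symmetric] norm_adj closed seqs_car)
  hence "cls (\<lambda>n. adj (?f n)) = cls (\<lambda>n. adj (f n))"
    using cls_eq f rf(1) seqs_adj by simp
  thus ?thesis by (simp add: completion_def)
qed

lemma compl_mul: assumes f: "f \<in> seqs" and g: "g \<in> seqs"
  shows "amul compl (cls f) (cls g) = cls (\<lambda>n. f n \<odot> g n)"
proof -
  let ?f = "representative (cls f)" and ?g = "representative (cls g)"
  note rf = representative_cls[OF f] and rg = representative_cls[OF g]
  obtain K1 where K1: "K1 > 0" "\<And>n. N (?g n) \<le> K1" using seqs_bounded rg by blast
  obtain K2 where K2: "K2 > 0" "\<And>n. N (f n) \<le> K2" using seqs_bounded f by blast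
  have "(\<lambda>n. N (?f n \<odot> ?g n \<ominus> f n \<odot> g n)) \<longlonglongrightarrow> 0"
  proof (rule Lim_null_comparison[OF always_eventually])
    show "(\<lambda>n. N (?f n \<ominus> f n) * K1 + K2 * N (?g n \<ominus> g n)) \<longlonglongrightarrow> 0"
      using tendsto_add[OF tendsto_mult_right[OF rf(2), of K1] tendsto_mult_left[OF rg(2), of K2]] by simp
    have "N (?f n \<odot> ?g n \<ominus> f n \<odot> g n) \<le> N (?f n \<ominus> f n) * K1 + K2 * N (?g n \<ominus> g n)" for n
    proof -
      have "N (?f n \<odot> ?g n \<ominus> f n \<odot> g n) \<le> N (?f n \<ominus> f n) * N (?g n) + N (f n) * N (?g n \<ominus> g n)"
        using f g rf(1) rg(1) by (intro norm_mul_sub_mul seqs_car)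
      also have "\<dots> \<le> N (?f n \<ominus> f n) * K1 + K2 * N (?g n \<ominus> g n)"
        using K1(2) K2(2) f g rf(1) rg(1)
        by (intro add_mono mult_left_mono mult_right_mono) (simp_all add: norm_nonneg closed seqs_car)
      finally show ?thesis .
    qed
    thus "\<forall>n. norm (N (?f n \<odot> ?g n \<ominus> f n \<odot> g n)) \<le> N (?f n \<ominus> f n) * K1 + K2 * N (?g n \<ominus> g n)"
      using f g rf(1) rg(1) by (simp add: norm_nonneg closed seqs_car)
  qed
  hence "cls (\<lambda>n. ?f n \<odot> ?g n) = cls (\<lambda>n. f n \<odot> g n)"
    using cls_eq f g rf(1) rg(1) seqs_mul by simp
  thus ?thesis by (simp add: completion_def)
qed

lemma compl_norm: assumes f: "f \<in> seqs" shows "(\<lambda>n. N (f n)) \<longlonglongrightarrow> anorm compl (cls f)"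
proof -
  let ?f = "representative (cls f)"
  note rf = representative_cls[OF f]
  have l: "(\<lambda>n. N (?f n)) \<longlonglongrightarrow> anorm compl (cls f)"
    using seqs_norm_convergent[OF rf(1)] by (simp add: completion_def convergent_LIMSEQ_iff)
  have "(\<lambda>n. N (f n) - N (?f n)) \<longlonglongrightarrow> 0"
  proof (rule Lim_null_comparison[OF always_eventually])
    show "(\<lambda>n. N (?f n \<ominus> f n)) \<longlonglongrightarrow> 0" by (rule rf)
    show "\<forall>n. norm (N (f n) - N (?f n)) \<le> N (?f n \<ominus> f n)"
      using norm_diff_le[of "?f n" "f n" for n] f rf(1)
      by (simp add: seqs_car abs_minus_commute)
  qed
  from tendsto_add[OF this l] show ?thesis by simp
qed

lemma compl_norm_eq: "f \<in> seqs \<Longrightarrow> (\<lambda>n. N (f n)) \<longlonglongrightarrow> l \<Longrightarrow> anorm compl (cls f) = l"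
  using compl_norm LIMSEQ_unique by blast

lemma normed_star_algebra_completion: "normed_star_algebra compl (anorm compl)"
proof -
  note [simp] = compl_zero compl_add compl_smul compl_mul compl_adj seqs_add seqs_smul seqs_mul
    seqs_adj seqs_const zero_closed
  have sc: "f \<in> seqs \<Longrightarrow> f n \<in> car" for f n by (rule seqs_car)
  have vs: "complex_vector_space compl"
  proof
    show "\<exists>w\<in>carrier compl. vadd compl v w = vzero compl" if "v \<in> carrier compl" for v
    proof -
      obtain f where f: "f \<in> seqs" "v = cls f" using \<open>v \<in> carrier compl\<close> compl_carrier by auto
      have "vadd compl v (cls (\<lambda>n. (-1) \<cdot> f n)) = vzero compl"
        using f by (simp add: add_minus sc)
      thus ?thesis using f compl_carrier seqs_smul by blast
    qed
    show "vadd compl u v = vadd compl v u" if "u \<in> carrier compl" "v \<in> carrier compl" for u v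
      using that by (auto simp: compl_carrier sc add_commute)
  qed (auto simp: compl_carrier sc add_assoc add_zero smul_add add_smul smul_smul smul_one)
  interpret c: complex_vector_space compl by (rule vs)
  have nrm: "is_norm compl (anorm compl)"
    unfolding is_norm_def
  proof (intro conjI ballI allI)
    fix v assume "v \<in> carrier compl"
    then obtain f where f: "f \<in> seqs" "v = cls f" using compl_carrier by auto
    show "0 \<le> anorm compl v"
      using LIMSEQ_le_const[OF compl_norm[OF f(1)], of 0] f norm_nonneg sc by auto
    have "anorm compl v = 0 \<longleftrightarrow> (\<lambda>n. N (f n)) \<longlonglongrightarrow> 0"
      using compl_norm[OF f(1)] compl_norm_eq[OF f(1)] f(2) by metis
    also have "\<dots> \<longleftrightarrow> v = vzero compl"
      using cls_eq[OF f(1), of "\<lambda>n. \<zero>"] f by (simp add: sub_zero sc)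
    finally show "anorm compl v = 0 \<longleftrightarrow> v = vzero compl" .
    show "anorm compl (vsmul compl c v) = cmod c * anorm compl v" for c
      using f tendsto_mult_left[OF compl_norm[OF f(1)], of "cmod c"]
      by (auto intro!: compl_norm_eq simp: norm_smul sc)
    fix u assume "u \<in> carrier compl"
    then obtain g where g: "g \<in> seqs" "u = cls g" using compl_carrier by auto
    show "anorm compl (vadd compl v u) \<le> anorm compl v + anorm compl u"
      using f g LIMSEQ_le[OF compl_norm[OF seqs_add[OF f(1) g(1)]]
          tendsto_add[OF compl_norm[OF f(1)] compl_norm[OF g(1)]]]
      by (auto simp: norm_add sc)
  qed
  show ?thesis
  proof
    fix a assume "a \<in> carrier compl"
    then obtain f where f: "f \<in> seqs" "a = cls f" using compl_carrier by auto
    show "anorm compl (aadj compl a) = anorm compl a"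
      using f compl_norm[OF f(1)] by (auto intro!: compl_norm_eq simp: norm_adj sc)
    fix b assume "b \<in> carrier compl"
    then obtain g where g: "g \<in> seqs" "b = cls g" using compl_carrier by auto
    show "anorm compl (amul compl a b) \<le> anorm compl a * anorm compl b"
      using f g LIMSEQ_le[OF compl_norm[OF seqs_mul[OF f(1) g(1)]]
          tendsto_mult[OF compl_norm[OF f(1)] compl_norm[OF g(1)]]]
      by (auto simp: norm_mul sc)
  qed (use nrm in \<open>auto simp: compl_carrier sc mul_add_left mul_add_right mul_smul_left mul_smul_right
      mul_assoc adj_add adj_smul adj_adj adj_mul\<close>)
qed

abbreviation emb where "emb \<equiv> completion_embed V N"

lemma emb_cls: "emb a = cls (\<lambda>n. a)"
  by (simp add: completion_embed_def)

lemma emb_closed: "a \<in> car \<Longrightarrow> emb a \<in> carrier compl"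
  using seqs_const compl_carrier by (auto simp: emb_cls)

lemma emb_hom:
  shows "a \<in> car \<Longrightarrow> b \<in> car \<Longrightarrow> vadd compl (emb a) (emb b) = emb (a \<oplus> b)"
    "a \<in> car \<Longrightarrow> b \<in> car \<Longrightarrow> amul compl (emb a) (emb b) = emb (a \<odot> b)"
    "a \<in> car \<Longrightarrow> vsmul compl c (emb a) = emb (c \<cdot> a)" "a \<in> car \<Longrightarrow> aadj compl (emb a) = emb (adj a)"
    "a \<in> car \<Longrightarrow> b \<in> car \<Longrightarrow> vsub compl (emb a) (emb b) = emb (a \<ominus> b)"
    "a \<in> car \<Longrightarrow> anorm compl (emb a) = N a"
    "vzero compl = emb \<zero>"
  by (auto simp: emb_cls compl_add compl_mul compl_smul compl_adj compl_zero seqs_const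
      vsub_def closed intro!: compl_norm_eq)

lemma emb_limit:
  assumes f: "f \<in> seqs"
  shows "(\<lambda>n. anorm compl (vsub compl (cls f) (emb (f n)))) \<longlonglongrightarrow> 0"
proof (rule LIMSEQ_I)
  fix r :: real assume r: "r > 0"
  interpret B: normed_star_algebra compl "anorm compl" by (rule normed_star_algebra_completion)
  obtain M where M: "\<And>m n. m \<ge> M \<Longrightarrow> n \<ge> M \<Longrightarrow> N (f m \<ominus> f n) < r/2"
    using seqs_cauchy[OF f, of "r/2"] r by auto
  have "norm (anorm compl (vsub compl (cls f) (emb (f n))) - 0) < r" if n: "n \<ge> M" for n
  proof -
    have s: "(\<lambda>m. f m \<ominus> f n) \<in> seqs"
      using seqs_add[OF f seqs_smul[OF seqs_const[OF seqs_car[OF f]]], of "-1" n] by (simp add: vsub_def)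
    have e: "vsub compl (cls f) (emb (f n)) = cls (\<lambda>m. f m \<ominus> f n)"
      using f by (simp add: vsub_def emb_cls compl_add compl_smul seqs_const seqs_smul seqs_car)
    have "anorm compl (cls (\<lambda>m. f m \<ominus> f n)) \<le> r/2"
      using LIMSEQ_le_const2[OF compl_norm[OF s], of "r/2"] M[OF _ n] by (meson less_imp_le)
    moreover have "0 \<le> anorm compl (cls (\<lambda>m. f m \<ominus> f n))"
      using B.norm_nonneg s compl_carrier by blast
    ultimately show ?thesis using e r by simp
  qed
  thus "\<exists>no. \<forall>n\<ge>no. norm (anorm compl (vsub compl (cls f) (emb (f n))) - 0) < r" by blast
qed

lemma emb_dense: assumes "b \<in> carrier compl" "e > 0"
  shows "\<exists>a\<in>car. anorm compl (vsub compl b (emb a)) < e"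
proof -
  obtain f where f: "f \<in> seqs" "b = cls f" using assms compl_carrier by auto
  show ?thesis
    using order_tendstoD(2)[OF emb_limit[OF f(1)] assms(2)] f seqs_car
    by (auto simp: eventually_sequentially)
qed

end

section \<open>Closed subspaces\<close>

locale banach_star_algebra = normed_star_algebra V "anorm V"
  for V :: "('a, 'm) normed_star_alg_scheme"
begin

abbreviation nrm where "nrm a \<equiv> anorm V a"

definition closed_sub where "closed_sub W \<longleftrightarrow> lin_subspace V W \<and> norm_closure V W \<subseteq> W"

lemma closureD: "b \<in> norm_closure V W \<Longrightarrow> e > 0 \<Longrightarrow> \<exists>s\<in>W. nrm (b \<ominus> s) < e"
  by (simp add: norm_closure_def)

lemma closed_subD:
  assumes "closed_sub W"
  shows "a \<in> W \<Longrightarrow> a \<in> car" "\<zero> \<in> W" "a \<in> W \<Longrightarrow> b \<in> W \<Longrightarrow> a \<oplus> b \<in> W" "a \<in> W \<Longrightarrow> c \<cdot> a \<in> W"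
    "a \<in> W \<Longrightarrow> b \<in> W \<Longrightarrow> a \<ominus> b \<in> W"
  using assms lin_subspace_sub[of W] by (auto simp: closed_sub_def lin_subspace_def)

lemma closed_sub_limit:
  assumes "closed_sub W" "b \<in> car" "\<And>e. e > 0 \<Longrightarrow> \<exists>s\<in>W. nrm (b \<ominus> s) < e"
  shows "b \<in> W"
  using assms by (auto simp: closed_sub_def norm_closure_def)

lemma norm_closure_superset: "W \<subseteq> car \<Longrightarrow> W \<subseteq> norm_closure V W"
  by (auto simp: norm_closure_def norm_zero sub_self intro!: bexI)

lemma lin_subspace_closure: assumes W: "lin_subspace V W" shows "lin_subspace V (norm_closure V W)"
proof -
  have Wc: "W \<subseteq> car" using W by (simp add: lin_subspace_def)
  have "u \<oplus> v \<in> norm_closure V W" if u: "u \<in> norm_closure V W" and v: "v \<in> norm_closure V W" for u v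
  proof -
    have c: "u \<in> car" "v \<in> car" using u v by (auto simp: norm_closure_def)
    have "\<exists>s\<in>W. nrm ((u \<oplus> v) \<ominus> s) < e" if e: "e > 0" for e
    proof -
      obtain s where s: "s \<in> W" "nrm (u \<ominus> s) < e/2" using closureD[OF u, of "e/2"] e by auto
      obtain t where t: "t \<in> W" "nrm (v \<ominus> t) < e/2" using closureD[OF v, of "e/2"] e by auto
      have "nrm ((u \<oplus> v) \<ominus> (s \<oplus> t)) < e"
        using norm_add_sub_add[of u v s t] c s t Wc by (auto simp: subset_iff)
      thus ?thesis using W s t by (auto simp: lin_subspace_def)
    qed
    thus ?thesis using c by (auto simp: norm_closure_def closed)
  qed
  moreover have "c \<cdot> u \<in> norm_closure V W" if u: "u \<in> norm_closure V W" for u c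
  proof -
    have uc: "u \<in> car" using u by (auto simp: norm_closure_def)
    have "\<exists>s\<in>W. nrm (c \<cdot> u \<ominus> s) < e" if e: "e > 0" for e
    proof -
      have p: "0 < e / (cmod c + 1)" using e by (simp add: add_nonneg_pos)
      obtain s where s: "s \<in> W" "nrm (u \<ominus> s) < e / (cmod c + 1)"
        using u p by (auto simp: norm_closure_def)
      have sc: "s \<in> car" using s Wc by auto
      have "cmod c * nrm (u \<ominus> s) \<le> (cmod c + 1) * nrm (u \<ominus> s)"
        using norm_nonneg[OF sub_closed[OF uc sc]] by (simp add: algebra_simps)
      also have "\<dots> < e" using s(2) add_nonneg_pos[of "cmod c" 1] by (simp add: pos_less_divide_eq mult.commute)
      finally have "nrm (c \<cdot> u \<ominus> c \<cdot> s) < e" using uc sc by (simp add: smul_sub norm_smul closed)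
      thus ?thesis using W s by (auto simp: lin_subspace_def)
    qed
    thus ?thesis using uc by (auto simp: norm_closure_def closed)
  qed
  moreover have "\<zero> \<in> norm_closure V W" using norm_closure_superset[OF Wc] W by (auto simp: lin_subspace_def)
  ultimately show ?thesis by (auto simp: lin_subspace_def norm_closure_def)
qed

lemma closed_sub_closure: assumes W: "lin_subspace V W" shows "closed_sub (norm_closure V W)"
proof -
  have Wc: "W \<subseteq> car" using W by (simp add: lin_subspace_def)
  have "b \<in> norm_closure V W" if b: "b \<in> norm_closure V (norm_closure V W)" for b
  proof -
    have bc: "b \<in> car" using b by (auto simp: norm_closure_def)
    have "\<exists>s\<in>W. nrm (b \<ominus> s) < e" if e: "e > 0" for e
    proof -
      obtain t where t: "t \<in> norm_closure V W" "nrm (b \<ominus> t) < e/2"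
        using closureD[OF b, of "e/2"] e by auto
      obtain s where s: "s \<in> W" "nrm (t \<ominus> s) < e/2"
        using closureD[OF t(1), of "e/2"] e by auto
      have "nrm (b \<ominus> s) < e" using norm_triangle[of b t s] bc t s Wc by (auto simp: norm_closure_def)
      thus ?thesis using s by auto
    qed
    thus ?thesis using bc by (auto simp: norm_closure_def)
  qed
  thus ?thesis using lin_subspace_closure[OF W] by (auto simp: closed_sub_def)
qed

lemma closed_span:
  assumes T: "T \<subseteq> car"
  shows "closed_sub (closed_span V T)" "T \<subseteq> closed_span V T"
proof -
  have l: "lin_subspace V (lin_span V T)" by (rule lin_subspace_span[OF T])
  show "closed_sub (closed_span V T)" unfolding closed_span_def by (rule closed_sub_closure[OF l])
  show "T \<subseteq> closed_span V T"
    unfolding closed_span_def using span_superset[of T] norm_closure_superset[of "lin_span V T"] l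
    by (auto simp: lin_subspace_def)
qed

lemma closed_span_minimal: assumes "closed_sub W" "T \<subseteq> W" shows "closed_span V T \<subseteq> W"
proof -
  have "lin_span V T \<subseteq> W" using assms by (intro span_minimal) (auto simp: closed_sub_def)
  hence "norm_closure V (lin_span V T) \<subseteq> norm_closure V W" unfolding norm_closure_def by blast
  thus ?thesis using assms unfolding closed_span_def closed_sub_def by blast
qed

lemma prod_space:
  assumes "S \<subseteq> car" "T \<subseteq> car"
  shows "closed_sub (prod_space V S T)" "a \<in> S \<Longrightarrow> b \<in> T \<Longrightarrow> a \<odot> b \<in> prod_space V S T"
    "closed_sub W \<Longrightarrow> (\<And>a b. a \<in> S \<Longrightarrow> b \<in> T \<Longrightarrow> a \<odot> b \<in> W) \<Longrightarrow> prod_space V S T \<subseteq> W"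
proof -
  have c: "{a \<odot> b |a b. a \<in> S \<and> b \<in> T} \<subseteq> car" using assms by (auto intro!: mul_closed)
  show "closed_sub (prod_space V S T)" "a \<in> S \<Longrightarrow> b \<in> T \<Longrightarrow> a \<odot> b \<in> prod_space V S T"
    using closed_span[OF c] unfolding prod_space_def by blast+
  show "closed_sub W \<Longrightarrow> (\<And>a b. a \<in> S \<Longrightarrow> b \<in> T \<Longrightarrow> a \<odot> b \<in> W) \<Longrightarrow> prod_space V S T \<subseteq> W"
    unfolding prod_space_def by (intro closed_span_minimal) auto
qed

text \<open>Closed spans of products are compared with closed subspaces given by a condition. This lemma and
  the following ones produce such subspaces, so that a condition has to be checked on generators only.\<close>

lemma closed_sub_vimage:
  assumes W: "closed_sub W" and f: "\<And>a. a \<in> car \<Longrightarrow> f a \<in> car"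
    "\<And>a b. a \<in> car \<Longrightarrow> b \<in> car \<Longrightarrow> f (a \<oplus> b) = f a \<oplus> f b"
    "\<And>a c. a \<in> car \<Longrightarrow> f (c \<cdot> a) = c \<cdot> f a"
    and K: "\<And>a. a \<in> car \<Longrightarrow> nrm (f a) \<le> K * nrm a"
  shows "closed_sub {a \<in> car. f a \<in> W}"
proof -
  have "f \<zero> = \<zero>" using f(3)[of \<zero> 0] by (simp add: smul_zero_scalar smul_zero zero_closed f(1))
  hence l: "lin_subspace V {a \<in> car. f a \<in> W}"
    by (simp add: lin_subspace_def closed subset_iff closed_subD(2-4)[OF W] f)
  have "b \<in> car \<and> f b \<in> W" if b: "b \<in> norm_closure V {a \<in> car. f a \<in> W}" for b
  proof
    show bc: "b \<in> car" using b by (simp add: norm_closure_def)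
    show "f b \<in> W"
    proof (rule closed_sub_limit[OF W f(1)[OF bc]])
      fix e :: real assume e: "e > 0"
      have "0 < e / (\<bar>K\<bar> + 1)" using e by (simp add: add_nonneg_pos)
      then obtain s where s: "s \<in> car" "f s \<in> W" "nrm (b \<ominus> s) < e / (\<bar>K\<bar> + 1)"
        using b unfolding norm_closure_def by blast
      have "f (b \<ominus> s) = f b \<ominus> f s" using bc s(1) by (simp add: vsub_def closed f)
      hence "nrm (f b \<ominus> f s) = nrm (f (b \<ominus> s))" by simp
      also have "\<dots> \<le> K * nrm (b \<ominus> s)" by (rule K[OF sub_closed[OF bc s(1)]])
      also have "\<dots> \<le> (\<bar>K\<bar> + 1) * nrm (b \<ominus> s)"
        by (rule mult_right_mono[OF _ norm_nonneg[OF sub_closed[OF bc s(1)]]]) simp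
      also have "\<dots> < e" using s(3) add_nonneg_pos[of "\<bar>K\<bar>" 1] by (simp add: pos_less_divide_eq mult.commute)
      finally show "\<exists>t\<in>W. nrm (f b \<ominus> t) < e" using s by blast
    qed
  qed
  thus ?thesis using l unfolding closed_sub_def by blast
qed

lemma closed_sub_mul_right:
  assumes "closed_sub W" "b \<in> car" shows "closed_sub {a \<in> car. a \<odot> b \<in> W}"
  by (rule closed_sub_vimage[OF assms(1), where K="nrm b"])
     (use assms norm_mul[OF _ assms(2)] in \<open>auto simp: mul_closed mul_add_left mul_smul_left mult.commute\<close>)

lemma closed_sub_mul_left:
  assumes "closed_sub W" "b \<in> car" shows "closed_sub {a \<in> car. b \<odot> a \<in> W}"
  by (rule closed_sub_vimage[OF assms(1), where K="nrm b"])
     (use assms in \<open>auto simp: mul_closed mul_add_right mul_smul_right norm_mul\<close>)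

lemma closed_sub_INT:
  assumes "closed_sub W" "\<And>i. i \<in> I \<Longrightarrow> closed_sub {a \<in> car. P i a}"
  shows "closed_sub {a \<in> W. \<forall>i\<in>I. P i a}"
  unfolding closed_sub_def
proof (intro conjI subsetI)
  show "lin_subspace V {a \<in> W. \<forall>i\<in>I. P i a}"
  proof -
    have 1: "P i \<zero>" if "i \<in> I" for i using closed_subD(2)[OF assms(2)[OF that]] by simp
    have 2: "P i (a \<oplus> b)" if "i \<in> I" "a \<in> car" "P i a" "b \<in> car" "P i b" for i a b
      using closed_subD(3)[OF assms(2)[OF that(1)], of a b] that by simp
    have 3: "P i (c \<cdot> a)" if "i \<in> I" "a \<in> car" "P i a" for i a c
      using closed_subD(4)[OF assms(2)[OF that(1)], of a c] that by simp
    show ?thesis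
      by (simp add: lin_subspace_def subset_iff closed_subD(1-4)[OF assms(1)] 1 2 3)
  qed
  fix b assume b: "b \<in> norm_closure V {a \<in> W. \<forall>i\<in>I. P i a}"
  have bc: "b \<in> car" using b by (simp add: norm_closure_def)
  have "b \<in> norm_closure V W" using closureD[OF b] bc by (auto simp: norm_closure_def)
  hence "b \<in> W" using assms(1) by (auto simp: closed_sub_def)
  moreover have "P i b" if i: "i \<in> I" for i
  proof -
    have "b \<in> {a \<in> car. P i a}"
    proof (rule closed_sub_limit[OF assms(2)[OF i]])
      show "b \<in> car" by (rule bc)
      fix e :: real assume "e > 0"
      from closureD[OF b this] obtain s where "s \<in> W" "\<forall>i\<in>I. P i s" "nrm (b \<ominus> s) < e" by auto
      thus "\<exists>s\<in>{a \<in> car. P i a}. nrm (b \<ominus> s) < e" using i closed_subD(1)[OF assms(1), of s] by auto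
    qed
    thus ?thesis by simp
  qed
  ultimately show "b \<in> {a \<in> W. \<forall>i\<in>I. P i a}" by simp
qed

text \<open>Uniform boundedness along the filter makes the convergence to zero pass to limits, by an
  \<open>\<epsilon>/2\<close> argument. A constant family gives kernels of functionals, and the filter of an approximate
  unit gives the vectors that it approximates.\<close>

lemma closed_sub_seminorm:
  assumes q: "eventually (\<lambda>u. \<forall>a\<in>car. 0 \<le> q u a \<and> q u a \<le> K * nrm a \<and> (\<forall>c. q u (c \<cdot> a) = cmod c * q u a)
      \<and> (\<forall>b\<in>car. q u (a \<oplus> b) \<le> q u a + q u b)) F"
  shows "closed_sub {y \<in> car. ((\<lambda>u. q u y) \<longlongrightarrow> (0::real)) F}"
proof -
  let ?W = "{y \<in> car. ((\<lambda>u. q u y) \<longlongrightarrow> 0) F}"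
  have smul: "((\<lambda>u. q u (c \<cdot> a)) \<longlongrightarrow> 0) F" if a: "a \<in> car" "((\<lambda>u. q u a) \<longlongrightarrow> 0) F" for a c
  proof -
    have "eventually (\<lambda>u. cmod c * q u a = q u (c \<cdot> a)) F" using q by eventually_elim (simp add: a(1))
    from Lim_transform_eventually[OF _ this] show ?thesis using tendsto_mult_left[OF a(2), of "cmod c"] by simp
  qed
  have dom: "((\<lambda>u. q u (a \<oplus> b)) \<longlongrightarrow> 0) F"
    if a: "a \<in> car" "((\<lambda>u. q u a) \<longlongrightarrow> 0) F" and b: "b \<in> car" "((\<lambda>u. q u b) \<longlongrightarrow> 0) F" for a b
  proof (rule Lim_null_comparison)
    show "eventually (\<lambda>u. norm (q u (a \<oplus> b)) \<le> q u a + q u b) F" using q by eventually_elim (simp add: closed a(1) b(1))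
    show "((\<lambda>u. q u a + q u b) \<longlongrightarrow> 0) F" using tendsto_add[OF a(2) b(2)] by simp
  qed
  have "eventually (\<lambda>u. 0 = q u \<zero>) F"
    using q
  proof eventually_elim
    case (elim u)
    hence "0 \<le> q u \<zero> \<and> q u \<zero> \<le> K * nrm \<zero>" using zero_closed by blast
    thus ?case by (simp add: norm_zero)
  qed
  hence zero: "((\<lambda>u. q u \<zero>) \<longlongrightarrow> 0) F" by (rule Lim_transform_eventually[OF tendsto_const])
  have l: "lin_subspace V ?W" by (simp add: lin_subspace_def closed zero smul dom subset_iff)
  have "b \<in> ?W" if b: "b \<in> norm_closure V ?W" for b
  proof -
    have bc: "b \<in> car" using b by (simp add: norm_closure_def)
    have "((\<lambda>u. q u b) \<longlongrightarrow> 0) F"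
    proof (rule tendstoI)
      fix d :: real assume d: "d > 0"
      have p: "0 < d / 2 / (\<bar>K\<bar> + 1)" using d by (simp add: add_nonneg_pos)
      obtain s where s: "s \<in> car" "((\<lambda>u. q u s) \<longlongrightarrow> 0) F" "nrm (b \<ominus> s) < d / 2 / (\<bar>K\<bar> + 1)"
        using closureD[OF b p] by auto
      have bs: "b \<ominus> s \<in> car" using bc s(1) by (rule sub_closed)
      have "K * nrm (b \<ominus> s) \<le> (\<bar>K\<bar> + 1) * nrm (b \<ominus> s)" by (rule mult_right_mono[OF _ norm_nonneg[OF bs]]) simp
      also have "\<dots> < d / 2" using s(3) add_nonneg_pos[of "\<bar>K\<bar>" 1] by (simp add: pos_less_divide_eq algebra_simps)
      finally have Kd: "K * nrm (b \<ominus> s) < d / 2" .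
      have "eventually (\<lambda>u. q u s < d / 2) F" using order_tendstoD(2)[OF s(2), of "d/2"] d by simp
      thus "eventually (\<lambda>u. dist (q u b) 0 < d) F"
        using q
      proof eventually_elim
        case (elim u)
        have "q u ((b \<ominus> s) \<oplus> s) \<le> q u (b \<ominus> s) + q u s" "q u (b \<ominus> s) \<le> K * nrm (b \<ominus> s)" "0 \<le> q u b"
          using elim(2) bs s(1) bc by blast+
        thus ?case using elim(1) Kd sub_add_cancel[OF bc s(1)] by (simp add: dist_real_def)
      qed
    qed
    thus ?thesis using bc by simp
  qed
  thus ?thesis using l unfolding closed_sub_def by blast
qed

lemma closed_sub_kernel:
  assumes f: "\<And>a b. a \<in> car \<Longrightarrow> b \<in> car \<Longrightarrow> f (a \<oplus> b) = f a + f b"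
    "\<And>a c. a \<in> car \<Longrightarrow> f (c \<cdot> a) = c * (f a :: complex)"
    and K: "\<And>a. a \<in> car \<Longrightarrow> cmod (f a) \<le> K * nrm a"
  shows "closed_sub {a \<in> car. f a = 0}"
  using closed_sub_seminorm[of "\<lambda>_ a. cmod (f a)" K sequentially] by (simp add: f K norm_mult norm_triangle_ineq LIMSEQ_const_iff)

section \<open>States and the localizing projection at a free point\<close>

text \<open>A state kills every product with a left factor \<open>a\<close> such that \<open>\<psi>(aa\<^sup>*) = 0\<close>: this is the
  degenerate case of the Cauchy-Schwarz inequality.\<close>

lemma positive_functional_degenerate:
  assumes add: "\<And>a b. a \<in> car \<Longrightarrow> b \<in> car \<Longrightarrow> \<psi> (a \<oplus> b) = \<psi> a + \<psi> b"
    and smul: "\<And>a c. a \<in> car \<Longrightarrow> \<psi> (c \<cdot> a) = c * \<psi> a"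
    and pos: "\<And>a. a \<in> car \<Longrightarrow> \<psi> (adj a \<odot> a) \<in> \<real>\<^sub>\<ge>\<^sub>0"
    and ab: "a \<in> car" "b \<in> car" and zero: "\<psi> (a \<odot> adj a) = 0"
  shows "\<psi> (a \<odot> b) = 0" "\<psi> (adj b \<odot> adj a) = 0"
proof -
  define p q r where "p = \<psi> (a \<odot> b)" and "q = \<psi> (adj b \<odot> adj a)" and "r = \<psi> (adj b \<odot> b)"
  have expand: "z * p + cnj z * q + z * cnj z * r \<in> \<real>\<^sub>\<ge>\<^sub>0" for z
  proof -
    have "adj (adj a \<oplus> z \<cdot> b) \<odot> (adj a \<oplus> z \<cdot> b)
        = (a \<odot> adj a \<oplus> z \<cdot> (a \<odot> b)) \<oplus> (cnj z \<cdot> (adj b \<odot> adj a) \<oplus> (z * cnj z) \<cdot> (adj b \<odot> b))"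
      using ab by (simp add: adj_add adj_smul adj_adj closed mul_add_left mul_add_right mul_smul_left
          mul_smul_right smul_smul smul_add mult.commute add4)
    thus ?thesis
      using pos[of "adj a \<oplus> z \<cdot> b"] ab zero by (simp add: closed add smul p_def q_def r_def add.assoc)
  qed
  have r: "r \<in> \<real>\<^sub>\<ge>\<^sub>0" using pos ab by (simp add: r_def)
  (* A linear form in t that is at least - r t^2 for all t vanishes. *)
  have real_lin: "u = 0" if "\<And>t::real. of_real t * u + of_real (t\<^sup>2) * r \<in> \<real>\<^sub>\<ge>\<^sub>0" for u
  proof -
    have im: "Im u = 0" "Re u + Re r \<ge> 0"
      using that[of 1] r by (auto simp: complex_nonneg_Reals_iff)
    have re: "t * Re u + t\<^sup>2 * Re r \<ge> 0" for t
      using that[of t] by (simp add: complex_nonneg_Reals_iff)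
    have r0: "Re r \<ge> 0" using r by (simp add: complex_nonneg_Reals_iff)
    have "Re u = 0"
    proof (rule ccontr)
      assume nz: "Re u \<noteq> 0"
      define t where "t = - Re u / (2 * (Re r + 1))"
      have d: "Re r + 1 > 0" using r0 by simp
      have e: "t * (2 * (Re r + 1)) = - Re u" using d by (simp add: t_def)
      have "t * Re u + t\<^sup>2 * Re r = t * (- t * (2 * (Re r + 1))) + t\<^sup>2 * Re r" using e by (metis minus_equation_iff mult_minus_left)
      also have "\<dots> = - (t\<^sup>2 * (Re r + 2))" by (simp add: algebra_simps power2_eq_square)
      also have "\<dots> < 0" using nz d r0 by (simp add: t_def)
      finally show False using re[of t] by simp
    qed
    thus ?thesis using im by (simp add: complex_eq_iff)
  qed
  have "p + q = 0"
    by (rule real_lin) (use expand[of "of_real t" for t] in \<open>simp add: algebra_simps power2_eq_square\<close>)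
  moreover have "\<i> * (p - q) = 0"
    by (rule real_lin) (use expand[of "\<i> * of_real t" for t] in \<open>simp add: algebra_simps power2_eq_square\<close>)
  ultimately show "\<psi> (a \<odot> b) = 0" "\<psi> (adj b \<odot> adj a) = 0" by (auto simp: p_def q_def)
qed

end

text \<open>The situation at a point of trivial isotropy. The functional \<open>\<phi>\<close> is evaluation at the point,
  \<open>J\<close> its kernel on \<open>A\<close>, and \<open>e\<close> a function with value \<open>1\<close>. The decisive assumption is
  \<open>decompose\<close>: modulo \<open>JB + BJ\<close> the algebra \<open>B\<close> is spanned by \<open>e\<close>. The filter \<open>F\<close> is an
  approximate unit of \<open>J\<close>.\<close>

locale localized_point = banach_star_algebra V
  for V :: "('a, 'm) normed_star_alg_scheme" +
  fixes A :: "'a set" and \<phi> :: "'a \<Rightarrow> complex" and e :: 'a and F :: "'a filter"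
  assumes A_car: "A \<subseteq> carrier V"
    and A_mul: "a \<in> A \<Longrightarrow> b \<in> A \<Longrightarrow> amul V a b \<in> A"
    and A_adj: "a \<in> A \<Longrightarrow> aadj V a \<in> A"
    and phi_add: "a \<in> carrier V \<Longrightarrow> b \<in> carrier V \<Longrightarrow> \<phi> (vadd V a b) = \<phi> a + \<phi> b"
    and phi_smul: "a \<in> carrier V \<Longrightarrow> \<phi> (vsmul V c a) = c * \<phi> a"
    and phi_adj: "a \<in> carrier V \<Longrightarrow> \<phi> (aadj V a) = cnj (\<phi> a)"
    and phi_bound: "a \<in> carrier V \<Longrightarrow> cmod (\<phi> a) \<le> anorm V a"
    and phi_left: "a \<in> A \<Longrightarrow> b \<in> carrier V \<Longrightarrow> \<phi> (amul V a b) = \<phi> a * \<phi> b"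
    and phi_right: "a \<in> A \<Longrightarrow> b \<in> carrier V \<Longrightarrow> \<phi> (amul V b a) = \<phi> b * \<phi> a"
    and e_A: "e \<in> A" and phi_e: "\<phi> e = 1"
    and decompose: "b \<in> carrier V \<Longrightarrow> vsub V b (vsmul V (\<phi> b) e) \<in> loc_L V {a \<in> A. \<phi> a = 0}"
    and F_nontrivial: "F \<noteq> bot"
    and F_J: "eventually (\<lambda>u. u \<in> A \<and> \<phi> u = 0 \<and> aadj V u = u \<and>
        (\<forall>b\<in>carrier V. anorm V (amul V u b) \<le> anorm V b)) F"
    and F_unit: "a \<in> A \<Longrightarrow> \<phi> a = 0 \<Longrightarrow> ((\<lambda>u. anorm V (vsub V a (amul V u a))) \<longlongrightarrow> 0) F"
begin

definition J where "J = {a \<in> A. \<phi> a = 0}"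

lemma J_car: "J \<subseteq> car" using A_car by (auto simp: J_def)

lemma e_car: "e \<in> car" using e_A A_car by blast

abbreviation JB where "JB \<equiv> prod_space V J car"
abbreviation BJ where "BJ \<equiv> prod_space V car J"
abbreviation C where "C \<equiv> loc_C V J"
abbreviation H where "H \<equiv> loc_H V J"
abbreviation LL where "LL \<equiv> loc_L V J"

lemmas JB = prod_space[OF J_car subset_refl] and BJ = prod_space[OF subset_refl J_car]

lemma phi_sub: "a \<in> car \<Longrightarrow> b \<in> car \<Longrightarrow> \<phi> (a \<ominus> b) = \<phi> a - \<phi> b"
  by (simp add: vsub_def phi_add phi_smul closed)

lemma adj_J: "j \<in> J \<Longrightarrow> adj j \<in> J"
  using A_adj phi_adj J_car by (auto simp: J_def)

lemma ker_closed: "closed_sub {a \<in> car. \<phi> a = 0}"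
  by (rule closed_sub_kernel[where K=1]) (simp_all add: phi_add phi_smul phi_bound)

lemma JB_ker: "JB \<subseteq> {a \<in> car. \<phi> a = 0}"
proof (rule JB(3)[OF ker_closed])
  fix j b assume j: "j \<in> J" and b: "b \<in> car"
  thus "j \<odot> b \<in> {a \<in> car. \<phi> a = 0}" using subsetD[OF J_car j] by (simp add: J_def phi_left mul_closed)
qed

lemma BJ_ker: "BJ \<subseteq> {a \<in> car. \<phi> a = 0}"
proof (rule BJ(3)[OF ker_closed])
  fix b j assume b: "b \<in> car" and j: "j \<in> J"
  thus "b \<odot> j \<in> {a \<in> car. \<phi> a = 0}" using subsetD[OF J_car j] by (simp add: J_def phi_right mul_closed)
qed

lemma LL_sums: "{a \<oplus> b |a b. a \<in> JB \<and> b \<in> BJ} \<subseteq> car"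
  using closed_subD(1)[OF JB(1)] closed_subD(1)[OF BJ(1)] by (auto intro!: add_closed)

lemma LL_closed: "closed_sub LL"
  unfolding loc_L_def sum_space_def by (rule closed_span(1)[OF LL_sums])

lemma LL_eq_ker: "LL = {a \<in> car. \<phi> a = 0}"
proof
  show "LL \<subseteq> {a \<in> car. \<phi> a = 0}"
    unfolding loc_L_def sum_space_def
    by (rule closed_span_minimal[OF ker_closed])
      (use subsetD[OF JB_ker] subsetD[OF BJ_ker] in \<open>fastforce simp: phi_add closed\<close>)
  show "{a \<in> car. \<phi> a = 0} \<subseteq> LL"
  proof
    fix b assume "b \<in> {a \<in> car. \<phi> a = 0}"
    hence b: "b \<in> car" "\<phi> b = 0" by simp_all
    show "b \<in> LL" using decompose[OF b(1)] unfolding b(2) J_def by (simp add: smul_zero_scalar e_car sub_zero b)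
  qed
qed

text \<open>Every state agreeing with \<open>\<phi>\<close> on \<open>A\<close> vanishes on \<open>JB + BJ\<close>, hence is \<open>\<phi>\<close>.\<close>

lemma state_unique:
  assumes st: "is_state V \<psi>" and A: "\<And>a. a \<in> A \<Longrightarrow> \<psi> a = \<phi> a" and b: "b \<in> car"
  shows "\<psi> b = \<phi> b"
proof -
  have add: "\<psi> (a \<oplus> b) = \<psi> a + \<psi> b" if "a \<in> car" "b \<in> car" for a b
    using st that by (simp add: is_state_def)
  have smul: "\<psi> (c \<cdot> a) = c * \<psi> a" if "a \<in> car" for a c
    using st that by (simp add: is_state_def)
  have pos: "\<psi> (adj a \<odot> a) \<in> \<real>\<^sub>\<ge>\<^sub>0" if "a \<in> car" for a
    using st that by (simp add: is_state_def)
  have bound: "cmod (\<psi> a) \<le> 1 * nrm a" if a: "a \<in> car" for a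
  proof (cases "nrm a = 0")
    case True
    hence "a = 0 \<cdot> a" using a norm_eq_0 smul_zero_scalar by simp
    hence "\<psi> a = 0" using smul[OF a, of 0] by simp
    thus ?thesis using True by simp
  next
    case False
    hence p: "nrm a > 0" using norm_nonneg[OF a] by simp
    let ?a = "of_real (1 / nrm a) \<cdot> a"
    have "nrm ?a \<le> 1" using p a by (simp add: norm_smul norm_inverse norm_divide)
    hence "cmod (\<psi> ?a) \<le> 1"
      using st a unfolding is_state_def by (metis (mono_tags, lifting) cSup_upper mem_Collect_eq smul_closed)
    thus ?thesis using p a by (simp add: smul norm_mult norm_divide field_simps)
  qed
  have ker: "closed_sub {a \<in> car. \<psi> a = 0}"
    by (rule closed_sub_kernel[where K=1]) (use add smul bound in auto)
  have jj: "\<psi> (j \<odot> adj j) = 0" if "j \<in> J" for j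
    using that A_car by (auto simp: J_def A A_mul A_adj phi_left closed subset_iff)
  have 1: "\<psi> (j \<odot> b) = 0" if "j \<in> J" "b \<in> car" for j b
    using positive_functional_degenerate(1)[of \<psi> j b] add smul pos jj J_car that by blast
  have 2: "\<psi> (b \<odot> j) = 0" if "j \<in> J" "b \<in> car" for j b
    using positive_functional_degenerate(2)[of \<psi> "adj j" "adj b"] add smul pos jj[OF adj_J[OF that(1)]] J_car that
    by (auto simp: adj_adj adj_closed subset_iff)
  have LLk: "LL \<subseteq> {a \<in> car. \<psi> a = 0}"
    unfolding loc_L_def sum_space_def
  proof (rule closed_span_minimal[OF ker])
    have "JB \<subseteq> {a \<in> car. \<psi> a = 0}"
      by (rule JB(3)[OF ker]) (simp add: 1 mul_closed subsetD[OF J_car])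
    moreover have "BJ \<subseteq> {a \<in> car. \<psi> a = 0}"
      by (rule BJ(3)[OF ker]) (simp add: 2 mul_closed subsetD[OF J_car])
    ultimately
    show "{a \<oplus> b |a b. a \<in> JB \<and> b \<in> BJ} \<subseteq> {a \<in> car. \<psi> a = 0}"
      by (fastforce simp: add closed)
  qed
  have "\<psi> (b \<ominus> \<phi> b \<cdot> e) = 0" using decompose[OF b] LLk by (auto simp: J_def)
  thus ?thesis using b e_car A[OF e_A] phi_e by (simp add: vsub_def add smul closed)
qed

lemma C_closed: "closed_sub C"
proof -
  have "closed_sub {c \<in> {c \<in> car. \<forall>j\<in>J. c \<odot> j \<in> JB}. \<forall>j\<in>J. j \<odot> c \<in> BJ}"
    using J_car lin_subspace_carrier
    by (intro closed_sub_INT closed_sub_mul_right closed_sub_mul_left JB(1) BJ(1))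
       (auto simp: closed_sub_def norm_closure_def)
  thus ?thesis by (simp add: loc_C_def conj_assoc)
qed

lemma C_car: "c \<in> C \<Longrightarrow> c \<in> car" by (simp add: loc_C_def)

lemma JB_mul: assumes y: "y \<in> JB" and b: "b \<in> car" shows "y \<odot> b \<in> JB"
proof -
  have "JB \<subseteq> {a \<in> car. a \<odot> b \<in> JB}"
    using J_car b by (intro JB(3) closed_sub_mul_right JB(1)) (auto simp: mul_closed mul_assoc subset_iff intro!: JB(2))
  thus ?thesis using y by auto
qed

lemma BJ_mul: assumes y: "y \<in> BJ" and b: "b \<in> car" shows "b \<odot> y \<in> BJ"
proof -
  have "BJ \<subseteq> {a \<in> car. b \<odot> a \<in> BJ}"
    using J_car b by (intro BJ(3) closed_sub_mul_left BJ(1)) (auto simp: mul_closed mul_assoc[symmetric] subset_iff intro!: BJ(2))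
  thus ?thesis using y by auto
qed

text \<open>The multiplier conditions defining \<open>C\<close> for \<open>J\<close> extend to \<open>JB\<close> and \<open>BJ\<close>, which is what a product needs.\<close>

lemma C_mul: assumes a: "a \<in> C" and b: "b \<in> C" shows "a \<odot> b \<in> C"
proof -
  note c = C_car[OF a] C_car[OF b]
  have 1: "JB \<subseteq> {y \<in> car. a \<odot> y \<in> JB}"
  proof (intro JB(3) closed_sub_mul_left JB(1) c)
    fix j b' assume j: "j \<in> J" "b' \<in> car"
    have "(a \<odot> j) \<odot> b' \<in> JB" using a j by (intro JB_mul[of "a \<odot> j"]) (simp_all add: loc_C_def)
    thus "j \<odot> b' \<in> {y \<in> car. a \<odot> y \<in> JB}" using j J_car c by (auto simp: mul_assoc closed subset_iff)
  qed
  have 2: "BJ \<subseteq> {y \<in> car. y \<odot> b \<in> BJ}"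
  proof (intro BJ(3) closed_sub_mul_right BJ(1) c)
    fix b' j assume j: "b' \<in> car" "j \<in> J"
    have "b' \<odot> (j \<odot> b) \<in> BJ" using b j by (intro BJ_mul[of "j \<odot> b"]) (simp_all add: loc_C_def)
    thus "b' \<odot> j \<in> {y \<in> car. y \<odot> b \<in> BJ}" using j J_car c by (auto simp: mul_assoc closed subset_iff)
  qed
  have "(a \<odot> b) \<odot> j \<in> JB" "j \<odot> (a \<odot> b) \<in> BJ" if j: "j \<in> J" for j
  proof -
    have jc: "j \<in> car" using j J_car by blast
    have "a \<odot> (b \<odot> j) \<in> JB" using 1 b j by (auto simp: loc_C_def)
    moreover have "(j \<odot> a) \<odot> b \<in> BJ" using 2 a j by (auto simp: loc_C_def)
    ultimately show "(a \<odot> b) \<odot> j \<in> JB" "j \<odot> (a \<odot> b) \<in> BJ" using c jc by (simp_all add: mul_assoc)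
  qed
  thus ?thesis using c by (simp add: loc_C_def closed)
qed

lemma F_contract:
  "eventually (\<lambda>u. u \<in> J \<and> u \<in> car \<and> (\<forall>b\<in>car. nrm (b \<ominus> u \<odot> b) \<le> 2 * nrm b \<and> nrm (b \<ominus> b \<odot> u) \<le> 2 * nrm b)) F"
  using F_J
proof eventually_elim
  case (elim u)
  hence uc: "u \<in> car" "adj u = u" using A_car by blast+
  have "nrm (b \<ominus> u \<odot> b) \<le> 2 * nrm b \<and> nrm (b \<ominus> b \<odot> u) \<le> 2 * nrm b" if b: "b \<in> car" for b
  proof -
    have "nrm (b \<odot> u) = nrm (u \<odot> adj b)" using norm_adj[OF mul_closed[OF b uc(1)]] adj_mul[OF b uc(1)] uc(2) by simp
    hence "nrm (u \<odot> b) \<le> nrm b" "nrm (b \<odot> u) \<le> nrm b" using elim b adj_closed[OF b] norm_adj[OF b] by auto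
    thus ?thesis using norm_sub_le[OF b mul_closed[OF uc(1) b]] norm_sub_le[OF b mul_closed[OF b uc(1)]] by linarith
  qed
  thus ?case using elim uc by (simp add: J_def)
qed

text \<open>The elements of the approximate unit are self-adjoint, so the right-hand version follows by taking
  adjoints.\<close>

lemma F_unit_right: assumes j: "j \<in> J" shows "((\<lambda>u. nrm (j \<ominus> j \<odot> u)) \<longlongrightarrow> 0) F"
proof (rule Lim_transform_eventually)
  show "((\<lambda>u. nrm (adj j \<ominus> u \<odot> adj j)) \<longlongrightarrow> 0) F" using F_unit adj_J[OF j] by (simp add: J_def)
  have jc: "j \<in> car" using j J_car by blast
  show "eventually (\<lambda>u. nrm (adj j \<ominus> u \<odot> adj j) = nrm (j \<ominus> j \<odot> u)) F"
    using F_J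
  proof eventually_elim
    case (elim u)
    hence uc: "u \<in> car" "adj u = u" using A_car by blast+
    have "adj (j \<ominus> j \<odot> u) = adj j \<ominus> u \<odot> adj j" using jc uc by (simp add: adj_sub adj_mul closed)
    thus ?case using norm_adj[of "j \<ominus> j \<odot> u"] jc uc by (simp add: closed)
  qed
qed

lemma J_sub_JB: assumes j: "j \<in> J" shows "j \<in> JB" "j \<in> BJ"
proof -
  have jc: "j \<in> car" using j J_car by blast
  have ex: "\<exists>u\<in>J. nrm (j \<ominus> u \<odot> j) < d \<and> nrm (j \<ominus> j \<odot> u) < d" if d: "d > 0" for d
  proof -
    have jA: "j \<in> A" "\<phi> j = 0" using j by (simp_all add: J_def)
    have "eventually (\<lambda>u. u \<in> J \<and> nrm (j \<ominus> u \<odot> j) < d \<and> nrm (j \<ominus> j \<odot> u) < d) F"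
      using F_J order_tendstoD(2)[OF F_unit[OF jA] d] order_tendstoD(2)[OF F_unit_right[OF j] d]
      by eventually_elim (simp add: J_def)
    thus ?thesis using F_nontrivial eventually_happens' by blast
  qed
  show "j \<in> JB" using ex j jc by (intro closed_sub_limit[OF JB(1)] jc) (meson JB(2))
  show "j \<in> BJ" using ex j jc by (intro closed_sub_limit[OF BJ(1)] jc) (meson BJ(2))
qed

lemma A_C: assumes a: "a \<in> A" shows "a \<in> C"
proof -
  have "a \<odot> j \<in> J" "j \<odot> a \<in> J" if "j \<in> J" for j
    using that a A_car by (auto simp: J_def A_mul phi_left phi_right subset_iff)
  thus ?thesis using a A_car J_sub_JB by (auto simp: loc_C_def)
qed

lemma J_C: "J \<subseteq> C" using A_C by (auto simp: J_def)

lemma C_sub_car: "C \<subseteq> car" using C_car by blast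

lemmas JC = prod_space[OF J_car C_sub_car]

lemma H_closed: "closed_sub H" unfolding loc_H_def by (rule JC(1))

lemma H_C: "H \<subseteq> C"
  unfolding loc_H_def by (rule JC(3)[OF C_closed]) (use J_C C_mul in blast)

lemma H_JB: "H \<subseteq> JB"
  unfolding loc_H_def by (rule JC(3)[OF JB(1)]) (use C_sub_car JB(2) in blast)

lemma H_ker: "h \<in> H \<Longrightarrow> \<phi> h = 0" using H_JB JB_ker by blast

lemma approx_JB: assumes y: "y \<in> JB" shows "((\<lambda>u. nrm (y \<ominus> u \<odot> y)) \<longlongrightarrow> 0) F"
proof -
  let ?W = "{y \<in> car. ((\<lambda>u. nrm (y \<ominus> u \<odot> y)) \<longlongrightarrow> 0) F}"
  have W: "closed_sub ?W"
    by (rule closed_sub_seminorm[where K=2], rule eventually_mono[OF F_contract])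
       (simp add: closed norm_add norm_smul norm_nonneg mul_add_right mul_smul_right add_sub_add smul_sub)
  have "JB \<subseteq> ?W"
  proof (rule JB(3)[OF W])
    fix j b assume j: "j \<in> J" and b: "b \<in> car"
    have jc: "j \<in> car" using j J_car by blast
    have "((\<lambda>u. nrm (j \<odot> b \<ominus> u \<odot> (j \<odot> b))) \<longlongrightarrow> 0) F"
    proof (rule Lim_null_comparison)
      show "((\<lambda>u. nrm (j \<ominus> u \<odot> j) * nrm b) \<longlongrightarrow> 0) F"
        using tendsto_mult_right[OF F_unit, of j "nrm b"] j by (simp add: J_def)
      show "eventually (\<lambda>u. norm (nrm (j \<odot> b \<ominus> u \<odot> (j \<odot> b))) \<le> nrm (j \<ominus> u \<odot> j) * nrm b) F"
        using F_contract
      proof eventually_elim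
        fix u assume "u \<in> J \<and> u \<in> car \<and> (\<forall>b\<in>car. nrm (b \<ominus> u \<odot> b) \<le> 2 * nrm b \<and> nrm (b \<ominus> b \<odot> u) \<le> 2 * nrm b)"
        hence u: "u \<in> car" by blast
        have "j \<odot> b \<ominus> u \<odot> (j \<odot> b) = (j \<ominus> u \<odot> j) \<odot> b" using u jc b by (simp add: mul_sub_left mul_assoc closed)
        thus "norm (nrm (j \<odot> b \<ominus> u \<odot> (j \<odot> b))) \<le> nrm (j \<ominus> u \<odot> j) * nrm b"
          using u jc b by (simp add: norm_mul norm_nonneg closed)
      qed
    qed
    thus "j \<odot> b \<in> ?W" using jc b by (simp add: closed)
  qed
  thus ?thesis using y by blast
qed

text \<open>On \<open>JB\<close> already \<open>y - uy\<close> tends to zero, and on \<open>BJ\<close> the norm of \<open>(1 - u)bj(1 - u)\<close> is controlled by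
  that of \<open>j(1 - u)\<close>.\<close>

lemma approx_LL: assumes y: "y \<in> LL"
  shows "((\<lambda>u. nrm ((y \<ominus> u \<odot> y) \<ominus> (y \<ominus> u \<odot> y) \<odot> u)) \<longlongrightarrow> 0) F"
proof -
  let ?T = "\<lambda>u y. (y \<ominus> u \<odot> y) \<ominus> (y \<ominus> u \<odot> y) \<odot> u"
  let ?W = "{y \<in> car. ((\<lambda>u. nrm (?T u y)) \<longlongrightarrow> 0) F}"
  have le4: "nrm (?T u a) \<le> 4 * nrm a"
    if u: "u \<in> J \<and> u \<in> car \<and> (\<forall>b\<in>car. nrm (b \<ominus> u \<odot> b) \<le> 2 * nrm b \<and> nrm (b \<ominus> b \<odot> u) \<le> 2 * nrm b)"
      and a: "a \<in> car" for u a
  proof -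
    have "a \<ominus> u \<odot> a \<in> car" using u a by (simp add: closed)
    hence "nrm (?T u a) \<le> 2 * nrm (a \<ominus> u \<odot> a)" using u by blast
    also have "\<dots> \<le> 2 * (2 * nrm a)" using u a by simp
    finally show ?thesis by simp
  qed
  have W: "closed_sub ?W"
    by (rule closed_sub_seminorm[where K=4], rule eventually_mono[OF F_contract])
       (simp add: closed norm_add norm_smul norm_nonneg mul_add_right mul_smul_right add_sub_add smul_sub mul_add_left mul_smul_left le4)
  have JBW: "JB \<subseteq> ?W"
  proof
    fix y assume y: "y \<in> JB"
    have yc: "y \<in> car" using closed_subD(1)[OF JB(1) y] .
    have "((\<lambda>u. nrm (?T u y)) \<longlongrightarrow> 0) F"
    proof (rule Lim_null_comparison)
      show "((\<lambda>u. 2 * nrm (y \<ominus> u \<odot> y)) \<longlongrightarrow> 0) F" using tendsto_mult_left[OF approx_JB[OF y], of 2] by simp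
      show "eventually (\<lambda>u. norm (nrm (?T u y)) \<le> 2 * nrm (y \<ominus> u \<odot> y)) F"
        using F_contract by eventually_elim (use yc in \<open>simp add: norm_nonneg closed\<close>)
    qed
    thus "y \<in> ?W" using yc by simp
  qed
  have BJW: "BJ \<subseteq> ?W"
  proof (rule BJ(3)[OF W])
    fix b j assume b: "b \<in> car" and j: "j \<in> J"
    have jc: "j \<in> car" using j J_car by blast
    have "((\<lambda>u. nrm (?T u (b \<odot> j))) \<longlongrightarrow> 0) F"
    proof (rule Lim_null_comparison)
      show "((\<lambda>u. 2 * nrm b * nrm (j \<ominus> j \<odot> u)) \<longlongrightarrow> 0) F"
        using tendsto_mult_left[OF F_unit_right[OF j], of "2 * nrm b"] by simp
      show "eventually (\<lambda>u. norm (nrm (?T u (b \<odot> j))) \<le> 2 * nrm b * nrm (j \<ominus> j \<odot> u)) F"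
        using F_contract
      proof eventually_elim
        fix u assume uu: "u \<in> J \<and> u \<in> car \<and> (\<forall>b\<in>car. nrm (b \<ominus> u \<odot> b) \<le> 2 * nrm b \<and> nrm (b \<ominus> b \<odot> u) \<le> 2 * nrm b)"
        hence u: "u \<in> car" by blast
        have z: "b \<ominus> u \<odot> b \<in> car" "j \<ominus> j \<odot> u \<in> car" using u b jc by (simp_all add: closed)
        have "?T u (b \<odot> j) = (b \<ominus> u \<odot> b) \<odot> (j \<ominus> j \<odot> u)"
          using u jc b by (simp add: mul_sub_left mul_sub_right mul_assoc closed)
        hence "nrm (?T u (b \<odot> j)) \<le> nrm (b \<ominus> u \<odot> b) * nrm (j \<ominus> j \<odot> u)" using norm_mul[OF z] by simp
        also have "\<dots> \<le> 2 * nrm b * nrm (j \<ominus> j \<odot> u)"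
          using uu b by (intro mult_right_mono norm_nonneg z) auto
        finally show "norm (nrm (?T u (b \<odot> j))) \<le> 2 * nrm b * nrm (j \<ominus> j \<odot> u)"
          using u jc b by (simp add: norm_nonneg closed)
      qed
    qed
    thus "b \<odot> j \<in> ?W" using jc b by (simp add: closed)
  qed
  have "LL \<subseteq> ?W"
    unfolding loc_L_def sum_space_def
  proof (rule closed_span_minimal[OF W])
    show "{a \<oplus> b |a b. a \<in> JB \<and> b \<in> BJ} \<subseteq> ?W" using JBW BJW closed_subD(3)[OF W] by blast
  qed
  thus ?thesis using y by blast
qed

text \<open>An element \<open>c\<close> of \<open>C\<close> killed by \<open>\<phi>\<close> is approximated by \<open>uc + cu - ucu\<close>. Here
  \<open>uc\<close> and \<open>ucu\<close> lie in \<open>JC\<close>, and \<open>cu\<close> lies in \<open>JB\<close>, so it is a limit of \<open>v(cu)\<close> in \<open>JC\<close>.\<close>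

lemma C_ker_H: assumes c: "c \<in> C" and z: "\<phi> c = 0" shows "c \<in> H"
proof -
  have cc: "c \<in> car" by (rule C_car[OF c])
  have cLL: "c \<in> LL" by (simp add: LL_eq_ker cc z)
  have cuH: "c \<odot> u \<in> H" if u: "u \<in> J" for u
  proof (rule closed_sub_limit[OF H_closed])
    show cu: "c \<odot> u \<in> car" using u cc J_car by (auto intro!: mul_closed)
    fix d :: real assume d: "d > 0"
    have cuJB: "c \<odot> u \<in> JB" using c u by (simp add: loc_C_def)
    have "eventually (\<lambda>v. v \<in> J \<and> nrm (c \<odot> u \<ominus> v \<odot> (c \<odot> u)) < d) F"
      using F_J order_tendstoD(2)[OF approx_JB[OF cuJB] d]
      by eventually_elim (auto simp: J_def)
    then obtain v where v: "v \<in> J" "nrm (c \<odot> u \<ominus> v \<odot> (c \<odot> u)) < d"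
      using F_nontrivial eventually_happens' by blast
    have "v \<odot> (c \<odot> u) \<in> H"
      unfolding loc_H_def using v u J_C c by (intro JC(2) C_mul) auto
    thus "\<exists>s\<in>H. nrm (c \<odot> u \<ominus> s) < d" using v by blast
  qed
  show ?thesis
  proof (rule closed_sub_limit[OF H_closed cc])
    fix d :: real assume d: "d > 0"
    have "eventually (\<lambda>u. u \<in> J \<and> nrm ((c \<ominus> u \<odot> c) \<ominus> (c \<ominus> u \<odot> c) \<odot> u) < d) F"
      using F_J order_tendstoD(2)[OF approx_LL[OF cLL] d]
      by eventually_elim (simp add: J_def)
    then obtain u where u: "u \<in> J" "nrm ((c \<ominus> u \<odot> c) \<ominus> (c \<ominus> u \<odot> c) \<odot> u) < d"
      using F_nontrivial eventually_happens' by blast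
    have uc: "u \<in> car" using u J_car by blast
    let ?h = "u \<odot> c \<oplus> (c \<ominus> u \<odot> c) \<odot> u"
    have "u \<odot> c \<in> H" "u \<odot> (c \<odot> u) \<in> H"
      unfolding loc_H_def using u c J_C by (auto intro!: JC(2) C_mul)
    hence hH: "?h \<in> H"
      using cuH[OF u(1)] cc uc by (simp add: mul_sub_left mul_closed mul_assoc closed_subD[OF H_closed])
    have "c \<ominus> ?h = (c \<ominus> u \<odot> c) \<ominus> (c \<ominus> u \<odot> c) \<odot> u"
      using cc uc by (simp add: vsub_def smul_add closed add_assoc)
    thus "\<exists>s\<in>H. nrm (c \<ominus> s) < d" using u(2) hH by metis
  qed
qed

lemma coset_eq:
  assumes W: "closed_sub W" and a: "a \<in> car" and b: "b \<in> car"
  shows "coset V W a = coset V W b \<longleftrightarrow> a \<ominus> b \<in> W"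
proof
  assume "coset V W a = coset V W b"
  moreover have "a \<in> coset V W a"
    using a closed_subD(2)[OF W] add_zero[OF a] unfolding coset_def by force
  ultimately obtain w where w: "w \<in> W" "a = b \<oplus> w" by (auto simp: coset_def)
  thus "a \<ominus> b \<in> W" using b closed_subD(1)[OF W] add_sub_cancel[of w b] add_commute[of b w] by simp
next
  have sub: "coset V W a \<subseteq> coset V W b" if a: "a \<in> car" and b: "b \<in> car" and ab: "a \<ominus> b \<in> W" for a b
  proof
    fix x assume "x \<in> coset V W a"
    then obtain w where w: "w \<in> W" "x = a \<oplus> w" by (auto simp: coset_def)
    have wc: "w \<in> car" "a \<ominus> b \<in> car" using w closed_subD(1)[OF W] a b sub_closed by auto
    have "x = b \<oplus> ((a \<ominus> b) \<oplus> w)"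
      using a b w wc sub_add_cancel[of a b] by (simp add: add_assoc[symmetric] add_commute[of b])
    thus "x \<in> coset V W b" using w ab closed_subD(3)[OF W] unfolding coset_def by blast
  qed
  assume ab: "a \<ominus> b \<in> W"
  hence "b \<ominus> a \<in> W" using sub_swap[OF a b] closed_subD(4)[OF W] by simp
  thus "coset V W a = coset V W b" using sub[OF a b ab] sub[OF b a] by blast
qed

lemma rep_coset: assumes a: "a \<in> C"
  shows "representative (coset V H a) \<in> C" "\<phi> (representative (coset V H a)) = \<phi> a"
proof -
  have "a \<in> coset V H a"
    using C_car[OF a] closed_subD(2)[OF H_closed] add_zero unfolding coset_def by force
  hence "representative (coset V H a) \<in> coset V H a" unfolding representative_def by (rule someI)
  then obtain h where h: "h \<in> H" "representative (coset V H a) = a \<oplus> h" by (auto simp: coset_def)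
  thus "representative (coset V H a) \<in> C" "\<phi> (representative (coset V H a)) = \<phi> a"
    using a H_C C_car H_ker closed_subD(3)[OF C_closed] by (auto simp: phi_add subset_iff)
qed

lemma coset_H_eq: assumes "a \<in> C" "b \<in> C"
  shows "coset V H a = coset V H b \<longleftrightarrow> \<phi> a = \<phi> b"
proof -
  have "a \<ominus> b \<in> H \<longleftrightarrow> \<phi> a = \<phi> b"
    using C_ker_H[of "a \<ominus> b"] H_ker[of "a \<ominus> b"] closed_subD(5)[OF C_closed] assms C_car
    by (auto simp: phi_sub)
  thus ?thesis using coset_eq[OF H_closed] assms C_car by simp
qed

text \<open>Modulo \<open>H\<close>, which is contained in \<open>JB\<close>, every \<open>a\<close> in \<open>C\<close> is \<open>\<phi>(a)e\<close>.\<close>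

lemma phi_mul_C: assumes a: "a \<in> C" and b: "b \<in> C" shows "\<phi> (a \<odot> b) = \<phi> a * \<phi> b"
proof -
  note c = C_car[OF a] C_car[OF b]
  have e: "e \<in> C" "\<phi> a \<cdot> e \<in> C" using A_C e_A closed_subD(4)[OF C_closed] by auto
  have "a \<ominus> \<phi> a \<cdot> e \<in> H"
    using a e c e_car by (intro C_ker_H closed_subD(5)[OF C_closed]) (simp_all add: phi_sub phi_smul phi_e closed)
  hence "(a \<ominus> \<phi> a \<cdot> e) \<odot> b \<in> JB" using H_JB c JB_mul by blast
  hence "\<phi> (a \<odot> b \<ominus> \<phi> a \<cdot> (e \<odot> b)) = 0"
    using JB_ker c e_car by (auto simp: mul_sub_left mul_smul_left closed)
  thus ?thesis using c e_car e_A by (simp add: phi_sub phi_smul closed phi_left phi_e)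
qed

text \<open>Thus \<open>C/H\<close> is the field of complex numbers through \<open>\<phi>\<close>, and so is \<open>B/L\<close>.\<close>

theorem localizing_projection_value:
  assumes b: "b \<in> car"
  shows "scalar_of (loc_alg V J) (localizing_projection V J b) = \<phi> b"
proof -
  let ?Q = "loc_alg V J"
  note e = A_C[OF e_A]
  have car_Q: "carrier ?Q = coset V H ` C" by (simp add: loc_alg_def quotient_alg_def)
  have mul_Q: "amul ?Q (coset V H a) (coset V H c) = coset V H (representative (coset V H a) \<odot> representative (coset V H c))" for a c
    by (simp add: loc_alg_def quotient_alg_def)
  have mul: "amul ?Q (coset V H a) (coset V H c) = coset V H d \<longleftrightarrow> \<phi> d = \<phi> a * \<phi> c"
    if "a \<in> C" "c \<in> C" "d \<in> C" for a c d
    unfolding mul_Q using that by (subst coset_H_eq) (auto intro!: C_mul rep_coset simp: phi_mul_C rep_coset)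
  have unit: "alg_unit ?Q = coset V H e"
    unfolding alg_unit_def
  proof (rule the_equality)
    show "coset V H e \<in> carrier ?Q \<and> (\<forall>a\<in>carrier ?Q. amul ?Q (coset V H e) a = a \<and> amul ?Q a (coset V H e) = a)"
      using e by (auto simp: car_Q mul phi_e)
    fix u assume u: "u \<in> carrier ?Q \<and> (\<forall>a\<in>carrier ?Q. amul ?Q u a = a \<and> amul ?Q a u = a)"
    then obtain a where a: "a \<in> C" "u = coset V H a" by (auto simp: car_Q)
    have "amul ?Q u (coset V H e) = coset V H e" using u e by (auto simp: car_Q)
    hence "\<phi> a = 1" using a e by (simp add: mul phi_e)
    thus "u = coset V H e" using a e by (simp add: coset_H_eq phi_e)
  qed
  have smul: "vsmul ?Q c (alg_unit ?Q) = coset V H (c \<cdot> e)" for c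
  proof -
    have "vsmul ?Q c (alg_unit ?Q) = coset V H (c \<cdot> representative (coset V H e))"
      by (simp add: unit) (simp add: loc_alg_def quotient_alg_def)
    also have "\<dots> = coset V H (c \<cdot> e)"
      using e rep_coset[OF e] closed_subD(4)[OF C_closed] by (subst coset_H_eq) (auto simp: phi_smul C_car)
    finally show ?thesis .
  qed
  have ce: "c \<cdot> e \<in> C" "\<phi> (c \<cdot> e) = c" for c
    using e closed_subD(4)[OF C_closed] by (auto simp: phi_smul C_car phi_e)
  have scal: "scalar_of ?Q (coset V H (c \<cdot> e)) = c" for c
    unfolding scalar_of_def smul by (intro the_inv_f_f injI) (simp add: coset_H_eq ce)
  have LL_coset: "coset V LL a = coset V LL d \<longleftrightarrow> \<phi> a = \<phi> d" if "a \<in> car" "d \<in> car" for a d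
    using coset_eq[OF LL_closed that] that by (simp add: LL_eq_ker phi_sub closed)
  have "localizing_projection V J b = coset V H (\<phi> b \<cdot> e)"
    unfolding localizing_projection_def
  proof (rule the_inv_into_f_eq)
    show "inj_on (loc_natural_map V J) (carrier ?Q)"
    proof (rule inj_onI)
      fix p q assume "p \<in> carrier ?Q" "q \<in> carrier ?Q" and eq: "loc_natural_map V J p = loc_natural_map V J q"
      then obtain a c where ac: "a \<in> C" "c \<in> C" "p = coset V H a" "q = coset V H c" by (auto simp: car_Q)
      have "\<phi> a = \<phi> c"
        using eq LL_coset rep_coset ac C_car by (auto simp: loc_natural_map_def)
      thus "p = q" using ac by (simp add: coset_H_eq)
    qed
    show "loc_natural_map V J (coset V H (\<phi> b \<cdot> e)) = coset V LL b"
      unfolding loc_natural_map_def using LL_coset rep_coset[OF ce(1)] ce b C_car by auto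
    show "coset V H (\<phi> b \<cdot> e) \<in> carrier ?Q" using ce by (auto simp: car_Q)
  qed
  thus ?thesis by (simp add: scal)
qed

end

section \<open>Extending functionals to the completion\<close>

context normed_star_algebra
begin

lemma norm_sub_sub_sub: assumes "a \<in> car" "b \<in> car" "c \<in> car" "d \<in> car"
  shows "N ((a \<ominus> b) \<ominus> (c \<ominus> d)) \<le> N (a \<ominus> c) + N (b \<ominus> d)"
proof -
  have "(a \<ominus> b) \<ominus> (c \<ominus> d) = (a \<oplus> (-1) \<cdot> b) \<ominus> (c \<oplus> (-1) \<cdot> d)" by (simp add: vsub_def)
  also have "N \<dots> \<le> N (a \<ominus> c) + N ((-1) \<cdot> b \<ominus> (-1) \<cdot> d)"
    using assms by (intro norm_add_sub_add closed)
  also have "N ((-1) \<cdot> b \<ominus> (-1) \<cdot> d) = N (b \<ominus> d)" using assms by (simp add: smul_sub norm_smul closed)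
  finally show ?thesis .
qed

definition bounded_functional where
  "bounded_functional \<phi> \<longleftrightarrow>
    (\<forall>a\<in>car. \<forall>b\<in>car. \<phi> (a \<oplus> b) = \<phi> a + \<phi> b) \<and> (\<forall>c. \<forall>a\<in>car. \<phi> (c \<cdot> a) = c * \<phi> a) \<and>
    (\<forall>a\<in>car. cmod (\<phi> a) \<le> N a)"

text \<open>\<open>\<phi>'\<close> is the continuous extension of \<open>\<phi>\<close> to the completion.\<close>

definition extends where
  "extends \<phi> \<phi>' \<longleftrightarrow> (\<forall>f\<in>seqs. (\<lambda>n. \<phi> (f n)) \<longlonglongrightarrow> (\<phi>' (cls f) :: complex))"

lemma bounded_functionalD:
  assumes "bounded_functional \<phi>"
  shows "a \<in> car \<Longrightarrow> b \<in> car \<Longrightarrow> \<phi> (a \<oplus> b) = \<phi> a + \<phi> b" "a \<in> car \<Longrightarrow> \<phi> (c \<cdot> a) = c * \<phi> a"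
    "a \<in> car \<Longrightarrow> cmod (\<phi> a) \<le> N a" "a \<in> car \<Longrightarrow> b \<in> car \<Longrightarrow> \<phi> (a \<ominus> b) = \<phi> a - \<phi> b"
  using assms by (auto simp: bounded_functional_def vsub_def closed)

lemma extension_exists:
  assumes b: "bounded_functional \<phi>"
  shows "extends \<phi> (\<lambda>b. lim (\<lambda>n. \<phi> (representative b n)))"
  unfolding extends_def
proof
  fix f assume f: "f \<in> seqs"
  note r = representative_cls[OF f]
  have d: "cmod (\<phi> (g m) - \<phi> (h n)) \<le> N (g m \<ominus> h n)" if "g \<in> seqs" "h \<in> seqs" for g h m n
    using bounded_functionalD(3)[OF b, of "g m \<ominus> h n"] seqs_car[OF that(1)] seqs_car[OF that(2)]
    by (simp add: closed bounded_functionalD(4)[OF b])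
  have "Cauchy (\<lambda>n. \<phi> (f n))"
  proof (rule metric_CauchyI)
    fix r :: real assume "r > 0"
    then obtain M where M: "\<forall>m\<ge>M. \<forall>n\<ge>M. N (f m \<ominus> f n) < r" using seqs_cauchy[OF f] by blast
    have "dist (\<phi> (f m)) (\<phi> (f n)) < r" if "m \<ge> M" "n \<ge> M" for m n
      using M that d[OF f f, of m n] unfolding dist_norm by fastforce
    thus "\<exists>M. \<forall>m\<ge>M. \<forall>n\<ge>M. dist (\<phi> (f m)) (\<phi> (f n)) < r" by blast
  qed
  then obtain l where l: "(\<lambda>n. \<phi> (f n)) \<longlonglongrightarrow> l" unfolding Cauchy_convergent_iff convergent_def by (rule exE)
  have "(\<lambda>n. \<phi> (representative (cls f) n) - \<phi> (f n)) \<longlonglongrightarrow> 0"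
    by (rule Lim_null_comparison[OF always_eventually r(2)]) (simp add: d[OF r(1) f])
  from tendsto_add[OF this l] have "(\<lambda>n. \<phi> (representative (cls f) n)) \<longlonglongrightarrow> l" by simp
  hence "lim (\<lambda>n. \<phi> (representative (cls f) n)) = l" by (rule limI)
  thus "(\<lambda>n. \<phi> (f n)) \<longlonglongrightarrow> lim (\<lambda>n. \<phi> (representative (cls f) n))" using l by simp
qed

lemma extendsD: "extends \<phi> \<phi>' \<Longrightarrow> f \<in> seqs \<Longrightarrow> (\<lambda>n. \<phi> (f n)) \<longlonglongrightarrow> \<phi>' (cls f)"
  by (simp add: extends_def)

lemma extends_eq: "extends \<phi> \<phi>' \<Longrightarrow> f \<in> seqs \<Longrightarrow> (\<lambda>n. \<phi> (f n)) \<longlonglongrightarrow> l \<Longrightarrow> \<phi>' (cls f) = l"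
  using extendsD LIMSEQ_unique by blast

lemma extends_linear:
  assumes e: "extends \<phi> \<phi>'" and b: "bounded_functional \<phi>"
  shows "a \<in> carrier compl \<Longrightarrow> a' \<in> carrier compl \<Longrightarrow> \<phi>' (vadd compl a a') = \<phi>' a + \<phi>' a'"
    "a \<in> carrier compl \<Longrightarrow> \<phi>' (vsmul compl c a) = c * \<phi>' a"
    "a \<in> carrier compl \<Longrightarrow> cmod (\<phi>' a) \<le> anorm compl a"
    "x \<in> car \<Longrightarrow> \<phi>' (emb x) = \<phi> x"
proof -
  note bd = bounded_functionalD[OF b]
  {
    fix a assume "a \<in> carrier compl"
    then obtain f where f: "f \<in> seqs" "a = cls f" using compl_carrier by auto
    show "cmod (\<phi>' a) \<le> anorm compl a"
      unfolding f(2) by (rule LIMSEQ_le[OF tendsto_norm[OF extendsD[OF e f(1)]] compl_norm[OF f(1)]])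
        (use bd(3)[OF seqs_car[OF f(1)]] in blast)
    show "\<phi>' (vsmul compl c a) = c * \<phi>' a" for c
      using tendsto_mult_left[OF extendsD[OF e f(1)], of c] f
      by (simp add: compl_smul) (rule extends_eq[OF e seqs_smul], simp_all add: bd seqs_car[OF f(1)])
    fix a' assume "a' \<in> carrier compl"
    then obtain g where g: "g \<in> seqs" "a' = cls g" using compl_carrier by auto
    show "\<phi>' (vadd compl a a') = \<phi>' a + \<phi>' a'"
      using tendsto_add[OF extendsD[OF e f(1)] extendsD[OF e g(1)]] f g
      by (simp add: compl_add) (rule extends_eq[OF e seqs_add], simp_all add: bd seqs_car[OF f(1)] seqs_car[OF g(1)])
  }
  show "x \<in> car \<Longrightarrow> \<phi>' (emb x) = \<phi> x"
    unfolding emb_cls by (rule extends_eq[OF e seqs_const]) simp_all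
qed

lemma extends_state:
  assumes e: "extends \<phi> \<phi>'" and b: "bounded_functional \<phi>"
    and pos: "\<And>a. a \<in> car \<Longrightarrow> \<phi> (adj a \<odot> a) \<in> \<real>\<^sub>\<ge>\<^sub>0"
    and u: "u \<in> car" "N u \<le> 1" "\<phi> u = 1"
  shows "is_state compl (restrict \<phi>' (carrier compl))"
proof -
  interpret B: normed_star_algebra compl "anorm compl" by (rule normed_star_algebra_completion)
  note l = extends_linear[OF e b]
  have posB: "\<phi>' (amul compl (aadj compl a) a) \<in> \<real>\<^sub>\<ge>\<^sub>0" if "a \<in> carrier compl" for a
  proof -
    obtain f where f: "f \<in> seqs" "a = cls f" using \<open>a \<in> carrier compl\<close> compl_carrier by auto
    have s: "(\<lambda>n. adj (f n) \<odot> f n) \<in> seqs" using f by (intro seqs_mul seqs_adj)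
    have "\<phi>' (cls (\<lambda>n. adj (f n) \<odot> f n)) \<in> \<real>\<^sub>\<ge>\<^sub>0"
      by (rule Lim_in_closed_set[OF closed_nonneg_Reals_complex _ _ extendsD[OF e s]])
         (simp_all add: pos seqs_car[OF f(1)])
    thus ?thesis using f by (simp add: compl_mul compl_adj seqs_adj)
  qed
  let ?S = "{cmod (restrict \<phi>' (carrier compl) a) | a. a \<in> carrier compl \<and> anorm compl a \<le> 1}"
  have ub: "x \<le> 1" if x: "x \<in> ?S" for x
  proof -
    obtain a where a: "a \<in> carrier compl" "anorm compl a \<le> 1" "x = cmod (restrict \<phi>' (carrier compl) a)"
      using x by blast
    thus ?thesis using l(3)[OF a(1)] by simp
  qed
  have "1 \<in> ?S"
  proof -
    have "emb u \<in> carrier compl" "anorm compl (emb u) \<le> 1" "\<phi>' (emb u) = 1"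
      by (simp_all add: u l(4) emb_closed emb_hom(6))
    thus ?thesis by (intro CollectI exI[of _ "emb u"]) simp
  qed
  hence "Sup ?S = 1" using ub by (rule cSup_eq_maximum)
  moreover have "bdd_above ?S" using ub by (rule bdd_aboveI)
  ultimately show ?thesis unfolding is_state_def by (simp add: B.closed l(1,2) posB)
qed

text \<open>The closure of the image of \<open>D\<close> consists of classes of sequences that run in \<open>D\<close>, not merely of
  classes that are approximated by \<open>D\<close>. This allows checking identities on \<open>A\<close> termwise.\<close>

lemma closure_emb:
  assumes D: "D \<subseteq> car"
  shows "a \<in> norm_closure compl (emb ` D) \<longleftrightarrow> (\<exists>d\<in>seqs. (\<forall>n. d n \<in> D) \<and> a = cls d)"
proof
  interpret B: banach_star_algebra compl
    unfolding banach_star_algebra_def by (rule normed_star_algebra_completion)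
  assume a: "a \<in> norm_closure compl (emb ` D)"
  hence ac: "a \<in> carrier compl" by (simp add: norm_closure_def)
  have "\<forall>n. \<exists>d\<in>D. anorm compl (vsub compl a (emb d)) < inverse (real (Suc n))"
  proof
    fix n
    have "0 < inverse (real (Suc n))" by simp
    from B.closureD[OF a this] show "\<exists>d\<in>D. anorm compl (vsub compl a (emb d)) < inverse (real (Suc n))" by auto
  qed
  then obtain d where d: "\<And>n. d n \<in> D" "\<And>n. anorm compl (vsub compl a (emb (d n))) < inverse (real (Suc n))" by metis
  have dc: "d n \<in> car" for n using d(1) D by auto
  have lim: "(\<lambda>n. anorm compl (vsub compl a (emb (d n)))) \<longlonglongrightarrow> 0"
    by (rule Lim_null_comparison[OF always_eventually LIMSEQ_inverse_real_of_nat])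
       (use d(2) B.norm_nonneg B.sub_closed ac emb_closed[OF dc] in \<open>auto simp: less_imp_le\<close>)
  have mn: "N (d m \<ominus> d n) \<le> anorm compl (vsub compl a (emb (d m))) + anorm compl (vsub compl a (emb (d n)))" for m n
    using B.norm_triangle[OF emb_closed[OF dc] ac emb_closed[OF dc], of m n]
      B.norm_sub_swap[OF ac emb_closed[OF dc], of m]
    by (simp add: emb_hom dc closed)
  have ds: "d \<in> seqs"
    unfolding cauchy_seqs_def
  proof (intro CollectI conjI allI impI dc)
    fix r :: real assume "r > 0"
    hence "eventually (\<lambda>n. anorm compl (vsub compl a (emb (d n))) < r/2) sequentially"
      using order_tendstoD(2)[OF lim, of "r/2"] by simp
    then obtain M where "\<And>n. n \<ge> M \<Longrightarrow> anorm compl (vsub compl a (emb (d n))) < r/2"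
      by (auto simp: eventually_sequentially)
    hence "\<forall>m\<ge>M. \<forall>n\<ge>M. N (d m \<ominus> d n) < r" using mn by (smt (verit) field_sum_of_halves)
    thus "\<exists>M. \<forall>m\<ge>M. \<forall>n\<ge>M. N (d m \<ominus> d n) < r" by blast
  qed
  have cd: "cls d \<in> carrier compl" using ds compl_carrier by blast
  have "anorm compl (vsub compl (cls d) a) \<le> 0"
  proof (rule LIMSEQ_le_const)
    show "(\<lambda>n. anorm compl (vsub compl (cls d) (emb (d n))) + anorm compl (vsub compl a (emb (d n)))) \<longlonglongrightarrow> 0"
      using tendsto_add[OF emb_limit[OF ds] lim] by simp
    have "anorm compl (vsub compl (cls d) a)
        \<le> anorm compl (vsub compl (cls d) (emb (d n))) + anorm compl (vsub compl a (emb (d n)))" for n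
      using B.norm_triangle[OF cd emb_closed[OF dc] ac, of n] B.norm_sub_swap[OF ac emb_closed[OF dc], of n] by simp
    thus "\<exists>M. \<forall>n\<ge>M. anorm compl (vsub compl (cls d) a)
        \<le> anorm compl (vsub compl (cls d) (emb (d n))) + anorm compl (vsub compl a (emb (d n)))" by blast
  qed
  hence "vsub compl (cls d) a = vzero compl"
    using B.norm_nonneg[OF B.sub_closed[OF cd ac]] B.norm_eq_0[OF B.sub_closed[OF cd ac]] by simp
  hence "a = cls d" using B.sub_eq_zero cd ac by simp
  thus "\<exists>d\<in>seqs. (\<forall>n. d n \<in> D) \<and> a = cls d" using ds d(1) by blast
next
  assume "\<exists>d\<in>seqs. (\<forall>n. d n \<in> D) \<and> a = cls d"
  then obtain d where d: "d \<in> seqs" "\<And>n. d n \<in> D" "a = cls d" by blast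
  have "\<exists>s\<in>emb ` D. anorm compl (vsub compl a s) < r" if r: "r > 0" for r
    using order_tendstoD(2)[OF emb_limit[OF d(1)] r] d by (auto simp: eventually_sequentially)
  thus "a \<in> norm_closure compl (emb ` D)" using d compl_carrier by (auto simp: norm_closure_def)
qed

end

text \<open>The hypotheses of \<open>localized_point\<close>, stated on a dense *-algebra where they can be checked by
  computing with sections. In \<open>decompose\<close> the span is not closed: the
  difference is a finite linear combination of products.\<close>

locale dense_point = normed_star_algebra V N
  for V :: "('a, 'm) star_alg_scheme" and N +
  fixes D :: "'a set" and \<phi> :: "'a \<Rightarrow> complex" and \<phi>' :: "(nat \<Rightarrow> 'a) set \<Rightarrow> complex"
    and e :: 'a and F :: "'a filter"
  assumes D_subspace: "lin_subspace V D"
    and D_mul: "a \<in> D \<Longrightarrow> b \<in> D \<Longrightarrow> amul V a b \<in> D"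
    and D_adj: "a \<in> D \<Longrightarrow> aadj V a \<in> D"
    and functional: "bounded_functional \<phi>" and extension: "extends \<phi> \<phi>'"
    and phi_adj: "a \<in> carrier V \<Longrightarrow> \<phi> (aadj V a) = cnj (\<phi> a)"
    and phi_left: "d \<in> D \<Longrightarrow> a \<in> carrier V \<Longrightarrow> \<phi> (amul V d a) = \<phi> d * \<phi> a"
    and phi_right: "d \<in> D \<Longrightarrow> a \<in> carrier V \<Longrightarrow> \<phi> (amul V a d) = \<phi> a * \<phi> d"
    and e_D: "e \<in> D" and phi_e: "\<phi> e = 1"
    and decompose: "a \<in> carrier V \<Longrightarrow> vsub V a (vsmul V (\<phi> a) e) \<in>
       lin_span V ({amul V d b | d b. d \<in> D \<and> \<phi> d = 0 \<and> b \<in> carrier V} \<union>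
                   {amul V b d | d b. d \<in> D \<and> \<phi> d = 0 \<and> b \<in> carrier V})"
    and F_nontrivial: "F \<noteq> bot"
    and F_contractive: "eventually (\<lambda>u. u \<in> D \<and> \<phi> u = 0 \<and> aadj V u = u \<and> (\<forall>b\<in>carrier V. N (amul V u b) \<le> N b)) F"
    and F_unit: "d \<in> D \<Longrightarrow> \<phi> d = 0 \<Longrightarrow> ((\<lambda>u. N (vsub V d (amul V u d))) \<longlongrightarrow> 0) F"
begin

abbreviation A where "A \<equiv> norm_closure compl (emb ` D)"

lemma D_car: "d \<in> D \<Longrightarrow> d \<in> car" using D_subspace by (auto simp: lin_subspace_def)

lemma A_iff: "a \<in> A \<longleftrightarrow> (\<exists>d\<in>seqs. (\<forall>n. d n \<in> D) \<and> a = cls d)"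
  by (rule closure_emb) (blast intro: D_car)

lemmas phi_lin = bounded_functionalD[OF functional]
lemmas phi'_lin = extends_linear[OF extension functional]

text \<open>Each hypothesis passes to limits: the two sides of an identity are continuous, \<open>loc_L\<close> is closed,
  and elements \<open>a\<close> of \<open>A\<close> with \<open>\<phi>(a) = 0\<close> are limits of elements \<open>d - \<phi>(d)e\<close> of \<open>D\<close> on which \<open>\<phi>\<close> vanishes.\<close>

lemma localized_point: "localized_point compl A \<phi>' (emb e) (filtermap emb F)"
proof -
  interpret B: banach_star_algebra compl
    unfolding banach_star_algebra_def by (rule normed_star_algebra_completion)
  let ?B = compl
  have A_car: "A \<subseteq> carrier ?B" by (auto simp: norm_closure_def)
  have embA: "emb d \<in> A" if "d \<in> D" for d
    unfolding A_iff by (rule bexI[of _ "\<lambda>_. d"]) (simp_all add: that emb_cls seqs_const D_car)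
  have contr: "anorm ?B (amul ?B (emb u) b) \<le> anorm ?B b"
    if u: "u \<in> car" "\<forall>b\<in>car. N (u \<odot> b) \<le> N b" and b: "b \<in> carrier ?B" for u b
  proof -
    obtain f where f: "f \<in> seqs" "b = cls f" using b compl_carrier by auto
    note s1 = seqs_mul[OF seqs_const[OF u(1)] f(1)]
    have "anorm ?B (cls (\<lambda>n. u \<odot> f n)) \<le> anorm ?B (cls f)"
      by (rule LIMSEQ_le[OF compl_norm[OF s1] compl_norm[OF f(1)]]) (simp add: u(2) seqs_car[OF f(1)])
    thus ?thesis by (simp add: f emb_cls compl_mul seqs_const u(1))
  qed
  have JBc: "{a \<in> A. \<phi>' a = 0} \<subseteq> carrier ?B" using A_car by blast
  let ?JB = "prod_space ?B {a \<in> A. \<phi>' a = 0} (carrier ?B)"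
  let ?BJ = "prod_space ?B (carrier ?B) {a \<in> A. \<phi>' a = 0}"
  let ?L = "loc_L ?B {a \<in> A. \<phi>' a = 0}"
  note JB = B.prod_space[OF JBc subset_refl] and BJ = B.prod_space[OF subset_refl JBc]
  have sums: "{vadd ?B a b |a b. a \<in> ?JB \<and> b \<in> ?BJ} \<subseteq> carrier ?B"
  proof clarify
    fix a b assume "a \<in> ?JB" "b \<in> ?BJ"
    thus "vadd ?B a b \<in> carrier ?B"
      by (rule B.add_closed[OF B.closed_subD(1)[OF JB(1)] B.closed_subD(1)[OF BJ(1)]])
  qed
  have L: "B.closed_sub ?L" and sumL: "{vadd ?B a b |a b. a \<in> ?JB \<and> b \<in> ?BJ} \<subseteq> ?L"
    unfolding loc_L_def sum_space_def by (rule B.closed_span[OF sums])+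
  have JBL: "y \<in> ?L" if "y \<in> ?JB" for y
  proof -
    have "vadd ?B y (vzero ?B) \<in> ?L" using sumL that B.closed_subD(2)[OF BJ(1)] by blast
    thus ?thesis using B.add_zero B.closed_subD(1)[OF JB(1) that] by simp
  qed
  have BJL: "y \<in> ?L" if "y \<in> ?BJ" for y
  proof -
    have "vadd ?B (vzero ?B) y \<in> ?L" using sumL that B.closed_subD(2)[OF JB(1)] by blast
    thus ?thesis using B.zero_add B.closed_subD(1)[OF BJ(1) that] by simp
  qed
  have embL: "emb k \<in> ?L"
    if k: "k \<in> lin_span V ({d \<odot> b | d b. d \<in> D \<and> \<phi> d = 0 \<and> b \<in> car} \<union> {b \<odot> d | d b. d \<in> D \<and> \<phi> d = 0 \<and> b \<in> car})" for k
  proof -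
    have "lin_subspace V {k \<in> car. emb k \<in> ?L}"
      unfolding lin_subspace_def
    proof (intro conjI ballI allI)
      show "\<zero> \<in> {k \<in> car. emb k \<in> ?L}" using B.closed_subD(2)[OF L] by (simp add: emb_hom(7) zero_closed)
      fix u assume "u \<in> {k \<in> car. emb k \<in> ?L}"
      hence u: "u \<in> car" "emb u \<in> ?L" by simp_all
      show "c \<cdot> u \<in> {k \<in> car. emb k \<in> ?L}" for c
        using B.closed_subD(4)[OF L u(2), of c] emb_hom(3)[OF u(1)] u(1) by (simp add: closed)
      fix v assume "v \<in> {k \<in> car. emb k \<in> ?L}"
      hence v: "v \<in> car" "emb v \<in> ?L" by simp_all
      show "u \<oplus> v \<in> {k \<in> car. emb k \<in> ?L}"
        using B.closed_subD(3)[OF L u(2) v(2)] emb_hom(1)[OF u(1) v(1)] u(1) v(1) by (simp add: closed)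
    qed blast
    moreover have "emb (d \<odot> b) \<in> ?L" "emb (b \<odot> d) \<in> ?L" if "d \<in> D" "\<phi> d = 0" "b \<in> car" for d b
    proof -
      have d: "emb d \<in> {a \<in> A. \<phi>' a = 0}" using embA[OF that(1)] phi'_lin(4)[OF D_car[OF that(1)]] that(2) by simp
      note eb = emb_closed[OF that(3)]
      show "emb (d \<odot> b) \<in> ?L" using JBL[OF JB(2)[OF d eb]] emb_hom(2)[OF D_car[OF that(1)] that(3)] by simp
      show "emb (b \<odot> d) \<in> ?L" using BJL[OF BJ(2)[OF eb d]] emb_hom(2)[OF that(3) D_car[OF that(1)]] by simp
    qed
    ultimately have "lin_span V ({d \<odot> b | d b. d \<in> D \<and> \<phi> d = 0 \<and> b \<in> car} \<union> {b \<odot> d | d b. d \<in> D \<and> \<phi> d = 0 \<and> b \<in> car})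
        \<subseteq> {k \<in> car. emb k \<in> ?L}"
      by (intro span_minimal) (auto simp: closed D_car)
    thus ?thesis using k by blast
  qed
  have ec: "e \<in> car" by (rule D_car[OF e_D])
  have dec: "vsub ?B b (vsmul ?B (\<phi>' b) (emb e)) \<in> ?L" if b: "b \<in> carrier ?B" for b
  proof (rule B.closed_sub_limit[OF L])
    show "vsub ?B b (vsmul ?B (\<phi>' b) (emb e)) \<in> carrier ?B" using b ec emb_closed by (simp add: B.closed)
    fix r :: real assume r: "r > 0"
    have Ne: "0 \<le> N e" by (rule norm_nonneg[OF ec])
    have "0 < r / (1 + N e)" using r Ne by simp
    from emb_dense[OF b this] obtain f where f: "f \<in> car" "anorm ?B (vsub ?B b (emb f)) < r / (1 + N e)" by blast
    note ef = emb_closed[OF f(1)]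
    let ?s = "emb (f \<ominus> \<phi> f \<cdot> e)"
    have s: "?s = vsub ?B (emb f) (vsmul ?B (\<phi> f) (emb e))"
      using f ec by (simp add: emb_hom closed)
    have "anorm ?B (vsub ?B (vsub ?B b (vsmul ?B (\<phi>' b) (emb e))) ?s)
      \<le> anorm ?B (vsub ?B b (emb f)) + anorm ?B (vsub ?B (vsmul ?B (\<phi>' b) (emb e)) (vsmul ?B (\<phi> f) (emb e)))"
      unfolding s using b ef emb_closed[OF ec] by (intro B.norm_sub_sub_sub B.closed)
    also have "anorm ?B (vsub ?B (vsmul ?B (\<phi>' b) (emb e)) (vsmul ?B (\<phi> f) (emb e))) = cmod (\<phi>' b - \<phi> f) * N e"
      using emb_closed[OF ec] by (simp add: B.sub_smul B.norm_smul emb_hom(6)[OF ec])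
    also have "\<phi>' b - \<phi> f = \<phi>' (vsub ?B b (emb f))"
      using b ef f by (simp add: vsub_def phi'_lin B.closed)
    also have "cmod \<dots> * N e \<le> anorm ?B (vsub ?B b (emb f)) * N e"
      using b ef Ne by (intro mult_right_mono phi'_lin(3)) (simp_all add: B.closed)
    also have "anorm ?B (vsub ?B b (emb f)) + \<dots> = anorm ?B (vsub ?B b (emb f)) * (1 + N e)" by (simp add: algebra_simps)
    also have "\<dots> < r" using f(2) Ne by (simp add: pos_less_divide_eq)
    finally have "anorm ?B (vsub ?B (vsub ?B b (vsmul ?B (\<phi>' b) (emb e))) ?s) < r" by simp
    thus "\<exists>s\<in>?L. anorm ?B (vsub ?B (vsub ?B b (vsmul ?B (\<phi>' b) (emb e))) s) < r"
      using embL[OF decompose[OF f(1)]] by blast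
  qed
  have near: "\<exists>d\<in>D. \<phi> d = 0 \<and> anorm ?B (vsub ?B a (emb d)) < r" if a: "a \<in> A" "\<phi>' a = 0" and r: "r > 0" for a r
  proof -
    obtain d where d: "d \<in> seqs" "\<And>n. d n \<in> D" "a = cls d" using A_iff a by blast
    have dc: "d n \<in> car" for n using d(2) D_car by blast
    let ?d = "\<lambda>n. d n \<ominus> \<phi> (d n) \<cdot> e"
    have lim: "(\<lambda>n. anorm ?B (vsub ?B a (emb (d n))) + cmod (\<phi> (d n)) * N e) \<longlonglongrightarrow> 0 + cmod (\<phi>' a) * N e"
      unfolding d(3) by (intro tendsto_intros emb_limit[OF d(1)] extendsD[OF extension d(1)])
    have "eventually (\<lambda>n. anorm ?B (vsub ?B a (emb (d n))) + cmod (\<phi> (d n)) * N e < r) sequentially"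
      using order_tendstoD(2)[OF lim, of r] r a by simp
    then obtain n where n: "anorm ?B (vsub ?B a (emb (d n))) + cmod (\<phi> (d n)) * N e < r"
      by (auto simp: eventually_sequentially)
    have "anorm ?B (vsub ?B a (emb (?d n))) \<le> anorm ?B (vsub ?B a (emb (d n))) + anorm ?B (vsub ?B (emb (d n)) (emb (?d n)))"
      using subsetD[OF A_car a(1)] by (intro B.norm_triangle emb_closed closed dc ec)
    also have "vsub ?B (emb (d n)) (emb (?d n)) = emb (\<phi> (d n) \<cdot> e)"
      using dc ec by (simp add: emb_hom closed sub_sub_cancel)
    also have "anorm ?B \<dots> = cmod (\<phi> (d n)) * N e"
      using ec emb_hom(6)[of "\<phi> (d n) \<cdot> e"] by (simp add: closed norm_smul)
    finally have "anorm ?B (vsub ?B a (emb (?d n))) < r" using n by simp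
    moreover have "?d n \<in> D"
      using D_subspace e_D by (intro lin_subspace_sub[OF D_subspace] d(2)) (simp add: lin_subspace_def)
    moreover have "\<phi> (?d n) = 0" using dc ec by (simp add: phi_lin closed phi_e)
    ultimately show ?thesis by blast
  qed
  have ucar: "eventually (\<lambda>u. u \<in> car \<and> (\<forall>b\<in>carrier ?B. anorm ?B (vsub ?B b (amul ?B (emb u) b)) \<le> 2 * anorm ?B b)) F"
    using F_contractive
  proof eventually_elim
    case (elim u)
    hence uc: "u \<in> car" using D_car by blast
    have "anorm ?B (vsub ?B b (amul ?B (emb u) b)) \<le> 2 * anorm ?B b" if b: "b \<in> carrier ?B" for b
      using contr[OF uc _ b] elim B.norm_sub_le[OF b B.mul_closed[OF emb_closed[OF uc] b]] by simp
    thus ?case using uc by blast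
  qed
  have W: "B.closed_sub {y \<in> carrier ?B. ((\<lambda>u. anorm ?B (vsub ?B y (amul ?B (emb u) y))) \<longlongrightarrow> 0) F}"
    by (rule B.closed_sub_seminorm[where K=2], rule eventually_mono[OF ucar])
       (simp add: B.closed B.norm_add B.norm_smul B.norm_nonneg B.mul_add_right B.mul_smul_right B.add_sub_add B.smul_sub emb_closed)
  have unit: "((\<lambda>u. anorm ?B (vsub ?B a (amul ?B (emb u) a))) \<longlongrightarrow> 0) F" if a: "a \<in> A" "\<phi>' a = 0" for a
  proof -
    have d1: "((\<lambda>u. anorm ?B (vsub ?B (emb d) (amul ?B (emb u) (emb d)))) \<longlongrightarrow> 0) F" if d: "d \<in> D" "\<phi> d = 0" for d
    proof (rule Lim_transform_eventually[OF F_unit[OF d]])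
      have dc: "d \<in> car" by (rule D_car[OF d(1)])
      show "eventually (\<lambda>u. N (d \<ominus> u \<odot> d) = anorm ?B (vsub ?B (emb d) (amul ?B (emb u) (emb d)))) F"
        using ucar
      proof eventually_elim
        case (elim u)
        hence u: "u \<in> car" by simp
        show ?case
          using emb_hom(2)[OF u dc] emb_hom(5)[OF dc mul_closed[OF u dc]] emb_hom(6)[of "d \<ominus> u \<odot> d"] dc u
          by (simp add: closed)
      qed
    qed
    have "a \<in> {y \<in> carrier ?B. ((\<lambda>u. anorm ?B (vsub ?B y (amul ?B (emb u) y))) \<longlongrightarrow> 0) F}"
    proof (rule B.closed_sub_limit[OF W subsetD[OF A_car a(1)]])
      fix r :: real assume "r > 0"
      from near[OF a this] obtain d where d: "d \<in> D" "\<phi> d = 0" "anorm ?B (vsub ?B a (emb d)) < r" by blast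
      show "\<exists>s\<in>{y \<in> carrier ?B. ((\<lambda>u. anorm ?B (vsub ?B y (amul ?B (emb u) y))) \<longlongrightarrow> 0) F}. anorm ?B (vsub ?B a s) < r"
        using d d1[OF d(1,2)] emb_closed[OF D_car[OF d(1)]] by (intro bexI[of _ "emb d"]) simp_all
    qed
    thus ?thesis by simp
  qed
  show ?thesis
  proof
    show "A \<subseteq> carrier ?B" by (rule A_car)
    fix a assume a: "a \<in> A"
    then obtain d where d: "d \<in> seqs" "\<And>n. d n \<in> D" "a = cls d" using A_iff by blast
    show "aadj ?B a \<in> A" unfolding A_iff
      using d seqs_adj[OF d(1)] D_adj by (intro bexI[of _ "\<lambda>n. adj (d n)"]) (simp_all add: compl_adj)
    { fix b assume "b \<in> A"
      then obtain d' where d': "d' \<in> seqs" "\<And>n. d' n \<in> D" "b = cls d'" using A_iff by blast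
      show "amul ?B a b \<in> A" unfolding A_iff
        using d d' seqs_mul[OF d(1) d'(1)] D_mul by (intro bexI[of _ "\<lambda>n. d n \<odot> d' n"]) (simp_all add: compl_mul) }
    { fix b assume "b \<in> carrier ?B"
      then obtain f where f: "f \<in> seqs" "b = cls f" using compl_carrier by auto
      show "\<phi>' (amul ?B a b) = \<phi>' a * \<phi>' b"
        using tendsto_mult[OF extendsD[OF extension d(1)] extendsD[OF extension f(1)]] d f seqs_car[OF f(1)]
        by (simp add: compl_mul) (rule extends_eq[OF extension seqs_mul], simp_all add: phi_left)
      show "\<phi>' (amul ?B b a) = \<phi>' b * \<phi>' a"
        using tendsto_mult[OF extendsD[OF extension f(1)] extendsD[OF extension d(1)]] d f seqs_car[OF f(1)]
        by (simp add: compl_mul) (rule extends_eq[OF extension seqs_mul], simp_all add: phi_right) }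
    show "((\<lambda>u. anorm ?B (vsub ?B a (amul ?B u a))) \<longlongrightarrow> 0) (filtermap emb F)" if "\<phi>' a = 0"
      using unit[OF a that] by (simp add: filterlim_filtermap)
  next
    fix b assume "b \<in> carrier ?B"
    then obtain f where f: "f \<in> seqs" "b = cls f" using compl_carrier by auto
    show "\<phi>' (aadj ?B b) = cnj (\<phi>' b)"
      using tendsto_cnj[OF extendsD[OF extension f(1)]] f seqs_car[OF f(1)]
      by (simp add: compl_adj) (rule extends_eq[OF extension seqs_adj], simp_all add: phi_adj)
  next
    show "eventually (\<lambda>u. u \<in> A \<and> \<phi>' u = 0 \<and> aadj ?B u = u \<and> (\<forall>b\<in>carrier ?B. anorm ?B (amul ?B u b) \<le> anorm ?B b)) (filtermap emb F)"
      unfolding eventually_filtermap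
      using F_contractive by eventually_elim (simp add: embA contr D_car phi'_lin(4) emb_hom(4))
    show "filtermap emb F \<noteq> bot" using F_nontrivial by (simp add: filtermap_bot_iff)
    show "emb e \<in> A" by (rule embA[OF e_D])
    show "\<phi>' (emb e) = 1" using phi'_lin(4)[OF ec] phi_e by simp
    show "\<And>b. b \<in> carrier ?B \<Longrightarrow> vsub ?B b (vsmul ?B (\<phi>' b) (emb e)) \<in> ?L" by (rule dec)
  qed (simp_all add: phi'_lin)
qed

end

section \<open>Topological preliminaries\<close>

lemma continuous_mapI_local:
  assumes "\<And>x. x \<in> topspace T \<Longrightarrow> f x \<in> topspace Y"
    and "\<And>x W. x \<in> topspace T \<Longrightarrow> openin Y W \<Longrightarrow> f x \<in> W \<Longrightarrow> \<exists>V. openin T V \<and> x \<in> V \<and> (\<forall>y\<in>V. f y \<in> W)"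
  shows "continuous_map T Y f"
proof -
  have "openin T {x \<in> topspace T. f x \<in> W}" if W: "openin Y W" for W
  proof (rule openin_subopen[THEN iffD2], rule ballI)
    fix x assume "x \<in> {x \<in> topspace T. f x \<in> W}"
    then obtain V where V: "openin T V" "x \<in> V" "\<forall>y\<in>V. f y \<in> W" using assms(2)[of x W] W by auto
    moreover have "V \<subseteq> topspace T" by (rule openin_subset[OF V(1)])
    ultimately show "\<exists>V. openin T V \<and> x \<in> V \<and> V \<subseteq> {x \<in> topspace T. f x \<in> W}" by blast
  qed
  thus ?thesis unfolding continuous_map_def using assms(1) by blast
qed

lemma continuous_map_normedI:
  fixes f :: "'a \<Rightarrow> 'b::real_normed_vector"
  assumes "\<And>x e. x \<in> topspace T \<Longrightarrow> e > 0 \<Longrightarrow> \<exists>V. openin T V \<and> x \<in> V \<and> (\<forall>y\<in>V. norm (f y - f x) < e)"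
  shows "continuous_map T euclidean f"
proof (rule continuous_mapI_local)
  fix x W assume x: "x \<in> topspace T" and W: "openin euclidean W" "f x \<in> W"
  hence "open W" by simp
  then obtain e where e: "e > 0" "ball (f x) e \<subseteq> W" using W(2) by (rule openE)
  obtain V where V: "openin T V" "x \<in> V" "\<forall>y\<in>V. norm (f y - f x) < e" using assms[OF x e(1)] by blast
  have "f y \<in> W" if "y \<in> V" for y
  proof -
    have "norm (f x - f y) < e" using V(3) that by (simp add: norm_minus_commute[of "f x"])
    thus ?thesis using e(2) by (auto simp: dist_norm)
  qed
  thus "\<exists>V. openin T V \<and> x \<in> V \<and> (\<forall>y\<in>V. f y \<in> W)" using V(1,2) by blast
qed simp

lemma continuous_map_normedD:
  fixes f :: "'a \<Rightarrow> 'b::real_normed_vector"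
  assumes "continuous_map T euclidean f" "x \<in> topspace T" "e > 0"
  shows "\<exists>V. openin T V \<and> x \<in> V \<and> (\<forall>y\<in>V. norm (f y - f x) < e)"
proof (intro exI conjI ballI)
  show "openin T {y \<in> topspace T. f y \<in> ball (f x) e}"
    using openin_continuous_map_preimage[OF assms(1), of "ball (f x) e"] by simp
  show "x \<in> {y \<in> topspace T. f y \<in> ball (f x) e}" using assms(2,3) by simp
  fix y assume "y \<in> {y \<in> topspace T. f y \<in> ball (f x) e}"
  thus "norm (f y - f x) < e" by (simp add: dist_norm norm_minus_commute[of "f x"])
qed

lemma local_homeomorphism_continuous_open:
  assumes lh: "local_homeomorphism T T' f"
  shows "continuous_map T T' f" "open_map T T' f"
proof -
  have ex: "\<exists>U. openin T U \<and> x \<in> U \<and> openin T' (f ` U) \<and> homeomorphic_map (subtopology T U) (subtopology T' (f ` U)) f"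
    if "x \<in> topspace T" for x using lh that by (simp add: local_homeomorphism_def)
  show "continuous_map T T' f"
  proof (rule continuous_mapI_local)
    fix x assume x: "x \<in> topspace T"
    show "f x \<in> topspace T'" using lh x by (auto simp: local_homeomorphism_def)
    fix W assume W: "openin T' W" "f x \<in> W"
    obtain U where U: "openin T U" "x \<in> U" "homeomorphic_map (subtopology T U) (subtopology T' (f ` U)) f"
      using ex[OF x] by blast
    have "continuous_map (subtopology T U) T' f"
      using homeomorphic_imp_continuous_map[OF U(3)] continuous_map_into_fulltopology by blast
    from openin_continuous_map_preimage[OF this W(1)]
    have "openin T {y \<in> topspace (subtopology T U). f y \<in> W}" by (rule openin_trans_full[OF _ U(1)])
    moreover have "x \<in> {y \<in> topspace (subtopology T U). f y \<in> W}" using x U(2) W(2) by simp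
    ultimately show "\<exists>V. openin T V \<and> x \<in> V \<and> (\<forall>y\<in>V. f y \<in> W)"
      by (intro exI[of _ "{y \<in> topspace (subtopology T U). f y \<in> W}"]) blast
  qed
  show "open_map T T' f"
    unfolding open_map_def
  proof (intro allI impI)
    fix W assume W: "openin T W"
    show "openin T' (f ` W)"
    proof (rule openin_subopen[THEN iffD2], rule ballI)
      fix y assume "y \<in> f ` W"
      then obtain x where x: "x \<in> W" "y = f x" by blast
      obtain U where U: "openin T U" "x \<in> U" "openin T' (f ` U)"
          "homeomorphic_map (subtopology T U) (subtopology T' (f ` U)) f"
        using ex[of x] x W openin_subset by blast
      have "openin (subtopology T U) (W \<inter> U)" using W by (auto simp: openin_subtopology)
      hence "openin (subtopology T' (f ` U)) (f ` (W \<inter> U))"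
        using homeomorphic_imp_open_map[OF U(4)] unfolding open_map_def by blast
      hence "openin T' (f ` (W \<inter> U))" using U(3) by (rule openin_trans_full)
      thus "\<exists>V. openin T' V \<and> y \<in> V \<and> V \<subseteq> f ` W" using x U(2) by blast
    qed
  qed
qed

lemma open_injective_inverse:
  assumes c: "continuous_map T Y f" and o: "open_map T Y f" and U: "openin T U" and i: "inj_on f U"
  shows "continuous_map (subtopology Y (f ` U)) T (the_inv_into U f)"
proof (rule continuous_mapI_local)
  have tU: "topspace (subtopology Y (f ` U)) = f ` U"
    using c openin_subset[OF U] by (auto simp: continuous_map_def)
  fix y assume "y \<in> topspace (subtopology Y (f ` U))"
  hence y: "y \<in> f ` U" by (simp add: tU)
  show "the_inv_into U f y \<in> topspace T"
    using the_inv_into_into[OF i y subset_refl] openin_subset[OF U] by blast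
  fix W assume W: "openin T W" "the_inv_into U f y \<in> W"
  have "openin Y (f ` (U \<inter> W))" using o U W unfolding open_map_def by (simp add: openin_Int)
  moreover have "f ` (U \<inter> W) \<subseteq> f ` U" by blast
  ultimately have "openin (subtopology Y (f ` U)) (f ` (U \<inter> W))"
    by (auto simp: openin_subtopology intro!: exI[of _ "f ` (U \<inter> W)"])
  moreover have "y \<in> f ` (U \<inter> W)"
    using the_inv_into_into[OF i y subset_refl] W(2)
    by (intro image_eqI[where x="the_inv_into U f y"]) (simp_all add: f_the_inv_into_f[OF i y])
  moreover have "\<forall>z\<in>f ` (U \<inter> W). the_inv_into U f z \<in> W" using the_inv_into_f_f[OF i] by auto
  ultimately show "\<exists>V. openin (subtopology Y (f ` U)) V \<and> y \<in> V \<and> (\<forall>z\<in>V. the_inv_into U f z \<in> W)" by blast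
qed

text \<open>\<open>V\<close> is itself locally compact, so a compact neighbourhood of \<open>K\<close> inside \<open>V\<close> serves as support.\<close>

lemma Urysohn_compact_support:
  assumes H: "Hausdorff_space X" and lc: "locally_compact_space X" and K: "compactin X K"
    and V: "openin X V" "K \<subseteq> V"
  obtains g :: "'a \<Rightarrow> real" and K' where "continuous_map X euclidean g" "\<And>x. 0 \<le> g x" "\<And>x. g x \<le> 1"
    "\<And>x. x \<in> K \<Longrightarrow> g x = 1" "compactin X K'" "K' \<subseteq> V" "\<And>x. x \<in> topspace X - K' \<Longrightarrow> g x = 0"
proof -
  have tV: "topspace (subtopology X V) = V" using openin_subset[OF V(1)] by auto
  have lcV: "locally_compact_space (subtopology X V)"
    using locally_compact_space_open_subset H lc V(1) by blast
  have "compactin (subtopology X V) K" using K V by (simp add: compactin_subtopology)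
  then obtain U L where UL: "openin (subtopology X V) U" "compactin (subtopology X V) L" "K \<subseteq> U" "U \<subseteq> L"
    using locally_compact_space_compact_closed_compact[of "subtopology X V"] lcV Hausdorff_space_subtopology[OF H]
    by blast
  have U: "openin X U" using UL(1) V(1) by (rule openin_trans_full)
  have L: "compactin X L" "L \<subseteq> V" using UL(2) by (auto simp: compactin_subtopology)
  have cr: "completely_regular_space X"
    using locally_compact_regular_imp_completely_regular_space[OF lc] locally_compact_Hausdorff_imp_regular_space[OF lc H]
      H by blast
  have "closedin X (topspace X - U)" "disjnt K (topspace X - U)"
    using U UL(3) by (auto simp: disjnt_def)
  from Urysohn_completely_regular_compact_closed[OF zero_le_one cr K this]
  obtain f where f: "continuous_map X (top_of_set {0..1::real}) f" "f ` (topspace X - U) \<subseteq> {0}" "f ` K \<subseteq> {1}"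
    by blast
  let ?g = "\<lambda>x. max 0 (min 1 (f x))"
  have f01: "f x \<in> {0..1}" if "x \<in> topspace X" for x using f(1) that unfolding continuous_map_in_subtopology by blast
  show thesis
  proof
    show "continuous_map X euclidean ?g"
      by (rule continuous_map_eq[OF continuous_map_into_fulltopology[OF f(1)]]) (simp add: f01[simplified])
    show "?g x = 1" if "x \<in> K" for x using f(3) that by auto
    show "?g x = 0" if "x \<in> topspace X - L" for x 
    proof -
      have "f x = 0" using f(2) that UL(4) by blast
      thus ?thesis by simp
    qed
  qed (use L in auto)
qed

section \<open>Algebra and topology of etale groupoids\<close>

context etale_groupoid
begin

abbreviation arr where "arr \<equiv> arrows G"
abbreviation T where "T \<equiv> gtop G"
abbreviation X where "X \<equiv> units G"
abbreviation TX where "TX \<equiv> unit_top G"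
abbreviation gm (infixl "\<star>" 70) where "a \<star> b \<equiv> gmul G a b"
abbreviation iv where "iv a \<equiv> ginv G a"
abbreviation s where "s a \<equiv> src G a"
abbreviation r where "r a \<equiv> rng G a"

lemma units_iff: "x \<in> X \<longleftrightarrow> x \<in> arr \<and> s x = x"
proof
  assume "x \<in> X"
  then obtain a where "a \<in> arr" "x = s a" unfolding units_def by blast
  thus "x \<in> arr \<and> s x = x" using src_closed[of a] src_src[of a] by simp
next
  assume "x \<in> arr \<and> s x = x"
  thus "x \<in> X" unfolding units_def by (metis image_eqI)
qed

lemma unitD: assumes "x \<in> X" shows "x \<in> arr" "s x = x" "r x = x"
proof -
  show 1: "x \<in> arr" "s x = x" using assms by (simp_all add: units_iff)
  show "r x = x" using rng_src[OF 1(1)] 1(2) by simp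
qed

lemma src_unit: "a \<in> arr \<Longrightarrow> s a \<in> X" and rng_unit: "a \<in> arr \<Longrightarrow> r a \<in> X"
  by (simp_all add: units_iff src_closed rng_closed src_src src_rng)

lemmas grp = src_closed rng_closed inv_closed src_inv rng_inv src_src rng_src src_rng rng_rng src_unit rng_unit

lemma mul_inv_cancel_right: "\<lbrakk>a \<in> arr; b \<in> arr; s a = r b\<rbrakk> \<Longrightarrow> (a \<star> b) \<star> iv b = a"
  using mul_src[of a] by (simp add: mul_assoc grp mul_inv)

lemma mul_inv_cancel_right': "\<lbrakk>a \<in> arr; b \<in> arr; s a = s b\<rbrakk> \<Longrightarrow> (a \<star> iv b) \<star> b = a"
  using mul_src[of a] by (simp add: mul_assoc grp inv_mul)

lemma inv_mul_cancel_left: "\<lbrakk>a \<in> arr; b \<in> arr; s a = r b\<rbrakk> \<Longrightarrow> iv a \<star> (a \<star> b) = b"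
  using rng_mul_self[of b] by (simp add: mul_assoc[symmetric] grp inv_mul)

lemma inv_mul_cancel_left': "\<lbrakk>a \<in> arr; b \<in> arr; r a = r b\<rbrakk> \<Longrightarrow> a \<star> (iv a \<star> b) = b"
  using rng_mul_self[of b] by (simp add: mul_assoc[symmetric] grp mul_inv)

lemma inv_inv: assumes "a \<in> arr" shows "iv (iv a) = a"
proof -
  have "iv (iv a) \<star> (iv a \<star> a) = a"
    using inv_mul_cancel_left[of "iv a" a] assms by (simp add: grp)
  thus ?thesis using assms mul_src[of "iv (iv a)"] by (simp add: inv_mul grp)
qed

lemma inv_unit: assumes "x \<in> X" shows "iv x = x"
  using inv_mul[of x] mul_src[of "iv x"] unitD[OF assms] by (simp add: grp)

lemma unit_mul: "x \<in> X \<Longrightarrow> a \<in> arr \<Longrightarrow> r a = x \<Longrightarrow> x \<star> a = a"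
  and mul_unit: "x \<in> X \<Longrightarrow> a \<in> arr \<Longrightarrow> s a = x \<Longrightarrow> a \<star> x = a"
  using rng_mul_self mul_src by blast+

lemma inv_of_mul: assumes "a \<in> arr" "b \<in> arr" "s a = r b" shows "iv (a \<star> b) = iv b \<star> iv a"
proof -
  let ?c = "a \<star> b"
  have c: "?c \<in> arr" "s ?c = s b" "r ?c = r a" using assms by (simp_all add: mul_closed src_mul rng_mul)
  have d: "iv b \<star> iv a \<in> arr" "s (iv b \<star> iv a) = r a" "r (iv b \<star> iv a) = s b"
    using assms by (simp_all add: mul_closed src_mul rng_mul grp)
  have "(iv b \<star> iv a) \<star> ?c = s b"
    using assms by (simp add: mul_assoc grp mul_closed rng_mul inv_mul_cancel_left inv_mul)
  hence "((iv b \<star> iv a) \<star> ?c) \<star> iv ?c = iv ?c"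
    using rng_mul_self[of "iv ?c"] c by (simp add: grp)
  thus ?thesis using mul_inv_cancel_right[OF d(1) c(1)] c d by simp
qed

lemma topspace_T: "topspace T = arr" by (simp add: arrows_def)

lemma topspace_TX: "topspace TX = X"
  by (auto simp: unit_top_def topspace_T units_iff)

lemma open_rng: "open_map T TX (rng G)" and cont_rng: "continuous_map T TX (rng G)"
  using local_homeomorphism_continuous_open[OF local_homeo_rng] by simp_all

lemma openin_arr: "openin T U \<Longrightarrow> U \<subseteq> arr"
  using openin_subset topspace_T by blast

lemma inv_image: "U \<subseteq> arr \<Longrightarrow> ginv G ` U = {a \<in> arr. iv a \<in> U}"
proof (intro equalityI subsetI)
  assume U: "U \<subseteq> arr"
  fix a assume "a \<in> ginv G ` U"
  then obtain b where "b \<in> U" "a = iv b" by blast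
  thus "a \<in> {a \<in> arr. iv a \<in> U}" using U inv_inv[of b] inv_closed[of b] by auto
next
  fix a assume "a \<in> {a \<in> arr. iv a \<in> U}"
  hence "a = iv (iv a)" "iv a \<in> U" using inv_inv[of a] by auto
  thus "a \<in> ginv G ` U" by (rule image_eqI)
qed

lemma open_inv: assumes "openin T U" shows "openin T {a \<in> arr. iv a \<in> U}"
  using openin_continuous_map_preimage[OF continuous_inv assms] by (simp add: topspace_T)

lemma cont_src: "continuous_map T TX (src G)"
proof -
  have "continuous_map T TX (rng G \<circ> ginv G)" by (rule continuous_map_compose[OF continuous_inv cont_rng])
  thus ?thesis by (rule continuous_map_eq) (simp add: topspace_T grp)
qed

lemma open_src: "open_map T TX (src G)"
  unfolding open_map_def
proof (intro allI impI)
  fix U assume U: "openin T U"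
  have Ua: "a \<in> arr" if "a \<in> U" for a using openin_arr[OF U] that by blast
  have "src G ` U = (\<lambda>a. r (iv a)) ` U" by (rule image_cong) (simp_all add: rng_inv Ua)
  also have "\<dots> = rng G ` {a \<in> arr. iv a \<in> U}" by (simp add: inv_image[OF openin_arr[OF U], symmetric] image_image)
  finally have "src G ` U = rng G ` {a \<in> arr. iv a \<in> U}" .
  thus "openin TX (src G ` U)" using open_rng open_inv[OF U] unfolding open_map_def by simp
qed

text \<open>Where \<open>r\<close> is injective on \<open>U\<close>, an arrow \<open>a\<close> in \<open>U\<close> with \<open>r(a)\<close> in \<open>U\<close> is a unit.\<close>

lemma open_units: "openin T X"
proof (rule openin_subopen[THEN iffD2], rule ballI)
  fix x assume x: "x \<in> X"
  then obtain U where U: "openin T U" "x \<in> U" "openin TX (rng G ` U)"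
      "homeomorphic_map (subtopology T U) (subtopology TX (rng G ` U)) (rng G)"
    using local_homeo_rng unitD[OF x] topspace_T unfolding local_homeomorphism_def by metis
  have inj: "inj_on (rng G) U"
    using homeomorphic_imp_injective_map[OF U(4)] openin_subset[OF U(1)] by (simp add: inf.absorb2)
  have cT: "continuous_map T T (rng G)"
    using cont_rng unfolding unit_top_def by (rule continuous_map_into_fulltopology)
  let ?W = "{a \<in> U. r a \<in> U}"
  have "openin T ?W" by (rule openin_continuous_map_preimage_gen[OF cT U(1) U(1)])
  moreover have "x \<in> ?W" using U(2) unitD[OF x] by simp
  moreover have "?W \<subseteq> X"
  proof
    fix a assume "a \<in> ?W"
    hence a: "a \<in> U" "r a \<in> U" "a \<in> arr" using openin_arr[OF U(1)] by auto
    hence "a = r a" using inj by (auto simp: inj_on_def grp)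
    thus "a \<in> X" using rng_unit[OF a(3)] by simp
  qed
  ultimately show "\<exists>V. openin T V \<and> x \<in> V \<and> V \<subseteq> X" by blast
qed

lemma openin_TX: "openin TX V \<longleftrightarrow> openin T V \<and> V \<subseteq> X"
  unfolding unit_top_def by (rule openin_open_subtopology[OF open_units])

lemma compactin_TX: "compactin TX K \<longleftrightarrow> compactin T K \<and> K \<subseteq> X"
  unfolding unit_top_def by (rule compactin_subtopology)

lemma bisection_units: "open_bisection G X"
  using open_units unitD by (auto simp: open_bisection_def intro!: inj_onI)

lemma bisection_arr: "open_bisection G U \<Longrightarrow> U \<subseteq> arr"
  using openin_arr by (simp add: open_bisection_def)

lemma inj_on_inv:
  "inj_on (rng G) U \<Longrightarrow> inj_on (src G) {a \<in> arr. iv a \<in> U}" "inj_on (src G) U \<Longrightarrow> inj_on (rng G) {a \<in> arr. iv a \<in> U}"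
proof -
  have eq: "a = b" if "iv a = iv b" "a \<in> arr" "b \<in> arr" for a b using inv_inv that by metis
  show "inj_on (rng G) U \<Longrightarrow> inj_on (src G) {a \<in> arr. iv a \<in> U}" by (rule inj_onI, rule eq) (auto simp: inj_on_def grp)
  show "inj_on (src G) U \<Longrightarrow> inj_on (rng G) {a \<in> arr. iv a \<in> U}" by (rule inj_onI, rule eq) (auto simp: inj_on_def grp)
qed

lemma bisection_inv: "open_bisection G U \<Longrightarrow> open_bisection G {a \<in> arr. iv a \<in> U}"
  by (simp add: open_bisection_def open_inv inj_on_inv)

lemma bisection_through: assumes a: "a \<in> arr" shows "\<exists>U. open_bisection G U \<and> a \<in> U"
proof -
  have ex: "\<exists>U. openin T U \<and> b \<in> U \<and> inj_on (rng G) U" if b: "b \<in> arr" for b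
  proof -
    obtain U where U: "openin T U" "b \<in> U"
      "homeomorphic_map (subtopology T U) (subtopology TX (rng G ` U)) (rng G)"
      using local_homeo_rng b topspace_T unfolding local_homeomorphism_def by metis
    have "inj_on (rng G) U"
      using homeomorphic_imp_injective_map[OF U(3)] openin_subset[OF U(1)] by (simp add: inf.absorb2)
    thus ?thesis using U by blast
  qed
  obtain U1 where U1: "openin T U1" "a \<in> U1" "inj_on (rng G) U1" using ex[OF a] by blast
  obtain U2 where U2: "openin T U2" "iv a \<in> U2" "inj_on (rng G) U2" using ex[OF inv_closed[OF a]] by blast
  let ?U = "U1 \<inter> {b \<in> arr. iv b \<in> U2}"
  have "inj_on (src G) ?U" using inj_on_inv(1)[OF U2(3)] by (rule inj_on_subset) blast
  moreover have "inj_on (rng G) ?U" using U1(3) by (rule inj_on_subset) blast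
  moreover have "openin T ?U" using U1(1) open_inv[OF U2(1)] by (rule openin_Int)
  ultimately show ?thesis using U1 U2 a by (auto simp: open_bisection_def)
qed

lemma bisection_Hausdorff: assumes "open_bisection G U" shows "Hausdorff_space (subtopology T U)"
proof (rule Hausdorff_space_injective_preimage[OF Hausdorff_units])
  show "continuous_map (subtopology T U) TX (rng G)" by (rule continuous_map_from_subtopology[OF cont_rng])
  show "inj_on (rng G) (topspace (subtopology T U))"
    using assms by (auto simp: open_bisection_def intro: inj_on_subset)
qed

lemma rng_inverse:
  assumes "open_bisection G U"
  shows "continuous_map (subtopology TX (rng G ` U)) T (the_inv_into U (rng G))"
    "a \<in> U \<Longrightarrow> the_inv_into U (rng G) (r a) = a" "openin TX (rng G ` U)"
  using assms open_injective_inverse[OF cont_rng open_rng, of U] the_inv_into_f_f[of "rng G" U a] open_rng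
  by (auto simp: open_bisection_def open_map_def)

lemma src_inverse:
  assumes "open_bisection G U"
  shows "continuous_map (subtopology TX (src G ` U)) T (the_inv_into U (src G))"
    "a \<in> U \<Longrightarrow> the_inv_into U (src G) (s a) = a" "openin TX (src G ` U)"
  using assms open_injective_inverse[OF cont_src open_src, of U] the_inv_into_f_f[of "src G" U a] open_src
  by (auto simp: open_bisection_def open_map_def)

lemma continuous_mul_comp:
  assumes "continuous_map Z T f" "continuous_map Z T g" "\<And>z. z \<in> topspace Z \<Longrightarrow> s (f z) = r (g z)"
  shows "continuous_map Z T (\<lambda>z. f z \<star> g z)"
proof -
  have "continuous_map Z (subtopology (prod_topology T T) {(a, b). s a = r b}) (\<lambda>z. (f z, g z))"
    using assms by (intro continuous_map_into_subtopology continuous_map_pairedI) auto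
  from continuous_map_compose[OF this continuous_mul] show ?thesis by (simp add: o_def)
qed

definition bprod where "bprod U V = {a \<star> b | a b. a \<in> U \<and> b \<in> V \<and> s a = r b}"

text \<open>In this form, with \<open>a = the_inv_into U (rng G) (r c)\<close> depending continuously on \<open>c\<close>, the product is
  visibly open.\<close>

lemma bprod_eq:
  assumes U: "open_bisection G U" and V: "open_bisection G V"
  shows "bprod U V = {c \<in> arr. r c \<in> rng G ` U \<and> iv (the_inv_into U (rng G) (r c)) \<star> c \<in> V}"
proof (intro equalityI subsetI)
  fix c assume "c \<in> bprod U V"
  then obtain a b where c: "c = a \<star> b" "a \<in> U" "b \<in> V" "s a = r b" by (auto simp: bprod_def)
  have ab: "a \<in> arr" "b \<in> arr" using c bisection_arr U V by auto
  have "r c = r a" "c \<in> arr" using c ab by (simp_all add: rng_mul mul_closed)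
  thus "c \<in> {c \<in> arr. r c \<in> rng G ` U \<and> iv (the_inv_into U (rng G) (r c)) \<star> c \<in> V}"
    using rng_inverse(2)[OF U c(2)] c ab by (simp add: inv_mul_cancel_left)
next
  fix c assume "c \<in> {c \<in> arr. r c \<in> rng G ` U \<and> iv (the_inv_into U (rng G) (r c)) \<star> c \<in> V}"
  then obtain a where c: "c \<in> arr" "a \<in> U" "r c = r a" "iv (the_inv_into U (rng G) (r c)) \<star> c \<in> V" by auto
  have a: "a \<in> arr" using c bisection_arr U by auto
  have 1: "iv a \<star> c \<in> V" using c rng_inverse(2)[OF U c(2)] by simp
  have "a \<star> (iv a \<star> c) = c" "s a = r (iv a \<star> c)" using a c by (simp_all add: inv_mul_cancel_left' rng_mul grp)
  thus "c \<in> bprod U V" using 1 c(2) unfolding bprod_def by force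
qed

lemma bisection_bprod:
  assumes U: "open_bisection G U" and V: "open_bisection G V" shows "open_bisection G (bprod U V)"
proof -
  have inj: "inj_on (rng G) U" "inj_on (src G) U" "inj_on (rng G) V" "inj_on (src G) V"
    and op: "openin T V" "openin T U" using U V by (auto simp: open_bisection_def)
  have arr: "a \<in> arr" if "a \<in> U \<or> a \<in> V" for a using that bisection_arr U V by auto
  let ?Z = "{c \<in> arr. r c \<in> rng G ` U}"
  have Z: "openin T ?Z"
    using openin_continuous_map_preimage[OF cont_rng rng_inverse(3)[OF U]] by (simp add: topspace_T)
  have "continuous_map (subtopology T ?Z) (subtopology TX (rng G ` U)) (rng G)"
    by (rule continuous_map_into_subtopology[OF continuous_map_from_subtopology[OF cont_rng]]) auto
  from continuous_map_compose[OF this rng_inverse(1)[OF U]]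
  have c1: "continuous_map (subtopology T ?Z) T (\<lambda>c. the_inv_into U (rng G) (r c))" by (simp add: o_def)
  have c2: "continuous_map (subtopology T ?Z) T (\<lambda>c. iv (the_inv_into U (rng G) (r c)))"
    using continuous_map_compose[OF c1 continuous_inv] by (simp add: o_def)
  have c3: "continuous_map (subtopology T ?Z) T (\<lambda>c. iv (the_inv_into U (rng G) (r c)) \<star> c)"
  proof (rule continuous_mul_comp[OF c2])
    show "continuous_map (subtopology T ?Z) T (\<lambda>c. c)" by (rule continuous_map_from_subtopology) simp
    fix c assume "c \<in> topspace (subtopology T ?Z)"
    then obtain a where a: "a \<in> U" "r c = r a" by auto
    thus "s (iv (the_inv_into U (rng G) (r c))) = r c" using rng_inverse(2)[OF U a(1)] arr by (simp add: grp)
  qed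
  have "openin (subtopology T ?Z) {c \<in> topspace (subtopology T ?Z). iv (the_inv_into U (rng G) (r c)) \<star> c \<in> V}"
    by (rule openin_continuous_map_preimage[OF c3 op(1)])
  hence "openin T {c \<in> topspace (subtopology T ?Z). iv (the_inv_into U (rng G) (r c)) \<star> c \<in> V}"
    by (rule openin_trans_full[OF _ Z])
  also have "{c \<in> topspace (subtopology T ?Z). iv (the_inv_into U (rng G) (r c)) \<star> c \<in> V} = bprod U V"
    unfolding bprod_eq[OF U V] by (auto simp: topspace_T)
  finally have "openin T (bprod U V)" .
  moreover have "inj_on (rng G) (bprod U V)"
  proof (rule inj_onI)
    fix c d assume "c \<in> bprod U V" "d \<in> bprod U V" and rcd: "r c = r d"
    then obtain a b a' b' where ab: "c = a \<star> b" "a \<in> U" "b \<in> V" "s a = r b" "d = a' \<star> b'" "a' \<in> U" "b' \<in> V" "s a' = r b'"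
      by (auto simp: bprod_def)
    have "a = a'" using rcd ab arr inj(1) by (auto simp: rng_mul inj_on_def)
    hence "b = b'" using ab inj(3) by (auto simp: inj_on_def)
    thus "c = d" using ab \<open>a = a'\<close> by simp
  qed
  moreover have "inj_on (src G) (bprod U V)"
  proof (rule inj_onI)
    fix c d assume "c \<in> bprod U V" "d \<in> bprod U V" and rcd: "s c = s d"
    then obtain a b a' b' where ab: "c = a \<star> b" "a \<in> U" "b \<in> V" "s a = r b" "d = a' \<star> b'" "a' \<in> U" "b' \<in> V" "s a' = r b'"
      by (auto simp: bprod_def)
    have "b = b'" using rcd ab arr inj(4) by (auto simp: src_mul inj_on_def)
    hence "a = a'" using ab inj(2) by (auto simp: inj_on_def)
    thus "c = d" using ab \<open>b = b'\<close> by simp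
  qed
  ultimately show ?thesis by (simp add: open_bisection_def)
qed

lemma compact_src_preimage:
  assumes U: "open_bisection G U" and K: "compactin TX K" "K \<subseteq> src G ` U"
  shows "compactin T {a \<in> U. s a \<in> K}"
proof -
  have inj: "inj_on (src G) U" using U by (simp add: open_bisection_def)
  have "{a \<in> U. s a \<in> K} = the_inv_into U (src G) ` K"
    using K(2) src_inverse(2)[OF U] by (auto intro!: rev_image_eqI)
  moreover have "compactin (subtopology TX (src G ` U)) K" using K by (simp add: compactin_subtopology)
  ultimately show ?thesis using image_compactin src_inverse(1)[OF U] by metis
qed

end

section \<open>Fibres of a Fell line bundle\<close>

lemma continuous_map_locally:
  assumes "\<And>z. z \<in> topspace Z \<Longrightarrow> \<exists>V. openin Z V \<and> z \<in> V \<and> continuous_map (subtopology Z V) Y h"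
  shows "continuous_map Z Y h"
proof (rule continuous_mapI_local)
  fix z assume z: "z \<in> topspace Z"
  then obtain V where V: "openin Z V" "z \<in> V" "continuous_map (subtopology Z V) Y h" using assms by blast
  show "h z \<in> topspace Y" using V(3) z V(2) unfolding continuous_map_def by auto
  fix W assume W: "openin Y W" "h z \<in> W"
  have "openin Z {y \<in> topspace (subtopology Z V). h y \<in> W}"
    by (rule openin_trans_full[OF openin_continuous_map_preimage[OF V(3) W(1)] V(1)])
  thus "\<exists>V. openin Z V \<and> z \<in> V \<and> (\<forall>y\<in>V. h y \<in> W)"
    using z V(2) W(2) by (intro exI[of _ "{y \<in> topspace (subtopology Z V). h y \<in> W}"]) auto
qed

locale fell_groupoid = etale_groupoid G + fell_line_bundle G L
  for G :: "'g groupoid" and L :: "('g, 'l) fell_bundle"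
begin

abbreviation TL where "TL \<equiv> ltop L"
abbreviation p where "p \<xi> \<equiv> proj L \<xi>"
abbreviation fb where "fb a \<equiv> fib L a"
abbreviation zr where "zr a \<equiv> lzero L a"
abbreviation la (infixl "\<boxplus>" 65) where "\<xi> \<boxplus> \<eta> \<equiv> ladd L \<xi> \<eta>"
abbreviation ls (infixr "\<cdot>" 75) where "c \<cdot> \<xi> \<equiv> lsmul L c \<xi>"
abbreviation lm (infixl "\<diamondop>" 70) where "\<xi> \<diamondop> \<eta> \<equiv> lmul L \<xi> \<eta>"
abbreviation ld where "ld \<xi> \<equiv> ladj L \<xi>"
abbreviation over_set where "over_set U \<equiv> {\<xi> \<in> topspace TL. p \<xi> \<in> U}"
abbreviation nm where "nm \<xi> \<equiv> lnorm L \<xi>"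

lemma fib_iff: "\<xi> \<in> fb a \<longleftrightarrow> \<xi> \<in> topspace TL \<and> p \<xi> = a"
  by (simp add: fib_def)

lemma fibre_simps [simp]: "carrier (fibre L a) = fb a" "vzero (fibre L a) = zr a"
  "vadd (fibre L a) = ladd L" "vsmul (fibre L a) = lsmul L" "amul (fibre L a) = lmul L"
  by (simp_all add: fibre_def)

lemma proj_arr: "\<xi> \<in> topspace TL \<Longrightarrow> p \<xi> \<in> arr"
  using continuous_proj topspace_T unfolding continuous_map_def by blast

lemma fb_total: "\<xi> \<in> topspace TL \<Longrightarrow> \<xi> \<in> fb (p \<xi>)"
  by (simp add: fib_iff)

lemmas fvs = fibre_vector_space
lemmas fb_zero = complex_vector_space.zero_closed[OF fvs, simplified]
lemmas fb_add = complex_vector_space.add_closed[OF fvs, simplified]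
lemmas fb_smul = complex_vector_space.smul_closed[OF fvs, simplified]
lemmas fb_add_assoc = complex_vector_space.add_assoc[OF fvs, simplified]
lemmas fb_add_commute = complex_vector_space.add_commute[OF fvs, simplified]
lemmas fb_add_zero = complex_vector_space.add_zero[OF fvs, simplified]
lemmas fb_zero_add = complex_vector_space.zero_add[OF fvs, simplified]
lemmas fb_smul_add = complex_vector_space.smul_add[OF fvs, simplified]
lemmas fb_add_smul = complex_vector_space.add_smul[OF fvs, simplified]
lemmas fb_smul_smul = complex_vector_space.smul_smul[OF fvs, simplified]
lemmas fb_smul_one = complex_vector_space.smul_one[OF fvs, simplified]
lemmas fb_zero_smul = complex_vector_space.smul_zero_scalar[OF fvs, simplified]
lemmas fb_smul_zero = complex_vector_space.smul_zero[OF fvs, simplified]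
lemmas fb_closed = fb_zero fb_add fb_smul

lemma nm_zero: "a \<in> arr \<Longrightarrow> nm (zr a) = 0"
  and nm_nonneg: "a \<in> arr \<Longrightarrow> \<xi> \<in> fb a \<Longrightarrow> 0 \<le> nm \<xi>"
  and nm_eq_0: "a \<in> arr \<Longrightarrow> \<xi> \<in> fb a \<Longrightarrow> nm \<xi> = 0 \<longleftrightarrow> \<xi> = zr a"
  and nm_add: "a \<in> arr \<Longrightarrow> \<xi> \<in> fb a \<Longrightarrow> \<eta> \<in> fb a \<Longrightarrow> nm (\<xi> \<boxplus> \<eta>) \<le> nm \<xi> + nm \<eta>"
  and nm_smul: "a \<in> arr \<Longrightarrow> \<xi> \<in> fb a \<Longrightarrow> nm (c \<cdot> \<xi>) = cmod c * nm \<xi>"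
  using fibre_norm[of a] fb_zero[of a] unfolding is_norm_def by auto

lemma ladj_norm: assumes a: "a \<in> arr" and x: "\<xi> \<in> fb a" shows "nm (ld \<xi>) = nm \<xi>"
proof -
  have le: "nm \<eta> \<le> nm (ld \<eta>)" if b: "b \<in> arr" and e: "\<eta> \<in> fb b" for b \<eta>
  proof (cases "nm \<eta> = 0")
    case True thus ?thesis using nm_nonneg[OF inv_closed[OF b] ladj_closed[OF b e]] by simp
  next
    case False
    hence pos: "nm \<eta> > 0" using nm_nonneg[OF b e] by simp
    have "nm \<eta> * nm \<eta> \<le> nm (ld \<eta>) * nm \<eta>"
      using lmul_norm[OF inv_closed[OF b] b _ ladj_closed[OF b e] e] lnorm_cstar[OF b e] b
      by (simp add: grp power2_eq_square)
    thus ?thesis using pos by simp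
  qed
  show ?thesis using le[OF a x] le[OF inv_closed[OF a] ladj_closed[OF a x]] ladj_ladj[OF a x] by simp
qed

lemma line: assumes a: "a \<in> arr" and e: "e \<in> fb a" "nm e \<noteq> 0" and x: "\<xi> \<in> fb a"
  shows "\<exists>c. \<xi> = c \<cdot> e"
proof -
  obtain f where f: "f \<in> fb a" "\<forall>v\<in>fb a. \<exists>c. v = c \<cdot> f"
    using fibre_line[OF a] by (auto simp: one_dimensional_def)
  obtain c where c: "e = c \<cdot> f" using f e by blast
  have "c \<noteq> 0" using c e f fb_zero_smul[OF a f(1)] nm_zero[OF a] by auto
  hence "f = (1/c) \<cdot> e" using c f a by (simp add: fb_smul_smul fb_smul_one)
  moreover obtain d where "\<xi> = d \<cdot> f" using f x by blast
  ultimately show ?thesis using a e(1) fb_smul_smul[OF a e(1)] by metis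
qed

lemma smul_inject: assumes "a \<in> arr" "e \<in> fb a" "nm e \<noteq> 0" "c \<cdot> e = d \<cdot> e" shows "c = d"
proof -
  have "(c - d) \<cdot> e = c \<cdot> e \<boxplus> (-d) \<cdot> e" using fb_add_smul[OF assms(1,2), of c "-d"] by simp
  also have "\<dots> = zr a" using assms fb_add_smul[OF assms(1,2), of d "-d"] fb_zero_smul[OF assms(1,2)] by simp
  finally have "cmod (c - d) * nm e = 0" using assms nm_smul[OF assms(1,2), of "c - d"] nm_zero by simp
  thus ?thesis using assms by simp
qed

lemma normalize: assumes a: "a \<in> arr" and x: "\<xi> \<in> fb a" "nm \<xi> \<noteq> 0"
  shows "(of_real (1 / nm \<xi>) \<cdot> \<xi>) \<in> fb a" "nm (of_real (1 / nm \<xi>) \<cdot> \<xi>) = 1"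
  using a x nm_nonneg[OF a x(1)] by (simp_all add: fb_smul nm_smul norm_divide)

lemma unit_vector: assumes a: "a \<in> arr" shows "\<exists>\<xi>\<in>fb a. nm \<xi> = 1"
proof -
  obtain f where f: "f \<in> fb a" "f \<noteq> zr a" using fibre_line[OF a] by (auto simp: one_dimensional_def)
  thus ?thesis using normalize[OF a f(1)] nm_eq_0[OF a f(1)] by blast
qed

text \<open>For a unit vector \<open>\<xi>\<close> the square of \<open>\<xi>\<^sup>*\<xi>\<close> is \<open>c \<xi>\<^sup>*\<xi>\<close> with \<open>|c| = 1\<close>, by the C*-identity, and then
  \<open>c\<^sup>-\<^sup>1 \<xi>\<^sup>*\<xi>\<close> is idempotent.\<close>

lemma unit_idempotent: assumes x: "x \<in> X" shows "\<exists>e\<in>fb x. nm e = 1 \<and> e \<diamondop> e = e"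
proof -
  note xa = unitD[OF x] and ix = inv_unit[OF x] and xx = unit_mul[OF x unitD(1)[OF x] unitD(3)[OF x]]
  have cl: "\<And>\<xi> \<eta>. \<xi> \<in> fb x \<Longrightarrow> \<eta> \<in> fb x \<Longrightarrow> \<xi> \<diamondop> \<eta> \<in> fb x"
    using lmul_closed[of x x] xa xx by simp
  have cd: "\<And>\<xi>. \<xi> \<in> fb x \<Longrightarrow> ld \<xi> \<in> fb x" using ladj_closed[of x] xa ix by simp
  obtain z where z: "z \<in> fb x" "nm z = 1" using unit_vector[OF xa(1)] by blast
  define h where "h = ld z \<diamondop> z"
  have h: "h \<in> fb x" "nm h = 1" using cl cd z lnorm_cstar[OF xa(1) z(1)] by (simp_all add: h_def)
  have hh: "ld h = h"
    using ladj_lmul[of x x "ld z" z] cd z xa ladj_ladj[OF xa(1) z(1)] by (simp add: h_def)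
  obtain c where c: "h \<diamondop> h = c \<cdot> h" using line[OF xa(1) h(1) _ cl[OF h(1) h(1)]] h by auto
  have "nm (c \<cdot> h) = 1" using lnorm_cstar[OF xa(1) h(1)] c hh h by simp
  hence c1: "cmod c = 1" using nm_smul[OF xa(1) h(1)] h by simp
  hence c0: "c \<noteq> 0" by auto
  let ?e = "(1/c) \<cdot> h"
  have e: "?e \<in> fb x" using fb_smul xa h by simp
  have "?e \<diamondop> ?e = (1/c) \<cdot> ((1/c) \<cdot> (h \<diamondop> h))"
    using lmul_smul_left[of x x h ?e "1/c"] lmul_smul_right[of x x h h "1/c"] xa h e by simp
  also have "\<dots> = ?e" using c c0 xa h by (simp add: fb_smul_smul)
  finally have "?e \<diamondop> ?e = ?e" .
  moreover have "nm ?e = 1" using nm_smul[OF xa(1) h(1)] h c1 by (simp add: norm_divide)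
  ultimately show ?thesis using e by blast
qed

text \<open>Over units the chosen unit vector is the unit of the fibre. The coordinate of a vector is taken with
  respect to this basis.\<close>

definition bas where "bas a = (SOME e. e \<in> fb a \<and> nm e = 1 \<and> (a \<in> X \<longrightarrow> e \<diamondop> e = e))"

definition crd where "crd a \<xi> = (THE c. \<xi> = c \<cdot> bas a)"

lemma bas: assumes "a \<in> arr" shows "bas a \<in> fb a" "nm (bas a) = 1" "a \<in> X \<Longrightarrow> bas a \<diamondop> bas a = bas a"
proof -
  have "\<exists>e. e \<in> fb a \<and> nm e = 1 \<and> (a \<in> X \<longrightarrow> e \<diamondop> e = e)"
    using unit_vector[OF assms] unit_idempotent[of a] by blast
  hence "bas a \<in> fb a \<and> nm (bas a) = 1 \<and> (a \<in> X \<longrightarrow> bas a \<diamondop> bas a = bas a)"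
    unfolding bas_def by (rule someI_ex)
  thus "bas a \<in> fb a" "nm (bas a) = 1" "a \<in> X \<Longrightarrow> bas a \<diamondop> bas a = bas a" by blast+
qed

lemma crd_unique: assumes "a \<in> arr" "\<xi> = c \<cdot> bas a" shows "crd a \<xi> = c"
  unfolding crd_def using assms smul_inject[OF assms(1) bas(1)[OF assms(1)]] bas(2)[OF assms(1)] by auto

lemma crd: assumes a: "a \<in> arr" and x: "\<xi> \<in> fb a" shows "crd a \<xi> \<cdot> bas a = \<xi>"
proof -
  obtain c where "\<xi> = c \<cdot> bas a" using line[OF a bas(1)[OF a] _ x] bas(2)[OF a] by auto
  thus ?thesis using crd_unique[OF a] by simp
qed

lemma crd_bas: "a \<in> arr \<Longrightarrow> crd a (bas a) = 1"
  by (rule crd_unique) (simp_all add: fb_smul_one bas)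

lemma crd_smul: "a \<in> arr \<Longrightarrow> \<xi> \<in> fb a \<Longrightarrow> crd a (c \<cdot> \<xi>) = c * crd a \<xi>"
  by (rule crd_unique) (simp_all add: fb_smul_smul[symmetric] bas crd)

lemma crd_add: "a \<in> arr \<Longrightarrow> \<xi> \<in> fb a \<Longrightarrow> \<eta> \<in> fb a \<Longrightarrow> crd a (\<xi> \<boxplus> \<eta>) = crd a \<xi> + crd a \<eta>"
  by (rule crd_unique) (simp_all add: fb_add_smul bas crd)

lemma crd_zero: "a \<in> arr \<Longrightarrow> crd a (zr a) = 0"
  by (rule crd_unique) (simp_all add: fb_zero_smul bas)

lemma nm_crd: "a \<in> arr \<Longrightarrow> \<xi> \<in> fb a \<Longrightarrow> nm \<xi> = cmod (crd a \<xi>)"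
  using nm_smul[of a "bas a" "crd a \<xi>"] by (simp add: crd bas)

lemma crd_inject: "a \<in> arr \<Longrightarrow> \<xi> \<in> fb a \<Longrightarrow> \<eta> \<in> fb a \<Longrightarrow> crd a \<xi> = crd a \<eta> \<longleftrightarrow> \<xi> = \<eta>"
  using crd by metis

lemma crd_eq_0: "a \<in> arr \<Longrightarrow> \<xi> \<in> fb a \<Longrightarrow> crd a \<xi> = 0 \<longleftrightarrow> \<xi> = zr a"
  using crd_inject[of a \<xi> "zr a"] by (simp add: crd_zero fb_zero)

lemma smul_bas: "a \<in> arr \<Longrightarrow> c \<cdot> bas a \<in> fb a" "a \<in> arr \<Longrightarrow> crd a (c \<cdot> bas a) = c"
  by (simp_all add: fb_smul bas crd_smul crd_bas)

lemma lmul_zero_left: "\<lbrakk>a \<in> arr; b \<in> arr; s a = r b; \<eta> \<in> fb b\<rbrakk> \<Longrightarrow> zr a \<diamondop> \<eta> = zr (a \<star> b)"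
  using lmul_smul_left[of a b "zr a" \<eta> 0] fb_zero_smul[of a "zr a"] fb_zero_smul[of "a \<star> b" "zr a \<diamondop> \<eta>"]
    lmul_closed[of a b "zr a" \<eta>] by (simp add: fb_zero mul_closed)

lemma lmul_zero_right: "\<lbrakk>a \<in> arr; b \<in> arr; s a = r b; \<xi> \<in> fb a\<rbrakk> \<Longrightarrow> \<xi> \<diamondop> zr b = zr (a \<star> b)"
  using lmul_smul_right[of a b \<xi> "zr b" 0] fb_zero_smul[of b "zr b"] fb_zero_smul[of "a \<star> b" "\<xi> \<diamondop> zr b"]
    lmul_closed[of a b \<xi> "zr b"] by (simp add: fb_zero mul_closed)

lemma ladj_zero: "a \<in> arr \<Longrightarrow> ld (zr a) = zr (iv a)"
  using ladj_norm[of a "zr a"] nm_eq_0[of "iv a" "ld (zr a)"] ladj_closed[of a "zr a"]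
  by (simp add: fb_zero nm_zero inv_closed)

lemma idempotent_eq_bas: assumes x: "x \<in> X" and e: "e \<in> fb x" "nm e = 1" "e \<diamondop> e = e" shows "e = bas x"
proof -
  note xa = unitD[OF x] and xx = unit_mul[OF x unitD(1)[OF x] unitD(3)[OF x]]
  define c where "c = crd x e"
  have ec: "e = c \<cdot> bas x" using crd[OF xa(1) e(1)] by (simp add: c_def)
  note b = bas[OF xa(1)]
  have "e \<diamondop> e = c \<cdot> (c \<cdot> (bas x \<diamondop> bas x))"
    unfolding ec using lmul_smul_left[of x x "bas x" "c \<cdot> bas x" c] lmul_smul_right[of x x "bas x" "bas x" c] xa b fb_smul
    by simp
  hence "(c * c) \<cdot> bas x = c \<cdot> bas x" using e(3) b(3)[OF x] ec xa b(1) by (simp add: fb_smul_smul)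
  from smul_inject[OF xa(1) b(1) _ this] b(2) have cc: "c * c = c" by simp
  have "cmod c = 1" using nm_crd[OF xa(1) e(1)] e(2) by (simp add: c_def)
  hence "c = 1" using cc by auto
  thus ?thesis using ec fb_smul_one xa b by simp
qed

lemma ladj_bas: assumes x: "x \<in> X" shows "ld (bas x) = bas x"
proof (rule idempotent_eq_bas[OF x])
  note xa = unitD[OF x] and b = bas[OF unitD(1)[OF x]]
  show "ld (bas x) \<in> fb x" using ladj_closed[OF xa(1) b(1)] inv_unit[OF x] by simp
  show "nm (ld (bas x)) = 1" using ladj_norm[OF xa(1) b(1)] b by simp
  show "ld (bas x) \<diamondop> ld (bas x) = ld (bas x)"
    using ladj_lmul[of x x "bas x" "bas x"] xa b b(3)[OF x] by simp
qed

text \<open>Multiplication by the idempotent is a scalar \<open>c\<close> with \<open>c\<^sup>2 = c\<close> on the line over \<open>a\<close>, and \<open>c = 0\<close> would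
  give \<open>\<xi>\<xi>\<^sup>*\<xi> = 0\<close>, against the C*-identity.\<close>

lemma bas_left: assumes a: "a \<in> arr" and x: "\<xi> \<in> fb a" shows "bas (r a) \<diamondop> \<xi> = \<xi>"
proof (cases "\<xi> = zr a")
  case True
  thus ?thesis using lmul_zero_right[of "r a" a "bas (r a)"] a by (simp add: grp bas rng_mul_self)
next
  case False
  hence nz: "nm \<xi> \<noteq> 0" using nm_eq_0[OF a x] by simp
  have ra: "r a \<in> arr" "s (r a) = r a" and u: "bas (r a) \<in> fb (r a)" using a by (simp_all add: grp bas)
  have bx: "bas (r a) \<diamondop> \<xi> \<in> fb a" using lmul_closed[OF ra(1) a ra(2) u x] a by (simp add: rng_mul_self)
  obtain c where c: "bas (r a) \<diamondop> \<xi> = c \<cdot> \<xi>" using line[OF a x nz bx] by blast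
  have "c \<cdot> \<xi> = bas (r a) \<diamondop> (bas (r a) \<diamondop> \<xi>)"
    using lmul_assoc[of "r a" "r a" a "bas (r a)" "bas (r a)" \<xi>] a x ra u bas(3)[OF ra(1)] c by (simp add: grp)
  also have "\<dots> = c \<cdot> (c \<cdot> \<xi>)" using c lmul_smul_right[OF ra(1) a ra(2) u x] by simp
  finally have "c \<cdot> \<xi> = (c * c) \<cdot> \<xi>" using a x by (simp add: fb_smul_smul)
  from smul_inject[OF a x nz this] have cc: "c = c * c" .
  have "c \<noteq> 0"
  proof
    assume c0: "c = 0"
    let ?y = "ld \<xi>"
    have ia: "iv a \<in> arr" "s (iv a) = r a" "r (iv a) = s a" and y: "?y \<in> fb (iv a)"
      using a x by (simp_all add: grp ladj_closed)
    have xy: "\<xi> \<diamondop> ?y \<in> fb (r a)" using lmul_closed[of a "iv a" \<xi> ?y] a x ia y by (simp add: mul_inv)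
    have yx: "?y \<diamondop> \<xi> \<in> fb (s a)" using lmul_closed[of "iv a" a ?y \<xi>] a x ia y by (simp add: inv_mul)
    define d where "d = crd (r a) (\<xi> \<diamondop> ?y)"
    have "(\<xi> \<diamondop> ?y) \<diamondop> \<xi> = (d \<cdot> bas (r a)) \<diamondop> \<xi>" using crd[OF ra(1) xy] by (simp add: d_def)
    also have "\<dots> = d \<cdot> (0 \<cdot> \<xi>)" using lmul_smul_left[OF ra(1) a ra(2) u x] c c0 by simp
    also have "\<dots> = zr a" using a x by (simp add: fb_zero_smul fb_smul_zero)
    finally have 0: "\<xi> \<diamondop> (?y \<diamondop> \<xi>) = zr a"
      using lmul_assoc[of a "iv a" a \<xi> ?y \<xi>] a x ia y by simp
    have "ld (?y \<diamondop> \<xi>) = ?y \<diamondop> \<xi>"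
      using ladj_lmul[of "iv a" a ?y \<xi>] a x ia y ladj_ladj[OF a x] by simp
    hence "(nm (?y \<diamondop> \<xi>))\<^sup>2 = nm ((?y \<diamondop> \<xi>) \<diamondop> (?y \<diamondop> \<xi>))"
      using lnorm_cstar[OF src_closed[OF a] yx] by simp
    also have "(?y \<diamondop> \<xi>) \<diamondop> (?y \<diamondop> \<xi>) = ?y \<diamondop> (\<xi> \<diamondop> (?y \<diamondop> \<xi>))"
      using lmul_assoc[of "iv a" a "s a" ?y \<xi> "?y \<diamondop> \<xi>"] a x ia y yx by (simp add: grp)
    also have "\<dots> = zr (s a)" using 0 lmul_zero_right[of "iv a" a ?y] a ia y by (simp add: inv_mul)
    also have "nm \<dots> = 0" using a by (simp add: nm_zero grp)
    finally have "nm (?y \<diamondop> \<xi>) = 0" by simp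
    thus False using lnorm_cstar[OF a x] nz by simp
  qed
  hence "c = 1" using cc by simp
  thus ?thesis using c fb_smul_one[OF a x] by simp
qed

lemma bas_right: assumes a: "a \<in> arr" and x: "\<xi> \<in> fb a" shows "\<xi> \<diamondop> bas (s a) = \<xi>"
proof -
  have sa: "s a \<in> arr" "r (s a) = s a" "s a \<in> X" and u: "bas (s a) \<in> fb (s a)" using a by (simp_all add: grp bas)
  have m: "\<xi> \<diamondop> bas (s a) \<in> fb a" using lmul_closed[of a "s a" \<xi> "bas (s a)"] a x sa u by (simp add: mul_src)
  have "ld (\<xi> \<diamondop> bas (s a)) = bas (s a) \<diamondop> ld \<xi>"
    using ladj_lmul[of a "s a" \<xi> "bas (s a)"] a x sa u ladj_bas[OF sa(3)] by simp
  also have "\<dots> = ld \<xi>" using bas_left[OF inv_closed[OF a] ladj_closed[OF a x]] a by (simp add: grp)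
  finally show ?thesis using ladj_ladj[OF a x] ladj_ladj[OF a m] by metis
qed

lemma unit_left: assumes "a \<in> arr" "\<xi> \<in> fb a" "\<delta> \<in> fb (r a)" shows "\<delta> \<diamondop> \<xi> = crd (r a) \<delta> \<cdot> \<xi>"
  using lmul_smul_left[of "r a" a "bas (r a)" \<xi> "crd (r a) \<delta>"] assms bas_left[of a \<xi>] crd[of "r a" \<delta>]
  by (simp add: grp bas)

lemma crd_adj_unit: assumes x: "x \<in> X" and d: "\<delta> \<in> fb x" shows "crd x (ld \<delta>) = cnj (crd x \<delta>)"
proof -
  note xa = unitD[OF x]
  have "ld \<delta> = ld (crd x \<delta> \<cdot> bas x)" using crd[OF xa(1) d] by simp
  also have "\<dots> = cnj (crd x \<delta>) \<cdot> bas x" using ladj_smul[OF xa(1) bas(1)[OF xa(1)]] ladj_bas[OF x] by simp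
  finally show ?thesis by (rule crd_unique[OF xa(1)])
qed

text \<open>Positivity provides \<open>\<eta>\<close> in the fibre over the unit with \<open>\<xi>\<^sup>*\<xi> = \<eta>\<^sup>*\<eta>\<close>. In that fibre the adjoint is
  conjugation of coordinates, so the coordinate of \<open>\<eta>\<^sup>*\<eta>\<close> is nonnegative, and the C*-identity gives its size.\<close>

lemma adj_mul_self: assumes a: "a \<in> arr" and x: "\<xi> \<in> fb a"
  shows "ld \<xi> \<diamondop> \<xi> = of_real ((nm \<xi>)\<^sup>2) \<cdot> bas (s a)"
proof -
  have sa: "s a \<in> arr" "s a \<in> X" "r (s a) = s a" using a by (simp_all add: grp)
  obtain h where h: "h \<in> fb (s a)" "ld \<xi> \<diamondop> \<xi> = ld h \<diamondop> h" using ladj_lmul_positive[OF a x] by blast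
  have lh: "ld h \<in> fb (s a)" using ladj_closed[OF sa(1) h(1)] inv_unit[OF sa(2)] by simp
  define c where "c = crd (s a) h"
  have hc: "h = c \<cdot> bas (s a)" using crd[OF sa(1) h(1)] by (simp add: c_def)
  have "ld h \<diamondop> h = cnj c \<cdot> h"
    using unit_left[OF sa(1) h(1)] lh crd_adj_unit[OF sa(2) h(1)] sa by (simp add: c_def)
  also have "\<dots> = (cnj c * c) \<cdot> bas (s a)" using hc sa by (simp add: fb_smul_smul bas)
  also have "cnj c * c = of_real ((cmod c)\<^sup>2)" by (simp only: complex_norm_square mult.commute)
  finally have e: "ld \<xi> \<diamondop> \<xi> = of_real ((cmod c)\<^sup>2) \<cdot> bas (s a)" using h by simp
  have "nm (ld \<xi> \<diamondop> \<xi>) = (cmod c)\<^sup>2" unfolding e using nm_smul[OF sa(1) bas(1)[OF sa(1)]] bas(2)[OF sa(1)] by (simp add: norm_power)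
  hence "(cmod c)\<^sup>2 = (nm \<xi>)\<^sup>2" using lnorm_cstar[OF a x] by simp
  thus ?thesis by (simp only: e)
qed

text \<open>Positivity makes \<open>\<xi>\<^sup>*\<xi>\<close> a multiple of a unit, so \<open>(\<xi>\<eta>)\<^sup>*(\<xi>\<eta>) = \<parallel>\<xi>\<parallel>\<^sup>2 \<eta>\<^sup>*\<eta>\<close>.\<close>

lemma nm_lmul: assumes "a \<in> arr" "b \<in> arr" "s a = r b" "\<xi> \<in> fb a" "\<eta> \<in> fb b"
  shows "nm (\<xi> \<diamondop> \<eta>) = nm \<xi> * nm \<eta>"
proof -
  have ab: "a \<star> b \<in> arr" "\<xi> \<diamondop> \<eta> \<in> fb (a \<star> b)" using assms by (simp_all add: mul_closed lmul_closed)
  have lx: "ld \<xi> \<in> fb (iv a)" "ld \<eta> \<in> fb (iv b)" using assms ladj_closed by simp_all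
  have "ld (\<xi> \<diamondop> \<eta>) \<diamondop> (\<xi> \<diamondop> \<eta>) = (ld \<eta> \<diamondop> ld \<xi>) \<diamondop> (\<xi> \<diamondop> \<eta>)"
    using ladj_lmul[OF assms] by simp
  also have "\<dots> = ld \<eta> \<diamondop> (ld \<xi> \<diamondop> (\<xi> \<diamondop> \<eta>))"
    using lmul_assoc[of "iv b" "iv a" "a \<star> b" "ld \<eta>" "ld \<xi>" "\<xi> \<diamondop> \<eta>"] assms lx ab by (simp add: grp rng_mul)
  also have "ld \<xi> \<diamondop> (\<xi> \<diamondop> \<eta>) = (ld \<xi> \<diamondop> \<xi>) \<diamondop> \<eta>"
    using lmul_assoc[of "iv a" a b "ld \<xi>" \<xi> \<eta>] assms lx by (simp add: grp)
  also have "\<dots> = of_real ((nm \<xi>)\<^sup>2) \<cdot> \<eta>"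
    unfolding adj_mul_self[OF assms(1,4)]
    using unit_left[of b \<eta> "of_real ((nm \<xi>)\<^sup>2) \<cdot> bas (r b)"] assms by (simp add: grp smul_bas)
  also have "ld \<eta> \<diamondop> (of_real ((nm \<xi>)\<^sup>2) \<cdot> \<eta>) = of_real ((nm \<xi>)\<^sup>2) \<cdot> (ld \<eta> \<diamondop> \<eta>)"
    using lmul_smul_right[of "iv b" b "ld \<eta>" \<eta>] assms lx by (simp add: grp)
  finally have "(nm (\<xi> \<diamondop> \<eta>))\<^sup>2 = nm (of_real ((nm \<xi>)\<^sup>2) \<cdot> (ld \<eta> \<diamondop> \<eta>))"
    using lnorm_cstar[OF ab] by simp
  also have "\<dots> = (nm \<xi>)\<^sup>2 * (nm \<eta>)\<^sup>2"
    using nm_smul[of "s b" "ld \<eta> \<diamondop> \<eta>"] lmul_closed[of "iv b" b "ld \<eta>" \<eta>] assms lx lnorm_cstar[of b \<eta>]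
    by (simp add: grp inv_mul norm_power)
  finally show ?thesis
    using nm_nonneg[OF ab] nm_nonneg assms by (simp add: power_mult_distrib[symmetric])
qed

lemma scalar_of_fibre: assumes x: "x \<in> X" and d: "\<delta> \<in> fb x" shows "scalar_of (fibre L x) \<delta> = crd x \<delta>"
proof -
  note xa = unitD[OF x] and b = bas[OF unitD(1)[OF x]]
  have u: "alg_unit (fibre L x) = bas x"
    unfolding alg_unit_def
  proof (rule the_equality)
    show "bas x \<in> carrier (fibre L x) \<and> (\<forall>a\<in>carrier (fibre L x). amul (fibre L x) (bas x) a = a \<and> amul (fibre L x) a (bas x) = a)"
      using b(1) bas_left[OF xa(1)] bas_right[OF xa(1)] xa(2,3) by simp
    fix u assume "u \<in> carrier (fibre L x) \<and> (\<forall>a\<in>carrier (fibre L x). amul (fibre L x) u a = a \<and> amul (fibre L x) a u = a)"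
    hence u: "u \<in> fb x" and "\<forall>a\<in>fb x. u \<diamondop> a = a \<and> a \<diamondop> u = a" by simp_all
    hence "u \<diamondop> bas x = bas x" using b(1) by blast
    thus "u = bas x" using bas_right[OF xa(1) u] xa(2) by simp
  qed
  have "inj (\<lambda>c. vsmul (fibre L x) c (bas x))"
    by (rule injI, rule smul_inject[OF xa(1) b(1)]) (simp_all add: b(2))
  from the_inv_f_f[OF this, of "crd x \<delta>"] show ?thesis
    unfolding scalar_of_def u using crd[OF xa(1) d] by simp
qed

section \<open>Continuity in a Fell line bundle\<close>

lemma open_over: "openin T U \<Longrightarrow> openin TL (over_set U)"
  by (rule openin_continuous_map_preimage[OF continuous_proj])

text \<open>The axioms speak of the restriction of the bundle to an open bisection. As this restriction is open,
  they are rephrased here in terms of the total space.\<close>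

lemma over:
  assumes U: "open_bisection G U"
  defines "E \<equiv> subtopology TL (over_set U)"
  shows "topspace E = (over_set U)"
    "openin E W \<longleftrightarrow> openin TL W \<and> W \<subseteq> (over_set U)"
    "openin TL W \<Longrightarrow> openin T (proj L ` (W \<inter> (over_set U)))"
    "continuous_map E euclideanreal (lnorm L)"
    "continuous_map (subtopology (prod_topology E E) {(\<xi>, \<eta>). p \<xi> = p \<eta>}) E (\<lambda>(\<xi>, \<eta>). \<xi> \<boxplus> \<eta>)"
    "continuous_map E E (lsmul L c)"
    "a \<in> U \<Longrightarrow> openin TL W \<Longrightarrow> zr a \<in> W \<Longrightarrow> \<exists>V e. openin T V \<and> a \<in> V \<and> V \<subseteq> U \<and> e > 0 \<and>
        {\<xi> \<in> topspace TL. p \<xi> \<in> V \<and> nm \<xi> < e} \<subseteq> W"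
proof -
  have oU: "openin T U" and Ua: "U \<subseteq> arr" using U bisection_arr by (auto simp: open_bisection_def)
  have oE: "openin TL (over_set U)" by (rule open_over[OF oU])
  show tE: "topspace E = (over_set U)" by (auto simp: E_def)
  show oo: "openin E W \<longleftrightarrow> openin TL W \<and> W \<subseteq> (over_set U)" for W
    unfolding E_def by (rule openin_open_subtopology[OF oE])
  have oT: "openin (subtopology T U) W \<longleftrightarrow> openin T W \<and> W \<subseteq> U" for W by (rule openin_open_subtopology[OF oU])
  have tU: "topspace (subtopology T U) = U" using Ua by (auto simp: topspace_T)
  note B = banach_bundle[OF U, unfolded continuous_banach_bundle_on_def Let_def, folded E_def]
  show "continuous_map E euclideanreal (lnorm L)" using B by (elim conjE) assumption
  show "continuous_map (subtopology (prod_topology E E) {(\<xi>, \<eta>). p \<xi> = p \<eta>}) E (\<lambda>(\<xi>, \<eta>). \<xi> \<boxplus> \<eta>)"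
    using B by (elim conjE) assumption
  have "\<forall>c. continuous_map E E (lsmul L c)" using B by (elim conjE) assumption
  thus "continuous_map E E (lsmul L c)" by (rule spec)
  show "openin TL W \<Longrightarrow> openin T (proj L ` (W \<inter> (over_set U)))"
  proof -
    assume "openin TL W"
    hence "openin E (W \<inter> (over_set U))" using oE by (auto simp: oo)
    moreover have "open_map E (subtopology T U) (proj L)" using B by (elim conjE) assumption
    ultimately have "openin (subtopology T U) (proj L ` (W \<inter> (over_set U)))"
      unfolding open_map_def by blast
    thus ?thesis by (simp only: oT)
  qed
  assume a: "a \<in> U" and W: "openin TL W" "zr a \<in> W"
  have o1: "openin E (W \<inter> (over_set U))" using W oE by (auto simp: oo)
  have z1: "zr a \<in> W \<inter> (over_set U)"
    using W a fb_zero[of a] Ua by (auto simp: fib_iff)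
  have B7: "\<forall>a\<in>topspace (subtopology T U). \<forall>W. openin E W \<and> zr a \<in> W \<longrightarrow>
      (\<exists>V e. openin (subtopology T U) V \<and> a \<in> V \<and> e > 0 \<and> {\<xi> \<in> topspace E. p \<xi> \<in> V \<and> nm \<xi> < e} \<subseteq> W)"
    using B by (elim conjE) assumption
  have a1: "a \<in> topspace (subtopology T U)" using a tU by simp
  from B7[THEN bspec, OF a1, THEN spec, THEN mp, OF conjI[OF o1 z1]]
  obtain V e where V: "openin (subtopology T U) V" "a \<in> V" "e > 0"
      "{\<xi> \<in> topspace E. p \<xi> \<in> V \<and> nm \<xi> < e} \<subseteq> W \<inter> (over_set U)"
    by (elim exE conjE)
  have V': "openin T V" "V \<subseteq> U" using V(1) by (simp_all only: oT)
  show "\<exists>V e. openin T V \<and> a \<in> V \<and> V \<subseteq> U \<and> e > 0 \<and> {\<xi> \<in> topspace TL. p \<xi> \<in> V \<and> nm \<xi> < e} \<subseteq> W"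
  proof (intro exI[of _ V] exI[of _ e] conjI V' V(2,3))
    show "{\<xi> \<in> topspace TL. p \<xi> \<in> V \<and> nm \<xi> < e} \<subseteq> W" using V(4) V'(2) unfolding tE by blast
  qed
qed

lemma chart: assumes f: "continuous_map Z TL f" and z: "z \<in> topspace Z"
  obtains U V where "open_bisection G U" "openin Z V" "z \<in> V"
    "continuous_map (subtopology Z V) (subtopology TL (over_set U)) f"
    "V = {y \<in> topspace Z. p (f y) \<in> U}"
proof -
  have fz: "f y \<in> topspace TL" if "y \<in> topspace Z" for y using f that unfolding continuous_map_def by blast
  obtain U where U: "open_bisection G U" "p (f z) \<in> U" using bisection_through[OF proj_arr[OF fz[OF z]]] by blast
  let ?V = "{y \<in> topspace Z. p (f y) \<in> U}"
  have "openin Z ?V"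
    using openin_continuous_map_preimage[OF continuous_map_compose[OF f continuous_proj], of U] U
    by (simp add: open_bisection_def)
  moreover have "continuous_map (subtopology Z ?V) (subtopology TL (over_set U)) f"
    by (rule continuous_map_into_subtopology[OF continuous_map_from_subtopology[OF f]]) (use fz in auto)
  ultimately show thesis using that U z by blast
qed

lemma cont_norm: assumes f: "continuous_map Z TL f" shows "continuous_map Z euclideanreal (\<lambda>z. nm (f z))"
proof (rule continuous_map_locally)
  fix z assume z: "z \<in> topspace Z"
  obtain U V where UV: "open_bisection G U" "openin Z V" "z \<in> V"
    "continuous_map (subtopology Z V) (subtopology TL (over_set U)) f" by (rule chart[OF f z])
  from continuous_map_compose[OF UV(4) over(4)[OF UV(1)]] UV(2,3)
  show "\<exists>V. openin Z V \<and> z \<in> V \<and> continuous_map (subtopology Z V) euclideanreal (\<lambda>z. nm (f z))"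
    unfolding o_def by blast
qed

lemma cont_smul_const: assumes f: "continuous_map Z TL f" shows "continuous_map Z TL (\<lambda>z. c \<cdot> f z)"
proof (rule continuous_map_locally)
  fix z assume z: "z \<in> topspace Z"
  obtain U V where UV: "open_bisection G U" "openin Z V" "z \<in> V"
    "continuous_map (subtopology Z V) (subtopology TL (over_set U)) f" by (rule chart[OF f z])
  from continuous_map_into_fulltopology[OF continuous_map_compose[OF UV(4) over(6)[OF UV(1)]]] UV(2,3)
  show "\<exists>V. openin Z V \<and> z \<in> V \<and> continuous_map (subtopology Z V) TL (\<lambda>z. c \<cdot> f z)"
    unfolding o_def by blast
qed

lemma cont_add:
  assumes f: "continuous_map Z TL f" and g: "continuous_map Z TL g"
    and pfg: "\<And>z. z \<in> topspace Z \<Longrightarrow> p (f z) = p (g z)"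
  shows "continuous_map Z TL (\<lambda>z. f z \<boxplus> g z)"
proof (rule continuous_map_locally)
  fix z assume z: "z \<in> topspace Z"
  obtain U V where UV: "open_bisection G U" "openin Z V" "z \<in> V"
    "continuous_map (subtopology Z V) (subtopology TL (over_set U)) f"
    "V = {y \<in> topspace Z. p (f y) \<in> U}" by (rule chart[OF f z])
  let ?E = "subtopology TL (over_set U)"
  have gz: "g y \<in> topspace TL" if "y \<in> topspace Z" for y using g that unfolding continuous_map_def by blast
  have "continuous_map (subtopology Z V) ?E g"
    by (rule continuous_map_into_subtopology[OF continuous_map_from_subtopology[OF g]])
       (simp add: Pi_iff UV(5) gz pfg[symmetric])
  from continuous_map_pairedI[OF UV(4) this]
  have "continuous_map (subtopology Z V) (subtopology (prod_topology ?E ?E) {(\<xi>, \<eta>). p \<xi> = p \<eta>}) (\<lambda>z. (f z, g z))"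
    by (rule continuous_map_into_subtopology) (simp add: Pi_iff pfg)
  from continuous_map_into_fulltopology[OF continuous_map_compose[OF this over(5)[OF UV(1)]]] UV(2,3)
  show "\<exists>V. openin Z V \<and> z \<in> V \<and> continuous_map (subtopology Z V) TL (\<lambda>z. f z \<boxplus> g z)"
    unfolding o_def case_prod_conv by blast
qed

lemma cont_lmul:
  assumes "continuous_map Z TL f" "continuous_map Z TL g"
    and "\<And>z. z \<in> topspace Z \<Longrightarrow> s (p (f z)) = r (p (g z))"
  shows "continuous_map Z TL (\<lambda>z. f z \<diamondop> g z)"
proof -
  have "continuous_map Z (subtopology (prod_topology TL TL) {(\<xi>, \<eta>). s (p \<xi>) = r (p \<eta>)}) (\<lambda>z. (f z, g z))"
    by (rule continuous_map_into_subtopology[OF continuous_map_pairedI[OF assms(1,2)]]) (simp add: Pi_iff assms(3))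
  from continuous_map_compose[OF this continuous_lmul] show ?thesis by (simp add: o_def)
qed

text \<open>Addition is continuous at the zero section, so a neighbourhood of \<open>\<xi>\<^sub>0\<close> contains a neighbourhood
  thickened by some \<open>\<epsilon>\<close> in each fibre.\<close>

lemma thick_neighbourhood:
  assumes W: "openin TL W" and x: "\<xi>\<^sub>0 \<in> W"
  obtains W' e where "openin TL W'" "\<xi>\<^sub>0 \<in> W'" "e > 0"
    "\<And>\<xi> \<zeta>. \<xi> \<in> W' \<Longrightarrow> \<zeta> \<in> fb (p \<xi>) \<Longrightarrow> nm \<zeta> < e \<Longrightarrow> \<xi> \<boxplus> \<zeta> \<in> W"
proof -
  have xt: "\<xi>\<^sub>0 \<in> topspace TL" using W x openin_subset by blast
  define a where "a = p \<xi>\<^sub>0"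
  have a: "a \<in> arr" and xa: "\<xi>\<^sub>0 \<in> fb a" using proj_arr[OF xt] xt by (simp_all add: a_def fib_iff)
  have z0: "zr a \<in> topspace TL" "p (zr a) = a" using fb_zero[OF a] by (simp_all add: fib_iff)
  let ?P = "subtopology (prod_topology TL TL) {(\<xi>, \<eta>). p \<xi> = p \<eta>}"
  have c1: "continuous_map ?P TL fst" "continuous_map ?P TL snd"
    by (auto intro!: continuous_map_from_subtopology continuous_map_fst continuous_map_snd)
  have "continuous_map ?P TL (\<lambda>z. fst z \<boxplus> snd z)" by (rule cont_add[OF c1]) auto
  from openin_subtopology[THEN iffD1, OF openin_continuous_map_preimage[OF this W]]
  obtain S where S: "openin (prod_topology TL TL) S"
      "{z \<in> topspace ?P. fst z \<boxplus> snd z \<in> W} = S \<inter> {(\<xi>, \<eta>). p \<xi> = p \<eta>}" by (elim exE conjE)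
  have "(\<xi>\<^sub>0, zr a) \<in> {z \<in> topspace ?P. fst z \<boxplus> snd z \<in> W}"
    using xt z0 x fb_add_zero[OF a xa] by (simp add: a_def)
  hence "(\<xi>\<^sub>0, zr a) \<in> S" unfolding S(2) by simp
  from S(1)[unfolded openin_prod_topology_alt, rule_format, OF this]
  obtain W1 W2 where W12: "openin TL W1" "openin TL W2" "\<xi>\<^sub>0 \<in> W1" "zr a \<in> W2" "W1 \<times> W2 \<subseteq> S"
    by (elim exE conjE)
  obtain U where U: "open_bisection G U" "a \<in> U" using bisection_through[OF a] by blast
  obtain V e where V: "openin T V" "a \<in> V" "e > 0" "{\<xi> \<in> topspace TL. p \<xi> \<in> V \<and> nm \<xi> < e} \<subseteq> W2"
    using over(7)[OF U W12(2,4)] by (elim exE conjE)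
  show thesis
  proof
    show "openin TL (W1 \<inter> (over_set V))" using W12(1) open_over[OF V(1)] by (rule openin_Int)
    show "\<xi>\<^sub>0 \<in> W1 \<inter> (over_set V)" using W12 xt V by (simp add: a_def)
    fix \<xi> \<zeta> assume x: "\<xi> \<in> W1 \<inter> (over_set V)" and z: "\<zeta> \<in> fb (p \<xi>)" "nm \<zeta> < e"
    have "\<zeta> \<in> W2" using V(4) x z by (auto simp: fib_iff)
    hence "(\<xi>, \<zeta>) \<in> S \<inter> {(\<xi>, \<eta>). p \<xi> = p \<eta>}" using W12(5) x z by (auto simp: fib_iff)
    thus "\<xi> \<boxplus> \<zeta> \<in> W" unfolding S(2)[symmetric] by simp
  qed (rule V)
qed

lemma sub_add: assumes "a \<in> arr" "\<xi> \<in> fb a" "\<eta> \<in> fb a" shows "\<xi> \<boxplus> (\<eta> \<boxplus> (-1) \<cdot> \<xi>) = \<eta>"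
  using assms by (simp add: crd_inject[symmetric, of a] fb_closed crd_add crd_smul)

text \<open>The norm compares vectors of one fibre only. So the values near a point are compared with vectors
  over the same base points taken from a neighbourhood of the value at that point.\<close>

lemma bundle_continuousI:
  assumes q: "continuous_map Z T q" and f: "\<And>z. z \<in> topspace Z \<Longrightarrow> f z \<in> fb (q z)"
    and near: "\<And>z W e. \<lbrakk>z \<in> topspace Z; openin TL W; f z \<in> W; e > 0\<rbrakk> \<Longrightarrow>
      \<exists>V. openin Z V \<and> z \<in> V \<and> (\<forall>y\<in>V. \<exists>\<xi>\<in>W. p \<xi> = q y \<and> nm (f y \<boxplus> (-1) \<cdot> \<xi>) < e)"
  shows "continuous_map Z TL f"
proof (rule continuous_mapI_local)
  fix z assume z: "z \<in> topspace Z"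
  show "f z \<in> topspace TL" using f[OF z] by (simp add: fib_iff)
  fix W assume W: "openin TL W" "f z \<in> W"
  obtain W' e where W': "openin TL W'" "f z \<in> W'" "e > 0"
    "\<And>\<xi> \<zeta>. \<xi> \<in> W' \<Longrightarrow> \<zeta> \<in> fb (p \<xi>) \<Longrightarrow> nm \<zeta> < e \<Longrightarrow> \<xi> \<boxplus> \<zeta> \<in> W" by (rule thick_neighbourhood[OF W], rule that)
  obtain V where V: "openin Z V" "z \<in> V" "\<forall>y\<in>V. \<exists>\<xi>\<in>W'. p \<xi> = q y \<and> nm (f y \<boxplus> (-1) \<cdot> \<xi>) < e"
    using near[OF z W'(1-3)] by blast
  have "f y \<in> W" if y: "y \<in> V" for y
  proof -
    have yZ: "y \<in> topspace Z" using V(1) y openin_subset by blast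
    have qa: "q y \<in> arr" using f[OF yZ] proj_arr[of "f y"] by (simp add: fib_iff)
    obtain \<xi> where x: "\<xi> \<in> W'" "p \<xi> = q y" "nm (f y \<boxplus> (-1) \<cdot> \<xi>) < e" using V(3) y by blast
    have xf: "\<xi> \<in> fb (q y)" using x W'(1) openin_subset by (auto simp: fib_iff)
    have "\<xi> \<boxplus> (f y \<boxplus> (-1) \<cdot> \<xi>) \<in> W"
      using x(2,3) by (intro W'(4)[OF x(1)]) (simp_all add: fb_closed qa f[OF yZ] xf)
    thus ?thesis using sub_add[OF qa xf f[OF yZ]] by simp
  qed
  thus "\<exists>V. openin Z V \<and> z \<in> V \<and> (\<forall>y\<in>V. f y \<in> W)" using V(1,2) by blast
qed

lemma cont_smul:
  assumes g: "continuous_map Z euclidean (g :: _ \<Rightarrow> complex)" and f: "continuous_map Z TL f"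
  shows "continuous_map Z TL (\<lambda>z. g z \<cdot> f z)"
proof (rule bundle_continuousI[where q="\<lambda>z. p (f z)"])
  show "continuous_map Z T (\<lambda>z. p (f z))" using continuous_map_compose[OF f continuous_proj] by (simp add: o_def)
  have ft: "f z \<in> topspace TL" if "z \<in> topspace Z" for z using f that unfolding continuous_map_def by blast
  have fa: "p (f z) \<in> arr" "f z \<in> fb (p (f z))" if "z \<in> topspace Z" for z
    using ft[OF that] proj_arr by (simp_all add: fib_iff)
  show "g z \<cdot> f z \<in> fb (p (f z))" if "z \<in> topspace Z" for z using fb_smul fa[OF that] by blast
  fix z W e assume z: "z \<in> topspace Z" and W: "openin TL W" "g z \<cdot> f z \<in> W" and e: "(e::real) > 0"
  have n0: "0 \<le> nm (f z)" using nm_nonneg fa[OF z] by blast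
  define d where "d = e / (nm (f z) + 1)"
  have d: "d > 0" using e n0 by (simp add: d_def)
  obtain V1 where V1: "openin Z V1" "z \<in> V1" "\<forall>y\<in>V1. cmod (g y - g z) < d"
    using continuous_map_normedD[OF g z d] by blast
  obtain V2 where V2: "openin Z V2" "z \<in> V2" "\<forall>y\<in>V2. norm (nm (f y) - nm (f z)) < 1"
    using continuous_map_normedD[OF cont_norm[OF f] z zero_less_one] by blast
  let ?V3 = "{y \<in> topspace Z. g z \<cdot> f y \<in> W}"
  have V3: "openin Z ?V3" by (rule openin_continuous_map_preimage[OF cont_smul_const[OF f] W(1)])
  show "\<exists>V. openin Z V \<and> z \<in> V \<and> (\<forall>y\<in>V. \<exists>\<xi>\<in>W. p \<xi> = p (f y) \<and> nm (g y \<cdot> f y \<boxplus> (-1) \<cdot> \<xi>) < e)"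
  proof (intro exI[of _ "V1 \<inter> V2 \<inter> ?V3"] conjI ballI)
    show "openin Z (V1 \<inter> V2 \<inter> ?V3)" using V1 V2 V3 by blast
    show "z \<in> V1 \<inter> V2 \<inter> ?V3" using V1 V2 z W by blast
    fix y assume y: "y \<in> V1 \<inter> V2 \<inter> ?V3"
    have yZ: "y \<in> topspace Z" using y by blast
    note fy = fa[OF yZ]
    have "g y \<cdot> f y \<boxplus> (-1) \<cdot> (g z \<cdot> f y) = (g y - g z) \<cdot> f y"
      using fb_add_smul[OF fy, of "g y" "- g z"] by (simp add: fb_smul_smul[OF fy])
    hence "nm (g y \<cdot> f y \<boxplus> (-1) \<cdot> (g z \<cdot> f y)) = cmod (g y - g z) * nm (f y)" by (simp add: nm_smul[OF fy])
    also have "\<dots> \<le> cmod (g y - g z) * (nm (f z) + 1)"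
      using V2(3) y by (intro mult_left_mono) (auto simp: abs_if split: if_splits)
    also have "\<dots> < d * (nm (f z) + 1)" using V1(3) y n0 by (intro mult_strict_right_mono) auto
    also have "\<dots> = e" using n0 by (simp add: d_def)
    finally have "nm (g y \<cdot> f y \<boxplus> (-1) \<cdot> (g z \<cdot> f y)) < e" .
    moreover have "p (g z \<cdot> f y) = p (f y)" using fb_smul[OF fy] by (simp add: fib_iff)
    ultimately show "\<exists>\<xi>\<in>W. p \<xi> = p (f y) \<and> nm (g y \<cdot> f y \<boxplus> (-1) \<cdot> \<xi>) < e" using y by blast
  qed
qed

text \<open>A vector \<open>\<xi> = c 1\<^sub>y\<close> near \<open>1\<^sub>x\<close> over a unit \<open>y\<close> near \<open>x\<close> is nearly idempotent, so \<open>c\<close> is near \<open>1\<close>.\<close>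

lemma continuous_bas: "continuous_map TX TL bas"
proof (rule bundle_continuousI[where q="\<lambda>x. x"])
  show "continuous_map TX T (\<lambda>x. x)" unfolding unit_top_def by (rule continuous_map_from_subtopology) simp
  show "bas x \<in> fb x" if "x \<in> topspace TX" for x using bas(1)[of x] that unitD by (simp add: topspace_TX)
  fix x W and e :: real assume x: "x \<in> topspace TX" and W: "openin TL W" "bas x \<in> W" and e: "e > 0"
  have xX: "x \<in> X" using x by (simp add: topspace_TX)
  note xa = unitD[OF xX]
  have oX: "openin TL (over_set X)" by (rule open_over[OF open_units])
  let ?E = "subtopology TL (over_set X)"
  have tE: "topspace ?E = (over_set X)" by auto
  have mulE: "\<xi> \<diamondop> \<xi> \<in> fb (p \<xi>)" "\<xi> \<in> fb (p \<xi>)" "p \<xi> \<in> arr" if "\<xi> \<in> topspace ?E" for \<xi>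
  proof -
    have px: "p \<xi> \<in> X" "\<xi> \<in> fb (p \<xi>)" using that by (simp_all add: fib_iff)
    show "\<xi> \<diamondop> \<xi> \<in> fb (p \<xi>)" "\<xi> \<in> fb (p \<xi>)" "p \<xi> \<in> arr"
      using lmul_closed[of "p \<xi>" "p \<xi>" \<xi> \<xi>] px unitD[OF px(1)] unit_mul[OF px(1) unitD(1)[OF px(1)]] by simp_all
  qed
  have id: "continuous_map ?E TL (\<lambda>\<xi>. \<xi>)" by (rule continuous_map_from_subtopology) simp
  have "continuous_map ?E TL (\<lambda>\<xi>. \<xi> \<diamondop> \<xi> \<boxplus> (-1) \<cdot> \<xi>)"
  proof (rule cont_add[OF cont_lmul[OF id id] cont_smul_const[OF id]])
    show "s (p \<xi>) = r (p \<xi>)" if "\<xi> \<in> topspace ?E" for \<xi> using that unitD by simp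
    show "p (\<xi> \<diamondop> \<xi>) = p ((-1) \<cdot> \<xi>)" if "\<xi> \<in> topspace ?E" for \<xi>
      using mulE[OF that] fb_smul[OF mulE(3,2)[OF that]] by (simp add: fib_iff)
  qed
  from cont_norm[OF this] have k: "continuous_map ?E euclidean (\<lambda>\<xi>. nm (\<xi> \<diamondop> \<xi> \<boxplus> (-1) \<cdot> \<xi>))" .
  let ?W1 = "{\<xi> \<in> topspace ?E. nm (\<xi> \<diamondop> \<xi> \<boxplus> (-1) \<cdot> \<xi>) \<in> {..<e/2}}"
  let ?W2 = "{\<xi> \<in> topspace ?E. nm \<xi> \<in> {1/2<..}}"
  have "openin ?E ?W1" "openin ?E ?W2"
    by (rule openin_continuous_map_preimage[OF k], simp) (rule openin_continuous_map_preimage[OF cont_norm[OF id]], simp)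
  hence o12: "openin TL ?W1" "openin TL ?W2" using oX openin_trans_full by blast+
  let ?W = "W \<inter> ?W1 \<inter> ?W2"
  have oW: "openin TL ?W" using W(1) o12 by blast
  have bE: "bas x \<in> topspace ?E" using bas(1)[OF xa(1)] xX by (simp add: fib_iff)
  have "bas x \<diamondop> bas x \<boxplus> (-1) \<cdot> bas x = zr x"
    using bas[OF xa(1)] xX fb_add_smul[OF xa(1) bas(1)[OF xa(1)], of 1 "-1"] fb_smul_one[OF xa(1) bas(1)[OF xa(1)]]
      fb_zero_smul[OF xa(1) bas(1)[OF xa(1)]] by simp
  hence bW: "bas x \<in> ?W" using W(2) bE e bas(2)[OF xa(1)] nm_zero[OF xa(1)] by simp
  have V: "openin T (proj L ` ?W)"
    using over(3)[OF bisection_units oW] by (simp add: Int_absorb2 subset_iff Int_assoc)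
  show "\<exists>V. openin TX V \<and> x \<in> V \<and> (\<forall>y\<in>V. \<exists>\<xi>\<in>W. p \<xi> = y \<and> nm (bas y \<boxplus> (-1) \<cdot> \<xi>) < e)"
  proof (intro exI[of _ "proj L ` ?W"] conjI ballI)
    show "openin TX (proj L ` ?W)" unfolding openin_TX using V by auto
    show "x \<in> proj L ` ?W" using bW bas(1)[OF xa(1)] by (auto simp: fib_iff intro!: rev_image_eqI)
    fix y assume "y \<in> proj L ` ?W"
    then obtain \<xi> where x: "\<xi> \<in> ?W" "y = p \<xi>" by blast
    have yX: "y \<in> X" and xE: "\<xi> \<in> topspace ?E" using x by auto
    note ya = unitD[OF yX]
    have xf: "\<xi> \<in> fb y" using mulE(2)[OF xE] x by simp
    define c where "c = crd y \<xi>"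
    have "crd y (\<xi> \<diamondop> \<xi>) = c * c"
      using unit_left[OF ya(1) xf, of \<xi>] ya xf crd_smul[OF ya(1) xf] by (simp add: c_def)
    hence "nm (\<xi> \<diamondop> \<xi> \<boxplus> (-1) \<cdot> \<xi>) = cmod (c * c - c)"
      using mulE[OF xE] x(2) xf ya by (simp add: nm_crd[of y] fb_closed crd_add crd_smul c_def)
    hence k1: "cmod c * cmod (c - 1) < e/2"
      using x(1) by (simp add: norm_mult[symmetric] algebra_simps)
    have k2: "cmod c > 1/2" using x(1) nm_crd[OF ya(1) xf] by (simp add: c_def)
    have "(1/2) * cmod (c - 1) \<le> cmod c * cmod (c - 1)" using k2 by (intro mult_right_mono) auto
    hence "cmod (c - 1) < e" using k1 by simp
    moreover have "nm (bas y \<boxplus> (-1) \<cdot> \<xi>) = cmod (1 - c)"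
      using xf ya by (simp add: nm_crd[of y] fb_closed crd_add crd_smul crd_bas bas c_def)
    ultimately show "\<exists>\<xi>\<in>W. p \<xi> = y \<and> nm (bas y \<boxplus> (-1) \<cdot> \<xi>) < e"
      using x by (intro bexI[of _ \<xi>]) (auto simp: norm_minus_commute)
  qed
qed

lemma cont_crd:
  assumes f: "continuous_map Z TL f" and X: "\<And>z. z \<in> topspace Z \<Longrightarrow> p (f z) \<in> X"
  shows "continuous_map Z euclidean (\<lambda>z. crd (p (f z)) (f z))"
proof (rule continuous_map_normedI)
  fix z and e :: real assume z: "z \<in> topspace Z" and e: "e > 0"
  have ft: "f y \<in> topspace TL" if "y \<in> topspace Z" for y using f that unfolding continuous_map_def by blast
  have ff: "f y \<in> fb (p (f y))" "p (f y) \<in> arr" if "y \<in> topspace Z" for y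
    using ft[OF that] unitD(1)[OF X[OF that]] by (simp_all add: fib_iff)
  define c where "c = crd (p (f z)) (f z)"
  have pf: "continuous_map Z TX (\<lambda>z. p (f z))"
    unfolding unit_top_def
    by (rule continuous_map_into_subtopology[OF continuous_map_compose[OF f continuous_proj, unfolded o_def]])
       (simp add: Pi_iff X)
  have b: "continuous_map Z TL (\<lambda>z. bas (p (f z)))"
    using continuous_map_compose[OF pf continuous_bas] by (simp add: o_def)
  have pb: "p ((-c) \<cdot> bas (p (f y))) = p (f y)" if "y \<in> topspace Z" for y
    using smul_bas(1)[OF ff(2)[OF that]] by (simp add: fib_iff)
  have "continuous_map Z TL (\<lambda>y. f y \<boxplus> (-c) \<cdot> bas (p (f y)))"
    by (rule cont_add[OF f cont_smul_const[OF b]]) (simp add: pb)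
  from continuous_map_normedD[OF cont_norm[OF this] z e]
  obtain V where V: "openin Z V" "z \<in> V"
    "\<forall>y\<in>V. norm (nm (f y \<boxplus> (-c) \<cdot> bas (p (f y))) - nm (f z \<boxplus> (-c) \<cdot> bas (p (f z)))) < e" by (elim exE conjE)
  have d: "nm (f y \<boxplus> (-c) \<cdot> bas (p (f y))) = cmod (crd (p (f y)) (f y) - c)" if "y \<in> topspace Z" for y
    using ff[OF that] smul_bas[OF ff(2)[OF that], of "-c"]
    by (simp add: nm_crd[of "p (f y)"] fb_closed crd_add)
  have "cmod (crd (p (f y)) (f y) - crd (p (f z)) (f z)) < e" if y: "y \<in> V" for y
  proof -
    have yZ: "y \<in> topspace Z" using V(1) y openin_subset by blast
    have "norm (cmod (crd (p (f y)) (f y) - c) - cmod (crd (p (f z)) (f z) - c)) < e"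
      using V(3)[rule_format, OF y] by (simp only: d[OF yZ] d[OF z])
    thus ?thesis by (simp add: c_def)
  qed
  thus "\<exists>V. openin Z V \<and> z \<in> V \<and> (\<forall>y\<in>V. norm (crd (p (f y)) (f y) - crd (p (f z)) (f z)) < e)"
    using V(1,2) by blast
qed

end

section \<open>Local sections of a line bundle\<close>

lemma integral_periodic_shift:
  fixes h :: "real \<Rightarrow> complex"
  assumes h: "continuous_on UNIV h" and per: "\<And>t. h (1 + t) = h t" and c: "0 \<le> c" "c \<le> 1"
  shows "integral {0..1} (\<lambda>t. h (c + t)) = integral {0..1} h"
proof -
  have int: "h integrable_on {a..b}" for a b
    by (rule integrable_continuous_interval[OF continuous_on_subset[OF h subset_UNIV]])
  have "integral {0..1} (\<lambda>t. h (c + t)) = integral {c..1+c} h"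
    using integral_shift_Icc_real[of 0 1 h c] by (simp add: o_def)
  also have "\<dots> = integral {c..1} h + integral {1..1+c} h"
    using Henstock_Kurzweil_Integration.integral_combine[OF c(2) _ int, of "1+c"] c by simp
  also have "integral {1..1+c} h = integral {0..c} h"
    using integral_shift_Icc_real[of 0 c h 1] per by (simp add: o_def add.commute)
  also have "integral {c..1} h + integral {0..c} h = integral {0..1} h"
    using Henstock_Kurzweil_Integration.integral_combine[OF c(1,2) int] by (simp add: add.commute)
  finally show ?thesis .
qed

definition turn where "turn t = cis (2 * pi * t)"

lemma norm_turn: "cmod (turn t) = 1"
  and turn_add: "turn (a + b) = turn a * turn b"
  and turn_periodic: "turn (1 + t) = turn t" "turn 0 = 1"
  by (simp_all add: turn_def cis_mult[symmetric] distrib_left flip: cis_mult)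

lemma turn_surj: assumes "cmod z = 1" shows "\<exists>t. 0 \<le> t \<and> t \<le> 1 \<and> turn t = z"
proof (intro exI[of _ "Arg2pi z / (2 * pi)"] conjI)
  show "0 \<le> Arg2pi z / (2 * pi)" "Arg2pi z / (2 * pi) \<le> 1" using Arg2pi_ge_0[of z] Arg2pi_lt_2pi[of z] by simp_all
  show "turn (Arg2pi z / (2 * pi)) = z"
    using complex_norm_eq_1_exp[of z] assms by (simp add: turn_def cis_conv_exp)
qed

lemma continuous_turn: "continuous_on UNIV turn"
  unfolding turn_def by (intro continuous_intros)

abbreviation circle where "circle \<equiv> top_of_set (sphere 0 1 :: complex set)"

lemma compactin_circle: "compactin circle (sphere 0 1)"
  by (simp add: compactin_subtopology)

context fell_groupoid
begin

text \<open>The bundle of unit vectors over \<open>U\<close>, a principal circle bundle.\<close>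

definition sph where "sph U = subtopology TL {\<xi>. p \<xi> \<in> U \<and> nm \<xi> = 1}"

lemma topspace_sph: "topspace (sph U) = {\<xi> \<in> topspace TL. p \<xi> \<in> U \<and> nm \<xi> = 1}"
  by (auto simp: sph_def)

lemma sph_fib: "\<xi> \<in> topspace (sph U) \<longleftrightarrow> p \<xi> \<in> U \<and> p \<xi> \<in> arr \<and> \<xi> \<in> fb (p \<xi>) \<and> nm \<xi> = 1"
  using proj_arr by (auto simp: topspace_sph fib_iff)

lemma cont_sph_id: "continuous_map (sph U) TL (\<lambda>\<xi>. \<xi>)"
  unfolding sph_def by (rule continuous_map_from_subtopology) simp

lemma sph_rotate: assumes "\<xi> \<in> topspace (sph U)" "cmod z = 1" shows "z \<cdot> \<xi> \<in> topspace (sph U)" "p (z \<cdot> \<xi>) = p \<xi>"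
proof -
  have x: "p \<xi> \<in> U" "p \<xi> \<in> arr" "\<xi> \<in> fb (p \<xi>)" "nm \<xi> = 1" using assms(1) by (simp_all add: sph_fib)
  have "z \<cdot> \<xi> \<in> fb (p \<xi>)" "nm (z \<cdot> \<xi>) = 1" using x assms(2) by (simp_all add: fb_smul nm_smul)
  thus "z \<cdot> \<xi> \<in> topspace (sph U)" "p (z \<cdot> \<xi>) = p \<xi>" using x by (simp_all add: fib_iff topspace_sph)
qed

lemma sph_transitive: assumes "\<xi> \<in> topspace (sph U)" "\<eta> \<in> topspace (sph U)" "p \<xi> = p \<eta>"
  shows "\<exists>z. cmod z = 1 \<and> \<eta> = z \<cdot> \<xi>"
proof -
  have x: "p \<xi> \<in> arr" "\<xi> \<in> fb (p \<xi>)" "nm \<xi> = 1" and y: "\<eta> \<in> fb (p \<xi>)" "nm \<eta> = 1"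
    using assms by (simp_all add: sph_fib)
  obtain z where z: "\<eta> = z \<cdot> \<xi>" using line[OF x(1,2) _ y(1)] x(3) by auto
  thus ?thesis using x y nm_smul[OF x(1,2), of z] by auto
qed

lemma cont_rotate:
  assumes g: "continuous_map Z euclidean (g :: _ \<Rightarrow> complex)" "\<And>z. z \<in> topspace Z \<Longrightarrow> cmod (g z) = 1"
    and f: "continuous_map Z (sph U) f"
  shows "continuous_map Z (sph U) (\<lambda>z. g z \<cdot> f z)"
proof -
  have fT: "continuous_map Z TL f" using f unfolding sph_def by (rule continuous_map_into_fulltopology)
  have fS: "f z \<in> topspace (sph U)" if "z \<in> topspace Z" for z using f that unfolding continuous_map_def by blast
  have "g z \<cdot> f z \<in> topspace (sph U)" if "z \<in> topspace Z" for z using sph_rotate(1)[OF fS[OF that] g(2)[OF that]] .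
  hence "g z \<cdot> f z \<in> {\<xi>. p \<xi> \<in> U \<and> nm \<xi> = 1}" if "z \<in> topspace Z" for z using that by (simp add: topspace_sph)
  thus ?thesis unfolding sph_def by (intro continuous_map_into_subtopology cont_smul g(1) fT) (simp add: Pi_iff)
qed

lemma cont_action: "continuous_map (prod_topology circle (sph U)) (sph U) (\<lambda>z. fst z \<cdot> snd z)"
proof (rule cont_rotate)
  show "continuous_map (prod_topology circle (sph U)) euclidean fst"
    using continuous_map_fst[of circle "sph U"] by (rule continuous_map_into_fulltopology)
  show "continuous_map (prod_topology circle (sph U)) (sph U) snd" by (rule continuous_map_snd)
qed auto

lemma open_sph_image:
  assumes U: "open_bisection G U" and W: "openin (sph U) W"
  shows "openin T (proj L ` W)"
proof -
  from openin_subtopology[THEN iffD1, OF W[unfolded sph_def]]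
  obtain W1 where W1: "openin TL W1" "W = W1 \<inter> {\<xi>. p \<xi> \<in> U \<and> nm \<xi> = 1}" by (elim exE conjE)
  have oU: "openin T U" using U by (simp add: open_bisection_def)
  let ?Y = "{\<xi> \<in> topspace TL. nm \<xi> \<in> {0<..}}"
  have oY: "openin TL ?Y"
    by (rule openin_continuous_map_preimage[OF cont_norm[of TL "\<lambda>\<xi>. \<xi>"]]) simp_all
  let ?Z = "subtopology TL ?Y"
  have id: "continuous_map ?Z TL (\<lambda>\<xi>. \<xi>)" by (rule continuous_map_from_subtopology) simp
  have c1: "continuous_map ?Z euclideanreal (\<lambda>\<xi>. inverse (nm \<xi>))"
    by (rule continuous_map_real_inverse[OF cont_norm[OF id]]) auto
  have c2: "continuous_map euclideanreal euclidean complex_of_real" by (simp add: continuous_on_of_real)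
  from continuous_map_compose[OF c1 c2]
  have "continuous_map ?Z euclidean (\<lambda>\<xi>. complex_of_real (inverse (nm \<xi>)))" by (simp add: o_def)
  from cont_smul[OF this id]
  have nz: "continuous_map ?Z TL (\<lambda>\<xi>. complex_of_real (inverse (nm \<xi>)) \<cdot> \<xi>)" .
  let ?W2 = "{\<xi> \<in> topspace ?Z. complex_of_real (inverse (nm \<xi>)) \<cdot> \<xi> \<in> W1}"
  have o2: "openin TL ?W2"
    by (rule openin_trans_full[OF openin_continuous_map_preimage[OF nz W1(1)] oY])
  have "proj L ` W = proj L ` (?W2 \<inter> (over_set U))"
  proof (intro equalityI subsetI)
    fix a assume "a \<in> proj L ` W"
    then obtain \<xi> where x: "\<xi> \<in> W" "a = p \<xi>" by blast
    have xs: "\<xi> \<in> topspace (sph U)" using x(1) W openin_subset by blast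
    hence "1 \<cdot> \<xi> = \<xi>" using fb_smul_one[of "p \<xi>" \<xi>] by (simp add: sph_fib)
    hence "\<xi> \<in> ?W2 \<inter> (over_set U)" using x(1) W1(2) xs by (simp add: topspace_sph)
    thus "a \<in> proj L ` (?W2 \<inter> (over_set U))" using x(2) by blast
  next
    fix a assume "a \<in> proj L ` (?W2 \<inter> (over_set U))"
    then obtain \<xi> where x: "\<xi> \<in> ?W2" "p \<xi> \<in> U" "\<xi> \<in> topspace TL" "a = p \<xi>" by blast
    have pa: "p \<xi> \<in> arr" "\<xi> \<in> fb (p \<xi>)" "nm \<xi> > 0" using x proj_arr[OF x(3)] fb_total[OF x(3)] by simp_all
    let ?e = "complex_of_real (inverse (nm \<xi>)) \<cdot> \<xi>"
    have "?e \<in> fb (p \<xi>)" "nm ?e = 1" using pa by (simp_all add: fb_smul nm_smul norm_inverse)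
    hence "?e \<in> W" "p ?e = a" using x W1(2) by (simp_all add: fib_iff)
    thus "a \<in> proj L ` W" by (metis image_eqI)
  qed
  thus ?thesis using over(3)[OF U o2] by simp
qed

lemma Hausdorff_sph: assumes U: "open_bisection G U" shows "Hausdorff_space (sph U)"
  unfolding Hausdorff_space_def
proof (intro allI impI; elim conjE)
  fix \<xi> \<eta> assume x: "\<xi> \<in> topspace (sph U)" and y: "\<eta> \<in> topspace (sph U)" and ne: "\<xi> \<noteq> \<eta>"
  have pc: "continuous_map (sph U) (subtopology T U) (proj L)"
    by (rule continuous_map_into_subtopology[OF continuous_map_compose[OF cont_sph_id continuous_proj, unfolded o_def]])
       (simp add: sph_fib)
  show "\<exists>A B. openin (sph U) A \<and> openin (sph U) B \<and> \<xi> \<in> A \<and> \<eta> \<in> B \<and> disjnt A B"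
  proof (cases "p \<xi> = p \<eta>")
    case False
    have "p \<xi> \<in> topspace (subtopology T U)" "p \<eta> \<in> topspace (subtopology T U)"
      using x y by (simp_all add: sph_fib topspace_T)
    then obtain A B where AB: "openin (subtopology T U) A" "openin (subtopology T U) B" "p \<xi> \<in> A" "p \<eta> \<in> B" "disjnt A B"
      using bisection_Hausdorff[OF U] False unfolding Hausdorff_space_def by blast
    show ?thesis
      using openin_continuous_map_preimage[OF pc AB(1)] openin_continuous_map_preimage[OF pc AB(2)] AB(3-5) x y
      by (intro exI[of _ "{\<zeta> \<in> topspace (sph U). p \<zeta> \<in> A}"] exI[of _ "{\<zeta> \<in> topspace (sph U). p \<zeta> \<in> B}"])
         (auto simp: disjnt_def)
  next
    case True
    let ?P = "subtopology (prod_topology (sph U) (sph U)) {(\<xi>, \<eta>). p \<xi> = p \<eta>}"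
    have fs: "continuous_map ?P TL fst" "continuous_map ?P TL snd"
      using continuous_map_compose[OF continuous_map_fst cont_sph_id, of U "sph U"]
        continuous_map_compose[OF continuous_map_snd cont_sph_id, of "sph U" U]
      by (auto intro!: continuous_map_from_subtopology simp: o_def)
    have "continuous_map ?P TL (\<lambda>z. fst z \<boxplus> (-1) \<cdot> snd z)"
    proof (rule cont_add[OF fs(1) cont_smul_const[OF fs(2)]])
      fix z assume "z \<in> topspace ?P"
      hence "snd z \<in> topspace (sph U)" "p (fst z) = p (snd z)" by auto
      thus "p (fst z) = p (- 1 \<cdot> snd z)" using sph_rotate(2)[of "snd z" U "-1"] by simp
    qed
    from openin_subtopology[THEN iffD1, OF openin_continuous_map_preimage[OF cont_norm[OF this], of "{0<..}"]]
    obtain S where S: "openin (prod_topology (sph U) (sph U)) S"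
      "{z \<in> topspace ?P. nm (fst z \<boxplus> (-1) \<cdot> snd z) \<in> {0<..}} = S \<inter> {(\<xi>, \<eta>). p \<xi> = p \<eta>}" by auto
    have f: "p \<xi> \<in> arr" "\<xi> \<in> fb (p \<xi>)" "\<eta> \<in> fb (p \<xi>)" using x y True by (simp_all add: sph_fib)
    have "nm (\<xi> \<boxplus> (-1) \<cdot> \<eta>) > 0"
      using ne f by (simp add: nm_crd[of "p \<xi>"] fb_closed crd_add crd_smul crd_inject)
    hence "(\<xi>, \<eta>) \<in> {z \<in> topspace ?P. nm (fst z \<boxplus> (-1) \<cdot> snd z) \<in> {0<..}}" using x y True by simp
    hence "(\<xi>, \<eta>) \<in> S" unfolding S(2) by simp
    from S(1)[unfolded openin_prod_topology_alt, rule_format, OF this]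
    obtain A B where AB: "openin (sph U) A" "openin (sph U) B" "\<xi> \<in> A" "\<eta> \<in> B" "A \<times> B \<subseteq> S" by (elim exE conjE)
    have "disjnt A B"
      unfolding disjnt_iff
    proof (intro allI notI; elim conjE)
      fix \<zeta> assume z: "\<zeta> \<in> A" "\<zeta> \<in> B"
      hence "(\<zeta>, \<zeta>) \<in> S \<inter> {(\<xi>, \<eta>). p \<xi> = p \<eta>}" using AB(5) by auto
      hence "nm (\<zeta> \<boxplus> (-1) \<cdot> \<zeta>) > 0" "\<zeta> \<in> topspace (sph U)" unfolding S(2)[symmetric] by simp_all
      thus False by (simp add: sph_fib nm_crd[of "p \<zeta>"] fb_closed crd_add crd_smul)
    qed
    thus ?thesis using AB by blast
  qed
qed

text \<open>The fibres are circles, and by the tube lemma a neighbourhood of one fibre contains all nearby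
  fibres.\<close>

lemma proper_sph: assumes U: "open_bisection G U" shows "proper_map (sph U) (subtopology T U) (proj L)"
proof -
  have oU: "openin T U" and Ua: "U \<subseteq> arr" using U bisection_arr by (auto simp: open_bisection_def)
  have bU: "bas a \<in> topspace (sph U)" "p (bas a) = a" if "a \<in> U" for a
    using bas(1,2)[of a] that Ua by (auto simp: topspace_sph fib_iff)
  have fibre: "{\<xi> \<in> topspace (sph U). p \<xi> = a} = (\<lambda>z. z \<cdot> bas a) ` sphere 0 1" if a: "a \<in> U" for a
  proof (intro equalityI subsetI)
    fix \<xi> assume "\<xi> \<in> {\<xi> \<in> topspace (sph U). p \<xi> = a}"
    then obtain z where "cmod z = 1" "\<xi> = z \<cdot> bas a" using sph_transitive[OF bU(1)[OF a], of \<xi>] bU(2)[OF a] by auto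
    thus "\<xi> \<in> (\<lambda>z. z \<cdot> bas a) ` sphere 0 1" by auto
  next
    fix \<xi> assume "\<xi> \<in> (\<lambda>z. z \<cdot> bas a) ` sphere 0 1"
    then obtain z where "cmod z = 1" "\<xi> = z \<cdot> bas a" by auto
    thus "\<xi> \<in> {\<xi> \<in> topspace (sph U). p \<xi> = a}" using sph_rotate[OF bU(1)[OF a]] bU(2)[OF a] by simp
  qed
  have c: "continuous_map circle (sph U) (\<lambda>z. z \<cdot> bas a)" if a: "a \<in> U" for a
    by (rule cont_rotate) (use bU[OF a] in \<open>auto simp: continuous_map_const intro: continuous_map_from_subtopology\<close>)
  show ?thesis
    unfolding proper_map_def
  proof (intro conjI ballI)
    fix a assume "a \<in> topspace (subtopology T U)"
    hence a: "a \<in> U" by simp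
    show "compactin (sph U) {\<xi> \<in> topspace (sph U). p \<xi> = a}"
      unfolding fibre[OF a] by (rule image_compactin[OF compactin_circle c[OF a]])
  next
    show "closed_map (sph U) (subtopology T U) (proj L)"
      unfolding closed_map_fibre_neighbourhood
    proof (intro conjI allI impI)
      show "proj L \<in> topspace (sph U) \<rightarrow> topspace (subtopology T U)" by (auto simp: sph_fib topspace_T)
      fix W a assume H: "openin (sph U) W \<and> a \<in> topspace (subtopology T U) \<and> {\<xi> \<in> topspace (sph U). p \<xi> = a} \<subseteq> W"
      hence W: "openin (sph U) W" "{\<xi> \<in> topspace (sph U). p \<xi> = a} \<subseteq> W" and a: "a \<in> U" by auto
      let ?P = "{z \<in> topspace (prod_topology circle (sph U)). fst z \<cdot> snd z \<in> W}"
      have oP: "openin (prod_topology circle (sph U)) ?P"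
        by (rule openin_continuous_map_preimage[OF cont_action W(1)])
      have "sphere 0 1 \<times> {bas a} \<subseteq> ?P"
        using W(2) fibre[OF a] bU(1)[OF a] by auto
      from tube_lemma_left[OF oP compactin_circle bU(1)[OF a] this]
      obtain Z V where V: "openin (sph U) V" "bas a \<in> V" "sphere 0 1 \<subseteq> Z" "Z \<times> V \<subseteq> ?P" by (elim exE conjE)
      have "{\<xi> \<in> topspace (sph U). p \<xi> \<in> proj L ` V} \<subseteq> W"
      proof
        fix \<eta> assume "\<eta> \<in> {\<xi> \<in> topspace (sph U). p \<xi> \<in> proj L ` V}"
        then obtain \<xi> where x: "\<eta> \<in> topspace (sph U)" "\<xi> \<in> V" "p \<xi> = p \<eta>" by auto
        have xs: "\<xi> \<in> topspace (sph U)" using x(2) V(1) openin_subset by blast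
        obtain z where z: "cmod z = 1" "\<eta> = z \<cdot> \<xi>" using sph_transitive[OF xs x(1,3)] by blast
        have "(z, \<xi>) \<in> ?P" using V(3,4) z(1) x(2) by (auto simp: subset_iff)
        thus "\<eta> \<in> W" using z(2) by simp
      qed
      moreover have "openin (subtopology T U) (proj L ` V)"
      proof -
        have "proj L ` V \<subseteq> U" using openin_subset[OF V(1)] by (auto simp: sph_fib)
        thus ?thesis using open_sph_image[OF U V(1)] oU by (simp add: openin_open_subtopology)
      qed
      moreover have "a \<in> proj L ` V" using V(2) bU(2)[OF a] by (metis image_eqI)
      ultimately show "\<exists>V. openin (subtopology T U) V \<and> a \<in> V \<and> {\<xi> \<in> topspace (sph U). p \<xi> \<in> V} \<subseteq> W" by blast
    qed
  qed
qed

lemma locally_compact_bisection: assumes U: "open_bisection G U" shows "locally_compact_space (subtopology T U)"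
proof -
  have Ua: "U \<subseteq> arr" by (rule bisection_arr[OF U])
  have oV: "openin TX (src G ` U)" by (rule src_inverse(3)[OF U])
  have "homeomorphic_maps (subtopology TX (src G ` U)) (subtopology T U) (the_inv_into U (src G)) (src G)"
    unfolding homeomorphic_maps_def
  proof (intro conjI ballI)
    show "continuous_map (subtopology TX (src G ` U)) (subtopology T U) (the_inv_into U (src G))"
      by (rule continuous_map_into_subtopology[OF src_inverse(1)[OF U]]) (use src_inverse(2)[OF U] in auto)
    show "continuous_map (subtopology T U) (subtopology TX (src G ` U)) (src G)"
      by (rule continuous_map_into_subtopology[OF continuous_map_from_subtopology[OF cont_src]]) auto
  qed (use src_inverse(2)[OF U] in auto)
  hence "(subtopology TX (src G ` U)) homeomorphic_space (subtopology T U)" unfolding homeomorphic_space_def by blast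
  moreover have "locally_compact_space (subtopology TX (src G ` U))"
    using locally_compact_space_open_subset[OF _ locally_compact_units oV] Hausdorff_units by blast
  ultimately show ?thesis using homeomorphic_locally_compact_spaceD by blast
qed

lemma locally_compact_sph: assumes U: "open_bisection G U" shows "locally_compact_space (sph U)"
  unfolding locally_compact_space_def
proof
  fix \<xi> assume x: "\<xi> \<in> topspace (sph U)"
  have pc: "continuous_map (sph U) (subtopology T U) (proj L)"
    by (rule continuous_map_into_subtopology[OF continuous_map_compose[OF cont_sph_id continuous_proj, unfolded o_def]])
       (simp add: sph_fib)
  have "p \<xi> \<in> topspace (subtopology T U)" using x by (simp add: sph_fib topspace_T)
  then obtain V K where VK: "openin (subtopology T U) V" "compactin (subtopology T U) K" "p \<xi> \<in> V" "V \<subseteq> K"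
    using locally_compact_bisection[OF U] unfolding locally_compact_space_def by blast
  show "\<exists>V K. openin (sph U) V \<and> compactin (sph U) K \<and> \<xi> \<in> V \<and> V \<subseteq> K"
    using openin_continuous_map_preimage[OF pc VK(1)] compactin_proper_map_preimage[OF proper_sph[OF U] VK(2)] VK(3,4) x
    by (intro exI[of _ "{\<zeta> \<in> topspace (sph U). p \<zeta> \<in> V}"] exI[of _ "{\<zeta> \<in> topspace (sph U). p \<zeta> \<in> K}"]) auto
qed

text \<open>A continuous bump \<open>F\<close> on the sphere bundle, concentrated on one side of a vector \<open>\<xi>\<^sub>0\<close> in its fibre,
  has a first Fourier coefficient \<open>f\<close> along the circle action. It satisfies \<open>f(z\<xi>) = z\<^sup>-\<^sup>1 f(\<xi>)\<close>,
  so \<open>f(\<xi>)\<xi>\<close> depends only on the base point and defines a section.\<close>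

lemma local_section:
  assumes U: "open_bisection G U" and g: "\<gamma> \<in> U"
  shows "\<exists>\<sigma>. continuous_map (subtopology T U) TL \<sigma> \<and> (\<forall>a\<in>U. \<sigma> a \<in> fb a) \<and> \<sigma> \<gamma> \<noteq> zr \<gamma>"
proof -
  have Ua: "a \<in> arr" if "a \<in> U" for a using U bisection_arr that by blast
  have bU: "bas a \<in> topspace (sph U)" "p (bas a) = a" if "a \<in> U" for a
    using bas(1,2)[OF Ua[OF that]] that by (auto simp: topspace_sph fib_iff)
  let ?b = "bas \<gamma>"
  define K0 where "K0 = (\<lambda>z. z \<cdot> ?b) ` (sphere 0 1 \<inter> {z. Re z \<le> 0})"
  have "continuous_map circle (sph U) (\<lambda>z. z \<cdot> ?b)"
    by (rule cont_rotate) (use bU[OF g] in \<open>auto simp: continuous_map_const intro: continuous_map_from_subtopology\<close>)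
  moreover have "compactin circle (sphere 0 1 \<inter> {z. Re z \<le> 0})"
    by (simp add: compactin_subtopology compact_Int_closed closed_halfspace_Re_le)
  ultimately have "compactin (sph U) K0" unfolding K0_def using image_compactin by blast
  hence K0: "closedin (sph U) K0" using compactin_imp_closedin Hausdorff_sph[OF U] by blast
  have bK0: "?b \<notin> K0"
  proof
    assume "?b \<in> K0"
    then obtain z where z: "Re z \<le> 0" "?b = z \<cdot> ?b" by (auto simp: K0_def)
    hence "1 \<cdot> ?b = z \<cdot> ?b" using fb_smul_one bas(1) Ua[OF g] by simp
    hence "1 = z" using smul_inject bas(1,2) Ua[OF g] by (metis zero_neq_one)
    thus False using z by simp
  qed
  have oV: "openin (sph U) (topspace (sph U) - K0)" using K0 by blast
  have cb: "compactin (sph U) {?b}" using bU[OF g] by simp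
  obtain F :: "'l \<Rightarrow> real" and K' where F: "continuous_map (sph U) euclidean F" "\<And>\<xi>. 0 \<le> F \<xi>" "\<And>\<xi>. F \<xi> \<le> 1"
    "\<And>\<xi>. \<xi> \<in> {?b} \<Longrightarrow> F \<xi> = 1" "compactin (sph U) K'" "K' \<subseteq> topspace (sph U) - K0" "\<And>\<xi>. \<xi> \<in> topspace (sph U) - K' \<Longrightarrow> F \<xi> = 0"
    by (rule Urysohn_compact_support[OF Hausdorff_sph[OF U] locally_compact_sph[OF U] cb oV])
       (use bU[OF g] bK0 in auto)
  (* F vanishes on the rotations by z with Re z <= 0 of the basis vector at \<gamma>, so f has positive real part there. *)
  define h where "h \<xi> t = of_real (F (turn t \<cdot> \<xi>)) * turn t" for \<xi> t
  define f where "f \<xi> = integral {0..1} (h \<xi>)" for \<xi>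
  have hc: "continuous_on UNIV (h \<xi>)" if x: "\<xi> \<in> topspace (sph U)" for \<xi>
  proof -
    have ct: "continuous_map euclideanreal euclidean turn" using continuous_turn by simp
    have "continuous_map euclideanreal (sph U) (\<lambda>t. turn t \<cdot> \<xi>)"
      by (rule cont_rotate[OF ct]) (use x in \<open>auto simp: norm_turn continuous_map_const\<close>)
    from continuous_map_compose[OF this F(1)] have "continuous_on UNIV (\<lambda>t. F (turn t \<cdot> \<xi>))" by (simp add: o_def)
    thus ?thesis unfolding h_def by (intro continuous_intros continuous_turn)
  qed
  have hi: "h \<xi> integrable_on {0..1}" if "\<xi> \<in> topspace (sph U)" for \<xi>
    by (rule integrable_continuous_interval[OF continuous_on_subset[OF hc[OF that] subset_UNIV]])
  (* Rotating the argument shifts the variable of integration. *)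
  have equiv: "z * f (z \<cdot> \<xi>) = f \<xi>" if x: "\<xi> \<in> topspace (sph U)" and z: "cmod z = 1" for z \<xi>
  proof -
    obtain c where c: "0 \<le> c" "c \<le> 1" "turn c = z" using turn_surj[OF z] by blast
    have xf: "p \<xi> \<in> arr" "\<xi> \<in> fb (p \<xi>)" using x by (simp_all add: sph_fib)
    have "z * h (z \<cdot> \<xi>) t = h \<xi> (c + t)" for t
      using fb_smul_smul[OF xf, of "turn t" z] c(3) by (simp add: h_def turn_add mult.commute mult.left_commute)
    hence "z * f (z \<cdot> \<xi>) = integral {0..1} (\<lambda>t. h \<xi> (c + t))"
      unfolding f_def by (simp flip: integral_mult_right)
    also have "\<dots> = f \<xi>"
      unfolding f_def by (rule integral_periodic_shift[OF hc[OF x] _ c(1,2)]) (simp add: h_def turn_periodic)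
    finally show ?thesis .
  qed
  (* By the tube lemma, F is uniformly close on whole orbits of the circle. *)
  have fcont: "continuous_map (sph U) euclidean f"
  proof (rule continuous_map_normedI)
    fix \<xi> and e :: real assume x: "\<xi> \<in> topspace (sph U)" and e: "e > 0"
    have cF: "continuous_map (prod_topology circle (sph U)) euclideanreal (\<lambda>z. F (fst z \<cdot> snd z))"
      using continuous_map_compose[OF cont_action F(1)] by (simp add: o_def)
    have "continuous_map (prod_topology circle (sph U)) (prod_topology circle (sph U)) (\<lambda>z. (fst z, \<xi>))"
      by (intro continuous_map_pairedI continuous_map_fst) (use x in \<open>simp add: continuous_map_const\<close>)
    from continuous_map_compose[OF this cF]
    have cF': "continuous_map (prod_topology circle (sph U)) euclideanreal (\<lambda>z. F (fst z \<cdot> \<xi>))" by (simp add: o_def)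
    let ?P = "{z \<in> topspace (prod_topology circle (sph U)). F (fst z \<cdot> snd z) - F (fst z \<cdot> \<xi>) \<in> {-(e/2)<..<e/2}}"
    have oP: "openin (prod_topology circle (sph U)) ?P"
      by (rule openin_continuous_map_preimage[OF continuous_map_diff[OF cF cF']]) simp
    have "sphere 0 1 \<times> {\<xi>} \<subseteq> ?P" using e x by auto
    from tube_lemma_left[OF oP compactin_circle x this]
    obtain Z V where V: "openin (sph U) V" "\<xi> \<in> V" "sphere 0 1 \<subseteq> Z" "Z \<times> V \<subseteq> ?P" by (elim exE conjE)
    have "cmod (f \<eta> - f \<xi>) < e" if y: "\<eta> \<in> V" for \<eta>
    proof -
      have ys: "\<eta> \<in> topspace (sph U)" using y V(1) openin_subset by blast
      have "\<bar>F (turn t \<cdot> \<eta>) - F (turn t \<cdot> \<xi>)\<bar> < e/2" for t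
      proof -
        have "turn t \<in> Z" using V(3) norm_turn[of t] by (auto simp: subset_iff)
        hence "(turn t, \<eta>) \<in> ?P" using V(4) y by blast
        hence "-(e/2) < F (turn t \<cdot> \<eta>) - F (turn t \<cdot> \<xi>)" "F (turn t \<cdot> \<eta>) - F (turn t \<cdot> \<xi>) < e/2" by simp_all
        thus ?thesis by linarith
      qed
      hence b: "cmod (h \<eta> t - h \<xi> t) \<le> e/2" for t
        by (simp add: h_def left_diff_distrib[symmetric] norm_mult norm_turn less_imp_le flip: of_real_diff)
      have "f \<eta> - f \<xi> = integral {0..1} (\<lambda>t. h \<eta> t - h \<xi> t)"
        unfolding f_def by (rule Henstock_Kurzweil_Integration.integral_diff[OF hi[OF ys] hi[OF x], symmetric])
      also have "cmod \<dots> \<le> e/2 * (1 - 0)"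
        by (rule integral_bound) (use b in \<open>auto intro!: continuous_intros continuous_on_subset[OF hc] ys x\<close>)
      finally show ?thesis using e by simp
    qed
    thus "\<exists>V. openin (sph U) V \<and> \<xi> \<in> V \<and> (\<forall>\<eta>\<in>V. cmod (f \<eta> - f \<xi>) < e)" using V(1,2) by blast
  qed
  have f0: "f ?b \<noteq> 0"
  proof
    assume "f ?b = 0"
    have nn: "0 \<le> Re (h ?b t)" for t
    proof (cases "F (turn t \<cdot> ?b) = 0")
      case False
      have "turn t \<cdot> ?b \<in> K'" using F(7)[of "turn t \<cdot> ?b"] False sph_rotate(1)[OF bU(1)[OF g] norm_turn] by blast
      hence "turn t \<cdot> ?b \<notin> K0" using F(6) by blast
      hence "Re (turn t) > 0" using norm_turn[of t] by (fastforce simp: K0_def)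
      thus ?thesis using F(2) by (simp add: h_def)
    qed (simp add: h_def)
    have "integral {0..1} (\<lambda>t. Re (h ?b t)) = Re (f ?b)"
      unfolding f_def using integral_linear[OF hi[OF bU(1)[OF g]] bounded_linear_Re] by (simp add: o_def)
    hence "integral {0..1} (\<lambda>t. Re (h ?b t)) = 0" using \<open>f ?b = 0\<close> by simp
    moreover have "continuous_on {0..1} (\<lambda>t. Re (h ?b t))"
      by (intro continuous_intros continuous_on_subset[OF hc[OF bU(1)[OF g]]]) simp
    ultimately have "Re (h ?b 0) = 0"
      using integral_eq_0_iff[of 0 1 "\<lambda>t. Re (h ?b t)"] nn by auto
    moreover have "h ?b 0 = 1"
      using F(4) fb_smul_one[OF Ua[OF g] bas(1)[OF Ua[OF g]]] by (simp add: h_def turn_periodic)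
    ultimately show False by simp
  qed
  define \<sigma> where "\<sigma> a = f (bas a) \<cdot> bas a" for a
  have indep: "\<sigma> (p \<xi>) = f \<xi> \<cdot> \<xi>" if x: "\<xi> \<in> topspace (sph U)" for \<xi>
  proof -
    have pU: "p \<xi> \<in> U" using x by (simp add: sph_fib)
    obtain z where z: "cmod z = 1" "\<xi> = z \<cdot> bas (p \<xi>)"
      using sph_transitive[OF bU(1)[OF pU] x] bU(2)[OF pU] by blast
    have "f \<xi> \<cdot> \<xi> = (f (z \<cdot> bas (p \<xi>)) * z) \<cdot> bas (p \<xi>)"
      using z(2) fb_smul_smul[OF Ua[OF pU] bas(1)[OF Ua[OF pU]]] by metis
    also have "f (z \<cdot> bas (p \<xi>)) * z = f (bas (p \<xi>))" using equiv[OF bU(1)[OF pU] z(1)] by (simp add: mult.commute)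
    finally show ?thesis by (simp add: \<sigma>_def)
  qed
  have cf: "continuous_map (sph U) TL (\<lambda>\<xi>. f \<xi> \<cdot> \<xi>)" by (rule cont_smul[OF fcont cont_sph_id])
  have s_fb: "\<sigma> a \<in> fb a" if "a \<in> U" for a unfolding \<sigma>_def by (rule smul_bas(1)[OF Ua[OF that]])
  have oU: "openin T U" using U by (simp add: open_bisection_def)
  have "continuous_map (subtopology T U) TL \<sigma>"
  proof (rule continuous_mapI_local)
    fix a assume "a \<in> topspace (subtopology T U)"
    hence a: "a \<in> U" by simp
    show "\<sigma> a \<in> topspace TL" using s_fb[OF a] by (simp add: fib_iff)
    fix W assume W: "openin TL W" "\<sigma> a \<in> W"
    let ?V = "{\<xi> \<in> topspace (sph U). f \<xi> \<cdot> \<xi> \<in> W}"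
    have V: "openin (sph U) ?V" by (rule openin_continuous_map_preimage[OF cf W(1)])
    have "bas a \<in> ?V" using bU[OF a] W(2) by (simp add: \<sigma>_def)
    hence "a \<in> proj L ` ?V" using bU(2)[OF a] by (metis (no_types, lifting) image_eqI)
    moreover have "openin (subtopology T U) (proj L ` ?V)"
      using open_sph_image[OF U V] oU by (auto simp: openin_open_subtopology sph_fib)
    moreover have "\<forall>b\<in>proj L ` ?V. \<sigma> b \<in> W" using indep by auto
    ultimately show "\<exists>V. openin (subtopology T U) V \<and> a \<in> V \<and> (\<forall>b\<in>V. \<sigma> b \<in> W)" by blast
  qed
  moreover have "\<sigma> \<gamma> \<noteq> zr \<gamma>"
  proof
    assume "\<sigma> \<gamma> = zr \<gamma>"
    hence "crd \<gamma> (f ?b \<cdot> ?b) = 0" using crd_zero[OF Ua[OF g]] by (simp add: \<sigma>_def)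
    thus False using f0 smul_bas(2)[OF Ua[OF g]] by simp
  qed
  ultimately show ?thesis using s_fb by blast
qed

end

section \<open>The convolution algebra as an algebra of matrices\<close>

context fell_groupoid
begin

abbreviation SA where "SA \<equiv> section_alg G L"
abbreviation secs where "secs \<equiv> (\<Pi>\<^sub>E a\<in>arr. fib L a)"

lemma SA_simps: "carrier SA = secs" "vzero SA = restrict (lzero L) arr"
  "vadd SA f g = (\<lambda>a\<in>arr. f a \<boxplus> g a)" "vsmul SA c f = (\<lambda>a\<in>arr. c \<cdot> f a)"
  "amul SA f g = (\<lambda>a\<in>arr. fibre_sum L a (\<lambda>(b, c). f b \<diamondop> g c) (factorizations G a))"
  "aadj SA f = (\<lambda>a\<in>arr. ld (f (iv a)))"
  by (simp_all add: section_alg_def)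

lemma secs_fb: "f \<in> secs \<Longrightarrow> a \<in> arr \<Longrightarrow> f a \<in> fb a"
  by (rule PiE_mem)

lemma secs_eqI: "f \<in> secs \<Longrightarrow> g \<in> secs \<Longrightarrow> (\<And>a. a \<in> arr \<Longrightarrow> f a = g a) \<Longrightarrow> f = g"
  by (rule PiE_ext)

lemma vector_space_SA: "complex_vector_space SA"
proof
  show "vzero SA \<in> carrier SA" by (simp add: SA_simps fb_zero)
  fix f assume f: "f \<in> carrier SA"
  hence f': "f \<in> secs" by (simp add: SA_simps)
  note F = secs_fb[OF f']
  show sm: "vsmul SA c f \<in> carrier SA" for c using F by (simp add: SA_simps fb_smul)
  show "vadd SA f (vzero SA) = f"
    by (rule secs_eqI) (use F f' in \<open>simp_all add: SA_simps fb_add_zero fb_zero\<close>)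
  show "vsmul SA (c + d) f = vadd SA (vsmul SA c f) (vsmul SA d f)" for c d
    by (rule secs_eqI) (use F in \<open>simp_all add: SA_simps fb_add_smul fb_closed\<close>)
  show "vsmul SA c (vsmul SA d f) = vsmul SA (c * d) f" for c d
    by (rule secs_eqI) (use F in \<open>simp_all add: SA_simps fb_smul_smul fb_closed\<close>)
  show "vsmul SA 1 f = f"
    by (rule secs_eqI) (use F f' in \<open>simp_all add: SA_simps fb_smul_one\<close>)
  show "\<exists>w\<in>carrier SA. vadd SA f w = vzero SA"
  proof (rule bexI[of _ "vsmul SA (-1) f"])
    have "\<xi> \<boxplus> (-1) \<cdot> \<xi> = zr a" if "a \<in> arr" "\<xi> \<in> fb a" for a \<xi>
      using complex_vector_space.add_minus[OF fvs[OF that(1)], of \<xi>] that by simp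
    thus "vadd SA f (vsmul SA (-1) f) = vzero SA"
      by (intro secs_eqI) (use F in \<open>simp_all add: SA_simps fb_closed\<close>)
  qed (rule sm)
  fix g assume g: "g \<in> carrier SA"
  hence Gb: "\<And>a. a \<in> arr \<Longrightarrow> g a \<in> fb a" by (auto simp: SA_simps)
  show "vadd SA f g \<in> carrier SA" using F Gb by (simp add: SA_simps fb_add)
  show "vadd SA f g = vadd SA g f"
    by (rule secs_eqI) (use F Gb in \<open>simp_all add: SA_simps fb_closed fb_add_commute\<close>)
  show "vsmul SA c (vadd SA f g) = vadd SA (vsmul SA c f) (vsmul SA c g)" for c
    by (rule secs_eqI) (use F Gb in \<open>simp_all add: SA_simps fb_closed fb_smul_add\<close>)
  fix h assume h: "h \<in> carrier SA"
  hence H: "\<And>a. a \<in> arr \<Longrightarrow> h a \<in> fb a" by (auto simp: SA_simps)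
  show "vadd SA (vadd SA f g) h = vadd SA f (vadd SA g h)"
    by (rule secs_eqI) (use F Gb H in \<open>simp_all add: SA_simps fb_closed fb_add_assoc\<close>)
qed

text \<open>The matrix of left convolution by \<open>f\<close>, with respect to the chosen basis vectors, on the
  sections over the arrows with a given source.\<close>

definition mat where
  "mat f a b = (if a \<in> arr \<and> b \<in> arr \<and> s a = s b then crd a (f (a \<star> iv b) \<diamondop> bas b) else 0)"

text \<open>A domain on which convolution makes sense and which it preserves: the sums in a matrix product are
  finite if rows and columns are.\<close>

definition finsec where
  "finsec = {f \<in> secs. (\<forall>a. finite {b. mat f a b \<noteq> 0}) \<and> (\<forall>b. finite {a. mat f a b \<noteq> 0})}"

lemma finsec_secs: "f \<in> finsec \<Longrightarrow> f \<in> secs"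
  and finite_row: "f \<in> finsec \<Longrightarrow> finite {b. mat f a b \<noteq> 0}"
  and finite_col: "f \<in> finsec \<Longrightarrow> finite {a. mat f a b \<noteq> 0}"
  by (simp_all add: finsec_def)

lemma div_arrow: assumes "a \<in> arr" "b \<in> arr" "s a = s b"
  shows "a \<star> iv b \<in> arr" "s (a \<star> iv b) = r b" "r (a \<star> iv b) = r a" "(a \<star> iv b) \<star> b = a"
    "iv (a \<star> iv b) = b \<star> iv a" "iv (a \<star> iv b) \<star> a = b"
  using assms by (simp_all add: mul_closed src_mul rng_mul grp mul_inv_cancel_right' inv_of_mul inv_inv)

lemma mat_fb: assumes "a \<in> arr" "b \<in> arr" "s a = s b" "f \<in> secs"
  shows "f (a \<star> iv b) \<diamondop> bas b \<in> fb a" "f (a \<star> iv b) \<in> fb (a \<star> iv b)"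
    "f (a \<star> iv b) \<diamondop> bas b = mat f a b \<cdot> bas a" "cmod (mat f a b) = nm (f (a \<star> iv b))"
proof -
  note d = div_arrow[OF assms(1-3)]
  show 1: "f (a \<star> iv b) \<in> fb (a \<star> iv b)" by (rule secs_fb[OF assms(4) d(1)])
  show 2: "f (a \<star> iv b) \<diamondop> bas b \<in> fb a"
    using lmul_closed[OF d(1) assms(2) d(2) 1 bas(1)[OF assms(2)]] d(4) by simp
  show "f (a \<star> iv b) \<diamondop> bas b = mat f a b \<cdot> bas a" using crd[OF assms(1) 2] assms by (simp add: mat_def)
  show "cmod (mat f a b) = nm (f (a \<star> iv b))"
    using nm_lmul[OF d(1) assms(2) d(2) 1 bas(1)[OF assms(2)]] nm_crd[OF assms(1) 2] bas(2)[OF assms(2)] assms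
    by (simp add: mat_def)
qed

lemma mat_eq_0: assumes "a \<in> arr" "b \<in> arr" "s a = s b" "f \<in> secs"
  shows "mat f a b = 0 \<longleftrightarrow> f (a \<star> iv b) = zr (a \<star> iv b)"
  using mat_fb[OF assms] nm_eq_0[OF div_arrow(1)[OF assms(1-3)] mat_fb(2)[OF assms]] by (metis norm_eq_zero)

lemma mat_nonzeroD: assumes "mat f a b \<noteq> 0" shows "a \<in> arr" "b \<in> arr" "s a = s b"
  using assms by (auto simp: mat_def split: if_splits)

lemma mat_src: assumes f: "f \<in> secs" and a: "a \<in> arr" shows "mat f a (s a) = crd a (f a)"
  using bas_right[OF a secs_fb[OF f a]] a inv_unit[OF src_unit[OF a]]
  by (simp add: mat_def grp mul_src)

lemma mat_diag: assumes f: "f \<in> secs" and a: "a \<in> arr" shows "mat f a a = crd (r a) (f (r a))"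
  using unit_left[OF a bas(1)[OF a] secs_fb[OF f rng_closed[OF a]]] smul_bas(2)[OF a]
  by (simp add: mat_def mul_inv[OF a] a)

lemma mat_add: assumes "f \<in> secs" "g \<in> secs" shows "mat (vadd SA f g) a b = mat f a b + mat g a b"
proof (cases "a \<in> arr \<and> b \<in> arr \<and> s a = s b")
  case True
  hence ab: "a \<in> arr" "b \<in> arr" "s a = s b" by auto
  note d = div_arrow[OF ab] and m = mat_fb[OF ab]
  show ?thesis
    using lmul_add_left[OF d(1) ab(2) d(2) m(2)[OF assms(1)] m(2)[OF assms(2)] bas(1)[OF ab(2)]]
      m(1)[OF assms(1)] m(1)[OF assms(2)] ab d(1)
    by (simp add: mat_def SA_simps crd_add)
qed (auto simp: mat_def)

lemma mat_smul: assumes "f \<in> secs" shows "mat (vsmul SA c f) a b = c * mat f a b"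
proof (cases "a \<in> arr \<and> b \<in> arr \<and> s a = s b")
  case True
  hence ab: "a \<in> arr" "b \<in> arr" "s a = s b" by auto
  note d = div_arrow[OF ab] and m = mat_fb[OF ab assms]
  show ?thesis
    using lmul_smul_left[OF d(1) ab(2) d(2) m(2) bas(1)[OF ab(2)]] m(1) ab d(1)
    by (simp add: mat_def SA_simps crd_smul)
qed (auto simp: mat_def)

text \<open>The entries \<open>mat f a (s a)\<close> are the coordinates of \<open>f\<close>. This reduces identities between sections to
  identities between matrices.\<close>

lemma mat_inject: assumes f: "f \<in> secs" and g: "g \<in> secs" and e: "\<And>a b. mat f a b = mat g a b" shows "f = g"
proof (rule secs_eqI[OF f g])
  fix a assume a: "a \<in> arr"
  have "crd a (f a) = crd a (g a)" using e[of a "s a"] mat_src[OF f a] mat_src[OF g a] by simp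
  thus "f a = g a" using crd_inject[OF a secs_fb[OF f a] secs_fb[OF g a]] by simp
qed

lemma comm_monoid_fb:
  assumes a: "a \<in> arr" shows "comm_monoid \<lparr>carrier = fb a, mult = ladd L, one = zr a\<rparr>"
  by (rule comm_monoidI) (use a in \<open>simp_all add: fb_closed fb_add_assoc fb_zero_add fb_add_zero fb_add_commute complex_vector_space.add_left_commute[OF fvs, simplified]\<close>)

lemma additive_fibre_sum:
  assumes a: "a \<in> arr" and fin: "finite {i \<in> I. h i \<noteq> zr a}" and h: "\<And>i. i \<in> I \<Longrightarrow> h i \<in> fb a"
    and T: "\<Theta> (zr a) = (0::complex)" "\<And>\<xi> \<eta>. \<xi> \<in> fb a \<Longrightarrow> \<eta> \<in> fb a \<Longrightarrow> \<Theta> (\<xi> \<boxplus> \<eta>) = \<Theta> \<xi> + \<Theta> \<eta>"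
  shows "fibre_sum L a h I \<in> fb a" "\<Theta> (fibre_sum L a h I) = (\<Sum>i | i \<in> I \<and> h i \<noteq> zr a. \<Theta> (h i))"
proof -
  let ?M = "\<lparr>carrier = fb a, mult = ladd L, one = zr a\<rparr>"
  interpret comm_monoid ?M by (rule comm_monoid_fb[OF a])
  have "finprod ?M h F \<in> fb a \<and> \<Theta> (finprod ?M h F) = (\<Sum>i\<in>F. \<Theta> (h i))" if "finite F" "F \<subseteq> I" for F
    using that
  proof (induction F rule: finite_induct)
    case empty
    have "finprod ?M h {} = zr a" using finprod_empty[of h] by simp
    thus ?case using T a by (simp add: fb_zero)
  next
    case (insert i F)
    have hF: "h \<in> F \<rightarrow> carrier ?M" "h i \<in> carrier ?M" using insert.prems h by auto
    have "finprod ?M h (insert i F) = h i \<boxplus> finprod ?M h F"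
      using finprod_insert[OF insert.hyps(1,2) hF] by simp
    thus ?case using insert T(2) hF a by (simp add: fb_add)
  qed
  from this[OF fin] show "fibre_sum L a h I \<in> fb a" "\<Theta> (fibre_sum L a h I) = (\<Sum>i | i \<in> I \<and> h i \<noteq> zr a. \<Theta> (h i))"
    by (auto simp: fibre_sum_def)
qed

text \<open>A factorization \<open>a = bc\<close> is determined by \<open>c\<close>, so convolution sums are sums over the arrows with the
  source of \<open>a\<close>.\<close>

lemma conv_sum:
  assumes f: "f \<in> finsec" and a: "a \<in> arr" and e: "\<And>c. c \<in> arr \<Longrightarrow> s c = s a \<Longrightarrow> \<eta> c \<in> fb c"
    and T: "\<Theta> (zr a) = (0::complex)" "\<And>\<xi> \<eta>. \<xi> \<in> fb a \<Longrightarrow> \<eta> \<in> fb a \<Longrightarrow> \<Theta> (\<xi> \<boxplus> \<eta>) = \<Theta> \<xi> + \<Theta> \<eta>"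
  shows "fibre_sum L a (\<lambda>(b, c). f b \<diamondop> \<eta> c) (factorizations G a) \<in> fb a"
    "\<Theta> (fibre_sum L a (\<lambda>(b, c). f b \<diamondop> \<eta> c) (factorizations G a)) = (\<Sum>c | mat f a c \<noteq> 0. \<Theta> (f (a \<star> iv c) \<diamondop> \<eta> c))"
proof -
  let ?h = "\<lambda>(b, c). f b \<diamondop> \<eta> c" and ?R = "{c. mat f a c \<noteq> 0}" and ?g = "\<lambda>c. (a \<star> iv c, c)"
  have fs: "f \<in> secs" by (rule finsec_secs[OF f])
  have fact: "b \<in> arr" "c \<in> arr" "s b = r c" "b \<star> c = a" "s c = s a" "b = a \<star> iv c" if "(b, c) \<in> factorizations G a" for b c
    using that by (auto simp: factorizations_def src_mul mul_inv_cancel_right)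
  have hfb: "?h i \<in> fb a" if "i \<in> factorizations G a" for i
  proof (cases i)
    case (Pair b c)
    have bc: "(b, c) \<in> factorizations G a" using that Pair by simp
    note F = fact[OF bc]
    show ?thesis using lmul_closed[OF F(1-3) secs_fb[OF fs F(1)] e[OF F(2,5)]] F(4) Pair by simp
  qed
  have sub: "{i \<in> factorizations G a. ?h i \<noteq> zr a} \<subseteq> ?g ` ?R"
  proof
    fix i assume i: "i \<in> {i \<in> factorizations G a. ?h i \<noteq> zr a}"
    obtain b c where bc: "i = (b, c)" by (cases i)
    have m: "(b, c) \<in> factorizations G a" "f b \<diamondop> \<eta> c \<noteq> zr a" using i bc by auto
    note F = fact[OF m(1)]
    have "f b \<noteq> zr b" using m(2) lmul_zero_left[OF F(1-3) e[OF F(2,5)]] F(4) by auto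
    hence "mat f a c \<noteq> 0" using mat_eq_0[OF a F(2) F(5)[symmetric] fs] F(6) by simp
    thus "i \<in> ?g ` ?R" using bc F(6) by auto
  qed
  have inR: "?g c \<in> factorizations G a" if "c \<in> ?R" for c
    using div_arrow[OF mat_nonzeroD[of f a c]] mat_nonzeroD[of f a c] that by (simp add: factorizations_def)
  have finR: "finite ?R" by (rule finite_row[OF f])
  have fin: "finite {i \<in> factorizations G a. ?h i \<noteq> zr a}" using sub finR by (rule finite_subset[OF _ finite_imageI])
  note A = additive_fibre_sum[OF a fin hfb T]
  show "fibre_sum L a ?h (factorizations G a) \<in> fb a" by (rule A(1))
  have "\<Theta> (fibre_sum L a ?h (factorizations G a)) = (\<Sum>i | i \<in> factorizations G a \<and> ?h i \<noteq> zr a. \<Theta> (?h i))"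
    by (rule A(2))
  also have "\<dots> = (\<Sum>i\<in>?g ` ?R. \<Theta> (?h i))"
    using finR sub inR T(1) by (intro sum.mono_neutral_left) auto
  also have "\<dots> = (\<Sum>c\<in>?R. \<Theta> (?h (?g c)))" by (subst sum.reindex) (auto intro: inj_onI)
  finally show "\<Theta> (fibre_sum L a ?h (factorizations G a)) = (\<Sum>c\<in>?R. \<Theta> (f (a \<star> iv c) \<diamondop> \<eta> c))" by simp
qed

lemma crd_lmul_mat:
  assumes "a \<in> arr" "c \<in> arr" "s a = s c" "f \<in> secs" "\<zeta> \<in> fb c"
  shows "crd a (f (a \<star> iv c) \<diamondop> \<zeta>) = mat f a c * crd c \<zeta>"
proof -
  note d = div_arrow[OF assms(1-3)] and m = mat_fb[OF assms(1-4)]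
  have "f (a \<star> iv c) \<diamondop> \<zeta> = f (a \<star> iv c) \<diamondop> (crd c \<zeta> \<cdot> bas c)" using crd[OF assms(2,5)] by simp
  also have "\<dots> = crd c \<zeta> \<cdot> (f (a \<star> iv c) \<diamondop> bas c)"
    by (rule lmul_smul_right[OF d(1) assms(2) d(2) m(2) bas(1)[OF assms(2)]])
  finally show ?thesis using crd_smul[OF assms(1) m(1)] assms by (simp add: mat_def)
qed

lemma crd_conv:
  assumes f: "f \<in> finsec" and a: "a \<in> arr" and e: "\<And>c. c \<in> arr \<Longrightarrow> s c = s a \<Longrightarrow> \<eta> c \<in> fb c"
  shows "crd a (fibre_sum L a (\<lambda>(b, c). f b \<diamondop> \<eta> c) (factorizations G a)) = (\<Sum>c | mat f a c \<noteq> 0. mat f a c * crd c (\<eta> c))"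
proof -
  have "crd a (fibre_sum L a (\<lambda>(b, c). f b \<diamondop> \<eta> c) (factorizations G a)) = (\<Sum>c | mat f a c \<noteq> 0. crd a (f (a \<star> iv c) \<diamondop> \<eta> c))"
    by (rule conv_sum(2)[OF f a e]) (simp_all add: crd_zero crd_add a)
  also have "\<dots> = (\<Sum>c | mat f a c \<noteq> 0. mat f a c * crd c (\<eta> c))"
  proof (rule sum.cong[OF refl])
    fix c assume "c \<in> {c. mat f a c \<noteq> 0}"
    hence "mat f a c \<noteq> 0" by simp
    note ac = mat_nonzeroD[OF this]
    show "crd a (f (a \<star> iv c) \<diamondop> \<eta> c) = mat f a c * crd c (\<eta> c)"
      by (rule crd_lmul_mat[OF ac finsec_secs[OF f] e[OF ac(2) ac(3)[symmetric]]])
  qed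
  finally show ?thesis .
qed

lemma conv_secs: assumes f: "f \<in> finsec" and g: "g \<in> secs" shows "amul SA f g \<in> secs"
  using conv_sum(1)[OF f _ secs_fb[OF g], where \<Theta>="\<lambda>_. 0"] by (simp add: SA_simps)

text \<open>By associativity in the bundle, \<open>(f(ab\<^sup>-\<^sup>1) g(bc\<^sup>-\<^sup>1)) 1\<^sub>c = f(ab\<^sup>-\<^sup>1) (g(bc\<^sup>-\<^sup>1) 1\<^sub>c)\<close> for the chosen
  basis vector \<open>1\<^sub>c\<close>. The factorizations of \<open>ac\<^sup>-\<^sup>1\<close> are indexed by \<open>b\<close>.\<close>

lemma mat_mul:
  assumes f: "f \<in> finsec" and g: "g \<in> secs"
  shows "mat (amul SA f g) a c = (\<Sum>b | mat f a b \<noteq> 0. mat f a b * mat g b c)"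
proof (cases "a \<in> arr \<and> c \<in> arr \<and> s a = s c")
  case True
  hence ac: "a \<in> arr" "c \<in> arr" "s a = s c" by auto
  have fs: "f \<in> secs" by (rule finsec_secs[OF f])
  let ?d = "a \<star> iv c"
  note d = div_arrow[OF ac]
  let ?T = "\<lambda>\<xi>. crd a (\<xi> \<diamondop> bas c)"
  have T: "?T (zr ?d) = 0" "\<And>\<xi> \<eta>. \<xi> \<in> fb ?d \<Longrightarrow> \<eta> \<in> fb ?d \<Longrightarrow> ?T (\<xi> \<boxplus> \<eta>) = ?T \<xi> + ?T \<eta>"
  proof -
    show "?T (zr ?d) = 0" using lmul_zero_left[OF d(1) ac(2) d(2) bas(1)[OF ac(2)]] d(4) ac by (simp add: crd_zero)
    fix \<xi> \<eta> assume x: "\<xi> \<in> fb ?d" "\<eta> \<in> fb ?d"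
    have cl: "\<And>\<xi>. \<xi> \<in> fb ?d \<Longrightarrow> \<xi> \<diamondop> bas c \<in> fb a"
      using lmul_closed[OF d(1) ac(2) d(2) _ bas(1)[OF ac(2)]] d(4) by simp
    show "?T (\<xi> \<boxplus> \<eta>) = ?T \<xi> + ?T \<eta>"
      using lmul_add_left[OF d(1) ac(2) d(2) x bas(1)[OF ac(2)]] cl x ac by (simp add: crd_add)
  qed
  have "mat (amul SA f g) a c = ?T (fibre_sum L ?d (\<lambda>(b, c). f b \<diamondop> g c) (factorizations G ?d))"
    using ac d(1) by (simp add: mat_def SA_simps)
  also have "\<dots> = (\<Sum>q | mat f ?d q \<noteq> 0. ?T (f (?d \<star> iv q) \<diamondop> g q))"
    by (rule conv_sum(2)[OF f d(1) secs_fb[OF g] T])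
  also have "\<dots> = (\<Sum>q | mat f ?d q \<noteq> 0. mat f a (q \<star> c) * mat g (q \<star> c) c)"
  proof (rule sum.cong[OF refl])
    fix q assume "q \<in> {q. mat f ?d q \<noteq> 0}"
    hence "mat f ?d q \<noteq> 0" by simp
    note dq = mat_nonzeroD[OF this]
    have q: "q \<in> arr" "s q = r c" using dq d(2) by simp_all
    let ?b = "q \<star> c"
    have b: "?b \<in> arr" "s ?b = s c" "?b \<star> iv c = q" using q ac by (simp_all add: mul_closed src_mul mul_inv_cancel_right)
    have db: "?d \<star> iv q = a \<star> iv ?b"
      using ac q by (simp add: inv_of_mul mul_assoc grp)
    have e: "s a = s ?b" using ac b by simp
    note D = div_arrow[OF dq] and m = mat_fb[OF ac(1) b(1) e fs] and mg = mat_fb[OF b(1) ac(2) b(2) g]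
    have "(f (?d \<star> iv q) \<diamondop> g q) \<diamondop> bas c = f (?d \<star> iv q) \<diamondop> (g q \<diamondop> bas c)"
      by (rule lmul_assoc[OF D(1) q(1) ac(2) D(2) q(2) secs_fb[OF fs D(1)] secs_fb[OF g q(1)] bas(1)[OF ac(2)]])
    also have "\<dots> = f (a \<star> iv ?b) \<diamondop> (g (?b \<star> iv c) \<diamondop> bas c)" by (simp add: db b(3))
    finally have "?T (f (?d \<star> iv q) \<diamondop> g q) = mat f a ?b * crd ?b (g (?b \<star> iv c) \<diamondop> bas c)"
      using crd_lmul_mat[OF ac(1) b(1) e fs mg(1)] by simp
    thus "?T (f (?d \<star> iv q) \<diamondop> g q) = mat f a ?b * mat g ?b c" using b ac by (simp add: mat_def)
  qed
  also have "\<dots> = (\<Sum>b | mat f a b \<noteq> 0. mat f a b * mat g b c)"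
  proof (rule sum.reindex_bij_witness[of _ "\<lambda>b. b \<star> iv c" "\<lambda>q. q \<star> c"])
    fix q assume "q \<in> {q. mat f ?d q \<noteq> 0}"
    hence nz: "mat f ?d q \<noteq> 0" by simp
    note dq = mat_nonzeroD[OF nz]
    have q: "q \<in> arr" "s q = r c" using dq d(2) by simp_all
    show "q \<star> c \<star> iv c = q" using q ac by (simp add: mul_inv_cancel_right)
    have db: "?d \<star> iv q = a \<star> iv (q \<star> c)" using ac q by (simp add: inv_of_mul mul_assoc grp)
    have b: "q \<star> c \<in> arr" "s a = s (q \<star> c)" using q ac by (simp_all add: mul_closed src_mul)
    show "q \<star> c \<in> {b. mat f a b \<noteq> 0}"
      using nz mat_eq_0[OF dq fs] mat_eq_0[OF ac(1) b fs] db by simp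
  next
    fix b assume "b \<in> {b. mat f a b \<noteq> 0}"
    hence nz: "mat f a b \<noteq> 0" by simp
    note ab = mat_nonzeroD[OF nz]
    have bc: "s b = s c" using ab ac by simp
    note q = div_arrow[OF ab(2) ac(2) bc]
    show "b \<star> iv c \<star> c = b" by (rule q(4))
    have db: "?d \<star> iv (b \<star> iv c) = a \<star> iv b"
    proof -
      have "?d \<star> iv (b \<star> iv c) = a \<star> (iv c \<star> (c \<star> iv b))" using q(5) ac ab bc by (simp add: mul_assoc grp mul_closed rng_mul)
      also have "iv c \<star> (c \<star> iv b) = iv b" using inv_mul_cancel_left[of c "iv b"] ac ab bc by (simp add: grp)
      finally show ?thesis .
    qed
    have e: "s ?d = s (b \<star> iv c)" using d q by simp
    show "b \<star> iv c \<in> {q. mat f ?d q \<noteq> 0}"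
      using nz mat_eq_0[OF ab fs] mat_eq_0[OF d(1) q(1) e fs] db by simp
  qed simp
  finally show ?thesis .
next
  case False
  have "mat f a b * mat g b c = 0" for b
    using False mat_nonzeroD[of f a b] mat_nonzeroD[of g b c] by (metis mult_eq_0_iff)
  moreover have "mat (amul SA f g) a c = 0" using False by (auto simp: mat_def)
  ultimately show ?thesis by (simp only: sum.neutral_const)
qed

lemma adj_secs: assumes f: "f \<in> secs" shows "aadj SA f \<in> secs"
proof -
  have "ld (f (iv a)) \<in> fb a" if a: "a \<in> arr" for a
    using ladj_closed[OF inv_closed[OF a] secs_fb[OF f inv_closed[OF a]]] inv_inv[OF a] by simp
  thus ?thesis by (simp add: SA_simps)
qed

text \<open>Compare coefficients of \<open>1\<^sub>a\<^sup>* f\<^sup>*(ab\<^sup>-\<^sup>1) 1\<^sub>b\<close>, using \<open>1\<^sub>a\<^sup>* 1\<^sub>a = 1\<close>.\<close>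

lemma mat_adj: assumes f: "f \<in> secs" shows "mat (aadj SA f) a b = cnj (mat f b a)"
proof (cases "a \<in> arr \<and> b \<in> arr \<and> s a = s b")
  case True
  hence ab: "a \<in> arr" "b \<in> arr" "s a = s b" by auto
  note d = div_arrow[OF ab] and d' = div_arrow[OF ab(2,1) ab(3)[symmetric]]
  note m = mat_fb[OF ab adj_secs[OF f]] and m' = mat_fb[OF ab(2,1) ab(3)[symmetric] f]
  let ?w = "f (b \<star> iv a)" and ?k = "mat f b a" and ?m = "mat (aadj SA f) a b"
  have val: "aadj SA f (a \<star> iv b) = ld ?w" using d by (simp add: SA_simps)
  have la: "ld (bas a) \<in> fb (iv a)" and lw: "ld ?w \<in> fb (a \<star> iv b)" using ladj_closed bas ab m(2) val by simp_all
  have sa: "s a \<in> arr" "bas (s a) \<in> fb (s a)" using ab by (simp_all add: grp bas)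
  have one: "ld (bas c) \<diamondop> bas c = bas (s c)" if "c \<in> arr" for c
    using adj_mul_self[OF that bas(1)[OF that]] bas(2)[OF that] fb_smul_one[of "s c" "bas (s c)"] that by (simp add: grp bas)
  have iva: "iv a \<in> arr" "s (iv a) = r a" "s (iv a) = r (a \<star> iv b)" using ab d by (simp_all add: grp)
  have "?m \<cdot> bas (s a) = ?m \<cdot> (ld (bas a) \<diamondop> bas a)" using one ab by simp
  also have "\<dots> = ld (bas a) \<diamondop> (?m \<cdot> bas a)"
    using lmul_smul_right[OF iva(1) ab(1) iva(2) la bas(1)[OF ab(1)]] by simp
  also have "\<dots> = ld (bas a) \<diamondop> (ld ?w \<diamondop> bas b)" using m(3) val by simp
  also have "\<dots> = (ld (bas a) \<diamondop> ld ?w) \<diamondop> bas b"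
    by (rule lmul_assoc[OF iva(1) d(1) ab(2) iva(3) d(2) la lw bas(1)[OF ab(2)], symmetric])
  also have "ld (bas a) \<diamondop> ld ?w = ld (?w \<diamondop> bas a)"
    by (rule ladj_lmul[OF d'(1) ab(1) d'(2) m'(2) bas(1)[OF ab(1)], symmetric])
  also have "\<dots> = cnj ?k \<cdot> ld (bas b)" using m'(3) ladj_smul[OF ab(2) bas(1)[OF ab(2)]] by simp
  also have "\<dots> \<diamondop> bas b = cnj ?k \<cdot> (ld (bas b) \<diamondop> bas b)"
    using lmul_smul_left[OF inv_closed[OF ab(2)] ab(2) src_inv[OF ab(2)] ladj_closed[OF ab(2) bas(1)[OF ab(2)]] bas(1)[OF ab(2)]] .
  also have "\<dots> = cnj ?k \<cdot> bas (s a)" using one ab by simp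
  finally show ?thesis using smul_inject[OF sa(1,2)] bas(2)[OF sa(1)] by simp
qed (auto simp: mat_def)

lemma secs_ops: "f \<in> secs \<Longrightarrow> g \<in> secs \<Longrightarrow> vadd SA f g \<in> secs" "f \<in> secs \<Longrightarrow> vsmul SA c f \<in> secs"
  using complex_vector_space.add_closed[OF vector_space_SA] complex_vector_space.smul_closed[OF vector_space_SA]
  by (simp_all add: SA_simps(1))

lemma finsec_ops:
  assumes f: "f \<in> finsec" shows "g \<in> finsec \<Longrightarrow> vadd SA f g \<in> finsec" "vsmul SA c f \<in> finsec"
proof -
  note fs = finsec_secs[OF f]
  have "{b. mat (vsmul SA c f) a b \<noteq> 0} \<subseteq> {b. mat f a b \<noteq> 0}" "{a. mat (vsmul SA c f) a b \<noteq> 0} \<subseteq> {a. mat f a b \<noteq> 0}" for a b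
    by (auto simp: mat_smul[OF fs])
  from finite_subset[OF this(1) finite_row[OF f]] finite_subset[OF this(2) finite_col[OF f]] show "vsmul SA c f \<in> finsec"
    using secs_ops(2)[OF fs] by (simp add: finsec_def)
  assume g: "g \<in> finsec"
  note gs = finsec_secs[OF g]
  have "{b. mat (vadd SA f g) a b \<noteq> 0} \<subseteq> {b. mat f a b \<noteq> 0} \<union> {b. mat g a b \<noteq> 0}"
    "{a. mat (vadd SA f g) a b \<noteq> 0} \<subseteq> {a. mat f a b \<noteq> 0} \<union> {a. mat g a b \<noteq> 0}" for a b
    by (auto simp: mat_add[OF fs gs])
  from finite_subset[OF this(1) finite_UnI[OF finite_row[OF f] finite_row[OF g]]]
    finite_subset[OF this(2) finite_UnI[OF finite_col[OF f] finite_col[OF g]]]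
  show "vadd SA f g \<in> finsec" using secs_ops(1)[OF fs gs] by (simp add: finsec_def)
qed

lemma conv_nonzero:
  assumes f: "f \<in> finsec" and g: "g \<in> secs" and a: "a \<in> arr" and nz: "amul SA f g a \<noteq> zr a"
  shows "\<exists>b c. b \<in> arr \<and> c \<in> arr \<and> s b = r c \<and> a = b \<star> c \<and> f b \<noteq> zr b \<and> g c \<noteq> zr c"
proof -
  have "crd a (amul SA f g a) \<noteq> 0" using crd_eq_0[OF a secs_fb[OF conv_secs[OF f g] a]] nz by simp
  moreover have "crd a (amul SA f g a) = (\<Sum>c | mat f a c \<noteq> 0. mat f a c * crd c (g c))"
    using crd_conv[OF f a secs_fb[OF g]] a by (simp add: SA_simps)
  ultimately obtain c where c: "mat f a c \<noteq> 0" "crd c (g c) \<noteq> 0"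
    by (metis (mono_tags, lifting) mult_zero_right sum.neutral mem_Collect_eq)
  note ac = mat_nonzeroD[OF c(1)]
  have "f (a \<star> iv c) \<noteq> zr (a \<star> iv c)" using mat_eq_0[OF ac finsec_secs[OF f]] c(1) by simp
  moreover have "g c \<noteq> zr c" using crd_eq_0[OF ac(2) secs_fb[OF g ac(2)]] c(2) by simp
  ultimately show ?thesis using div_arrow[OF ac] ac(2) by metis
qed

lemma finsec_mul: assumes f: "f \<in> finsec" and g: "g \<in> finsec" shows "amul SA f g \<in> finsec"
proof -
  note gs = finsec_secs[OF g]
  have "\<exists>b. mat f a b \<noteq> 0 \<and> mat g b c \<noteq> 0" if "mat (amul SA f g) a c \<noteq> 0" for a c
  proof (rule ccontr)
    assume n: "\<not> ?thesis"
    have "mat f a b * mat g b c = 0" for b using n by auto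
    hence "(\<Sum>b | mat f a b \<noteq> 0. mat f a b * mat g b c) = 0" by (simp only: sum.neutral_const)
    thus False using that unfolding mat_mul[OF f gs] by simp
  qed
  hence "{c. mat (amul SA f g) a c \<noteq> 0} \<subseteq> (\<Union>b\<in>{b. mat f a b \<noteq> 0}. {c. mat g b c \<noteq> 0})"
    "{a. mat (amul SA f g) a c \<noteq> 0} \<subseteq> (\<Union>b\<in>{b. mat g b c \<noteq> 0}. {a. mat f a b \<noteq> 0})" for a c
    by blast+
  from finite_subset[OF this(1) finite_UN_I[OF finite_row[OF f] finite_row[OF g]]]
    finite_subset[OF this(2) finite_UN_I[OF finite_col[OF g] finite_col[OF f]]]
  show ?thesis using conv_secs[OF f gs] by (simp add: finsec_def)
qed

lemma finsec_adj: assumes f: "f \<in> finsec" shows "aadj SA f \<in> finsec"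
  using finite_row[OF f] finite_col[OF f] adj_secs[OF finsec_secs[OF f]]
  by (simp add: finsec_def mat_adj[OF finsec_secs[OF f]])

text \<open>The laws of a *-algebra hold because they hold for matrices. Sums over a row are first extended to a
  finite set that serves both sides of an equation.\<close>

lemma mat_mul_superset:
  assumes "f \<in> finsec" "g \<in> secs" "finite R" "{b. mat f a b \<noteq> 0} \<subseteq> R"
  shows "mat (amul SA f g) a c = (\<Sum>b\<in>R. mat f a b * mat g b c)"
  unfolding mat_mul[OF assms(1,2)] by (rule sum.mono_neutral_left) (use assms in auto)

lemma mat_mul_superset':
  assumes "f \<in> finsec" "g \<in> secs" "finite R" "{b. mat g b c \<noteq> 0} \<subseteq> R"
  shows "mat (amul SA f g) a c = (\<Sum>b\<in>R. mat f a b * mat g b c)"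
proof -
  let ?R = "R \<union> {b. mat f a b \<noteq> 0}"
  have "mat (amul SA f g) a c = (\<Sum>b\<in>?R. mat f a b * mat g b c)"
    by (rule mat_mul_superset[OF assms(1,2)]) (use assms(3) finite_row[OF assms(1)] in auto)
  also have "\<dots> = (\<Sum>b\<in>R. mat f a b * mat g b c)"
    by (rule sum.mono_neutral_right) (use assms(3,4) finite_row[OF assms(1)] in auto)
  finally show ?thesis .
qed

lemma finsec_linear_laws:
  assumes f: "f \<in> finsec" and g: "g \<in> finsec" and h: "h \<in> finsec"
  shows "amul SA (vadd SA f g) h = vadd SA (amul SA f h) (amul SA g h)"
    "amul SA f (vadd SA g h) = vadd SA (amul SA f g) (amul SA f h)"
    "amul SA (vsmul SA z f) g = vsmul SA z (amul SA f g)"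
    "amul SA f (vsmul SA z g) = vsmul SA z (amul SA f g)"
proof -
  note fs = finsec_secs[OF f] and gs = finsec_secs[OF g] and hs = finsec_secs[OF h]
  note fg = conv_secs[OF f gs] and fh = conv_secs[OF f hs] and gh = conv_secs[OF g hs]
  show "amul SA (vadd SA f g) h = vadd SA (amul SA f h) (amul SA g h)"
  proof (rule mat_inject[OF conv_secs[OF finsec_ops(1)[OF f g] hs] secs_ops(1)[OF fh gh]])
    fix a b let ?R = "{c. mat f a c \<noteq> 0} \<union> {c. mat g a c \<noteq> 0}"
    have fin: "finite ?R" using finite_row[OF f] finite_row[OF g] by simp
    have sub: "{c. mat (vadd SA f g) a c \<noteq> 0} \<subseteq> ?R" by (auto simp: mat_add[OF fs gs])
    show "mat (amul SA (vadd SA f g) h) a b = mat (vadd SA (amul SA f h) (amul SA g h)) a b"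
      unfolding mat_add[OF fh gh] mat_mul_superset[OF finsec_ops(1)[OF f g] hs fin sub]
        mat_mul_superset[OF f hs fin Un_upper1] mat_mul_superset[OF g hs fin Un_upper2] mat_add[OF fs gs]
      by (simp add: distrib_right sum.distrib)
  qed
  show "amul SA f (vadd SA g h) = vadd SA (amul SA f g) (amul SA f h)"
  proof (rule mat_inject[OF conv_secs[OF f secs_ops(1)[OF gs hs]] secs_ops(1)[OF fg fh]])
    show "mat (amul SA f (vadd SA g h)) a b = mat (vadd SA (amul SA f g) (amul SA f h)) a b" for a b
      unfolding mat_add[OF fg fh] mat_mul[OF f gs] mat_mul[OF f hs] mat_mul[OF f secs_ops(1)[OF gs hs]] mat_add[OF gs hs]
      by (simp add: distrib_left sum.distrib)
  qed
  show "amul SA (vsmul SA z f) g = vsmul SA z (amul SA f g)"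
  proof (rule mat_inject[OF conv_secs[OF finsec_ops(2)[OF f] gs] secs_ops(2)[OF fg]])
    fix a b
    have sub: "{c. mat (vsmul SA z f) a c \<noteq> 0} \<subseteq> {c. mat f a c \<noteq> 0}" by (auto simp: mat_smul[OF fs])
    show "mat (amul SA (vsmul SA z f) g) a b = mat (vsmul SA z (amul SA f g)) a b"
      unfolding mat_smul[OF fg] mat_mul[OF f gs] mat_mul_superset[OF finsec_ops(2)[OF f] gs finite_row[OF f] sub] mat_smul[OF fs]
      by (simp add: sum_distrib_left mult.assoc)
  qed
  show "amul SA f (vsmul SA z g) = vsmul SA z (amul SA f g)"
  proof (rule mat_inject[OF conv_secs[OF f secs_ops(2)[OF gs]] secs_ops(2)[OF fg]])
    show "mat (amul SA f (vsmul SA z g)) a b = mat (vsmul SA z (amul SA f g)) a b" for a b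
      unfolding mat_smul[OF fg] mat_mul[OF f gs] mat_mul[OF f secs_ops(2)[OF gs]] mat_smul[OF gs]
      by (simp add: sum_distrib_left mult.left_commute)
  qed
qed

lemma finsec_assoc:
  assumes f: "f \<in> finsec" and g: "g \<in> finsec" and h: "h \<in> finsec"
  shows "amul SA (amul SA f g) h = amul SA f (amul SA g h)"
proof -
  note gs = finsec_secs[OF g] and hs = finsec_secs[OF h] and fg = finsec_mul[OF f g] and gh = finsec_mul[OF g h]
  show ?thesis
  proof (rule mat_inject[OF conv_secs[OF fg hs] conv_secs[OF f finsec_secs[OF gh]]])
    fix a d
    let ?Q = "{b. mat f a b \<noteq> 0}"
    let ?R = "(\<Union>b\<in>?Q. {c. mat g b c \<noteq> 0}) \<union> {c. mat (amul SA f g) a c \<noteq> 0}"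
    have fin: "finite ?R" using finite_row[OF f] finite_row[OF g] finite_row[OF fg] by simp
    have "mat (amul SA (amul SA f g) h) a d = (\<Sum>c\<in>?R. mat (amul SA f g) a c * mat h c d)"
      by (rule mat_mul_superset[OF fg hs fin Un_upper2])
    also have "\<dots> = (\<Sum>c\<in>?R. \<Sum>b\<in>?Q. mat f a b * mat g b c * mat h c d)"
      by (rule sum.cong[OF refl]) (simp only: mat_mul[OF f gs] sum_distrib_right)
    also have "\<dots> = (\<Sum>b\<in>?Q. \<Sum>c\<in>?R. mat f a b * mat g b c * mat h c d)" by (rule sum.swap)
    also have "\<dots> = (\<Sum>b\<in>?Q. mat f a b * mat (amul SA g h) b d)"
    proof (rule sum.cong[OF refl])
      fix b assume "b \<in> ?Q"
      hence "{c. mat g b c \<noteq> 0} \<subseteq> ?R" by blast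
      from mat_mul_superset[OF g hs fin this]
      show "(\<Sum>c\<in>?R. mat f a b * mat g b c * mat h c d) = mat f a b * mat (amul SA g h) b d"
        by (simp only: sum_distrib_left mult.assoc)
    qed
    also have "\<dots> = mat (amul SA f (amul SA g h)) a d" by (simp only: mat_mul[OF f finsec_secs[OF gh]])
    finally show "mat (amul SA (amul SA f g) h) a d = mat (amul SA f (amul SA g h)) a d" .
  qed
qed

lemma finsec_adj_laws:
  assumes f: "f \<in> finsec" and g: "g \<in> finsec"
  shows "aadj SA (vadd SA f g) = vadd SA (aadj SA f) (aadj SA g)"
    "aadj SA (vsmul SA z f) = vsmul SA (cnj z) (aadj SA f)"
    "aadj SA (aadj SA f) = f"
    "aadj SA (amul SA f g) = amul SA (aadj SA g) (aadj SA f)"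
proof -
  note fs = finsec_secs[OF f] and gs = finsec_secs[OF g]
  note fa = adj_secs[OF fs] and ga = adj_secs[OF gs]
  show "aadj SA (vadd SA f g) = vadd SA (aadj SA f) (aadj SA g)"
    by (rule mat_inject[OF adj_secs[OF secs_ops(1)[OF fs gs]] secs_ops(1)[OF fa ga]])
       (simp only: mat_adj[OF secs_ops(1)[OF fs gs]] mat_add[OF fs gs] mat_add[OF fa ga] mat_adj[OF fs] mat_adj[OF gs] complex_cnj_add)
  show "aadj SA (vsmul SA z f) = vsmul SA (cnj z) (aadj SA f)"
    by (rule mat_inject[OF adj_secs[OF secs_ops(2)[OF fs]] secs_ops(2)[OF fa]])
       (simp only: mat_adj[OF secs_ops(2)[OF fs]] mat_smul[OF fs] mat_smul[OF fa] mat_adj[OF fs] complex_cnj_mult)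
  show "aadj SA (aadj SA f) = f"
    by (rule mat_inject[OF adj_secs[OF fa] fs]) (simp only: mat_adj[OF fa] mat_adj[OF fs] complex_cnj_cnj)
  show "aadj SA (amul SA f g) = amul SA (aadj SA g) (aadj SA f)"
  proof (rule mat_inject[OF adj_secs[OF conv_secs[OF f gs]] conv_secs[OF finsec_adj[OF g] fa]])
    fix a c
    have "{b. mat (aadj SA f) b c \<noteq> 0} \<subseteq> {b. mat f c b \<noteq> 0}" by (simp add: mat_adj[OF fs])
    from mat_mul_superset'[OF finsec_adj[OF g] fa finite_row[OF f] this]
    show "mat (aadj SA (amul SA f g)) a c = mat (amul SA (aadj SA g) (aadj SA f)) a c"
      unfolding mat_adj[OF conv_secs[OF f gs]] mat_mul[OF f gs] mat_adj[OF fs] mat_adj[OF gs]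
      by (simp add: mult.commute)
  qed
qed

end

section \<open>Compactly supported sections\<close>

context fell_groupoid
begin

abbreviation CA where "CA \<equiv> Cc_alg G L"
abbreviation Cc where "Cc \<equiv> Cc_on G L"
abbreviation gens where "gens \<equiv> \<Union> (Cc ` Collect (open_bisection G))"

lemma CA_simps: "carrier CA = lin_span SA gens" "vzero CA = vzero SA" "vadd CA = vadd SA"
  "vsmul CA = vsmul SA" "amul CA = amul SA" "aadj CA = aadj SA"
  by (simp_all add: Cc_alg_def)

lemma cc_iff:
  assumes U: "open_bisection G U"
  shows "f \<in> Cc U \<longleftrightarrow> f \<in> secs \<and> continuous_map (subtopology T U) TL f \<and>
    (\<exists>K. compactin T K \<and> K \<subseteq> U \<and> (\<forall>a\<in>arr - K. f a = zr a))"
proof -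
  have Ua: "U \<subseteq> arr" by (rule bisection_arr[OF U])
  let ?TU = "subtopology T U" and ?S = "{a \<in> U. f a \<noteq> zr a}"
  have tU: "topspace ?TU = U" using Ua by (auto simp: topspace_T)
  have "(compactin ?TU (?TU closure_of ?S) \<and> (\<forall>a\<in>arr - U. f a = zr a)) \<longleftrightarrow>
      (\<exists>K. compactin T K \<and> K \<subseteq> U \<and> (\<forall>a\<in>arr - K. f a = zr a))"
  proof
    assume H: "compactin ?TU (?TU closure_of ?S) \<and> (\<forall>a\<in>arr - U. f a = zr a)"
    have "?S \<subseteq> ?TU closure_of ?S" by (rule closure_of_subset) (use Ua in \<open>auto simp: topspace_T\<close>)
    hence "\<forall>a\<in>arr - ?TU closure_of ?S. f a = zr a" using H by blast
    thus "\<exists>K. compactin T K \<and> K \<subseteq> U \<and> (\<forall>a\<in>arr - K. f a = zr a)"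
      using H by (intro exI[of _ "?TU closure_of ?S"]) (simp add: compactin_subtopology)
  next
    assume "\<exists>K. compactin T K \<and> K \<subseteq> U \<and> (\<forall>a\<in>arr - K. f a = zr a)"
    then obtain K where K: "compactin T K" "K \<subseteq> U" "\<forall>a\<in>arr - K. f a = zr a" by (elim exE conjE)
    have cK: "compactin ?TU K" using K by (simp add: compactin_subtopology)
    hence clK: "closedin ?TU K" by (rule compactin_imp_closedin[OF bisection_Hausdorff[OF U]])
    have "?S \<subseteq> K" using K(3) Ua by blast
    hence "?TU closure_of ?S \<subseteq> K" by (rule closure_of_minimal[OF _ clK])
    hence "compactin ?TU (?TU closure_of ?S)" by (rule closed_compactin[OF cK _ closedin_closure_of])
    thus "compactin ?TU (?TU closure_of ?S) \<and> (\<forall>a\<in>arr - U. f a = zr a)" using K by blast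
  qed
  thus ?thesis unfolding Cc_on_def by (simp add: SA_simps)
qed

lemma ccD:
  assumes "open_bisection G U" "f \<in> Cc U"
  shows "f \<in> secs" "continuous_map (subtopology T U) TL f" "a \<in> arr \<Longrightarrow> f a \<noteq> zr a \<Longrightarrow> a \<in> U"
    "\<exists>K. compactin T K \<and> K \<subseteq> U \<and> (\<forall>a\<in>arr - K. f a = zr a)"
  using cc_iff[OF assms(1), of f] assms(2) by (simp_all add: Cc_on_def) blast

lemma cc_bounded: assumes U: "open_bisection G U" and f: "f \<in> Cc U"
  shows "\<exists>M>0. \<forall>a\<in>arr. nm (f a) \<le> M"
proof -
  obtain K where K: "compactin T K" "K \<subseteq> U" "\<forall>a\<in>arr - K. f a = zr a" using ccD(4)[OF assms] by (elim exE conjE)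
  have "compactin euclideanreal ((\<lambda>a. nm (f a)) ` K)"
    using K by (intro image_compactin[OF _ cont_norm[OF ccD(2)[OF assms]]]) (simp add: compactin_subtopology)
  hence "bounded ((\<lambda>a. nm (f a)) ` K)" by (simp add: compact_imp_bounded)
  then obtain M where M: "M > 0" "\<And>a. a \<in> K \<Longrightarrow> \<bar>nm (f a)\<bar> \<le> M" unfolding bounded_pos by auto
  have "nm (f a) \<le> M" if "a \<in> arr" for a
    using M(1) M(2)[of a] K(3) nm_zero[OF that] that by (cases "a \<in> K") auto
  thus ?thesis using M(1) by blast
qed

text \<open>A section supported on a bisection acts as a weighted partial permutation.\<close>

lemma gen_mat_unique:
  assumes U: "open_bisection G U" and f: "f \<in> Cc U"
  shows "mat f a b \<noteq> 0 \<Longrightarrow> mat f a b' \<noteq> 0 \<Longrightarrow> b = b'" "mat f a b \<noteq> 0 \<Longrightarrow> mat f a' b \<noteq> 0 \<Longrightarrow> a = a'"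
proof -
  have inj: "inj_on (rng G) U" "inj_on (src G) U" using U by (auto simp: open_bisection_def)
  have inU: "a \<star> iv b \<in> U" if nz: "mat f a b \<noteq> 0" for a b
    using ccD(3)[OF assms div_arrow(1)[OF mat_nonzeroD[OF nz]]] mat_eq_0[OF mat_nonzeroD[OF nz] ccD(1)[OF assms]] nz by simp
  show "b = b'" if nz: "mat f a b \<noteq> 0" "mat f a b' \<noteq> 0" for a b b'
  proof -
    note d = div_arrow[OF mat_nonzeroD[OF nz(1)]] and d' = div_arrow[OF mat_nonzeroD[OF nz(2)]]
    have "a \<star> iv b = a \<star> iv b'" by (rule inj_onD[OF inj(1) trans[OF d(3) d'(3)[symmetric]] inU[OF nz(1)] inU[OF nz(2)]])
    thus "b = b'" using d(6) d'(6) by metis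
  qed
  show "a = a'" if nz: "mat f a b \<noteq> 0" "mat f a' b \<noteq> 0" for a a' b
  proof -
    note d = div_arrow[OF mat_nonzeroD[OF nz(1)]] and d' = div_arrow[OF mat_nonzeroD[OF nz(2)]]
    have "a \<star> iv b = a' \<star> iv b" by (rule inj_onD[OF inj(2) trans[OF d(2) d'(2)[symmetric]] inU[OF nz(1)] inU[OF nz(2)]])
    thus "a = a'" using d(4) d'(4) by metis
  qed
qed

lemma gen_finsec: assumes U: "open_bisection G U" and f: "f \<in> Cc U" shows "f \<in> finsec"
proof -
  have fin: "finite S" if "\<And>x y. x \<in> S \<Longrightarrow> y \<in> S \<Longrightarrow> x = y" for S :: "'g set"
  proof (cases "S = {}")
    case False
    then obtain x where "x \<in> S" by blast
    hence "S \<subseteq> {x}" using that by blast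
    thus ?thesis by (rule finite_subset) simp
  qed simp
  have "finite {b. mat f a b \<noteq> 0}" "finite {b. mat f b a \<noteq> 0}" for a
    by (rule fin, rule gen_mat_unique[OF assms], simp, simp)+
  thus ?thesis using ccD(1)[OF assms] by (simp add: finsec_def)
qed

lemma gens_secs: "gens \<subseteq> carrier SA" using ccD(1) by (auto simp: SA_simps)

lemmas CA_subspace = complex_vector_space.lin_subspace_span[OF vector_space_SA gens_secs, folded CA_simps(1)]

lemma gen_CA: "open_bisection G U \<Longrightarrow> f \<in> Cc U \<Longrightarrow> f \<in> carrier CA"
  unfolding CA_simps using complex_vector_space.span_superset[OF vector_space_SA, of gens] by auto

lemma CA_ops: "vzero SA \<in> carrier CA" "f \<in> carrier CA \<Longrightarrow> g \<in> carrier CA \<Longrightarrow> vadd SA f g \<in> carrier CA"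
    "f \<in> carrier CA \<Longrightarrow> vsmul SA c f \<in> carrier CA"
  using CA_subspace by (auto simp: lin_subspace_def)

text \<open>The zero section is covered by the first case: it is supported on the empty bisection.\<close>

lemma CA_induct [consumes 1, case_names gen add smul]:
  assumes "f \<in> carrier CA" and "\<And>U f. open_bisection G U \<Longrightarrow> f \<in> Cc U \<Longrightarrow> P f"
    and "\<And>f g. f \<in> carrier CA \<Longrightarrow> g \<in> carrier CA \<Longrightarrow> P f \<Longrightarrow> P g \<Longrightarrow> P (vadd SA f g)"
    and "\<And>c f. f \<in> carrier CA \<Longrightarrow> P f \<Longrightarrow> P (vsmul SA c f)"
  shows "P f"
proof -
  have zero: "P (vzero SA)"
  proof (rule assms(2))
    show U: "open_bisection G {}" by (simp add: open_bisection_def)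
    show "vzero SA \<in> Cc {}"
      unfolding cc_iff[OF U] by (auto simp: SA_simps fb_zero continuous_map_on_empty intro!: exI[of _ "{}"])
  qed
  have CS: "carrier CA \<subseteq> carrier SA" using CA_subspace by (simp add: lin_subspace_def)
  have "lin_subspace SA {f \<in> carrier CA. P f}"
    unfolding lin_subspace_def
  proof (intro conjI ballI allI)
    show "{f \<in> carrier CA. P f} \<subseteq> carrier SA" using CS by blast
    show "vzero SA \<in> {f \<in> carrier CA. P f}" by (simp add: CA_ops(1) zero)
    fix f assume "f \<in> {f \<in> carrier CA. P f}"
    hence f: "f \<in> carrier CA" "P f" by simp_all
    show "vsmul SA c f \<in> {f \<in> carrier CA. P f}" for c using CA_ops(3)[OF f(1)] assms(4)[OF f] by simp
    fix g assume "g \<in> {f \<in> carrier CA. P f}"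
    hence g: "g \<in> carrier CA" "P g" by simp_all
    show "vadd SA f g \<in> {f \<in> carrier CA. P f}" using CA_ops(2)[OF f(1) g(1)] assms(3)[OF f(1) g(1) f(2) g(2)] by simp
  qed
  moreover have "gens \<subseteq> {f \<in> carrier CA. P f}"
  proof
    fix f assume "f \<in> gens"
    then obtain U where U: "open_bisection G U" "f \<in> Cc U" by blast
    show "f \<in> {f \<in> carrier CA. P f}" using gen_CA[OF U] assms(2)[OF U] by simp
  qed
  ultimately have "lin_span SA gens \<subseteq> {f \<in> carrier CA. P f}"
    by (rule complex_vector_space.span_minimal[OF vector_space_SA])
  thus ?thesis using assms(1) unfolding CA_simps(1) by blast
qed

lemma CA_finsec: assumes "f \<in> carrier CA" shows "f \<in> finsec"
  using assms
  by (induction rule: CA_induct) (simp_all add: gen_finsec finsec_ops)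

text \<open>An arrow has at most one factorization with factors in two given bisections.\<close>

lemma gen_mul_value:
  assumes U: "open_bisection G U" and V: "open_bisection G V" and f: "f \<in> Cc U" and g: "g \<in> Cc V"
  shows "a \<in> U \<Longrightarrow> b \<in> V \<Longrightarrow> s a = r b \<Longrightarrow> amul SA f g (a \<star> b) = f a \<diamondop> g b"
    "c \<in> arr \<Longrightarrow> c \<notin> bprod U V \<Longrightarrow> amul SA f g c = zr c"
proof -
  note fF = gen_finsec[OF U f] and fs = ccD(1)[OF U f] and gs = ccD(1)[OF V g]
  note ms = conv_secs[OF fF gs]
  have Ua: "\<And>a. a \<in> U \<Longrightarrow> a \<in> arr" and Va: "\<And>a. a \<in> V \<Longrightarrow> a \<in> arr" using bisection_arr U V by blast+
  have inj: "inj_on (rng G) U" using U by (simp add: open_bisection_def)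
  { assume a: "a \<in> U" and b: "b \<in> V" and ab: "s a = r b"
    let ?c = "a \<star> b"
    have c: "?c \<in> arr" "r ?c = r a" "s ?c = s b" using Ua[OF a] Va[OF b] ab by (simp_all add: mul_closed rng_mul src_mul)
    have cb: "?c \<star> iv b = a" using Ua[OF a] Va[OF b] ab by (simp add: mul_inv_cancel_right)
    have R: "d = b" if "mat f ?c d \<noteq> 0" for d
    proof -
      note cd = mat_nonzeroD[OF that] and D = div_arrow[OF mat_nonzeroD[OF that]]
      have "f (?c \<star> iv d) \<noteq> zr (?c \<star> iv d)" using mat_eq_0[OF cd fs] that by simp
      hence "?c \<star> iv d \<in> U" by (rule ccD(3)[OF U f D(1)])
      moreover have "r (?c \<star> iv d) = r a" using D(3) c(2) by (rule trans)
      ultimately have e: "?c \<star> iv d = a" using inj_onD[OF inj _ _ a] by blast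
      have ad: "a \<star> d = ?c" "s a = r d" using D(4) D(2) unfolding e .
      have "d = iv a \<star> (a \<star> d)" by (rule inv_mul_cancel_left[OF Ua[OF a] cd(2) ad(2), symmetric])
      also have "\<dots> = b" unfolding ad(1) by (rule inv_mul_cancel_left[OF Ua[OF a] Va[OF b] ab])
      finally show "d = b" .
    qed
    have "crd ?c (amul SA f g ?c) = (\<Sum>d | mat f ?c d \<noteq> 0. mat f ?c d * crd d (g d))"
      using crd_conv[OF fF c(1) secs_fb[OF gs]] c(1) by (simp add: SA_simps)
    also have "\<dots> = (\<Sum>d\<in>{b}. mat f ?c d * crd d (g d))"
    proof (rule sum.mono_neutral_left)
      show "{d. mat f ?c d \<noteq> 0} \<subseteq> {b}" using R by blast
    qed auto
    also have "\<dots> = crd ?c (f (?c \<star> iv b) \<diamondop> g b)"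
      using crd_lmul_mat[OF c(1) Va[OF b] c(3) fs secs_fb[OF gs Va[OF b]]] by simp
    finally have "crd ?c (amul SA f g ?c) = crd ?c (f a \<diamondop> g b)" by (simp add: cb)
    thus "amul SA f g ?c = f a \<diamondop> g b"
      using crd_inject[OF c(1) secs_fb[OF ms c(1)] lmul_closed[OF Ua[OF a] Va[OF b] ab secs_fb[OF fs Ua[OF a]] secs_fb[OF gs Va[OF b]]]]
      by simp }
  { assume c: "c \<in> arr" "c \<notin> bprod U V"
    show "amul SA f g c = zr c"
    proof (rule ccontr)
      assume "amul SA f g c \<noteq> zr c"
      from conv_nonzero[OF fF gs c(1) this]
      obtain a b where ab: "a \<in> arr" "b \<in> arr" "s a = r b" "c = a \<star> b" "f a \<noteq> zr a" "g b \<noteq> zr b" by (elim exE conjE)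
      have "a \<in> U" "b \<in> V" using ccD(3)[OF U f ab(1,5)] ccD(3)[OF V g ab(2,6)] by simp_all
      thus False using c(2) ab(3,4) by (auto simp: bprod_def)
    qed }
qed

text \<open>The two factors of an arrow in the product depend continuously on it. The support of the product
  is the image of a compact set of composable pairs, which is closed because the unit space is Hausdorff.\<close>

lemma gen_mul:
  assumes U: "open_bisection G U" and V: "open_bisection G V" and f: "f \<in> Cc U" and g: "g \<in> Cc V"
  shows "amul SA f g \<in> Cc (bprod U V)"
proof -
  let ?W = "bprod U V"
  note W = bisection_bprod[OF U V] and val = gen_mul_value[OF U V f g]
  note fs = ccD(1)[OF U f] and gs = ccD(1)[OF V g]
  have Ua: "\<And>a. a \<in> U \<Longrightarrow> a \<in> arr" and Va: "\<And>a. a \<in> V \<Longrightarrow> a \<in> arr" using bisection_arr U V by blast+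
  have Wa: "?W \<subseteq> arr" by (rule bisection_arr[OF W])
  let ?a = "\<lambda>c. the_inv_into U (rng G) (r c)" and ?b = "\<lambda>c. the_inv_into V (src G) (s c)"
  have ab: "?a c \<in> U \<and> ?b c \<in> V \<and> s (?a c) = r (?b c) \<and> c = ?a c \<star> ?b c \<and> r c \<in> rng G ` U \<and> s c \<in> src G ` V"
    if cW: "c \<in> ?W" for c
  proof -
    obtain a b where c: "c = a \<star> b" "a \<in> U" "b \<in> V" "s a = r b" using cW unfolding bprod_def by blast
    have "r c = r a" "s c = s b" using c Ua Va by (simp_all add: rng_mul src_mul)
    thus ?thesis using c rng_inverse(2)[OF U c(2)] src_inverse(2)[OF V c(3)] by simp
  qed
  have tW: "topspace (subtopology T ?W) = ?W" using Wa by (auto simp: topspace_T)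
  have "continuous_map (subtopology T ?W) (subtopology TX (rng G ` U)) (rng G)"
    by (rule continuous_map_into_subtopology[OF continuous_map_from_subtopology[OF cont_rng]]) (use ab tW in auto)
  from continuous_map_compose[OF this rng_inverse(1)[OF U]]
  have "continuous_map (subtopology T ?W) T ?a" by (simp add: o_def)
  hence ca: "continuous_map (subtopology T ?W) (subtopology T U) ?a"
    by (rule continuous_map_into_subtopology) (use ab tW in auto)
  have "continuous_map (subtopology T ?W) (subtopology TX (src G ` V)) (src G)"
    by (rule continuous_map_into_subtopology[OF continuous_map_from_subtopology[OF cont_src]]) (use ab tW in auto)
  from continuous_map_compose[OF this src_inverse(1)[OF V]]
  have "continuous_map (subtopology T ?W) T ?b" by (simp add: o_def)
  hence cb: "continuous_map (subtopology T ?W) (subtopology T V) ?b"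
    by (rule continuous_map_into_subtopology) (use ab tW in auto)
  have cfa: "continuous_map (subtopology T ?W) TL (\<lambda>c. f (?a c))" and cgb: "continuous_map (subtopology T ?W) TL (\<lambda>c. g (?b c))"
    using continuous_map_compose[OF ca ccD(2)[OF U f]] continuous_map_compose[OF cb ccD(2)[OF V g]] by (simp_all add: o_def)
  have pf: "p (f a) = a" if "a \<in> arr" for a using secs_fb[OF fs that] by (simp add: fib_iff)
  have pg: "p (g a) = a" if "a \<in> arr" for a using secs_fb[OF gs that] by (simp add: fib_iff)
  have "continuous_map (subtopology T ?W) TL (\<lambda>c. f (?a c) \<diamondop> g (?b c))"
  proof (rule cont_lmul[OF cfa cgb])
    fix c assume "c \<in> topspace (subtopology T ?W)"
    hence c: "c \<in> ?W" using tW by simp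
    show "s (p (f (?a c))) = r (p (g (?b c)))" using ab[OF c] pf[of "?a c"] pg[of "?b c"] Ua Va by simp
  qed
  hence cont: "continuous_map (subtopology T ?W) TL (amul SA f g)"
  proof (rule continuous_map_eq)
    fix c assume "c \<in> topspace (subtopology T ?W)"
    hence c: "c \<in> ?W" using tW by simp
    show "f (?a c) \<diamondop> g (?b c) = amul SA f g c" using val(1)[of "?a c" "?b c"] ab[OF c] by simp
  qed
  obtain K1 where K1: "compactin T K1" "K1 \<subseteq> U" "\<forall>a\<in>arr - K1. f a = zr a" using ccD(4)[OF U f] by (elim exE conjE)
  obtain K2 where K2: "compactin T K2" "K2 \<subseteq> V" "\<forall>a\<in>arr - K2. g a = zr a" using ccD(4)[OF V g] by (elim exE conjE)
  let ?P = "prod_topology T T" and ?Z = "{(a, b). s a = r b}"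
  let ?E = "{z \<in> topspace ?P. s (fst z) = r (snd z)}" and ?m = "\<lambda>(a, b). a \<star> b"
  have "continuous_map ?P TX (\<lambda>z. s (fst z))" "continuous_map ?P TX (\<lambda>z. r (snd z))"
    using continuous_map_compose[OF continuous_map_fst cont_src] continuous_map_compose[OF continuous_map_snd cont_rng]
    by (simp_all add: o_def)
  hence "closedin ?P ?E" by (rule closedin_continuous_maps_eq[OF Hausdorff_units])
  hence "compactin ?P (?E \<inter> K1 \<times> K2)"
    by (rule closed_Int_compactin) (use K1(1) K2(1) in \<open>simp add: compactin_Times\<close>)
  hence "compactin (subtopology ?P ?Z) (?E \<inter> K1 \<times> K2)" by (auto simp: compactin_subtopology)
  from image_compactin[OF this continuous_mul] have cK: "compactin T (?m ` (?E \<inter> K1 \<times> K2))" .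
  have KW: "?m ` (?E \<inter> K1 \<times> K2) \<subseteq> ?W" using K1(2) K2(2) by (auto simp: bprod_def) blast
  have "amul SA f g c = zr c" if c: "c \<in> arr - ?m ` (?E \<inter> K1 \<times> K2)" for c
  proof (rule ccontr)
    assume nz: "amul SA f g c \<noteq> zr c"
    from conv_nonzero[OF gen_finsec[OF U f] gs _ nz] c
    obtain a b where ab: "a \<in> arr" "b \<in> arr" "s a = r b" "c = a \<star> b" "f a \<noteq> zr a" "g b \<noteq> zr b" by auto
    have "(a, b) \<in> ?E \<inter> K1 \<times> K2" using ab K1(3) K2(3) by (auto simp: topspace_T)
    thus False using c ab(4) by force
  qed
  thus ?thesis unfolding cc_iff[OF W]
    using conv_secs[OF gen_finsec[OF U f] gs] cont cK KW by (intro conjI exI[of _ "?m ` (?E \<inter> K1 \<times> K2)"]) auto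
qed

lemma gen_adj: assumes U: "open_bisection G U" and f: "f \<in> Cc U"
  shows "aadj SA f \<in> Cc {a \<in> arr. iv a \<in> U}"
proof -
  let ?W = "{a \<in> arr. iv a \<in> U}"
  note W = bisection_inv[OF U] and fs = ccD(1)[OF U f]
  have tW: "topspace (subtopology T ?W) = ?W" by (auto simp: topspace_T)
  have ci: "continuous_map (subtopology T ?W) (subtopology T U) (ginv G)"
    by (rule continuous_map_into_subtopology[OF continuous_map_from_subtopology[OF continuous_inv]]) auto
  from continuous_map_compose[OF continuous_map_compose[OF ci ccD(2)[OF U f]] continuous_ladj]
  have "continuous_map (subtopology T ?W) TL (\<lambda>a. ld (f (iv a)))" by (simp add: o_def)
  hence cont: "continuous_map (subtopology T ?W) TL (aadj SA f)"
    by (rule continuous_map_eq) (simp add: SA_simps topspace_T)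
  obtain K where K: "compactin T K" "K \<subseteq> U" "\<forall>a\<in>arr - K. f a = zr a" using ccD(4)[OF U f] by (elim exE conjE)
  have cK: "compactin T (ginv G ` K)" by (rule image_compactin[OF K(1) continuous_inv])
  have Ka: "\<And>a. a \<in> K \<Longrightarrow> a \<in> arr" using K(2) bisection_arr[OF U] by blast
  have KW: "ginv G ` K \<subseteq> ?W" using K(2) Ka inv_inv by (auto simp: inv_closed)
  have "aadj SA f a = zr a" if a: "a \<in> arr - ginv G ` K" for a
  proof -
    have "iv a \<notin> K" using a inv_inv[of a] by (metis DiffD1 DiffD2 image_eqI)
    hence "f (iv a) = zr (iv a)" using K(3) a inv_closed[of a] by blast
    thus ?thesis using a ladj_zero[of "iv a"] inv_inv[of a] inv_closed[of a] by (simp add: SA_simps)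
  qed
  thus ?thesis unfolding cc_iff[OF W] using adj_secs[OF fs] cont cK KW by (intro conjI exI[of _ "ginv G ` K"]) auto
qed

lemma CA_mul: assumes f: "f \<in> carrier CA" and g: "g \<in> carrier CA" shows "amul SA f g \<in> carrier CA"
  using f
proof (induction rule: CA_induct)
  case (gen U f)
  show ?case
    using g
  proof (induction rule: CA_induct)
    case (gen V g)
    show ?case by (rule gen_CA[OF bisection_bprod[OF \<open>open_bisection G U\<close> gen(1)]
        gen_mul[OF \<open>open_bisection G U\<close> gen(1) \<open>f \<in> Cc U\<close> gen(2)]])
  next
    case (add g h)
    have "amul SA f (vadd SA g h) = vadd SA (amul SA f g) (amul SA f h)"
      by (rule finsec_linear_laws(2)[OF gen_finsec[OF gen] CA_finsec[OF add(1)] CA_finsec[OF add(2)]])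
    thus ?case using add CA_ops(2) by simp
  next
    case (smul c g)
    have "amul SA f (vsmul SA c g) = vsmul SA c (amul SA f g)"
      by (rule finsec_linear_laws(4)[OF gen_finsec[OF gen] CA_finsec[OF smul(1)] CA_finsec[OF smul(1)]])
    thus ?case using smul CA_ops(3) by simp
  qed
next
  case (add f h)
  have "amul SA (vadd SA f h) g = vadd SA (amul SA f g) (amul SA h g)"
    by (rule finsec_linear_laws(1)[OF CA_finsec[OF add(1)] CA_finsec[OF add(2)] CA_finsec[OF g]])
  thus ?case using add CA_ops(2) by simp
next
  case (smul c f)
  have "amul SA (vsmul SA c f) g = vsmul SA c (amul SA f g)"
    by (rule finsec_linear_laws(3)[OF CA_finsec[OF smul(1)] CA_finsec[OF g] CA_finsec[OF g]])
  thus ?case using smul CA_ops(3) by simp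
qed

lemma CA_adj: assumes f: "f \<in> carrier CA" shows "aadj SA f \<in> carrier CA"
  using f
proof (induction rule: CA_induct)
  case (gen U f) show ?case by (rule gen_CA[OF bisection_inv[OF gen(1)] gen_adj[OF gen]])
next
  case (add f g)
  have "aadj SA (vadd SA f g) = vadd SA (aadj SA f) (aadj SA g)"
    by (rule finsec_adj_laws(1)[OF CA_finsec[OF add(1)] CA_finsec[OF add(2)]])
  thus ?case using add CA_ops(2) by simp
next
  case (smul c f)
  have "aadj SA (vsmul SA c f) = vsmul SA (cnj c) (aadj SA f)"
    by (rule finsec_adj_laws(2)[OF CA_finsec[OF smul(1)] CA_finsec[OF smul(1)]])
  thus ?case using smul CA_ops(3) by simp
qed

lemma vector_space_CA: "complex_vector_space CA"
proof -
  have e: "CA = SA\<lparr>carrier := carrier CA\<rparr>" by (simp add: Cc_alg_def)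
  show ?thesis
    by (subst e) (rule complex_vector_space.complex_vector_space_subspace[OF vector_space_SA CA_subspace])
qed

lemma normed_star_algebra_CA: assumes N: "is_cstar_norm CA N" shows "normed_star_algebra CA N"
proof -
  interpret complex_vector_space CA by (rule vector_space_CA)
  have laws: "amul SA (vsmul SA z f) g = vsmul SA z (amul SA f g)" "amul SA f (vsmul SA z g) = vsmul SA z (amul SA f g)"
    "aadj SA (vsmul SA z f) = vsmul SA (cnj z) (aadj SA f)" "aadj SA (aadj SA f) = f"
    if "f \<in> finsec" "g \<in> finsec" for f g z
    using finsec_linear_laws(3,4)[OF that that(2)] finsec_adj_laws(2,3)[OF that(1,1)] by simp_all
  show ?thesis
  proof
    show adj2: "aadj CA (aadj CA a) = a" if "a \<in> carrier CA" for a
      using laws(4)[OF CA_finsec[OF that] CA_finsec[OF that]] by (simp only: CA_simps(6))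
    show adjc: "aadj CA a \<in> carrier CA" if "a \<in> carrier CA" for a
      using CA_adj[OF that] by (simp only: CA_simps(6))
    show "N (aadj CA a) = N a" if "a \<in> carrier CA" for a
      by (rule cstar_norm_adj[OF N adjc adj2 that])
    show "is_norm CA N" "\<And>a b. a \<in> carrier CA \<Longrightarrow> b \<in> carrier CA \<Longrightarrow> N (amul CA a b) \<le> N a * N b"
      using N by (simp_all add: is_cstar_norm_def)
    show "aadj CA (vsmul CA z a) = vsmul CA (cnj z) (aadj CA a)" if "a \<in> carrier CA" for a z
      using laws(3)[OF CA_finsec[OF that] CA_finsec[OF that]] by (simp only: CA_simps(2-6))
    show "amul CA (vsmul CA z a) b = vsmul CA z (amul CA a b)" "amul CA a (vsmul CA z b) = vsmul CA z (amul CA a b)"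
      if "a \<in> carrier CA" "b \<in> carrier CA" for a b z
      using laws(1,2)[OF CA_finsec[OF that(1)] CA_finsec[OF that(2)]] by (simp_all only: CA_simps(2-6))
  qed (simp_all only: CA_simps(2-6) CA_mul finsec_linear_laws(1,2) finsec_assoc finsec_adj_laws(1,4) CA_finsec)
qed

section \<open>Functions on the unit space\<close>

text \<open>Through the basis vectors over the units, these functions are the compactly supported sections over
  the unit space.\<close>

definition cfun :: "('g \<Rightarrow> complex) \<Rightarrow> bool" where
  "cfun k \<longleftrightarrow> continuous_map TX euclidean k \<and> (\<exists>K. compactin TX K \<and> (\<forall>x\<in>X - K. k x = 0))"

definition fn :: "('g \<Rightarrow> complex) \<Rightarrow> 'g \<Rightarrow> 'l" where
  "fn k = (\<lambda>a\<in>arr. if a \<in> X then k a \<cdot> bas a else zr a)"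

lemma fn_secs: "fn k \<in> secs"
  by (simp add: fn_def smul_bas fb_zero)

lemma TX_eq: "subtopology T X = TX" by (simp add: unit_top_def)

lemma fn_cc: assumes k: "cfun k" shows "fn k \<in> Cc X"
  unfolding cc_iff[OF bisection_units] TX_eq
proof (intro conjI fn_secs)
  have kc: "continuous_map TX euclidean k" using k by (simp add: cfun_def)
  obtain K where K: "compactin TX K" "\<forall>x\<in>X - K. k x = 0" using k unfolding cfun_def by (elim exE conjE)
  have "continuous_map TX TL (\<lambda>x. k x \<cdot> bas x)" by (rule cont_smul[OF kc continuous_bas])
  thus "continuous_map TX TL (fn k)"
    by (rule continuous_map_eq) (simp add: fn_def topspace_TX unitD)
  show "\<exists>K. compactin T K \<and> K \<subseteq> X \<and> (\<forall>a\<in>arr - K. fn k a = zr a)"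
    using K by (intro exI[of _ K]) (auto simp: compactin_TX fn_def fb_zero_smul bas)
qed

lemma fn_CA: "cfun k \<Longrightarrow> fn k \<in> carrier CA" by (rule gen_CA[OF bisection_units fn_cc])

lemma fn_finsec: "cfun k \<Longrightarrow> fn k \<in> finsec" by (rule CA_finsec[OF fn_CA])

lemma fn_surj: assumes f: "f \<in> Cc X"
  shows "f = fn (\<lambda>x. crd x (f x))" "cfun (\<lambda>x. crd x (f x))"
proof -
  note fs = ccD(1)[OF bisection_units f]
  have pf: "p (f x) = x" if "x \<in> arr" for x using secs_fb[OF fs that] by (simp add: fib_iff)
  have "continuous_map TX TL f" using ccD(2)[OF bisection_units f] by (simp add: TX_eq)
  hence "continuous_map TX euclidean (\<lambda>x. crd (p (f x)) (f x))"
    by (rule cont_crd) (simp add: topspace_TX pf unitD(1))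
  hence c: "continuous_map TX euclidean (\<lambda>x. crd x (f x))"
    by (rule continuous_map_eq) (simp add: topspace_TX pf unitD(1))
  obtain K where K: "compactin T K" "K \<subseteq> X" "\<forall>a\<in>arr - K. f a = zr a"
    using ccD(4)[OF bisection_units f] by (elim exE conjE)
  have "\<forall>x\<in>X - K. crd x (f x) = 0" using K(3) by (auto simp: crd_zero unitD(1))
  thus "cfun (\<lambda>x. crd x (f x))" unfolding cfun_def using c K(1,2) compactin_TX by blast
  show "f = fn (\<lambda>x. crd x (f x))"
  proof (rule secs_eqI[OF fs fn_secs])
    fix a assume a: "a \<in> arr"
    show "f a = fn (\<lambda>x. crd x (f x)) a"
      using ccD(3)[OF bisection_units f a] crd[OF a secs_fb[OF fs a]] a by (auto simp: fn_def)
  qed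
qed

lemma crd_fn: "x \<in> X \<Longrightarrow> crd x (fn k x) = k x"
  by (simp add: fn_def unitD(1) smul_bas)

lemma mat_fn: "mat (fn k) a b = (if a \<in> arr \<and> a = b then k (r a) else 0)"
proof (cases "a \<in> arr \<and> b \<in> arr \<and> s a = s b")
  case True
  hence ab: "a \<in> arr" "b \<in> arr" "s a = s b" by auto
  note d = div_arrow[OF ab]
  show ?thesis
  proof (cases "a \<star> iv b \<in> X")
    case True
    have e: "a \<star> iv b = r b" by (rule trans[OF unitD(2)[OF True, symmetric] d(2)])
    have "a = b" using d(4) rng_mul_self[OF ab(2)] unfolding e by simp
    thus ?thesis using mat_diag[OF fn_secs ab(1)] ab crd_fn[OF rng_unit[OF ab(1)]] by simp
  next
    case False
    hence "fn k (a \<star> iv b) = zr (a \<star> iv b)" using d(1) by (simp add: fn_def)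
    hence "mat (fn k) a b = 0" using mat_eq_0[OF ab fn_secs] by simp
    moreover have "a \<noteq> b" using False mul_inv[OF ab(1)] rng_unit[OF ab(1)] by auto
    ultimately show ?thesis by simp
  qed
qed (auto simp: mat_def)

lemma mat_fn_mul: assumes k: "cfun k" and f: "f \<in> secs" shows "mat (amul SA (fn k) f) a b = k (r a) * mat f a b"
proof (cases "a \<in> arr")
  case True
  have "mat (amul SA (fn k) f) a b = (\<Sum>c\<in>{a}. mat (fn k) a c * mat f c b)"
    by (rule mat_mul_superset[OF fn_finsec[OF k] f]) (auto simp: mat_fn)
  thus ?thesis using True by (simp add: mat_fn)
qed (simp add: mat_def)

lemma mat_mul_fn: assumes k: "cfun k" and f: "f \<in> finsec" shows "mat (amul SA f (fn k)) a b = mat f a b * k (r b)"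
proof (cases "b \<in> arr")
  case True
  have "mat (amul SA f (fn k)) a b = (\<Sum>c\<in>{b}. mat f a c * mat (fn k) c b)"
    by (rule mat_mul_superset'[OF f fn_secs]) (auto simp: mat_fn)
  thus ?thesis using True by (simp add: mat_fn)
qed (simp add: mat_def)

lemma fn_mul_value:
  assumes k: "cfun k" and f: "f \<in> finsec" and a: "a \<in> arr"
  shows "crd a (amul SA (fn k) f a) = k (r a) * crd a (f a)" "crd a (amul SA f (fn k) a) = k (s a) * crd a (f a)"
  using mat_fn_mul[OF k finsec_secs[OF f], of a "s a"] mat_mul_fn[OF k f, of a "s a"] a
    mat_src[OF conv_secs[OF fn_finsec[OF k] finsec_secs[OF f]] a] mat_src[OF conv_secs[OF f fn_secs] a] mat_src[OF finsec_secs[OF f] a]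
  by (simp_all add: grp)

lemma cfun_comp: assumes "cfun k" "continuous_on UNIV \<theta>" "\<theta> 0 = 0" shows "cfun (\<lambda>x. \<theta> (k x))"
proof -
  have "continuous_map euclidean euclidean \<theta>" using assms(2) by simp
  from continuous_map_compose[OF _ this] assms(1)
  have "continuous_map TX euclidean (\<lambda>x. \<theta> (k x))" unfolding cfun_def o_def by blast
  thus ?thesis using assms(1,3) unfolding cfun_def by metis
qed

lemma continuous_map_cmult:
  assumes "continuous_map Z euclidean (k :: _ \<Rightarrow> complex)" "continuous_map Z euclidean l"
  shows "continuous_map Z euclidean (\<lambda>x. k x * l x)"
proof -
  have "continuous_map Z (prod_topology euclidean euclidean) (\<lambda>x. (k x, l x))" by (rule continuous_map_pairedI[OF assms])
  hence 1: "continuous_map Z euclidean (\<lambda>x. (k x, l x))" by simp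
  have 2: "continuous_map euclidean euclidean (\<lambda>z :: complex \<times> complex. fst z * snd z)"
    by (simp add: continuous_on_mult continuous_on_fst continuous_on_snd continuous_on_id)
  from continuous_map_compose[OF 1 2] show ?thesis by (simp add: o_def)
qed

lemma cfun_mult: assumes k: "cfun k" and l: "continuous_map TX euclidean l" shows "cfun (\<lambda>x. k x * l x)"
proof -
  have "continuous_map TX euclidean (\<lambda>x. k x * l x)" using k l by (intro continuous_map_cmult) (simp_all add: cfun_def)
  thus ?thesis using k unfolding cfun_def by (metis mult_zero_left)
qed

lemma fn_ops:
  assumes "cfun k" "cfun l"
  shows "amul SA (fn k) (fn l) = fn (\<lambda>x. k x * l x)" "aadj SA (fn k) = fn (\<lambda>x. cnj (k x))"
    "vsmul SA c (fn k) = fn (\<lambda>x. c * k x)" "vadd SA (fn k) (fn l) = fn (\<lambda>x. k x + l x)"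
proof -
  show "amul SA (fn k) (fn l) = fn (\<lambda>x. k x * l x)"
    by (rule mat_inject[OF conv_secs[OF fn_finsec[OF assms(1)] fn_secs] fn_secs])
       (auto simp: mat_fn_mul[OF assms(1) fn_secs] mat_fn)
  show "aadj SA (fn k) = fn (\<lambda>x. cnj (k x))"
    by (rule mat_inject[OF adj_secs[OF fn_secs] fn_secs]) (auto simp: mat_adj[OF fn_secs] mat_fn)
  show "vsmul SA c (fn k) = fn (\<lambda>x. c * k x)"
    by (rule mat_inject[OF secs_ops(2)[OF fn_secs] fn_secs]) (auto simp: mat_smul[OF fn_secs] mat_fn)
  show "vadd SA (fn k) (fn l) = fn (\<lambda>x. k x + l x)"
    by (rule mat_inject[OF secs_ops(1)[OF fn_secs fn_secs] fn_secs]) (auto simp: mat_add[OF fn_secs fn_secs] mat_fn)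
qed

lemma bump:
  assumes K: "compactin TX K" and V: "openin TX V" "K \<subseteq> V"
  shows "\<exists>k :: 'g \<Rightarrow> real. cfun (\<lambda>x. of_real (k x)) \<and> (\<forall>x. 0 \<le> k x \<and> k x \<le> 1) \<and> (\<forall>x\<in>K. k x = 1) \<and>
    (\<forall>x\<in>X. x \<notin> V \<longrightarrow> k x = 0) \<and> (\<exists>K'. compactin TX K' \<and> K' \<subseteq> V \<and> (\<forall>x\<in>X - K'. k x = 0))"
proof -
  obtain k :: "'g \<Rightarrow> real" and K' where k: "continuous_map TX euclidean k" "\<And>x. 0 \<le> k x" "\<And>x. k x \<le> 1"
    "\<And>x. x \<in> K \<Longrightarrow> k x = 1" "compactin TX K'" "K' \<subseteq> V" "\<And>x. x \<in> topspace TX - K' \<Longrightarrow> k x = 0"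
    by (rule Urysohn_compact_support[OF Hausdorff_units locally_compact_units K V], rule that)
  have "continuous_map euclideanreal euclidean complex_of_real" by (simp add: continuous_on_of_real)
  from continuous_map_compose[OF k(1) this]
  have c: "continuous_map TX euclidean (\<lambda>x. complex_of_real (k x))" by (simp add: o_def)
  have z: "k x = 0" if "x \<in> X - K'" for x using k(7)[of x] that by (simp add: topspace_TX)
  have "cfun (\<lambda>x. of_real (k x))" unfolding cfun_def using c k(5) z by (intro conjI exI[of _ K']) auto
  moreover have "\<forall>x\<in>X. x \<notin> V \<longrightarrow> k x = 0" using z k(6) by blast
  moreover have "\<exists>K'. compactin TX K' \<and> K' \<subseteq> V \<and> (\<forall>x\<in>X - K'. k x = 0)" using k(5,6) z by blast
  moreover have "\<forall>x. 0 \<le> k x \<and> k x \<le> 1" "\<forall>x\<in>K. k x = 1" using k(2,3,4) by simp_all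
  ultimately show ?thesis by blast
qed

end

section \<open>The reduced norm\<close>

lemma infsum_nonneg_le:
  fixes h :: "'a \<Rightarrow> real"
  assumes "\<And>a. a \<in> A \<Longrightarrow> 0 \<le> h a" "\<And>F. finite F \<Longrightarrow> F \<subseteq> A \<Longrightarrow> sum h F \<le> C"
  shows "h summable_on A" "infsum h A \<le> C"
proof -
  show s: "h summable_on A"
    by (rule nonneg_bdd_above_summable_on[OF assms(1)]) (auto intro!: bdd_aboveI[of _ C] assms(2))
  show "infsum h A \<le> C" by (rule infsum_le_finite_sums[OF s assms(2)])
qed

context fell_groupoid
begin

abbreviation gx where "gx x \<equiv> src_fibre G x"

lemma gx_iff: "a \<in> gx x \<longleftrightarrow> a \<in> arr \<and> s a = x"
  by (simp add: src_fibre_def)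

definition blk where "blk f \<xi> E F = L2_set (\<lambda>a. cmod (\<Sum>b\<in>F. mat f a b * \<xi> b)) E"

text \<open>As rows and columns are finite, the norms of finite blocks determine the norm of the operator on
  square-summable sections.\<close>

definition bnd where
  "bnd x f M \<longleftrightarrow> (\<forall>E F \<xi>. finite E \<and> finite F \<and> E \<subseteq> gx x \<and> F \<subseteq> gx x \<longrightarrow> blk f \<xi> E F \<le> M * L2_set (\<lambda>b. cmod (\<xi> b)) F)"

lemma bndD: "bnd x f M \<Longrightarrow> finite E \<Longrightarrow> finite F \<Longrightarrow> E \<subseteq> gx x \<Longrightarrow> F \<subseteq> gx x \<Longrightarrow>
   blk f \<xi> E F \<le> M * L2_set (\<lambda>b. cmod (\<xi> b)) F"
  unfolding bnd_def by blast

lemma bndI: "(\<And>E F \<xi>. finite E \<Longrightarrow> finite F \<Longrightarrow> E \<subseteq> gx x \<Longrightarrow> F \<subseteq> gx x \<Longrightarrow>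
   blk f \<xi> E F \<le> M * L2_set (\<lambda>b. cmod (\<xi> b)) F) \<Longrightarrow> bnd x f M"
  unfolding bnd_def by blast

lemma bnd_mono: assumes "bnd x f M" "M \<le> M'" shows "bnd x f M'"
  by (rule bndI) (rule order_trans[OF bndD[OF assms(1)] mult_right_mono[OF assms(2) L2_set_nonneg]])

lemma bnd_add: assumes f: "f \<in> secs" "bnd x f M" and g: "g \<in> secs" "bnd x g M'" shows "bnd x (vadd SA f g) (M + M')"
proof (rule bndI)
  fix E F \<xi> assume H: "finite E" "finite F" "E \<subseteq> gx x" "F \<subseteq> gx x"
  have "blk (vadd SA f g) \<xi> E F \<le> L2_set (\<lambda>a. cmod (\<Sum>b\<in>F. mat f a b * \<xi> b) + cmod (\<Sum>b\<in>F. mat g a b * \<xi> b)) E"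
    unfolding blk_def mat_add[OF f(1) g(1)] distrib_right sum.distrib by (rule L2_set_mono) (auto intro: norm_triangle_ineq)
  also have "\<dots> \<le> blk f \<xi> E F + blk g \<xi> E F" unfolding blk_def by (rule L2_set_triangle_ineq)
  also have "\<dots> \<le> M * L2_set (\<lambda>b. cmod (\<xi> b)) F + M' * L2_set (\<lambda>b. cmod (\<xi> b)) F"
    by (rule add_mono[OF bndD[OF f(2) H] bndD[OF g(2) H]])
  finally show "blk (vadd SA f g) \<xi> E F \<le> (M + M') * L2_set (\<lambda>b. cmod (\<xi> b)) F" by (simp add: distrib_right)
qed

lemma bnd_smul: assumes f: "f \<in> secs" "bnd x f M" shows "bnd x (vsmul SA c f) (cmod c * M)"
proof (rule bndI)
  fix E F \<xi> assume H: "finite E" "finite F" "E \<subseteq> gx x" "F \<subseteq> gx x"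
  have "blk (vsmul SA c f) \<xi> E F = cmod c * blk f \<xi> E F"
    unfolding blk_def mat_smul[OF f(1)]
    by (simp add: mult.assoc norm_mult L2_set_right_distrib flip: sum_distrib_left)
  also have "\<dots> \<le> cmod c * (M * L2_set (\<lambda>b. cmod (\<xi> b)) F)" by (rule mult_left_mono[OF bndD[OF f(2) H]]) simp
  finally show "blk (vsmul SA c f) \<xi> E F \<le> cmod c * M * L2_set (\<lambda>b. cmod (\<xi> b)) F" by (simp add: mult.assoc)
qed

lemma row_gx: assumes "E \<subseteq> gx x" shows "(\<Union>a\<in>E. {b. mat f a b \<noteq> 0}) \<subseteq> gx x"
proof
  fix b assume "b \<in> (\<Union>a\<in>E. {b. mat f a b \<noteq> 0})"
  then obtain a where a: "a \<in> E" and nz: "mat f a b \<noteq> 0" by blast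
  show "b \<in> gx x" using a assms mat_nonzeroD[OF nz] by (auto simp: gx_iff)
qed

lemma bnd_mul: assumes f: "f \<in> finsec" "bnd x f M" and g: "g \<in> finsec" "bnd x g M'" and M: "0 \<le> M"
  shows "bnd x (amul SA f g) (M * M')"
proof (rule bndI)
  fix E F \<xi> assume H: "finite E" "finite F" "E \<subseteq> gx x" "F \<subseteq> gx x"
  let ?R = "\<Union>a\<in>E. {b. mat f a b \<noteq> 0}"
  have R: "finite ?R" "?R \<subseteq> gx x"
    using finite_row[OF f(1)] H row_gx[OF H(3)] by simp_all
  define \<eta> where "\<eta> b = (\<Sum>c\<in>F. mat g b c * \<xi> c)" for b
  have "(\<Sum>c\<in>F. mat (amul SA f g) a c * \<xi> c) = (\<Sum>b\<in>?R. mat f a b * \<eta> b)" if a: "a \<in> E" for a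
  proof -
    have sub: "{b. mat f a b \<noteq> 0} \<subseteq> ?R" using a by blast
    have "(\<Sum>c\<in>F. mat (amul SA f g) a c * \<xi> c) = (\<Sum>c\<in>F. \<Sum>b\<in>?R. mat f a b * mat g b c * \<xi> c)"
      by (rule sum.cong[OF refl]) (simp only: mat_mul_superset[OF f(1) finsec_secs[OF g(1)] R(1) sub] sum_distrib_right)
    also have "\<dots> = (\<Sum>b\<in>?R. \<Sum>c\<in>F. mat f a b * mat g b c * \<xi> c)" by (rule sum.swap)
    also have "\<dots> = (\<Sum>b\<in>?R. mat f a b * \<eta> b)" unfolding \<eta>_def sum_distrib_left mult.assoc ..
    finally show ?thesis .
  qed
  hence "blk (amul SA f g) \<xi> E F = blk f \<eta> E ?R" unfolding blk_def by (intro L2_set_cong) simp_all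
  also have "\<dots> \<le> M * L2_set (\<lambda>b. cmod (\<eta> b)) ?R" by (rule bndD[OF f(2) H(1) R(1) H(3) R(2)])
  also have "L2_set (\<lambda>b. cmod (\<eta> b)) ?R = blk g \<xi> ?R F" by (simp add: blk_def \<eta>_def)
  also have "M * \<dots> \<le> M * (M' * L2_set (\<lambda>b. cmod (\<xi> b)) F)"
    by (rule mult_left_mono[OF bndD[OF g(2) R(1) H(2) R(2) H(4)] M])
  finally show "blk (amul SA f g) \<xi> E F \<le> M * M' * L2_set (\<lambda>b. cmod (\<xi> b)) F" by (simp add: mult.assoc)
qed

lemma sum_sq_L2: "finite E \<Longrightarrow> (\<Sum>a\<in>E. cnj (u a) * u a) = of_real ((L2_set (\<lambda>a. cmod (u a)) E)\<^sup>2)"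
  by (simp add: L2_set_def sum_nonneg complex_norm_square mult.commute del: of_real_power)

lemma cmod_sum_le_L2: "cmod (\<Sum>a\<in>E. u a * v a) \<le> L2_set (\<lambda>a. cmod (u a)) E * L2_set (\<lambda>a. cmod (v a)) E"
proof -
  have "cmod (\<Sum>a\<in>E. u a * v a) \<le> (\<Sum>a\<in>E. \<bar>cmod (u a)\<bar> * \<bar>cmod (v a)\<bar>)"
    using norm_sum[of "\<lambda>a. u a * v a" E] by (simp add: norm_mult)
  also have "\<dots> \<le> L2_set (\<lambda>a. cmod (u a)) E * L2_set (\<lambda>a. cmod (v a)) E" by (rule L2_set_mult_ineq)
  finally show ?thesis .
qed

lemma cmod_of_real_eq: "0 \<le> t \<Longrightarrow> of_real t = z \<Longrightarrow> t = cmod z"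
  by auto

lemma bnd_adj: assumes f: "f \<in> secs" "bnd x f M" shows "bnd x (aadj SA f) M"
proof (rule bndI)
  fix E F \<xi> assume H: "finite E" "finite F" "E \<subseteq> gx x" "F \<subseteq> gx x"
  define \<eta> where "\<eta> a = (\<Sum>b\<in>F. mat (aadj SA f) a b * \<xi> b)" for a
  let ?n = "L2_set (\<lambda>a. cmod (\<eta> a)) E"
  have n: "blk (aadj SA f) \<xi> E F = ?n" by (simp add: blk_def \<eta>_def)
  have "of_real (?n\<^sup>2) = (\<Sum>a\<in>E. cnj (\<eta> a) * (\<Sum>b\<in>F. mat (aadj SA f) a b * \<xi> b))"
    unfolding \<eta>_def[symmetric] by (rule sum_sq_L2[OF H(1), symmetric])
  also have "\<dots> = (\<Sum>a\<in>E. \<Sum>b\<in>F. cnj (mat f b a * \<eta> a) * \<xi> b)"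
    by (simp only: sum_distrib_left mat_adj[OF f(1)] complex_cnj_mult mult_ac)
  also have "\<dots> = (\<Sum>b\<in>F. \<Sum>a\<in>E. cnj (mat f b a * \<eta> a) * \<xi> b)" by (rule sum.swap)
  also have "\<dots> = (\<Sum>b\<in>F. cnj (\<Sum>a\<in>E. mat f b a * \<eta> a) * \<xi> b)" by (simp only: sum_distrib_right cnj_sum)
  finally have "?n\<^sup>2 = cmod (\<Sum>b\<in>F. cnj (\<Sum>a\<in>E. mat f b a * \<eta> a) * \<xi> b)"
    by (rule cmod_of_real_eq[OF zero_le_power2])
  also have "\<dots> \<le> L2_set (\<lambda>b. cmod (cnj (\<Sum>a\<in>E. mat f b a * \<eta> a))) F * L2_set (\<lambda>b. cmod (\<xi> b)) F"
    by (rule cmod_sum_le_L2)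
  also have "L2_set (\<lambda>b. cmod (cnj (\<Sum>a\<in>E. mat f b a * \<eta> a))) F = blk f \<eta> F E"
    unfolding blk_def complex_mod_cnj ..
  also have "\<dots> * L2_set (\<lambda>b. cmod (\<xi> b)) F \<le> (M * ?n) * L2_set (\<lambda>b. cmod (\<xi> b)) F"
    by (rule mult_right_mono[OF bndD[OF f(2) H(2,1,4,3)] L2_set_nonneg])
  finally have le: "?n * ?n \<le> ?n * (M * L2_set (\<lambda>b. cmod (\<xi> b)) F)" by (simp add: power2_eq_square mult.commute mult.left_commute)
  show "blk (aadj SA f) \<xi> E F \<le> M * L2_set (\<lambda>b. cmod (\<xi> b)) F"
  proof (cases "?n = 0")
    case True
    have "blk f (\<lambda>_. 1) F F \<le> M * L2_set (\<lambda>b. cmod (1::complex)) F" by (rule bndD[OF f(2) H(2,2,4,4)])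
    hence M: "0 \<le> M * L2_set (\<lambda>b. 1) F" unfolding blk_def using order_trans[OF L2_set_nonneg] by simp
    have "0 \<le> M * L2_set (\<lambda>b. cmod (\<xi> b)) F"
    proof (cases "0 \<le> M")
      case False
      have "L2_set (\<lambda>b. 1::real) F = 0" using M False L2_set_nonneg[of "\<lambda>b. 1::real" F] by (simp add: zero_le_mult_iff)
      hence "F = {}" using L2_set_eq_0_iff[OF H(2), of "\<lambda>b. 1"] by auto
      thus ?thesis by simp
    qed (simp add: L2_set_nonneg)
    thus ?thesis using True n by simp
  next
    case False
    hence "?n > 0" using L2_set_nonneg[of "\<lambda>a. cmod (\<eta> a)" E] by (simp only: less_le) simp
    thus ?thesis using le n by simp
  qed
qed

text \<open>The quadratic form of \<open>f\<^sup>*f\<close> at \<open>\<xi>\<close> is \<open>\<parallel>f\<xi>\<parallel>\<^sup>2\<close>.\<close>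

lemma square_form:
  assumes f: "f \<in> finsec" and F: "finite F" and R: "finite R" "(\<Union>b\<in>F. {a. mat f a b \<noteq> 0}) \<subseteq> R"
  shows "(\<Sum>b\<in>F. cnj (\<xi> b) * (\<Sum>c\<in>F. mat (amul SA (aadj SA f) f) b c * \<xi> c))
    = of_real ((L2_set (\<lambda>a. cmod (\<Sum>b\<in>F. mat f a b * \<xi> b)) R)\<^sup>2)"
proof -
  note fs = finsec_secs[OF f]
  define \<eta> where "\<eta> a = (\<Sum>b\<in>F. mat f a b * \<xi> b)" for a
  let ?h = "amul SA (aadj SA f) f"
  have mh: "mat ?h b c = (\<Sum>a\<in>R. cnj (mat f a b) * mat f a c)" if "c \<in> F" for b c
  proof -
    have sub: "{a. mat f a c \<noteq> 0} \<subseteq> R" using that R(2) by blast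
    show ?thesis using mat_mul_superset'[OF finsec_adj[OF f] fs R(1) sub] by (simp add: mat_adj[OF fs])
  qed
  have "of_real ((L2_set (\<lambda>a. cmod (\<eta> a)) R)\<^sup>2) = (\<Sum>a\<in>R. cnj (\<eta> a) * \<eta> a)" by (rule sum_sq_L2[OF R(1), symmetric])
  also have "\<dots> = (\<Sum>a\<in>R. \<Sum>b\<in>F. \<Sum>c\<in>F. cnj (\<xi> b) * (cnj (mat f a b) * mat f a c * \<xi> c))"
  proof (rule sum.cong[OF refl])
    fix a
    have "cnj (\<eta> a) * \<eta> a = (\<Sum>b\<in>F. \<Sum>c\<in>F. cnj (mat f a b * \<xi> b) * (mat f a c * \<xi> c))"
      unfolding \<eta>_def cnj_sum by (rule sum_product)
    thus "cnj (\<eta> a) * \<eta> a = (\<Sum>b\<in>F. \<Sum>c\<in>F. cnj (\<xi> b) * (cnj (mat f a b) * mat f a c * \<xi> c))"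
      by (simp only: complex_cnj_mult mult_ac)
  qed
  also have "\<dots> = (\<Sum>b\<in>F. \<Sum>a\<in>R. \<Sum>c\<in>F. cnj (\<xi> b) * (cnj (mat f a b) * mat f a c * \<xi> c))" by (rule sum.swap)
  also have "\<dots> = (\<Sum>b\<in>F. cnj (\<xi> b) * (\<Sum>c\<in>F. mat ?h b c * \<xi> c))"
  proof (rule sum.cong[OF refl])
    fix b assume "b \<in> F"
    have "(\<Sum>a\<in>R. \<Sum>c\<in>F. cnj (\<xi> b) * (cnj (mat f a b) * mat f a c * \<xi> c))
        = (\<Sum>c\<in>F. \<Sum>a\<in>R. cnj (\<xi> b) * (cnj (mat f a b) * mat f a c * \<xi> c))" by (rule sum.swap)
    also have "\<dots> = (\<Sum>c\<in>F. cnj (\<xi> b) * (mat ?h b c * \<xi> c))"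
      by (rule sum.cong[OF refl]) (simp only: mh sum_distrib_left sum_distrib_right)
    finally show "(\<Sum>a\<in>R. \<Sum>c\<in>F. cnj (\<xi> b) * (cnj (mat f a b) * mat f a c * \<xi> c))
        = cnj (\<xi> b) * (\<Sum>c\<in>F. mat ?h b c * \<xi> c)" by (simp only: sum_distrib_left)
  qed
  finally show ?thesis by (simp only: \<eta>_def)
qed

lemma bnd_cstar: assumes f: "f \<in> finsec" and b: "bnd x (amul SA (aadj SA f) f) (M\<^sup>2)" and M: "0 \<le> M" shows "bnd x f M"
proof (rule bndI)
  fix E F \<xi> assume H: "finite E" "finite F" "E \<subseteq> gx x" "F \<subseteq> gx x"
  let ?R = "E \<union> (\<Union>b\<in>F. {a. mat f a b \<noteq> 0})"
  have R: "finite ?R" using finite_col[OF f] H by simp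
  let ?n = "L2_set (\<lambda>a. cmod (\<Sum>b\<in>F. mat f a b * \<xi> b)) ?R" and ?x = "L2_set (\<lambda>b. cmod (\<xi> b)) F"
  have "blk f \<xi> E F \<le> ?n"
    unfolding blk_def L2_set_def
    by (rule real_sqrt_le_mono, rule sum_mono2[OF R]) auto
  also have "?n \<le> M * ?x"
  proof (rule power2_le_imp_le)
    let ?h = "amul SA (aadj SA f) f"
    have "?n\<^sup>2 = cmod (\<Sum>b\<in>F. cnj (\<xi> b) * (\<Sum>c\<in>F. mat ?h b c * \<xi> c))"
      by (rule cmod_of_real_eq[OF zero_le_power2 square_form[OF f H(2) R, symmetric]]) simp
    also have "\<dots> \<le> L2_set (\<lambda>b. cmod (cnj (\<xi> b))) F * L2_set (\<lambda>b. cmod (\<Sum>c\<in>F. mat ?h b c * \<xi> c)) F"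
      by (rule cmod_sum_le_L2)
    also have "\<dots> = ?x * blk ?h \<xi> F F" by (simp add: blk_def)
    also have "\<dots> \<le> ?x * (M\<^sup>2 * ?x)" by (rule mult_left_mono[OF bndD[OF b H(2,2,4,4)] L2_set_nonneg])
    finally show "?n\<^sup>2 \<le> (M * ?x)\<^sup>2" by (simp add: power_mult_distrib power2_eq_square mult.commute mult.left_commute)
    show "0 \<le> M * ?x" using M by (simp add: L2_set_nonneg)
  qed
  finally show "blk f \<xi> E F \<le> M * ?x" .
qed

lemma bnd_gen:
  assumes U: "open_bisection G U" and f: "f \<in> Cc U" and M0: "0 \<le> M" and M: "\<And>a. a \<in> arr \<Longrightarrow> nm (f a) \<le> M"
  shows "bnd x f M"
proof (rule bndI)
  fix E F \<xi> assume H: "finite E" "finite F" "E \<subseteq> gx x" "F \<subseteq> gx x"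
  note fF = gen_finsec[OF U f] and fs = ccD(1)[OF U f]
  note row = gen_mat_unique(1)[OF U f] and col = gen_mat_unique(2)[OF U f]
  let ?E = "{a \<in> E. \<exists>b\<in>F. mat f a b \<noteq> 0}"
  define q where "q a = (SOME b. b \<in> F \<and> mat f a b \<noteq> 0)" for a
  have q: "q a \<in> F" "mat f a (q a) \<noteq> 0" if "a \<in> ?E" for a
  proof -
    have "\<exists>b. b \<in> F \<and> mat f a b \<noteq> 0" using that by blast
    hence "q a \<in> F \<and> mat f a (q a) \<noteq> 0" unfolding q_def by (rule someI_ex)
    thus "q a \<in> F" "mat f a (q a) \<noteq> 0" by simp_all
  qed
  have le: "cmod (\<Sum>b\<in>F. mat f a b * \<xi> b) \<le> M * cmod (\<xi> (q a))" if a: "a \<in> ?E" for a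
  proof -
    have "(\<Sum>b\<in>F. mat f a b * \<xi> b) = (\<Sum>b\<in>{q a}. mat f a b * \<xi> b)"
      proof (rule sum.mono_neutral_right[OF H(2)])
      show "{q a} \<subseteq> F" using q(1)[OF a] by simp
      show "\<forall>b\<in>F - {q a}. mat f a b * \<xi> b = 0"
      proof
        fix b assume b: "b \<in> F - {q a}"
        have "mat f a b = 0"
        proof (rule ccontr)
          assume "mat f a b \<noteq> 0"
          from row[OF this q(2)[OF a]] show False using b by simp
        qed
        thus "mat f a b * \<xi> b = 0" by simp
      qed
    qed
    moreover have "cmod (mat f a (q a)) \<le> M"
      using mat_fb(4)[OF mat_nonzeroD[OF q(2)[OF a]] fs] M[OF div_arrow(1)[OF mat_nonzeroD[OF q(2)[OF a]]]] by simp
    ultimately show ?thesis by (simp add: norm_mult mult_right_mono)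
  qed
  have "blk f \<xi> E F = L2_set (\<lambda>a. cmod (\<Sum>b\<in>F. mat f a b * \<xi> b)) ?E"
    unfolding blk_def L2_set_def
    by (rule arg_cong[where f=sqrt], rule sum.mono_neutral_right[OF H(1)]) (auto simp: sum.neutral)
  also have "\<dots> \<le> L2_set (\<lambda>a. M * cmod (\<xi> (q a))) ?E" by (rule L2_set_mono[OF le norm_ge_zero])
  also have "\<dots> = M * L2_set (\<lambda>a. cmod (\<xi> (q a))) ?E" by (rule L2_set_right_distrib[OF M0, symmetric])
  also have "\<dots> \<le> M * L2_set (\<lambda>b. cmod (\<xi> b)) F"
  proof (rule mult_left_mono[OF _ M0])
    have iq: "inj_on q ?E"
    proof (rule inj_onI)
      fix a a' assume aa: "a \<in> ?E" "a' \<in> ?E" and e: "q a = q a'"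
      show "a = a'" by (rule col[OF q(2)[OF aa(1)], unfolded e, OF q(2)[OF aa(2)]])
    qed
    have qF: "q ` ?E \<subseteq> F"
    proof
      fix b assume "b \<in> q ` ?E"
      then obtain a where a: "a \<in> ?E" "b = q a" by (rule imageE)
      show "b \<in> F" unfolding a(2) by (rule q(1)[OF a(1)])
    qed
    have "(\<Sum>a\<in>?E. (cmod (\<xi> (q a)))\<^sup>2) = (\<Sum>b\<in>q ` ?E. (cmod (\<xi> b))\<^sup>2)" by (simp add: sum.reindex[OF iq])
    also have "\<dots> \<le> (\<Sum>b\<in>F. (cmod (\<xi> b))\<^sup>2)" by (rule sum_mono2[OF H(2) qF]) simp
    finally show "L2_set (\<lambda>a. cmod (\<xi> (q a))) ?E \<le> L2_set (\<lambda>b. cmod (\<xi> b)) F" unfolding L2_set_def by (rule real_sqrt_le_mono)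
  qed
  finally show "blk f \<xi> E F \<le> M * L2_set (\<lambda>b. cmod (\<xi> b)) F" .
qed

lemma CA_bnd: assumes "f \<in> carrier CA" shows "\<exists>M\<ge>0. \<forall>x. bnd x f M"
  using assms
proof (induction rule: CA_induct)
  case (gen U f)
  obtain M where M: "M > 0" "\<forall>a\<in>arr. nm (f a) \<le> M" using cc_bounded[OF gen] by blast
  have "bnd x f M" for x by (rule bnd_gen[OF gen less_imp_le[OF M(1)] bspec[OF M(2)]])
  thus ?case using M(1) by (intro exI[of _ M]) simp
next
  case (add f g)
  obtain M M' where "M \<ge> 0" "\<forall>x. bnd x f M" "M' \<ge> 0" "\<forall>x. bnd x g M'" using add(3,4) by blast
  thus ?case using bnd_add[OF finsec_secs[OF CA_finsec[OF add(1)]] _ finsec_secs[OF CA_finsec[OF add(2)]]]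
    by (intro exI[of _ "M + M'"]) simp
next
  case (smul c f)
  obtain M where "M \<ge> 0" "\<forall>x. bnd x f M" using smul(2) by blast
  thus ?case using bnd_smul[OF finsec_secs[OF CA_finsec[OF smul(1)]]] by (intro exI[of _ "cmod c * M"]) simp
qed

lemma crd_regular_rep:
  assumes f: "f \<in> finsec" and x: "\<xi> \<in> (\<Pi>\<^sub>E a\<in>gx x. fb a)" and a: "a \<in> gx x"
  shows "nm (regular_rep G L x f \<xi> a) = cmod (\<Sum>c | mat f a c \<noteq> 0. mat f a c * crd c (\<xi> c))"
proof -
  have aa: "a \<in> arr" "s a = x" using a by (simp_all add: gx_iff)
  have e: "\<xi> c \<in> fb c" if "c \<in> arr" "s c = s a" for c using PiE_mem[OF x, of c] that aa by (simp add: gx_iff)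
  have "regular_rep G L x f \<xi> a = fibre_sum L a (\<lambda>(b, c). f b \<diamondop> \<xi> c) (factorizations G a)"
    using a by (simp add: regular_rep_def)
  thus ?thesis using crd_conv[OF f aa(1) e] nm_crd[OF aa(1) conv_sum(1)[OF f aa(1) e, where \<Theta>="\<lambda>_. 0"]] by simp
qed

lemma rep_block:
  assumes f: "f \<in> finsec" and x: "\<xi> \<in> (\<Pi>\<^sub>E a\<in>gx x. fb a)" and E: "finite E" "E \<subseteq> gx x"
    and F: "finite F" "(\<Union>a\<in>E. {c. mat f a c \<noteq> 0}) \<subseteq> F"
  shows "(\<Sum>a\<in>E. (nm (regular_rep G L x f \<xi> a))\<^sup>2) = (blk f (\<lambda>c. crd c (\<xi> c)) E F)\<^sup>2"
proof -
  have "nm (regular_rep G L x f \<xi> a) = cmod (\<Sum>c\<in>F. mat f a c * crd c (\<xi> c))" if a: "a \<in> E" for a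
  proof -
    have "(\<Sum>c | mat f a c \<noteq> 0. mat f a c * crd c (\<xi> c)) = (\<Sum>c\<in>F. mat f a c * crd c (\<xi> c))"
      by (rule sum.mono_neutral_left[OF F(1)]) (use F(2) a in auto)
    thus ?thesis using crd_regular_rep[OF f x] a E(2) by auto
  qed
  thus ?thesis unfolding blk_def L2_set_def by (simp add: sum_nonneg)
qed

lemma rep_bounded:
  assumes f: "f \<in> finsec" and b: "bnd x f M" and M: "0 \<le> M" and x: "\<xi> \<in> l2_sections G L x"
  shows "(\<lambda>a. (nm (regular_rep G L x f \<xi> a))\<^sup>2) summable_on gx x"
    "l2_norm G L x (regular_rep G L x f \<xi>) \<le> M * l2_norm G L x \<xi>"
proof -
  have xf: "\<xi> \<in> (\<Pi>\<^sub>E a\<in>gx x. fb a)" and xs: "(\<lambda>a. (nm (\<xi> a))\<^sup>2) summable_on gx x"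
    using x by (simp_all add: l2_sections_def)
  let ?S = "\<Sum>\<^sub>\<infinity>a\<in>gx x. (nm (\<xi> a))\<^sup>2"
  have fin: "(\<Sum>a\<in>E. (nm (regular_rep G L x f \<xi> a))\<^sup>2) \<le> M\<^sup>2 * ?S" if E: "finite E" "E \<subseteq> gx x" for E
  proof -
    let ?F = "\<Union>a\<in>E. {c. mat f a c \<noteq> 0}"
    have F: "finite ?F" "?F \<subseteq> gx x"
      using finite_row[OF f] E row_gx[OF E(2)] by simp_all
    have "(\<Sum>a\<in>E. (nm (regular_rep G L x f \<xi> a))\<^sup>2) = (blk f (\<lambda>c. crd c (\<xi> c)) E ?F)\<^sup>2"
      by (rule rep_block[OF f xf E F(1) order.refl])
    also have "\<dots> \<le> (M * L2_set (\<lambda>c. cmod (crd c (\<xi> c))) ?F)\<^sup>2"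
      by (rule power_mono[OF bndD[OF b E(1) F(1) E(2) F(2)]]) (simp add: blk_def L2_set_nonneg)
    also have "\<dots> = M\<^sup>2 * (\<Sum>c\<in>?F. (cmod (crd c (\<xi> c)))\<^sup>2)" by (simp add: power_mult_distrib L2_set_def sum_nonneg)
    also have "(\<Sum>c\<in>?F. (cmod (crd c (\<xi> c)))\<^sup>2) = (\<Sum>c\<in>?F. (nm (\<xi> c))\<^sup>2)"
    proof (rule sum.cong[OF refl])
      fix c assume "c \<in> ?F"
      hence c: "c \<in> gx x" using F(2) by blast
      show "(cmod (crd c (\<xi> c)))\<^sup>2 = (nm (\<xi> c))\<^sup>2" using nm_crd[of c "\<xi> c"] PiE_mem[OF xf c] c by (simp add: gx_iff)
    qed
    also have "M\<^sup>2 * \<dots> \<le> M\<^sup>2 * ?S"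
      by (rule mult_left_mono[OF finite_sum_le_infsum[OF xs F]]) simp_all
    finally show ?thesis .
  qed
  show "(\<lambda>a. (nm (regular_rep G L x f \<xi> a))\<^sup>2) summable_on gx x" by (rule infsum_nonneg_le(1)[OF _ fin]) simp
  have "(\<Sum>\<^sub>\<infinity>a\<in>gx x. (nm (regular_rep G L x f \<xi> a))\<^sup>2) \<le> M\<^sup>2 * ?S" by (rule infsum_nonneg_le(2)[OF _ fin]) simp_all
  hence "sqrt (\<Sum>\<^sub>\<infinity>a\<in>gx x. (nm (regular_rep G L x f \<xi> a))\<^sup>2) \<le> sqrt (M\<^sup>2 * ?S)" by (rule real_sqrt_le_mono)
  thus "l2_norm G L x (regular_rep G L x f \<xi>) \<le> M * l2_norm G L x \<xi>"
    using M by (simp add: l2_norm_def real_sqrt_mult)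
qed

text \<open>Test the operator on finitely supported sections.\<close>

lemma bnd_of_rep:
  assumes f: "f \<in> finsec" and b: "bnd x f M" and M: "0 \<le> M"
    and P: "\<And>\<xi>. \<xi> \<in> l2_sections G L x \<Longrightarrow> l2_norm G L x \<xi> \<le> 1 \<Longrightarrow> l2_norm G L x (regular_rep G L x f \<xi>) \<le> P"
  shows "bnd x f P"
proof (rule bndI)
  fix E F \<xi> assume H: "finite E" "finite F" "E \<subseteq> gx x" "F \<subseteq> gx x"
  let ?c = "L2_set (\<lambda>b. cmod (\<xi> b)) F"
  show "blk f \<xi> E F \<le> P * ?c"
  proof (cases "?c = 0")
    case True
    hence "\<And>b. b \<in> F \<Longrightarrow> \<xi> b = 0" using L2_set_eq_0_iff[OF H(2)] by simp
    thus ?thesis using True by (simp add: blk_def L2_set_def)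
  next
    case False
    hence c: "?c > 0" using L2_set_nonneg[of "\<lambda>b. cmod (\<xi> b)" F] by (simp only: less_le) simp
    define \<eta> where "\<eta> = (\<lambda>a\<in>gx x. if a \<in> F then (\<xi> a / of_real ?c) \<cdot> bas a else zr a)"
    have ef: "\<eta> \<in> (\<Pi>\<^sub>E a\<in>gx x. fb a)" unfolding \<eta>_def by (auto simp: gx_iff smul_bas fb_zero)
    have ce: "crd a (\<eta> a) = (if a \<in> F then \<xi> a / of_real ?c else 0)" if "a \<in> gx x" for a
      using that by (simp add: \<eta>_def gx_iff smul_bas crd_zero)
    have ne: "(nm (\<eta> a))\<^sup>2 = (if a \<in> F then (cmod (\<xi> a))\<^sup>2 / ?c\<^sup>2 else 0)" if a: "a \<in> gx x" for a
      using nm_crd[of a "\<eta> a"] PiE_mem[OF ef a] ce[OF a] a c by (auto simp: gx_iff norm_divide power_divide)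
    have c2: "?c\<^sup>2 = (\<Sum>a\<in>F. (cmod (\<xi> a))\<^sup>2)" by (simp add: L2_set_def sum_nonneg)
    have S: "((\<lambda>a. (nm (\<eta> a))\<^sup>2) has_sum 1) (gx x)"
    proof -
      have "(\<Sum>a\<in>F. (nm (\<eta> a))\<^sup>2) = (\<Sum>a\<in>F. (cmod (\<xi> a))\<^sup>2 / ?c\<^sup>2)"
        by (rule sum.cong[OF refl]) (use ne H(4) in auto)
      also have "\<dots> = ?c\<^sup>2 / ?c\<^sup>2" unfolding c2 by (rule sum_divide_distrib[symmetric])
      also have "\<dots> = 1" using c by simp
      finally have "((\<lambda>a. (nm (\<eta> a))\<^sup>2) has_sum 1) F" using has_sum_finite[OF H(2), of "\<lambda>a. (nm (\<eta> a))\<^sup>2"] by simp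
      thus ?thesis by (rule has_sum_cong_neutral[THEN iffD1, rotated -1]) (use ne H(4) in auto)
    qed
    have el: "\<eta> \<in> l2_sections G L x" using ef S by (auto simp: l2_sections_def summable_on_def)
    have "l2_norm G L x \<eta> = 1" using infsumI[OF S] by (simp add: l2_norm_def)
    hence le: "l2_norm G L x (regular_rep G L x f \<eta>) \<le> P" using P[OF el] by simp
    let ?F = "F \<union> (\<Union>a\<in>E. {c. mat f a c \<noteq> 0})"
    have F': "finite ?F" "?F \<subseteq> gx x"
      using finite_row[OF f] H row_gx[OF H(3)] by simp_all
    have "(\<Sum>b\<in>?F. mat f a b * crd b (\<eta> b)) = (\<Sum>b\<in>F. mat f a b * \<xi> b) / of_real ?c" for a
    proof -
      have "(\<Sum>b\<in>?F. mat f a b * crd b (\<eta> b)) = (\<Sum>b\<in>F. mat f a b * crd b (\<eta> b))"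
        by (rule sum.mono_neutral_right[OF F'(1)]) (use ce F'(2) in auto)
      also have "\<dots> = (\<Sum>b\<in>F. mat f a b * \<xi> b / of_real ?c)"
        by (rule sum.cong[OF refl]) (use ce H(4) in auto)
      finally show ?thesis by (simp add: sum_divide_distrib)
    qed
    hence "blk f (\<lambda>b. crd b (\<eta> b)) E ?F = blk f \<xi> E F / ?c"
      using c L2_set_left_distrib[of "inverse ?c" "\<lambda>a. cmod (\<Sum>b\<in>F. mat f a b * \<xi> b)" E]
      by (simp add: blk_def norm_mult norm_inverse divide_inverse)
    hence "(blk f \<xi> E F / ?c)\<^sup>2 = (\<Sum>a\<in>E. (nm (regular_rep G L x f \<eta> a))\<^sup>2)"
      using rep_block[OF f ef H(1,3) F'(1)] by simp
    also have "\<dots> \<le> (\<Sum>\<^sub>\<infinity>a\<in>gx x. (nm (regular_rep G L x f \<eta> a))\<^sup>2)"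
      by (rule finite_sum_le_infsum[OF rep_bounded(1)[OF f b M el] H(1,3)]) simp
    finally have "sqrt ((blk f \<xi> E F / ?c)\<^sup>2) \<le> l2_norm G L x (regular_rep G L x f \<eta>)"
      unfolding l2_norm_def by (rule real_sqrt_le_mono)
    moreover have "0 \<le> blk f \<xi> E F / ?c" using c by (simp add: blk_def L2_set_nonneg)
    ultimately have "blk f \<xi> E F / ?c \<le> P" using le unfolding real_sqrt_abs by linarith
    thus ?thesis using c by (simp add: pos_divide_le_eq)
  qed
qed

lemma rep_norm_facts:
  assumes f: "f \<in> finsec" and b: "bnd x f M" and M: "0 \<le> M"
  shows "regular_rep_norm G L x f \<le> M" "bnd x f (regular_rep_norm G L x f)" "x \<in> X \<Longrightarrow> 0 \<le> regular_rep_norm G L x f"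
proof -
  let ?S = "{l2_norm G L x (regular_rep G L x f \<xi>) | \<xi>. \<xi> \<in> l2_sections G L x \<and> l2_norm G L x \<xi> \<le> 1}"
  have le: "y \<le> M" if y: "y \<in> ?S" for y
  proof -
    obtain \<xi> where x: "\<xi> \<in> l2_sections G L x" "l2_norm G L x \<xi> \<le> 1" "y = l2_norm G L x (regular_rep G L x f \<xi>)"
      using y by blast
    have "y \<le> M * l2_norm G L x \<xi>" unfolding x(3) by (rule rep_bounded(2)[OF f b M x(1)])
    also have "\<dots> \<le> M * 1" by (rule mult_left_mono[OF x(2) M])
    finally show ?thesis by simp
  qed
  let ?z = "restrict (lzero L) (gx x)"
  have z: "?z \<in> l2_sections G L x" "l2_norm G L x ?z \<le> 1"
  proof -
    have "nm (?z a) = 0" if "a \<in> gx x" for a using that by (simp add: gx_iff nm_zero)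
    hence "((\<lambda>a. (nm (?z a))\<^sup>2) has_sum 0) (gx x)" by (intro has_sum_0) simp
    thus "?z \<in> l2_sections G L x" "l2_norm G L x ?z \<le> 1"
      by (auto simp: l2_sections_def summable_on_def gx_iff fb_zero l2_norm_def dest: infsumI)
  qed
  have mem: "l2_norm G L x (regular_rep G L x f ?z) \<in> ?S" using z by blast
  have bdd: "bdd_above ?S" using le by (rule bdd_aboveI)
  show "regular_rep_norm G L x f \<le> M" unfolding regular_rep_norm_def by (rule cSup_least[OF _ le]) (use mem in blast)
  show "bnd x f (regular_rep_norm G L x f)"
  proof (rule bnd_of_rep[OF f b M])
    fix \<xi> assume "\<xi> \<in> l2_sections G L x" "l2_norm G L x \<xi> \<le> 1"
    hence "l2_norm G L x (regular_rep G L x f \<xi>) \<in> ?S" by blast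
    thus "l2_norm G L x (regular_rep G L x f \<xi>) \<le> regular_rep_norm G L x f"
      unfolding regular_rep_norm_def by (rule cSup_upper[OF _ bdd])
  qed
  have "0 \<le> l2_norm G L x (regular_rep G L x f ?z)" by (simp add: l2_norm_def infsum_nonneg)
  also have "\<dots> \<le> regular_rep_norm G L x f" unfolding regular_rep_norm_def by (rule cSup_upper[OF mem bdd])
  finally show "0 \<le> regular_rep_norm G L x f" .
qed

text \<open>This characterization makes the C*-norm properties of the reduced norm statements about
  matrix blocks.\<close>

lemma red_norm_facts:
  assumes f: "f \<in> carrier CA"
  shows "0 \<le> red_norm G L f" "x \<in> X \<Longrightarrow> bnd x f (red_norm G L f)"
    "0 \<le> M \<Longrightarrow> (\<And>x. x \<in> X \<Longrightarrow> bnd x f M) \<Longrightarrow> red_norm G L f \<le> M"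
proof -
  have fF: "f \<in> finsec" by (rule CA_finsec[OF f])
  obtain M0 where M0: "M0 \<ge> 0" "\<forall>x. bnd x f M0" using CA_bnd[OF f] by blast
  let ?S = "insert 0 {regular_rep_norm G L x f | x. x \<in> X}"
  have le: "y \<le> M" if y: "y \<in> ?S" and M: "0 \<le> M" and b: "\<And>x. x \<in> X \<Longrightarrow> bnd x f M" for y M
  proof -
    from y consider "y = 0" | x where "y = regular_rep_norm G L x f" "x \<in> X" by blast
    thus ?thesis
    proof cases
      case 2
      show ?thesis unfolding 2(1) by (rule rep_norm_facts(1)[OF fF b[OF 2(2)] M])
    qed (simp add: M)
  qed
  have bdd: "bdd_above ?S" by (rule bdd_aboveI[of _ M0], rule le[OF _ M0(1) spec[OF M0(2)]])
  show "0 \<le> red_norm G L f" unfolding red_norm_def by (rule cSup_upper[OF _ bdd]) simp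
  show "0 \<le> M \<Longrightarrow> (\<And>x. x \<in> X \<Longrightarrow> bnd x f M) \<Longrightarrow> red_norm G L f \<le> M"
  proof -
    assume M: "0 \<le> M" and b: "\<And>x. x \<in> X \<Longrightarrow> bnd x f M"
    show ?thesis unfolding red_norm_def by (rule cSup_least[OF insert_not_empty le[OF _ M b]])
  qed
  assume x: "x \<in> X"
  have "regular_rep_norm G L x f \<le> red_norm G L f"
    unfolding red_norm_def by (rule cSup_upper[OF _ bdd]) (use x in blast)
  thus "bnd x f (red_norm G L f)" by (rule bnd_mono[OF rep_norm_facts(2)[OF fF spec[OF M0(2)] M0(1)]])
qed

lemma red_norm_entry: assumes f: "f \<in> carrier CA" shows "cmod (mat f a b) \<le> red_norm G L f"
proof (cases "mat f a b = 0")
  case False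
  note ab = mat_nonzeroD[OF False]
  have "blk f (\<lambda>_. 1) {a} {b} \<le> red_norm G L f * L2_set (\<lambda>b. cmod (1::complex)) {b}"
    by (rule bndD[OF red_norm_facts(2)[OF f src_unit[OF ab(1)]]]) (use ab in \<open>auto simp: gx_iff\<close>)
  thus ?thesis by (simp add: blk_def L2_set_def)
qed (simp add: red_norm_facts(1)[OF f])

lemma red_norm_value: assumes f: "f \<in> carrier CA" and a: "a \<in> arr" shows "nm (f a) \<le> red_norm G L f"
  using red_norm_entry[OF f, of a "s a"] mat_src[OF finsec_secs[OF CA_finsec[OF f]] a]
    nm_crd[OF a secs_fb[OF finsec_secs[OF CA_finsec[OF f]] a]] by simp

text \<open>Inequalities suffice: applying them to \<open>c\<^sup>-\<^sup>1\<close> and to \<open>f\<^sup>*\<close> gives the equations. Inequalities are what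
  suprema inherit.\<close>

lemma is_cstar_normI:
  assumes pos: "\<And>f. f \<in> carrier CA \<Longrightarrow> 0 \<le> N f"
    and definite: "\<And>f. f \<in> carrier CA \<Longrightarrow> N f = 0 \<Longrightarrow> f = vzero SA"
    and scale: "\<And>f c. f \<in> carrier CA \<Longrightarrow> N (vsmul SA c f) \<le> cmod c * N f"
    and add: "\<And>f g. f \<in> carrier CA \<Longrightarrow> g \<in> carrier CA \<Longrightarrow> N (vadd SA f g) \<le> N f + N g"
    and mul: "\<And>f g. f \<in> carrier CA \<Longrightarrow> g \<in> carrier CA \<Longrightarrow> N (amul SA f g) \<le> N f * N g"
    and star: "\<And>f. f \<in> carrier CA \<Longrightarrow> N (aadj SA f) \<le> N f"
    and cstar: "\<And>f. f \<in> carrier CA \<Longrightarrow> (N f)\<^sup>2 \<le> N (amul SA (aadj SA f) f)"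
  shows "is_cstar_norm CA N"
proof -
  note zero = complex_vector_space.smul_zero[OF vector_space_SA]
  have "N (vzero SA) = 0" using scale[OF CA_ops(1), of 0] pos[OF CA_ops(1)] zero[of 0] by simp
  hence eq0: "N f = 0 \<longleftrightarrow> f = vzero SA" if "f \<in> carrier CA" for f using definite[OF that] by auto
  have sc: "N (vsmul SA c f) = cmod c * N f" if f: "f \<in> carrier CA" for c f
  proof (cases "c = 0")
    case True
    thus ?thesis using scale[OF f, of 0] pos[OF CA_ops(3)[OF f], of 0] by simp
  next
    case False
    have "vsmul SA (1/c) (vsmul SA c f) = f"
      using complex_vector_space.smul_smul[OF vector_space_SA, of f "1/c" c] complex_vector_space.smul_one[OF vector_space_SA, of f]
        finsec_secs[OF CA_finsec[OF f]] False by (simp add: SA_simps(1))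
    hence "N f \<le> cmod (1/c) * N (vsmul SA c f)" using scale[OF CA_ops(3)[OF f], of "1/c" c] by simp
    hence "cmod c * N f \<le> N (vsmul SA c f)" using False by (simp add: norm_divide field_simps)
    thus ?thesis using scale[OF f, of c] by simp
  qed
  have cs: "N (amul SA (aadj SA f) f) = (N f)\<^sup>2" if f: "f \<in> carrier CA" for f
    using mul[OF CA_adj[OF f] f] mult_right_mono[OF star[OF f] pos[OF f]] cstar[OF f] by (simp add: power2_eq_square)
  show ?thesis
    unfolding is_cstar_norm_def is_norm_def CA_simps(2-6) using pos eq0 add sc mul cs by simp
qed

theorem red_norm_cstar: "is_cstar_norm CA (red_norm G L)"
proof (rule is_cstar_normI)
  fix f assume f: "f \<in> carrier CA"
  note fF = CA_finsec[OF f] and pos = red_norm_facts(1)[OF f] and b = red_norm_facts(2)[OF f]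
  note fs = finsec_secs[OF fF]
  show "0 \<le> red_norm G L f" by (rule pos)
  show "f = vzero SA" if "red_norm G L f = 0"
  proof (rule secs_eqI[OF fs finsec_secs[OF CA_finsec[OF CA_ops(1)]]])
    fix a assume a: "a \<in> arr"
    have "f a = zr a"
      using red_norm_value[OF f a] nm_eq_0[OF a secs_fb[OF fs a]] nm_nonneg[OF a secs_fb[OF fs a]] that by simp
    thus "f a = vzero SA a" using a by (simp add: SA_simps)
  qed
  show "red_norm G L (vsmul SA c f) \<le> cmod c * red_norm G L f" for c
    by (rule red_norm_facts(3)[OF CA_ops(3)[OF f] mult_nonneg_nonneg[OF norm_ge_zero pos]]) (rule bnd_smul[OF fs b])
  show "red_norm G L (aadj SA f) \<le> red_norm G L f" by (rule red_norm_facts(3)[OF CA_adj[OF f] pos]) (rule bnd_adj[OF fs b])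
  let ?h = "amul SA (aadj SA f) f"
  note h = CA_mul[OF CA_adj[OF f] f]
  have h0: "0 \<le> red_norm G L ?h" by (rule red_norm_facts(1)[OF h])
  have "red_norm G L f \<le> sqrt (red_norm G L ?h)"
  proof (rule red_norm_facts(3)[OF f])
    show "bnd x f (sqrt (red_norm G L ?h))" if "x \<in> X" for x
      using red_norm_facts(2)[OF h that] h0 by (intro bnd_cstar[OF fF]) simp_all
  qed (use h0 in simp)
  from power_mono[OF this pos, of 2] show "(red_norm G L f)\<^sup>2 \<le> red_norm G L ?h" using h0 by simp
  fix g assume g: "g \<in> carrier CA"
  note gF = CA_finsec[OF g] and pos' = red_norm_facts(1)[OF g] and b' = red_norm_facts(2)[OF g]
  show "red_norm G L (vadd SA f g) \<le> red_norm G L f + red_norm G L g"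
    by (rule red_norm_facts(3)[OF CA_ops(2)[OF f g] add_nonneg_nonneg[OF pos pos']]) (rule bnd_add[OF fs b finsec_secs[OF gF] b'])
  show "red_norm G L (amul SA f g) \<le> red_norm G L f * red_norm G L g"
    by (rule red_norm_facts(3)[OF CA_mul[OF f g] mult_nonneg_nonneg[OF pos pos']]) (rule bnd_mul[OF fF b gF b' pos])
qed

end

section \<open>Estimates valid in every C*-norm\<close>

context fell_groupoid
begin

lemma cstar_normD:
  assumes N: "is_cstar_norm CA N" and f: "f \<in> carrier CA"
  shows "0 \<le> N f" "N f = 0 \<longleftrightarrow> f = vzero SA" "N (vsmul SA c f) = cmod c * N f"
    "N (aadj SA f) = N f" "N (amul SA (aadj SA f) f) = (N f)\<^sup>2"
    "g \<in> carrier CA \<Longrightarrow> N (vadd SA f g) \<le> N f + N g" "g \<in> carrier CA \<Longrightarrow> N (amul SA f g) \<le> N f * N g"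
proof -
  interpret N: normed_star_algebra CA N by (rule normed_star_algebra_CA[OF N])
  show "0 \<le> N f" "N f = 0 \<longleftrightarrow> f = vzero SA" "N (vsmul SA c f) = cmod c * N f" "N (aadj SA f) = N f"
    "g \<in> carrier CA \<Longrightarrow> N (vadd SA f g) \<le> N f + N g" "g \<in> carrier CA \<Longrightarrow> N (amul SA f g) \<le> N f * N g"
    using f N.norm_nonneg N.norm_eq_0 N.norm_smul N.norm_adj N.norm_add N.norm_mul by (simp_all add: CA_simps(2-6))
  show "N (amul SA (aadj SA f) f) = (N f)\<^sup>2" using N f unfolding is_cstar_norm_def CA_simps(5,6) by blast
qed

text \<open>Left multiplication by functions of absolute value one preserves \<open>b\<^sup>*b\<close>, hence every C*-norm. Such
  functions need not be sections, so only the result of the multiplication is assumed to lie in the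
  algebra.\<close>

lemma norm_unitary_multiple:
  assumes N: "is_cstar_norm CA N" and b: "b \<in> carrier CA" and u: "u \<in> carrier CA"
    and m: "\<And>a c. mat u a c = w (r a) * mat b a c" and w: "\<And>x. x \<in> X \<Longrightarrow> cmod (w x) = 1"
  shows "N u = N b"
proof -
  note bF = CA_finsec[OF b] and uF = CA_finsec[OF u]
  note bs = finsec_secs[OF bF] and us = finsec_secs[OF uF]
  have "amul SA (aadj SA u) u = amul SA (aadj SA b) b"
  proof (rule mat_inject[OF conv_secs[OF finsec_adj[OF uF] us] conv_secs[OF finsec_adj[OF bF] bs]])
    fix a c let ?R = "{d. mat b d c \<noteq> 0}"
    have fin: "finite ?R" by (rule finite_col[OF bF])
    have sub: "{d. mat u d c \<noteq> 0} \<subseteq> ?R" by (auto simp: m)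
    have "mat (amul SA (aadj SA u) u) a c = (\<Sum>d\<in>?R. cnj (mat u d a) * mat u d c)"
      using mat_mul_superset'[OF finsec_adj[OF uF] us fin sub] by (simp add: mat_adj[OF us])
    also have "\<dots> = (\<Sum>d\<in>?R. cnj (mat b d a) * mat b d c)"
    proof (rule sum.cong[OF refl])
      fix d assume "d \<in> ?R"
      hence nz: "mat b d c \<noteq> 0" by simp
      have "w (r d) * cnj (w (r d)) = 1"
        using w[OF rng_unit[OF mat_nonzeroD(1)[OF nz]]] by (simp flip: complex_norm_square)
      hence "cnj (mat b d a) * mat b d c * (w (r d) * cnj (w (r d))) = cnj (mat b d a) * mat b d c" by simp
      thus "cnj (mat u d a) * mat u d c = cnj (mat b d a) * mat b d c" by (simp only: m complex_cnj_mult mult_ac)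
    qed
    also have "\<dots> = mat (amul SA (aadj SA b) b) a c"
      using mat_mul_superset'[OF finsec_adj[OF bF] bs fin order.refl, of a] by (simp add: mat_adj[OF bs])
    finally show "mat (amul SA (aadj SA u) u) a c = mat (amul SA (aadj SA b) b) a c" .
  qed
  hence "(N u)\<^sup>2 = (N b)\<^sup>2" using cstar_normD(5)[OF N u] cstar_normD(5)[OF N b] by simp
  thus ?thesis using cstar_normD(1)[OF N u] cstar_normD(1)[OF N b] by (simp add: power2_eq_iff_nonneg)
qed

text \<open>A real function \<open>k\<close> with \<open>\<bar>k\<bar> \<le> 1\<close> is the mean of the unitary multipliers
  \<open>k \<plusminus> i\<surd>(1 - k\<^sup>2)\<close>, so it acts contractively in every C*-norm.\<close>

lemma fn_contractive_left:
  assumes N: "is_cstar_norm CA N" and k: "cfun (\<lambda>x. of_real (k x))" and k1: "\<And>x. x \<in> X \<Longrightarrow> \<bar>k x\<bar> \<le> 1"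
    and b: "b \<in> carrier CA"
  shows "N (amul SA (fn (\<lambda>x. of_real (k x))) b) \<le> N b"
proof -
  note bs = finsec_secs[OF CA_finsec[OF b]]
  define m where "m z x = of_real (k x) + z * of_real (sqrt (1 - (k x)\<^sup>2) - 1)" for z :: complex and x
  have cm: "cfun (m z)" for z
  proof -
    have "cfun (\<lambda>x. (\<lambda>y. y + z * of_real (sqrt (1 - (Re y)\<^sup>2) - 1)) (of_real (k x)))"
      by (rule cfun_comp[OF k]) (auto intro!: continuous_intros)
    thus ?thesis by (simp add: m_def[abs_def])
  qed
  define u where "u z = vadd SA (vsmul SA z b) (amul SA (fn (m z)) b)" for z
  have uc: "u z \<in> carrier CA" for z unfolding u_def by (intro CA_ops(2,3) CA_mul b fn_CA cm)
  have mu: "mat (u z) a c = (z + m z (r a)) * mat b a c" for z a c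
    unfolding u_def using mat_add[OF secs_ops(2)[OF bs] conv_secs[OF fn_finsec[OF cm] bs]] mat_smul[OF bs] mat_fn_mul[OF cm bs]
    by (simp add: distrib_right)
  have one: "cmod (z + m z x) = 1" if z: "z = \<i> \<or> z = - \<i>" and x: "x \<in> X" for z x
  proof -
    have "(k x)\<^sup>2 \<le> 1" using k1[OF x] by (simp add: abs_square_le_1)
    moreover have "z + m z x = Complex (k x) (if z = \<i> then sqrt (1 - (k x)\<^sup>2) else - sqrt (1 - (k x)\<^sup>2))"
      using z by (auto simp: m_def complex_eq_iff)
    ultimately show ?thesis by (simp add: cmod_def)
  qed
  have nu: "N (u z) = N b" if "z = \<i> \<or> z = - \<i>" for z
    by (rule norm_unitary_multiple[OF N b uc mu one[OF that]])
  have "N (amul SA (fn (\<lambda>x. of_real (k x))) b) = N (vsmul SA (1/2) (vadd SA (u \<i>) (u (- \<i>))))"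
  proof (rule arg_cong[where f=N], rule mat_inject)
    have us: "u z \<in> secs" for z by (rule finsec_secs[OF CA_finsec[OF uc]])
    show "amul SA (fn (\<lambda>x. of_real (k x))) b \<in> secs" by (rule conv_secs[OF fn_finsec[OF k] bs])
    show "vsmul SA (1/2) (vadd SA (u \<i>) (u (- \<i>))) \<in> secs" by (intro secs_ops us)
    show "mat (amul SA (fn (\<lambda>x. of_real (k x))) b) a c = mat (vsmul SA (1/2) (vadd SA (u \<i>) (u (- \<i>)))) a c" for a c
      by (simp add: mat_fn_mul[OF k bs] mat_smul[OF secs_ops(1)[OF us us]] mat_add[OF us us] mu m_def algebra_simps)
  qed
  also have "\<dots> \<le> 1/2 * (N (u \<i>) + N (u (- \<i>)))"
    using cstar_normD(3)[OF N CA_ops(2)[OF uc uc], of "1/2"] cstar_normD(6)[OF N uc uc] by simp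
  also have "\<dots> = N b" by (simp add: nu)
  finally show ?thesis .
qed

text \<open>For \<open>0 \<le> q \<le> 1\<close> \<open>fn_contractive_left\<close> gives \<open>N(q)\<^sup>2 = N(qq) \<le> N(q)\<close>. The general case follows with
  \<open>q = |k|\<^sup>2/M\<^sup>2\<close>.\<close>

lemma fn_norm_le:
  assumes N: "is_cstar_norm CA N" and k: "cfun k" and kM: "\<And>x. x \<in> X \<Longrightarrow> cmod (k x) \<le> M" and M: "0 \<le> M"
  shows "N (fn k) \<le> M"
proof -
  have pos: "N (fn k) \<le> M" if M: "0 < M" and kM: "\<And>x. x \<in> X \<Longrightarrow> cmod (k x) \<le> M" for M
  proof -
    define q where "q x = (cmod (k x))\<^sup>2 / M\<^sup>2" for x
    have q: "cfun (\<lambda>x. of_real (q x))"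
    proof -
      have "cfun (\<lambda>x. (\<lambda>z. complex_of_real ((cmod z)\<^sup>2 / M\<^sup>2)) (k x))"
        by (rule cfun_comp[OF k]) (use M in \<open>auto intro!: continuous_intros\<close>)
      thus ?thesis by (simp add: q_def[abs_def])
    qed
    have q1: "\<bar>q x\<bar> \<le> 1" if "x \<in> X" for x
      using power_mono[OF kM[OF that], of 2] M by (simp add: q_def)
    let ?q = "fn (\<lambda>x. of_real (q x))"
    note qc = fn_CA[OF q]
    have "(N ?q)\<^sup>2 = N (amul SA ?q ?q)" using cstar_normD(5)[OF N qc] fn_ops(2)[OF q q] by simp
    also have "\<dots> \<le> N ?q" by (rule fn_contractive_left[OF N q q1 qc])
    finally have "N ?q * N ?q \<le> N ?q * 1" by (simp add: power2_eq_square)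
    hence q_le: "N ?q \<le> 1" using cstar_normD(1)[OF N qc] by (cases "N ?q = 0") simp_all
    have kc: "cfun (\<lambda>x. cnj (k x))" by (rule cfun_comp[OF k]) (auto intro!: continuous_intros)
    have "amul SA (aadj SA (fn k)) (fn k) = fn (\<lambda>x. cnj (k x) * k x)"
      using fn_ops(1)[OF kc k] fn_ops(2)[OF k k] by simp
    also have "(\<lambda>x. cnj (k x) * k x) = (\<lambda>x. of_real (M\<^sup>2) * of_real (q x))"
      using M by (intro ext) (simp add: q_def complex_norm_square mult.commute flip: of_real_mult del: of_real_power)
    also have "fn \<dots> = vsmul SA (of_real (M\<^sup>2)) ?q" by (rule fn_ops(3)[OF q q, symmetric])
    finally have "(N (fn k))\<^sup>2 = cmod (of_real (M\<^sup>2)) * N ?q"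
      using cstar_normD(5)[OF N fn_CA[OF k]] cstar_normD(3)[OF N qc, of "of_real (M\<^sup>2)"] by simp
    also have "cmod (of_real (M\<^sup>2)) = M\<^sup>2" unfolding norm_of_real by simp
    also have "M\<^sup>2 * N ?q \<le> M\<^sup>2 * 1" by (rule mult_left_mono[OF q_le]) simp
    finally have "(N (fn k))\<^sup>2 \<le> M\<^sup>2" by simp
    thus ?thesis by (rule power2_le_imp_le) (use M in simp)
  qed
  show ?thesis
  proof (rule field_le_epsilon)
    fix e :: real assume e: "0 < e"
    show "N (fn k) \<le> M + e"
    proof (rule pos)
      show "cmod (k x) \<le> M + e" if "x \<in> X" for x using kM[OF that] e by linarith
    qed (use M e in linarith)
  qed
qed

lemma bnd_entry:
  assumes b: "bnd x f M" and a: "a \<in> gx x" and c: "c \<in> gx x" shows "cmod (mat f a c) \<le> M"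
  using bndD[OF b, of "{a}" "{c}" "\<lambda>_. 1"] a c by (simp add: blk_def L2_set_def)

text \<open>Outside the compact set \<open>K\<close> the section is zero, so continuity on \<open>W \<inter> X\<close> and on the complement of
  \<open>K\<close> can be pasted.\<close>

lemma unit_supported:
  assumes W: "open_bisection G W" and h: "h \<in> Cc W"
    and K: "compactin T K" "K \<subseteq> W \<inter> X" "\<forall>a\<in>arr - K. h a = zr a"
  shows "h \<in> Cc X"
proof -
  let ?W = "W \<inter> X"
  note hs = ccD(1)[OF W h]
  define k where "k x = crd x (h x)" for x
  have hfb: "h x \<in> fb x" if "x \<in> X" for x by (rule secs_fb[OF hs unitD(1)[OF that]])
  have KX: "compactin TX K" using K(1,2) by (simp add: compactin_TX)
  have Wo: "openin TX ?W" using W open_units by (simp add: openin_TX open_bisection_def openin_Int)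
  have k0: "k x = 0" if "x \<in> X - K" for x using K(3) that by (simp add: k_def crd_zero unitD(1))
  have kW: "continuous_map (subtopology TX ?W) euclidean k"
  proof -
    have e: "subtopology TX ?W = subtopology (subtopology T W) X" by (simp add: unit_top_def subtopology_subtopology inf.absorb2 Int_commute)
    have pX: "p (h z) = z" "z \<in> X" if "z \<in> topspace (subtopology (subtopology T W) X)" for z
      using that hfb by (auto simp: fib_iff)
    have "continuous_map (subtopology (subtopology T W) X) euclidean (\<lambda>z. crd (p (h z)) (h z))"
      by (rule cont_crd[OF continuous_map_from_subtopology[OF ccD(2)[OF W h]]]) (simp add: pX)
    thus ?thesis unfolding e by (rule continuous_map_eq) (simp add: pX k_def)
  qed
  have kc: "continuous_map TX euclidean k"
  proof (rule pasting_lemma[where I = UNIV and T = "\<lambda>i. if i then ?W else X - K" and f = "\<lambda>i. if i then k else (\<lambda>_. 0)"])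
    fix i :: bool
    have "openin TX (X - K)" using openin_diff[OF openin_topspace compactin_imp_closedin[OF Hausdorff_units KX]] by (simp add: topspace_TX)
    thus "openin TX (if i then ?W else X - K)" using Wo by simp
    show "continuous_map (subtopology TX (if i then ?W else X - K)) euclidean (if i then k else (\<lambda>_. 0))" using kW by simp
  next
    fix i j x assume "x \<in> topspace TX \<inter> (if i then ?W else X - K) \<inter> (if j then ?W else X - K)"
    thus "(if i then k else (\<lambda>_. 0)) x = (if j then k else (\<lambda>_. 0)) x" using k0[of x] by (cases i; cases j) auto
  next
    fix x assume "x \<in> topspace TX"
    hence x: "x \<in> X" by (simp add: topspace_TX)
    show "\<exists>j. j \<in> UNIV \<and> x \<in> (if j then ?W else X - K) \<and> k x = (if j then k else (\<lambda>_. 0)) x"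
      using x K(2) by (intro exI[of _ "x \<in> ?W"]) (auto intro: k0)
  qed
  have c: "cfun k" unfolding cfun_def using kc KX k0 by blast
  have "h = fn k"
  proof (rule secs_eqI[OF hs fn_secs])
    fix a assume a: "a \<in> arr"
    show "h a = fn k a"
    proof (cases "a \<in> X")
      case True thus ?thesis using crd[OF a hfb[OF True]] a by (simp add: fn_def k_def)
    next
      case False thus ?thesis using K(2,3) a by (auto simp: fn_def)
    qed
  qed
  thus ?thesis using fn_cc[OF c] by simp
qed

text \<open>In a bisection \<open>U\<close>, arrows with the same range are equal, so \<open>U\<^sup>-\<^sup>1U\<close> consists of units.\<close>

lemma gen_square:
  assumes U: "open_bisection G U" and f: "f \<in> Cc U" and M: "0 \<le> M" "\<And>a. a \<in> arr \<Longrightarrow> nm (f a) \<le> M"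
  shows "\<exists>k. cfun k \<and> (\<forall>x\<in>X. cmod (k x) \<le> M\<^sup>2) \<and> amul SA (aadj SA f) f = fn k"
proof -
  let ?V = "{a \<in> arr. iv a \<in> U}" and ?h = "amul SA (aadj SA f) f"
  let ?W = "bprod ?V U"
  note V = bisection_inv[OF U] and fa = gen_adj[OF U f] and fF = gen_finsec[OF U f]
  note W = bisection_bprod[OF V U] and h = gen_mul[OF V U fa f]
  have WX: "?W \<subseteq> X"
  proof
    fix c assume "c \<in> ?W"
    then obtain a b where c: "c = a \<star> b" "a \<in> arr" "iv a \<in> U" "b \<in> U" "s a = r b" by (auto simp: bprod_def)
    have b: "b \<in> arr" using bisection_arr[OF U] c(4) by blast
    have inj: "inj_on (rng G) U" using U by (simp add: open_bisection_def)
    have "r (iv a) = r b" using c(2,5) by (simp add: rng_inv)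
    hence e: "iv a = b" by (rule inj_onD[OF inj _ c(3,4)])
    have "iv (iv a) = a" by (rule inv_inv[OF c(2)])
    hence "c = s b" using c(1) e inv_mul[OF b] by simp
    thus "c \<in> X" using src_unit[OF b] by simp
  qed
  note hs = ccD(1)[OF W h] and hF = gen_finsec[OF W h]
  obtain K where K: "compactin T K" "K \<subseteq> ?W" "\<forall>a\<in>arr - K. ?h a = zr a" using ccD(4)[OF W h] by (elim exE conjE)
  have "?h \<in> Cc X" by (rule unit_supported[OF W h K(1) _ K(3)]) (use K(2) WX in blast)
  note k = fn_surj[OF this]
  have "cmod (crd x (?h x)) \<le> M\<^sup>2" if x: "x \<in> X" for x
  proof -
    have f': "bnd x f M" by (rule bnd_gen[OF U f M])
    have "bnd x ?h (M * M)" by (rule bnd_mul[OF finsec_adj[OF fF] bnd_adj[OF finsec_secs[OF fF] f'] fF f' M(1)])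
    from bnd_entry[OF this, of x x] have "cmod (mat ?h x x) \<le> M * M" using unitD[OF x] by (simp add: gx_iff)
    thus ?thesis using mat_src[OF hs unitD(1)[OF x]] unitD[OF x] by (simp add: power2_eq_square)
  qed
  thus ?thesis using k by blast
qed

lemma gen_norm_le:
  assumes N: "is_cstar_norm CA N" and U: "open_bisection G U" and f: "f \<in> Cc U"
    and M: "0 \<le> M" "\<And>a. a \<in> arr \<Longrightarrow> nm (f a) \<le> M"
  shows "N f \<le> M"
proof -
  have "\<exists>k. cfun k \<and> (\<forall>x\<in>X. cmod (k x) \<le> M\<^sup>2) \<and> amul SA (aadj SA f) f = fn k" by (rule gen_square[OF U f M])
  then obtain k where k: "cfun k" "\<forall>x\<in>X. cmod (k x) \<le> M\<^sup>2" "amul SA (aadj SA f) f = fn k" by (elim exE conjE)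
  have "N (fn k) \<le> M\<^sup>2" by (rule fn_norm_le[OF N k(1) bspec[OF k(2)]]) simp_all
  hence "(N f)\<^sup>2 \<le> M\<^sup>2" using cstar_normD(5)[OF N gen_CA[OF U f]] k(3) by simp
  thus ?thesis by (rule power2_le_imp_le[OF _ M(1)])
qed

section \<open>The full norm\<close>

text \<open>This makes the supremum defining the full norm finite.\<close>

lemma cstar_norms_bounded: assumes "f \<in> carrier CA" shows "\<exists>M. \<forall>N. is_cstar_norm CA N \<longrightarrow> N f \<le> M"
  using assms
proof (induction rule: CA_induct)
  case (gen U f)
  obtain M where M: "M > 0" "\<forall>a\<in>arr. nm (f a) \<le> M" using cc_bounded[OF gen] by blast
  have "N f \<le> M" if "is_cstar_norm CA N" for N by (rule gen_norm_le[OF that gen less_imp_le[OF M(1)] bspec[OF M(2)]])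
  thus ?case by blast
next
  case (add f g)
  obtain M M' where M: "\<forall>N. is_cstar_norm CA N \<longrightarrow> N f \<le> M" "\<forall>N. is_cstar_norm CA N \<longrightarrow> N g \<le> M'"
    using add(3,4) by (elim exE)
  have "N (vadd SA f g) \<le> M + M'" if N: "is_cstar_norm CA N" for N
    using cstar_normD(6)[OF N add(1,2)] mp[OF spec[OF M(1)] N] mp[OF spec[OF M(2)] N] by simp
  thus ?case by blast
next
  case (smul c f)
  obtain M where M: "\<forall>N. is_cstar_norm CA N \<longrightarrow> N f \<le> M" using smul(2) by (elim exE)
  have "N (vsmul SA c f) \<le> cmod c * M" if N: "is_cstar_norm CA N" for N
    using cstar_normD(3)[OF N smul(1)] mult_left_mono[OF mp[OF spec[OF M] N] norm_ge_zero] by simp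
  thus ?case by blast
qed

lemma full_norm_upper: assumes f: "f \<in> carrier CA" and N: "is_cstar_norm CA N" shows "N f \<le> full_norm G L f"
proof -
  obtain M where M: "\<forall>N. is_cstar_norm CA N \<longrightarrow> N f \<le> M" using cstar_norms_bounded[OF f] by (elim exE)
  have "bdd_above {N f | N. is_cstar_norm CA N}" by (rule bdd_aboveI[of _ M]) (use M in blast)
  thus ?thesis unfolding full_norm_def using N by (intro cSup_upper) blast+
qed

lemma full_norm_least: assumes "\<And>N. is_cstar_norm CA N \<Longrightarrow> N f \<le> M" shows "full_norm G L f \<le> M"
  unfolding full_norm_def
proof (rule cSup_least)
  show "{N f | N. is_cstar_norm CA N} \<noteq> {}" using red_norm_cstar by blast
  fix y assume "y \<in> {N f | N. is_cstar_norm CA N}"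
  then obtain N where N: "is_cstar_norm CA N" "y = N f" by blast
  show "y \<le> M" unfolding N(2) by (rule assms[OF N(1)])
qed

theorem full_norm_cstar: "is_cstar_norm CA (full_norm G L)"
proof (rule is_cstar_normI)
  let ?F = "full_norm G L"
  have pos: "0 \<le> ?F f" if f: "f \<in> carrier CA" for f
    by (rule order_trans[OF red_norm_facts(1)[OF f] full_norm_upper[OF f red_norm_cstar]])
  fix f assume f: "f \<in> carrier CA"
  show "0 \<le> ?F f" by (rule pos[OF f])
  show "f = vzero SA" if "?F f = 0"
    using full_norm_upper[OF f red_norm_cstar] red_norm_facts(1)[OF f] cstar_normD(2)[OF red_norm_cstar f] that by simp
  show "?F (vsmul SA c f) \<le> cmod c * ?F f" for c
  proof (rule full_norm_least)
    show "N (vsmul SA c f) \<le> cmod c * ?F f" if N: "is_cstar_norm CA N" for N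
      unfolding cstar_normD(3)[OF N f] by (rule mult_left_mono[OF full_norm_upper[OF f N] norm_ge_zero])
  qed
  show "?F (aadj SA f) \<le> ?F f"
  proof (rule full_norm_least)
    show "N (aadj SA f) \<le> ?F f" if N: "is_cstar_norm CA N" for N
      unfolding cstar_normD(4)[OF N f] by (rule full_norm_upper[OF f N])
  qed
  let ?h = "amul SA (aadj SA f) f"
  note h = CA_mul[OF CA_adj[OF f] f]
  have "?F f \<le> sqrt (?F ?h)"
  proof (rule full_norm_least)
    show "N f \<le> sqrt (?F ?h)" if N: "is_cstar_norm CA N" for N
      using full_norm_upper[OF h N] unfolding cstar_normD(5)[OF N f] by (rule real_le_rsqrt)
  qed
  from power_mono[OF this pos[OF f], of 2] show "(?F f)\<^sup>2 \<le> ?F ?h" using pos[OF h] by simp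
  fix g assume g: "g \<in> carrier CA"
  show "?F (vadd SA f g) \<le> ?F f + ?F g"
  proof (rule full_norm_least)
    show "N (vadd SA f g) \<le> ?F f + ?F g" if N: "is_cstar_norm CA N" for N
      using cstar_normD(6)[OF N f g] full_norm_upper[OF f N] full_norm_upper[OF g N] by simp
  qed
  show "?F (amul SA f g) \<le> ?F f * ?F g"
  proof (rule full_norm_least)
    fix N assume N: "is_cstar_norm CA N"
    have "N (amul SA f g) \<le> N f * N g" by (rule cstar_normD(7)[OF N f g])
    also have "\<dots> \<le> ?F f * ?F g"
      by (rule mult_mono[OF full_norm_upper[OF f N] full_norm_upper[OF g N] pos[OF f] cstar_normD(1)[OF N g]])
    finally show "N (amul SA f g) \<le> ?F f * ?F g" .
  qed
qed

end

section \<open>Vector functionals and evaluation at a unit\<close>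

context fell_groupoid
begin

text \<open>The vector functional \<open>f \<mapsto> \<langle>h, fh\<rangle>\<close> of the regular representation, for finitely supported \<open>h\<close>.
  Evaluation at a unit \<open>x\<close> is the case of the basis vector at \<open>x\<close>.\<close>

definition vst where "vst E h f = (\<Sum>a\<in>E. cnj (h a) * (\<Sum>b\<in>E. mat f a b * h b))"

abbreviation pv where "pv x f \<equiv> crd x (f x)"

lemma vst_linear:
  assumes f: "f \<in> secs" and g: "g \<in> secs"
  shows "vst E h (vadd SA f g) = vst E h f + vst E h g" "vst E h (vsmul SA c f) = c * vst E h f"
proof -
  show "vst E h (vadd SA f g) = vst E h f + vst E h g"
    unfolding vst_def mat_add[OF f g] by (simp only: distrib_right sum.distrib distrib_left)
  show "vst E h (vsmul SA c f) = c * vst E h f"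
    unfolding vst_def mat_smul[OF f] by (simp only: mult.assoc mult.left_commute sum_distrib_left)
qed

lemma vst_bound:
  assumes f: "f \<in> carrier CA" and x: "x \<in> X" and E: "finite E" "E \<subseteq> gx x" and h: "L2_set (\<lambda>a. cmod (h a)) E = 1"
  shows "cmod (vst E h f) \<le> red_norm G L f"
proof -
  have "cmod (vst E h f) \<le> L2_set (\<lambda>a. cmod (cnj (h a))) E * L2_set (\<lambda>a. cmod (\<Sum>b\<in>E. mat f a b * h b)) E"
    unfolding vst_def by (rule cmod_sum_le_L2)
  also have "\<dots> = blk f h E E" by (simp add: h blk_def)
  also have "\<dots> \<le> red_norm G L f * L2_set (\<lambda>a. cmod (h a)) E" by (rule bndD[OF red_norm_facts(2)[OF f x] E(1,1,2,2)])
  finally show ?thesis by (simp add: h)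
qed

lemma vst_positive:
  assumes f: "f \<in> finsec" and E: "finite E" shows "vst E h (amul SA (aadj SA f) f) \<in> \<real>\<^sub>\<ge>\<^sub>0"
proof -
  have "finite (\<Union>b\<in>E. {a. mat f a b \<noteq> 0})" using E finite_col[OF f] by simp
  from square_form[OF f E this order.refl]
  show ?thesis unfolding vst_def by simp
qed

lemma vst_fn:
  assumes E: "finite E" "E \<subseteq> arr" "\<And>a. a \<in> E \<Longrightarrow> r a = x" and h: "L2_set (\<lambda>a. cmod (h a)) E = 1"
  shows "vst E h (fn k) = k x"
proof -
  have "vst E h (fn k) = (\<Sum>a\<in>E. cnj (h a) * h a * k x)"
    unfolding vst_def
  proof (rule sum.cong[OF refl])
    fix a assume a: "a \<in> E"
    have "(\<Sum>b\<in>E. mat (fn k) a b * h b) = (\<Sum>b\<in>{a}. mat (fn k) a b * h b)"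
      by (rule sum.mono_neutral_right[OF E(1)]) (use a in \<open>auto simp: mat_fn\<close>)
    also have "\<dots> = k x * h a" using a E(2) E(3)[OF a] by (auto simp: mat_fn)
    finally show "cnj (h a) * (\<Sum>b\<in>E. mat (fn k) a b * h b) = cnj (h a) * h a * k x" by simp
  qed
  also have "\<dots> = k x" using sum_sq_L2[OF E(1), of h] by (simp add: h flip: sum_distrib_right)
  finally show ?thesis .
qed

lemma pv_vst: assumes x: "x \<in> X" and f: "f \<in> secs" shows "pv x f = vst {x} (\<lambda>_. 1) f"
  using mat_src[OF f unitD(1)[OF x]] unitD[OF x] by (simp add: vst_def)

lemma unit_gx: "x \<in> X \<Longrightarrow> {x} \<subseteq> gx x"
  using unitD by (simp add: gx_iff)

lemma pv_fn: "cfun k \<Longrightarrow> x \<in> X \<Longrightarrow> pv x (fn k) = k x"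
  by (rule crd_fn)

end

text \<open>The remaining arguments apply to any C*-norm dominating the reduced norm.\<close>

locale fell_cstar_norm = fell_groupoid G L
  for G :: "'g groupoid" and L :: "('g, 'l) fell_bundle" +
  fixes N :: "('g \<Rightarrow> 'l) \<Rightarrow> real"
  assumes cstar_norm: "is_cstar_norm (Cc_alg G L) N"
    and red_le: "f \<in> carrier (Cc_alg G L) \<Longrightarrow> red_norm G L f \<le> N f"
begin

lemmas nsa = normed_star_algebra_CA[OF cstar_norm]

abbreviation bfun where "bfun \<equiv> normed_star_algebra.bounded_functional CA N"
abbreviation exts where "exts \<equiv> normed_star_algebra.extends CA N"

lemma vst_functional:
  assumes x: "x \<in> X" and E: "finite E" "E \<subseteq> gx x" and h: "L2_set (\<lambda>a. cmod (h a)) E = 1"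
  shows "bfun (vst E h)"
  unfolding normed_star_algebra.bounded_functional_def[OF nsa] CA_simps(3,4)
proof (intro conjI ballI allI)
  fix f assume f: "f \<in> carrier CA"
  note fs = finsec_secs[OF CA_finsec[OF f]]
  show "vst E h (vadd SA f g) = vst E h f + vst E h g" if "g \<in> carrier CA" for g
    by (rule vst_linear(1)[OF fs finsec_secs[OF CA_finsec[OF that]]])
  show "vst E h (vsmul SA c f) = c * vst E h f" for c by (rule vst_linear(2)[OF fs fs])
  show "cmod (vst E h f) \<le> N f" using vst_bound[OF f x E h] red_le[OF f] by simp
qed

lemma pv_functional:
  assumes x: "x \<in> X" shows "bfun (pv x)"
proof -
  interpret I: normed_star_algebra CA N by (rule nsa)
  have v: "pv x f = vst {x} (\<lambda>_. 1) f" if "f \<in> carrier CA" for f by (rule pv_vst[OF x finsec_secs[OF CA_finsec[OF that]]])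
  have "bfun (vst {x} (\<lambda>_. 1))" by (rule vst_functional[OF x _ unit_gx[OF x]]) simp_all
  thus ?thesis unfolding I.bounded_functional_def using v I.add_closed I.smul_closed by simp
qed

lemma cauchy_red: assumes "f \<in> cauchy_seqs CA N" shows "f \<in> cauchy_seqs CA (red_norm G L)"
proof -
  interpret I: normed_star_algebra CA N by (rule nsa)
  note c = I.seqs_car[OF assms]
  have "\<exists>M. \<forall>m\<ge>M. \<forall>n\<ge>M. red_norm G L (vsub CA (f m) (f n)) < e" if e: "e > 0" for e
  proof -
    obtain M where M: "\<forall>m\<ge>M. \<forall>n\<ge>M. N (vsub CA (f m) (f n)) < e" using I.seqs_cauchy[OF assms e] by (rule exE)
    have "red_norm G L (vsub CA (f m) (f n)) < e" if "m \<ge> M" "n \<ge> M" for m n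
      using M that red_le[OF I.sub_closed[OF c[of m] c[of n]]] by (meson le_less_trans)
    thus ?thesis by blast
  qed
  thus ?thesis unfolding cauchy_seqs_def using c by blast
qed

end

context fell_groupoid
begin

lemma fell_cstar_norm_red: "fell_cstar_norm G L (red_norm G L)"
  by unfold_locales (rule red_norm_cstar, rule order.refl)

lemma fell_cstar_norm_full: "fell_cstar_norm G L (full_norm G L)"
  by unfold_locales (rule full_norm_cstar, rule full_norm_upper[OF _ red_norm_cstar])

text \<open>The values at \<open>x\<close> of all representatives of a class have the same limit, which the definition of
  \<open>red_eval\<close> therefore picks out.\<close>

lemma red_value_extends:
  assumes x: "x \<in> X" shows "normed_star_algebra.extends CA (red_norm G L) (pv x) (red_value G L x)"
proof -
  interpret I: normed_star_algebra CA "red_norm G L" by (rule normed_star_algebra_CA[OF red_norm_cstar])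
  note xa = unitD(1)[OF x]
  have bounded_functional_ok: "I.bounded_functional (pv x)" by (rule fell_cstar_norm.pv_functional[OF fell_cstar_norm_red x])
  note ex = I.extension_exists[OF bounded_functional_ok]
  show ?thesis
    unfolding I.extends_def
  proof
    fix f assume f: "f \<in> I.seqs"
    obtain l where l: "(\<lambda>n. pv x (f n)) \<longlonglongrightarrow> l" using I.extendsD[OF ex f] by blast
    have lim: "(\<lambda>n. pv x (g n)) \<longlonglongrightarrow> l" if g: "g \<in> I.cls f" for g
    proof -
      have gs: "g \<in> I.seqs" using g by (simp add: cauchy_class_def)
      have "I.cls f = I.cls g" unfolding I.cls_eq[OF f gs] using g by (simp add: cauchy_class_def)
      thus ?thesis using I.extendsD[OF ex f] I.extendsD[OF ex gs] LIMSEQ_unique[OF l I.extendsD[OF ex f]] by simp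
    qed
    have gfb: "g n x \<in> fb x" if "g \<in> I.cls f" for g n
      using that I.seqs_car[of g n] secs_fb[OF finsec_secs[OF CA_finsec] xa] by (simp add: cauchy_class_def)
    have nd: "nm (vsub (fibre L x) (g n x) \<xi>) = cmod (pv x (g n) - crd x \<xi>)" if g: "g \<in> I.cls f" and xi: "\<xi> \<in> fb x" for g n \<xi>
      using gfb[OF g, of n] xi xa by (simp add: vsub_def nm_crd fb_add fb_smul crd_add crd_smul)
    have iff: "(\<lambda>n. nm (vsub (fibre L x) (g n x) \<xi>)) \<longlonglongrightarrow> 0 \<longleftrightarrow> crd x \<xi> = l" if g: "g \<in> I.cls f" and xi: "\<xi> \<in> fb x" for g \<xi>
    proof -
      have "(\<lambda>n. nm (vsub (fibre L x) (g n x) \<xi>)) \<longlonglongrightarrow> 0 \<longleftrightarrow> (\<lambda>n. pv x (g n)) \<longlonglongrightarrow> crd x \<xi>"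
        unfolding nd[OF g xi] tendsto_norm_zero_iff by (rule LIM_zero_iff)
      thus ?thesis using lim[OF g] LIMSEQ_unique by blast
    qed
    have "red_eval G L x (I.cls f) = l \<cdot> bas x"
      unfolding red_eval_def
    proof (rule the_equality)
      show "l \<cdot> bas x \<in> fb x \<and> (\<forall>g\<in>I.cls f. (\<lambda>n. nm (vsub (fibre L x) (g n x) (l \<cdot> bas x))) \<longlonglongrightarrow> 0)"
        using iff smul_bas[OF xa] by simp
      fix \<xi> assume H: "\<xi> \<in> fb x \<and> (\<forall>g\<in>I.cls f. (\<lambda>n. nm (vsub (fibre L x) (g n x) \<xi>)) \<longlonglongrightarrow> 0)"
      hence "crd x \<xi> = l" using iff[OF I.mem_cls[OF f]] I.mem_cls[OF f] by blast
      thus "\<xi> = l \<cdot> bas x" using crd[OF xa, of \<xi>] H by simp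
    qed
    hence "red_value G L x (I.cls f) = l"
      unfolding red_value_def using scalar_of_fibre[OF x smul_bas(1)[OF xa]] smul_bas(2)[OF xa] by simp
    thus "(\<lambda>n. pv x (f n)) \<longlonglongrightarrow> red_value G L x (I.cls f)" using l by simp
  qed
qed

text \<open>A sequence that is Cauchy for the full norm is Cauchy for the reduced norm, with the same values
  at \<open>x\<close>.\<close>

lemma full_value_extends:
  assumes x: "x \<in> X" shows "normed_star_algebra.extends CA (full_norm G L) (pv x) (full_value G L x)"
proof -
  interpret I: normed_star_algebra CA "full_norm G L" by (rule normed_star_algebra_CA[OF full_norm_cstar])
  interpret R: normed_star_algebra CA "red_norm G L" by (rule normed_star_algebra_CA[OF red_norm_cstar])
  have bd: "I.bounded_functional (pv x)" by (rule fell_cstar_norm.pv_functional[OF fell_cstar_norm_full x])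
  note ex = I.extension_exists[OF bd]
  show ?thesis
    unfolding I.extends_def
  proof
    fix f assume f: "f \<in> I.seqs"
    let ?g = "representative (I.cls f)"
    note g = I.representative_cls[OF f]
    have "I.cls ?g = I.cls f" using I.cls_eq[OF g(1) f] g(2) by simp
    hence "(\<lambda>n. pv x (?g n)) \<longlonglongrightarrow> lim (\<lambda>n. pv x (?g n))" using I.extendsD[OF ex g(1)] by simp
    moreover have "(\<lambda>n. pv x (?g n)) \<longlonglongrightarrow> red_value G L x (R.cls ?g)"
      by (rule R.extendsD[OF red_value_extends[OF x] fell_cstar_norm.cauchy_red[OF fell_cstar_norm_full g(1)]])
    ultimately have "lim (\<lambda>n. pv x (?g n)) = full_value G L x (I.cls f)"
      unfolding full_value_def Lambda_def by (rule LIMSEQ_unique)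
    thus "(\<lambda>n. pv x (f n)) \<longlonglongrightarrow> full_value G L x (I.cls f)" using I.extendsD[OF ex f] by simp
  qed
qed

section \<open>Functions on the unit space as a subalgebra\<close>

lemma cfun_add: assumes k: "cfun k" and l: "cfun l" shows "cfun (\<lambda>x. k x + l x)"
proof -
  obtain K where K: "compactin TX K" "\<forall>x\<in>X - K. k x = 0" using k unfolding cfun_def by (elim exE conjE)
  obtain K' where K': "compactin TX K'" "\<forall>x\<in>X - K'. l x = 0" using l unfolding cfun_def by (elim exE conjE)
  have c: "continuous_map TX euclidean k" "continuous_map TX euclidean l" using k l by (simp_all add: cfun_def)
  have "compactin TX (K \<union> K')" "\<forall>x\<in>X - (K \<union> K'). k x + l x = 0" using K K' by (simp_all add: compactin_Un)
  thus ?thesis unfolding cfun_def using continuous_map_add[OF c] by blast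
qed

lemma cfun_smul: "cfun k \<Longrightarrow> cfun (\<lambda>x. c * k x)"
  by (rule cfun_comp) (auto intro!: continuous_intros)

lemma cfun_zero: "cfun (\<lambda>_. 0)"
  unfolding cfun_def by (intro conjI exI[of _ "{}"]) simp_all

lemma fn_zero: "fn (\<lambda>_. 0) = vzero SA"
  by (rule secs_eqI[OF fn_secs finsec_secs[OF CA_finsec[OF CA_ops(1)]]]) (simp add: fn_def SA_simps fb_zero_smul bas)

lemma fn_zero_onX: assumes "\<And>x. x \<in> X \<Longrightarrow> k x = l x" shows "fn k = fn l"
  unfolding fn_def by (rule restrict_ext) (simp add: assms)

lemma CcX_iff: "f \<in> Cc X \<longleftrightarrow> (\<exists>k. cfun k \<and> f = fn k)"
  using fn_surj fn_cc by blast

lemma CcX_subspace: "lin_subspace CA (Cc X)"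
  unfolding lin_subspace_def CA_simps(2-4)
proof (intro conjI ballI allI)
  show "Cc X \<subseteq> carrier CA" using gen_CA[OF bisection_units] by blast
  show "vzero SA \<in> Cc X" using fn_cc[OF cfun_zero] fn_zero by simp
  fix f assume "f \<in> Cc X"
  then obtain k where k: "cfun k" "f = fn k" unfolding CcX_iff by (elim exE conjE)
  show "vsmul SA c f \<in> Cc X" for c using fn_ops(3)[OF k(1,1)] fn_cc[OF cfun_smul[OF k(1)]] k(2) by simp
  fix g assume "g \<in> Cc X"
  then obtain l where l: "cfun l" "g = fn l" unfolding CcX_iff by (elim exE conjE)
  show "vadd SA f g \<in> Cc X" using fn_ops(4)[OF k(1) l(1)] fn_cc[OF cfun_add[OF k(1) l(1)]] k(2) l(2) by simp
qed

lemma CcX_mul: assumes "f \<in> Cc X" "g \<in> Cc X" shows "amul SA f g \<in> Cc X"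
proof -
  obtain k l where k: "cfun k" "f = fn k" and l: "cfun l" "g = fn l" using assms unfolding CcX_iff by (elim exE conjE)
  have "cfun (\<lambda>x. k x * l x)" by (rule cfun_mult[OF k(1)]) (use l(1) in \<open>simp add: cfun_def\<close>)
  thus ?thesis using fn_ops(1)[OF k(1) l(1)] fn_cc k(2) l(2) by simp
qed

lemma CcX_adj: assumes "f \<in> Cc X" shows "aadj SA f \<in> Cc X"
proof -
  obtain k where k: "cfun k" "f = fn k" using assms unfolding CcX_iff by (elim exE conjE)
  have "cfun (\<lambda>x. cnj (k x))" by (rule cfun_comp[OF k(1)]) (auto intro!: continuous_intros)
  thus ?thesis using fn_ops(2)[OF k(1,1)] fn_cc k(2) by simp
qed

end

section \<open>Trivial isotropy\<close>

context fell_groupoid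
begin

lemma bprod_units: assumes "U \<subseteq> arr" shows "bprod X U = U" "bprod U X = U"
proof -
  show "bprod X U = U"
  proof (intro equalityI subsetI)
    fix c assume "c \<in> bprod X U"
    then obtain a b where c: "c = a \<star> b" "a \<in> X" "b \<in> U" "s a = r b" by (auto simp: bprod_def)
    have "a = r b" by (rule trans[OF unitD(2)[OF c(2), symmetric] c(4)])
    hence "c = b" using rng_mul_self[of b] c(1,3) assms by auto
    thus "c \<in> U" using c(3) by simp
  next
    fix c assume c: "c \<in> U"
    hence ca: "c \<in> arr" using assms by blast
    have "c = r c \<star> c" "r c \<in> X" "s (r c) = r c" using rng_mul_self[OF ca] ca by (simp_all add: grp)
    thus "c \<in> bprod X U" unfolding bprod_def using c by blast
  qed
  show "bprod U X = U"
  proof (intro equalityI subsetI)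
    fix c assume "c \<in> bprod U X"
    then obtain a b where c: "c = a \<star> b" "a \<in> U" "b \<in> X" "s a = r b" by (auto simp: bprod_def)
    have "b = s a" by (rule trans[OF unitD(3)[OF c(3), symmetric] c(4)[symmetric]])
    hence "c = a" using mul_src[of a] c(1,2) assms by auto
    thus "c \<in> U" using c(2) by simp
  next
    fix c assume c: "c \<in> U"
    hence ca: "c \<in> arr" using assms by blast
    have "c = c \<star> s c" "s c \<in> X" "s c = r (s c)" using mul_src[OF ca] ca by (simp_all add: grp)
    thus "c \<in> bprod U X" unfolding bprod_def using c by blast
  qed
qed

text \<open>If \<open>x\<close> has trivial isotropy, then a section \<open>f\<close> over a bisection can be cut down to a
  function on the unit space by multiplying it on both sides with a bump function \<open>a\<close> at \<open>x\<close>: near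
  \<open>x\<close>, either \<open>f\<close> lives on units only, or the bisection moves every point of the support of \<open>a\<close>
  out of it.\<close>

lemma compress:
  assumes x: "x \<in> X" and iso: "isotropy G x = {x}" and U: "open_bisection G U" and f: "f \<in> Cc U"
  shows "\<exists>a k. cfun (\<lambda>y. of_real (a y)) \<and> a x = (1::real) \<and> cfun k \<and> k x = pv x f \<and>
    amul SA (amul SA (fn (\<lambda>y. of_real (a y))) f) (fn (\<lambda>y. of_real (a y))) = fn k"
proof -
  note fF = gen_finsec[OF U f] and fs = ccD(1)[OF U f] and Ua = bisection_arr[OF U]
  have inj: "inj_on (rng G) U" "inj_on (src G) U" and Uo: "openin T U" using U by (simp_all add: open_bisection_def)
  define h where "h a = amul SA (amul SA (fn (\<lambda>y. of_real (a y))) f) (fn (\<lambda>y. of_real (a y)))" for a :: "'g \<Rightarrow> real"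
  have hU: "h a \<in> Cc U" if a: "cfun (\<lambda>y. of_real (a y))" for a
  proof -
    have "amul SA (fn (\<lambda>y. of_real (a y))) f \<in> Cc U"
      using gen_mul[OF bisection_units U fn_cc[OF a] f] bprod_units(1)[OF Ua] by simp
    from gen_mul[OF U bisection_units this fn_cc[OF a]] show ?thesis using bprod_units(2)[OF Ua] by (simp add: h_def)
  qed
  have hv: "crd g (h a g) = of_real (a (r g)) * crd g (f g) * of_real (a (s g))"
    if a: "cfun (\<lambda>y. of_real (a y))" and g: "g \<in> arr" for a g
    unfolding h_def using fn_mul_value(2)[OF a finsec_mul[OF fn_finsec[OF a] fF] g] fn_mul_value(1)[OF a fF g] by simp
  have hs: "h a \<in> secs" if a: "cfun (\<lambda>y. of_real (a y))" for a by (rule ccD(1)[OF U hU[OF a]])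
  have hz: "h a g = zr g" if a: "cfun (\<lambda>y. of_real (a y))" and g: "g \<in> arr" and z: "f g \<noteq> zr g \<Longrightarrow> a (r g) = 0 \<or> a (s g) = 0" for a g
  proof -
    have "crd g (h a g) = 0" using hv[OF a g] z crd_zero[OF g] by (cases "f g = zr g") auto
    thus ?thesis using crd_eq_0[OF g secs_fb[OF hs[OF a] g]] by simp
  qed
  note xx = unitD[OF x]
  have cx: "compactin TX {x}" using x by (simp add: topspace_TX)
  have ph: "crd x (h a x) = pv x f" if a: "cfun (\<lambda>y. of_real (a y))" "a x = 1" for a
    using hv[OF a(1) xx(1)] a(2) xx(2,3) by simp
  have "\<exists>a. cfun (\<lambda>y. of_real (a y)) \<and> a x = 1 \<and> h a \<in> Cc X"
  proof (cases "x \<in> U")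
    case True
    (* Near x, an arrow of U with range in U is a unit by injectivity of the range map. *)
    have V: "openin TX (U \<inter> X)" "{x} \<subseteq> U \<inter> X" using Uo open_units True x by (simp_all add: openin_TX openin_Int)
    obtain a :: "'g \<Rightarrow> real" and K' where a: "cfun (\<lambda>y. of_real (a y))" and a1: "\<forall>y\<in>{x}. a y = 1"
      and K': "compactin TX K'" "K' \<subseteq> U \<inter> X" "\<forall>y\<in>X - K'. a y = 0"
      using bump[OF cx V] by (elim exE conjE)
    note a = a bspec[OF a1 singletonI]
    have "h a \<in> Cc X"
    proof (rule unit_supported[OF U hU[OF a(1)] _ K'(2)])
      show "compactin T K'" using K'(1) by (simp add: compactin_TX)
      show "\<forall>g\<in>arr - K'. h a g = zr g"
      proof
        fix g assume g: "g \<in> arr - K'"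
        hence ga: "g \<in> arr" by simp
        show "h a g = zr g"
        proof (rule hz[OF a(1) ga])
          assume "f g \<noteq> zr g"
          hence gU: "g \<in> U" by (rule ccD(3)[OF U f ga])
          have "a (r g) = 0"
          proof (rule ccontr)
            assume "a (r g) \<noteq> 0"
            hence rK: "r g \<in> K'" using K'(3) rng_unit[OF ga] by blast
            hence "r g \<in> U" using K'(2) by blast
            hence "r g = g" by (rule inj_onD[OF inj(1) rng_rng[OF ga] _ gU])
            thus False using rK g by simp
          qed
          thus "a (r g) = 0 \<or> a (s g) = 0" ..
        qed
      qed
    qed
    thus ?thesis using a by blast
  next
    case xU: False
    obtain K where K: "compactin T K" "K \<subseteq> U" "\<forall>g\<in>arr - K. f g = zr g" using ccD(4)[OF U f] by (elim exE conjE)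
    have "\<exists>V. openin TX V \<and> x \<in> V \<and> (\<forall>g\<in>K. r g \<notin> V \<or> s g \<notin> V)"
    proof (cases "x \<in> src G ` K")
      case False
      (* Here x is not a source of the support, and the bump avoids all of these sources. *)
      have "compactin TX (src G ` K)" by (rule image_compactin[OF K(1) cont_src])
      hence "openin TX (X - src G ` K)"
        using openin_diff[OF openin_topspace compactin_imp_closedin[OF Hausdorff_units]] by (metis topspace_TX)
      thus ?thesis using False x by (intro exI[of _ "X - src G ` K"]) auto
    next
      case True
      (* Here x is the source of an arrow of U with another range; separate the two. *)
      then obtain g0 where g0: "g0 \<in> K" "x = s g0" by (rule imageE)
      have g0U: "g0 \<in> U" using g0(1) K(2) by blast
      hence g0a: "g0 \<in> arr" using Ua by blast
      have "r g0 \<noteq> x"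
      proof
        assume "r g0 = x"
        hence "g0 \<in> isotropy G x" using g0(2) g0a by (simp add: isotropy_def)
        hence "g0 = x" using iso by simp
        thus False using g0U xU by simp
      qed
      hence "\<exists>V1 V2. openin TX V1 \<and> openin TX V2 \<and> x \<in> V1 \<and> r g0 \<in> V2 \<and> disjnt V1 V2"
        using Hausdorff_units x rng_unit[OF g0a] unfolding Hausdorff_space_def by (simp add: topspace_TX)
      then obtain V1 V2 where V: "openin TX V1" "openin TX V2" "x \<in> V1" "r g0 \<in> V2" "disjnt V1 V2" by (elim exE conjE)
      let ?S = "{g \<in> topspace T. r g \<in> V2} \<inter> U"
      have "openin T ?S" by (rule openin_Int[OF openin_continuous_map_preimage[OF cont_rng V(2)] Uo])
      hence oS: "openin TX (src G ` ?S)" using open_src by (simp add: open_map_def)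
      have xS: "x \<in> src G ` ?S" using g0(2) g0U g0a V(4) by (auto simp: topspace_T)
      have "r g \<notin> V1 \<inter> src G ` ?S \<or> s g \<notin> V1 \<inter> src G ` ?S" if g: "g \<in> K" for g
      proof (rule ccontr)
        assume "\<not> ?thesis"
        hence H: "r g \<in> V1" "s g \<in> src G ` ?S" by simp_all
        obtain g' where g': "s g = s g'" "g' \<in> ?S" using H(2) by (rule imageE)
        have gU: "g \<in> U" using g K(2) by blast
        have "g = g'" by (rule inj_onD[OF inj(2) g'(1) gU]) (use g'(2) in simp)
        hence "r g \<in> V2" using g'(2) by simp
        thus False using H(1) V(5) by (auto simp: disjnt_def)
      qed
      thus ?thesis using V(1,3) oS xS by (intro exI[of _ "V1 \<inter> src G ` ?S"]) (simp add: openin_Int)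
    qed
    then obtain V where V: "openin TX V" "x \<in> V" "\<forall>g\<in>K. r g \<notin> V \<or> s g \<notin> V" by (elim exE conjE)
    have xV: "{x} \<subseteq> V" using V(2) by simp
    obtain a :: "'g \<Rightarrow> real" where a: "cfun (\<lambda>y. of_real (a y))" and a1: "\<forall>y\<in>{x}. a y = 1" and aV: "\<forall>y\<in>X. y \<notin> V \<longrightarrow> a y = 0"
      using bump[OF cx V(1) xV] by (elim exE conjE)
    note a = a bspec[OF a1 singletonI]
    have "h a = fn (\<lambda>_. 0)"
    proof (rule secs_eqI[OF hs[OF a(1)] fn_secs])
      fix g assume g: "g \<in> arr"
      have "h a g = zr g"
      proof (rule hz[OF a(1) g])
        assume "f g \<noteq> zr g"
        hence "g \<in> K" using K(3) g by blast
        hence "r g \<notin> V \<or> s g \<notin> V" using V(3) by blast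
        thus "a (r g) = 0 \<or> a (s g) = 0" using aV rng_unit[OF g] src_unit[OF g] by blast
      qed
      thus "h a g = fn (\<lambda>_. 0) g" using g by (simp add: fn_def fb_zero_smul bas)
    qed
    hence "h a \<in> Cc X" using fn_cc[OF cfun_zero] by simp
    thus ?thesis using a by blast
  qed
  then obtain a where a: "cfun (\<lambda>y. of_real (a y))" "a x = 1" "h a \<in> Cc X" by (elim exE conjE)
  note k = fn_surj[OF a(3)]
  show ?thesis
    using a(1,2) k ph[OF a(1,2)] unfolding h_def by blast
qed

definition ideal_span where
  "ideal_span x = lin_span CA ({amul CA d b | d b. d \<in> Cc X \<and> pv x d = 0 \<and> b \<in> carrier CA} \<union>
                   {amul CA b d | d b. d \<in> Cc X \<and> pv x d = 0 \<and> b \<in> carrier CA})"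

lemma ideal_span:
  shows "lin_subspace CA (ideal_span x)"
    "d \<in> Cc X \<Longrightarrow> pv x d = 0 \<Longrightarrow> b \<in> carrier CA \<Longrightarrow> amul SA d b \<in> ideal_span x"
    "d \<in> Cc X \<Longrightarrow> pv x d = 0 \<Longrightarrow> b \<in> carrier CA \<Longrightarrow> amul SA b d \<in> ideal_span x"
proof -
  interpret V: complex_vector_space CA by (rule vector_space_CA)
  let ?S = "{amul CA d b | d b. d \<in> Cc X \<and> pv x d = 0 \<and> b \<in> carrier CA} \<union>
                   {amul CA b d | d b. d \<in> Cc X \<and> pv x d = 0 \<and> b \<in> carrier CA}"
  have D: "d \<in> carrier CA" if "d \<in> Cc X" for d by (rule gen_CA[OF bisection_units that])
  have S: "?S \<subseteq> carrier CA" using CA_mul D by (auto simp: CA_simps(5))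
  show "lin_subspace CA (ideal_span x)" unfolding ideal_span_def by (rule V.lin_subspace_span[OF S])
  show "amul SA d b \<in> ideal_span x" "amul SA b d \<in> ideal_span x" if "d \<in> Cc X" "pv x d = 0" "b \<in> carrier CA"
    using V.span_superset[of ?S] that unfolding ideal_span_def CA_simps(5) by blast+
qed

text \<open>With \<open>a\<close> as in \<open>compress\<close> and \<open>u = 1\<close> on the range and source of the support of \<open>f\<close>,
  \<open>f - afa = (u - a)f + af(u - a)\<close>, and \<open>u - a\<close> vanishes at \<open>x\<close> if also \<open>u(x) = 1\<close>.\<close>

lemma decompose:
  assumes x: "x \<in> X" and iso: "isotropy G x = {x}" and e: "e \<in> Cc X" "pv x e = 1" and f: "f \<in> carrier CA"
  shows "vsub CA f (vsmul CA (pv x f) e) \<in> ideal_span x"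
  using f
proof (induction rule: CA_induct)
  case (add f g)
  interpret V: complex_vector_space CA by (rule vector_space_CA)
  note ec = gen_CA[OF bisection_units e(1)]
  have "pv x (vadd SA f g) = pv x f + pv x g"
    using crd_add[OF unitD(1)[OF x] secs_fb[OF finsec_secs[OF CA_finsec[OF add(1)]] unitD(1)[OF x]] secs_fb[OF finsec_secs[OF CA_finsec[OF add(2)]] unitD(1)[OF x]]]
      unitD(1)[OF x] by (simp add: SA_simps)
  hence "vsub CA (vadd SA f g) (vsmul CA (pv x (vadd SA f g)) e)
      = vadd CA (vsub CA f (vsmul CA (pv x f) e)) (vsub CA g (vsmul CA (pv x g) e))"
    using V.add_sub_add[OF add(1,2) V.smul_closed[OF ec] V.smul_closed[OF ec]] V.add_smul[OF ec] by (simp add: CA_simps(3))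
  thus ?case using add(3,4) ideal_span(1)[of x] by (simp add: lin_subspace_def)
next
  case (smul c f)
  interpret V: complex_vector_space CA by (rule vector_space_CA)
  note ec = gen_CA[OF bisection_units e(1)]
  have "pv x (vsmul SA c f) = c * pv x f"
    using crd_smul[OF unitD(1)[OF x] secs_fb[OF finsec_secs[OF CA_finsec[OF smul(1)]] unitD(1)[OF x]]]
      unitD(1)[OF x] by (simp add: SA_simps)
  hence "vsub CA (vsmul SA c f) (vsmul CA (pv x (vsmul SA c f)) e) = vsmul CA c (vsub CA f (vsmul CA (pv x f) e))"
    using V.smul_sub[OF smul(1) V.smul_closed[OF ec]] V.smul_smul[OF ec] by (simp add: CA_simps(4))
  thus ?case using smul(2) ideal_span(1)[of x] by (simp add: lin_subspace_def)
next
  case (gen U f)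
  interpret V: complex_vector_space CA by (rule vector_space_CA)
  note ec = gen_CA[OF bisection_units e(1)] and fc = gen_CA[OF gen] and fF = gen_finsec[OF gen] and fs = ccD(1)[OF gen]
  have "\<exists>a k. cfun (\<lambda>y. of_real (a y)) \<and> a x = (1::real) \<and> cfun k \<and> k x = pv x f \<and>
    amul SA (amul SA (fn (\<lambda>y. of_real (a y))) f) (fn (\<lambda>y. of_real (a y))) = fn k"
    by (rule compress[OF x iso gen])
  then obtain a k where a: "cfun (\<lambda>y. of_real (a y))" "a x = (1::real)" and k: "cfun k" "k x = pv x f"
    and afa: "amul SA (amul SA (fn (\<lambda>y. of_real (a y))) f) (fn (\<lambda>y. of_real (a y))) = fn k" by (elim exE conjE)
  let ?a = "fn (\<lambda>y. of_real (a y))"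
  obtain K where K: "compactin T K" "K \<subseteq> U" "\<forall>g\<in>arr - K. f g = zr g" using ccD(4)[OF gen] by (elim exE conjE)
  have Ka: "K \<subseteq> arr" using K(2) bisection_arr[OF gen(1)] by blast
  (* The function u is 1 on C, so multiplication by u fixes f and d = u - a vanishes at x. *)
  let ?C = "insert x (rng G ` K \<union> src G ` K)"
  have "compactin TX {x}" using x by (simp add: topspace_TX)
  hence "compactin TX ({x} \<union> (rng G ` K \<union> src G ` K))"
    by (intro compactin_Un image_compactin[OF K(1) cont_rng] image_compactin[OF K(1) cont_src])
  hence C: "compactin TX ?C" by simp
  have CX: "?C \<subseteq> X" using C by (simp add: compactin_TX)
  have oX: "openin TX X" using openin_topspace[of TX] by (simp add: topspace_TX)
  obtain u :: "'g \<Rightarrow> real" where u: "cfun (\<lambda>y. of_real (u y))" "\<forall>y\<in>?C. u y = 1"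
    using bump[OF C oX CX] by (elim exE conjE)
  define d where "d y = complex_of_real (u y) - of_real (a y)" for y
  have dc: "cfun d"
    using cfun_add[OF u(1) cfun_smul[OF a(1), of "-1"]] by (simp add: d_def[abs_def])
  have d0: "pv x (fn d) = 0" using pv_fn[OF dc x] u(2) a(2) by (simp add: d_def)
  have af: "amul SA ?a f \<in> carrier CA" by (rule CA_mul[OF fn_CA[OF a(1)] fc])
  note fns = fn_finsec[OF a(1)] and fnd = fn_finsec[OF dc]
  have "vsub CA f (fn k) = vadd SA (amul SA (fn d) f) (amul SA (amul SA ?a f) (fn d))"
    unfolding vsub_def CA_simps(3,4) afa[symmetric]
  proof (rule mat_inject)
    note s1 = conv_secs[OF fns fs] and s2 = conv_secs[OF fnd fs]
    note s3 = finsec_mul[OF fns fF]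
    show "vadd SA f (vsmul SA (- 1) (amul SA (amul SA ?a f) ?a)) \<in> secs"
      by (intro secs_ops fs conv_secs[OF s3 fn_secs])
    show "vadd SA (amul SA (fn d) f) (amul SA (amul SA ?a f) (fn d)) \<in> secs"
      by (intro secs_ops s2 conv_secs[OF s3 fn_secs])
    fix b c
    have m: "mat (vadd SA f (vsmul SA (- 1) (amul SA (amul SA ?a f) ?a))) b c = mat f b c - of_real (a (r b)) * mat f b c * of_real (a (r c))"
      using mat_add[OF fs secs_ops(2)[OF conv_secs[OF s3 fn_secs]]] mat_smul[OF conv_secs[OF s3 fn_secs]] mat_mul_fn[OF a(1) s3] mat_fn_mul[OF a(1) fs]
      by simp
    have m': "mat (vadd SA (amul SA (fn d) f) (amul SA (amul SA ?a f) (fn d))) b c = d (r b) * mat f b c + of_real (a (r b)) * mat f b c * d (r c)"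
      using mat_add[OF s2 conv_secs[OF s3 fn_secs]] mat_mul_fn[OF dc s3] mat_fn_mul[OF a(1) fs] mat_fn_mul[OF dc fs] by simp
    show "mat (vadd SA f (vsmul SA (- 1) (amul SA (amul SA ?a f) ?a))) b c = mat (vadd SA (amul SA (fn d) f) (amul SA (amul SA ?a f) (fn d))) b c"
      unfolding m m'
    proof (cases "mat f b c = 0")
      case False
      note bc = mat_nonzeroD[OF False]
      note D = div_arrow[OF bc]
      have "f (b \<star> iv c) \<noteq> zr (b \<star> iv c)" using mat_eq_0[OF bc fs] False by simp
      hence "b \<star> iv c \<in> K" using K(3) D(1) by blast
      hence "r b \<in> ?C" "r c \<in> ?C" using imageI[of "b \<star> iv c" K "rng G"] imageI[of "b \<star> iv c" K "src G"] unfolding D(2,3) by simp_all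
      hence "u (r b) = 1" "u (r c) = 1" using u(2) by blast+
      hence dd: "d (r b) = 1 - of_real (a (r b))" "d (r c) = 1 - of_real (a (r c))" unfolding d_def by simp_all
      thus "mat f b c - of_real (a (r b)) * mat f b c * of_real (a (r c)) = d (r b) * mat f b c + of_real (a (r b)) * mat f b c * d (r c)"
        unfolding dd by (simp add: algebra_simps)
    qed simp
  qed
  moreover have "amul SA (fn d) f \<in> ideal_span x" by (rule ideal_span(2)[OF fn_cc[OF dc] d0 fc])
  moreover have "amul SA (amul SA ?a f) (fn d) \<in> ideal_span x" by (rule ideal_span(3)[OF fn_cc[OF dc] d0 af])
  ultimately have 1: "vsub CA f (fn k) \<in> ideal_span x" using ideal_span(1)[of x] by (simp add: lin_subspace_def CA_simps(3))
  obtain l where l: "cfun l" "e = fn l" using e(1) unfolding CcX_iff by (elim exE conjE)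
  define j where "j y = k y + (- pv x f) * l y" for y
  have jc: "cfun j" unfolding j_def[abs_def] by (rule cfun_add[OF k(1) cfun_smul[OF l(1)]])
  have "vsub CA (fn k) (vsmul CA (pv x f) e) = fn j"
    unfolding vsub_def l(2) CA_simps(3,4)
    using fn_ops(3)[OF l(1,1)] fn_ops(3)[OF cfun_smul[OF l(1)] l(1)] fn_ops(4)[OF k(1) cfun_smul[OF l(1)], of "- pv x f"] by (simp add: j_def[abs_def])
  moreover have "fn j \<in> ideal_span x"
  proof -
    obtain K where K: "compactin TX K" "\<forall>y\<in>X - K. j y = 0" using jc unfolding cfun_def by (elim exE conjE)
    have KX: "K \<subseteq> X" using K(1) by (simp add: compactin_TX)
    obtain v :: "'g \<Rightarrow> real" where v: "cfun (\<lambda>y. of_real (v y))" "\<forall>y\<in>K. v y = 1"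
      using bump[OF K(1) oX KX] by (elim exE conjE)
    have "l x = 1" using e(2) l(2) pv_fn[OF l(1) x] by simp
    hence j0: "pv x (fn j) = 0" using pv_fn[OF jc x] k(2) by (simp add: j_def)
    have "amul SA (fn j) (fn (\<lambda>y. of_real (v y))) = fn (\<lambda>y. j y * of_real (v y))" by (rule fn_ops(1)[OF jc v(1)])
    also have "\<dots> = fn j"
    proof (rule fn_zero_onX)
      fix y assume "y \<in> X"
      thus "j y * of_real (v y) = j y" using K(2) v(2) by (cases "y \<in> K") simp_all
    qed
    finally show ?thesis using ideal_span(2)[OF fn_cc[OF jc] j0 fn_CA[OF v(1)]] by simp
  qed
  ultimately have 2: "vsub CA (fn k) (vsmul CA (pv x f) e) \<in> ideal_span x" by simp
  show ?case
    using V.sub_trans[OF fc fn_CA[OF k(1)] V.smul_closed[OF ec, of "pv x f"]] 1 2 ideal_span(1)[of x]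
    by (simp add: lin_subspace_def) metis
qed

text \<open>The approximate unit of the functions vanishing at \<open>x\<close>: functions that are \<open>1\<close> on larger and
  larger compact sets avoiding \<open>x\<close>.\<close>

definition unit_set where
  "unit_set x C = {fn (\<lambda>y. of_real (u y)) | u :: 'g \<Rightarrow> real. cfun (\<lambda>y. of_real (u y)) \<and> (\<forall>y\<in>X. \<bar>u y\<bar> \<le> 1) \<and> u x = 0 \<and> (\<forall>y\<in>C. u y = 1)}"

definition approx_unit where
  "approx_unit x = (INF C\<in>{C. compactin TX C \<and> x \<notin> C}. principal (unit_set x C))"

lemma eventually_approx_unit:
  "eventually P (approx_unit x) \<longleftrightarrow> (\<exists>C. compactin TX C \<and> x \<notin> C \<and> (\<forall>u\<in>unit_set x C. P u))"
proof -
  have "eventually P (approx_unit x) \<longleftrightarrow> (\<exists>C\<in>{C. compactin TX C \<and> x \<notin> C}. eventually P (principal (unit_set x C)))"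
    unfolding approx_unit_def
  proof (rule eventually_INF_base)
    show "{C. compactin TX C \<and> x \<notin> C} \<noteq> {}" using compactin_empty by blast
    fix C C' assume H: "C \<in> {C. compactin TX C \<and> x \<notin> C}" "C' \<in> {C. compactin TX C \<and> x \<notin> C}"
    have "unit_set x (C \<union> C') \<subseteq> unit_set x C \<inter> unit_set x C'" unfolding unit_set_def by blast
    hence "principal (unit_set x (C \<union> C')) \<le> inf (principal (unit_set x C)) (principal (unit_set x C'))" by simp
    moreover have "C \<union> C' \<in> {C. compactin TX C \<and> x \<notin> C}" using H by (simp add: compactin_Un)
    ultimately show "\<exists>c\<in>{C. compactin TX C \<and> x \<notin> C}. principal (unit_set x c) \<le> inf (principal (unit_set x C)) (principal (unit_set x C'))"
      by blast
  qed
  thus ?thesis by (auto simp: eventually_principal)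
qed

lemma approx_unit_nontrivial: assumes x: "x \<in> X" shows "approx_unit x \<noteq> bot"
proof -
  have "unit_set x C \<noteq> {}" if C: "compactin TX C" "x \<notin> C" for C
  proof -
    have "compactin TX {x}" using x by (simp add: topspace_TX)
    hence o: "openin TX (X - {x})"
      using openin_diff[OF openin_topspace compactin_imp_closedin[OF Hausdorff_units]] by (metis topspace_TX)
    have sub: "C \<subseteq> X - {x}" using C by (auto simp: compactin_TX)
    obtain u :: "'g \<Rightarrow> real" where u: "cfun (\<lambda>y. of_real (u y))" "\<forall>y. 0 \<le> u y \<and> u y \<le> 1" "\<forall>y\<in>C. u y = 1"
      "\<forall>y\<in>X. y \<notin> X - {x} \<longrightarrow> u y = 0"
      using bump[OF C(1) o sub] by (elim exE conjE)
    have "\<forall>y\<in>X. \<bar>u y\<bar> \<le> 1" using u(2) by simp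
    moreover have "u x = 0" using u(4) x by simp
    ultimately have "fn (\<lambda>y. of_real (u y)) \<in> unit_set x C" unfolding unit_set_def using u(1,3) by blast
    thus ?thesis by blast
  qed
  hence "\<not> eventually (\<lambda>_. False) (approx_unit x)" unfolding eventually_approx_unit by blast
  thus ?thesis by (simp add: trivial_limit_def)
qed

end

context fell_cstar_norm
begin

text \<open>The set \<open>C\<close> where \<open>|k| \<ge> \<epsilon>/2\<close> is compact and avoids \<open>x\<close>. Off \<open>C\<close> the factor \<open>1 - u\<close> is at most \<open>2\<close>.\<close>

lemma approx_unit_fn:
  assumes k: "cfun k" and x: "k x = 0" and e: "0 < e"
  shows "\<exists>C. compactin TX C \<and> x \<notin> C \<and> (\<forall>u\<in>unit_set x C. N (vsub CA (fn k) (amul CA u (fn k))) \<le> e)"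
proof -
  obtain K where K: "compactin TX K" "\<forall>y\<in>X - K. k y = 0" using k unfolding cfun_def by (elim exE conjE)
  have kc: "continuous_map TX euclidean k" using k by (simp add: cfun_def)
  let ?S = "{y \<in> topspace TX. k y \<in> - ball 0 (e/2)}"
  let ?C = "K \<inter> ?S"
  have "closedin TX ?S" by (rule closedin_continuous_map_preimage[OF kc]) (simp add: closed_Compl)
  hence C: "compactin TX ?C" using closed_Int_compactin[of TX ?S K] K(1) by (simp add: Int_commute)
  have xC: "x \<notin> ?C" using x e by simp
  have "N (vsub CA (fn k) (amul CA u (fn k))) \<le> e" if uC: "u \<in> unit_set x ?C" for u
  proof -
    obtain w :: "'g \<Rightarrow> real" where w: "u = fn (\<lambda>y. of_real (w y))" "cfun (\<lambda>y. of_real (w y))" "\<forall>y\<in>X. \<bar>w y\<bar> \<le> 1" "\<forall>y\<in>?C. w y = 1"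
      using uC unfolding unit_set_def by blast
    let ?m = "\<lambda>y. k y + (-1) * (of_real (w y) * k y)"
    have wk: "cfun (\<lambda>y. of_real (w y) * k y)" by (rule cfun_mult[OF w(2) kc])
    have m: "cfun ?m" by (rule cfun_add[OF k cfun_smul[OF wk]])
    have eq: "vsub CA (fn k) (amul CA u (fn k)) = fn ?m"
      unfolding vsub_def CA_simps(3-5) w(1) fn_ops(1)[OF w(2) k] fn_ops(3)[OF wk k] fn_ops(4)[OF k cfun_smul[OF wk]] ..
    have "N (fn ?m) \<le> e"
    proof (rule fn_norm_le[OF cstar_norm m _ less_imp_le[OF e]])
      fix y assume y: "y \<in> X"
      have "?m y = of_real (1 - w y) * k y" by (simp add: algebra_simps)
      hence n: "cmod (?m y) = \<bar>1 - w y\<bar> * cmod (k y)" by (simp only: norm_mult norm_of_real)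
      show "cmod (?m y) \<le> e"
      proof (cases "y \<in> ?C")
        case True thus ?thesis using n w(4) e by simp
      next
        case False
        hence ky: "cmod (k y) \<le> e/2" using y K(2) e by (cases "y \<in> K") (auto simp: topspace_TX dist_norm)
        have "\<bar>w y\<bar> \<le> 1" using w(3) y by blast
        hence "\<bar>1 - w y\<bar> \<le> 2" by linarith
        from mult_mono[OF this ky] show ?thesis using n by simp
      qed
    qed
    thus ?thesis unfolding eq .
  qed
  thus ?thesis using C xC by blast
qed

lemma dense_point_trivial_isotropy:
  assumes x: "x \<in> X" and iso: "isotropy G x = {x}" and e: "e \<in> Cc X" "pv x e = 1" and ev: "exts (pv x) ev"
  shows "dense_point CA N (Cc X) (pv x) ev e (approx_unit x)"
proof (intro dense_point.intro nsa dense_point_axioms.intro)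
  show "lin_subspace CA (Cc X)" by (rule CcX_subspace)
  show "bfun (pv x)" by (rule pv_functional[OF x])
  show "exts (pv x) ev" by (rule ev)
  show "e \<in> Cc X" "pv x e = 1" by (rule e)+
  show "approx_unit x \<noteq> bot" by (rule approx_unit_nontrivial[OF x])
  show "pv x (aadj CA a) = cnj (pv x a)" if "a \<in> carrier CA" for a
  proof -
    note as = finsec_secs[OF CA_finsec[OF that]]
    show ?thesis using mat_adj[OF as, of x x] mat_src[OF as unitD(1)[OF x]] mat_src[OF adj_secs[OF as] unitD(1)[OF x]] unitD[OF x]
      by (simp add: CA_simps(6))
  qed
  show "amul CA a b \<in> Cc X" if "a \<in> Cc X" "b \<in> Cc X" for a b
    unfolding CA_simps(5) by (rule CcX_mul[OF that])
  show "aadj CA a \<in> Cc X" if "a \<in> Cc X" for a unfolding CA_simps(6) by (rule CcX_adj[OF that])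
  note xx = unitD[OF x]
  show "pv x (amul CA d a) = pv x d * pv x a" "pv x (amul CA a d) = pv x a * pv x d"
    if d: "d \<in> Cc X" and a: "a \<in> carrier CA" for d a
  proof -
    obtain k where k: "cfun k" "d = fn k" using d unfolding CcX_iff by (elim exE conjE)
    show "pv x (amul CA d a) = pv x d * pv x a" "pv x (amul CA a d) = pv x a * pv x d"
      using fn_mul_value[OF k(1) CA_finsec[OF a] xx(1)] pv_fn[OF k(1) x] xx(2,3) by (simp_all add: CA_simps(5) k(2))
  qed
  show "vsub CA a (vsmul CA (pv x a) e) \<in> lin_span CA
     ({amul CA d b |d b. d \<in> Cc X \<and> pv x d = 0 \<and> b \<in> carrier CA} \<union>
      {amul CA b d |d b. d \<in> Cc X \<and> pv x d = 0 \<and> b \<in> carrier CA})" if "a \<in> carrier CA" for a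
    using decompose[OF x iso e that] unfolding ideal_span_def .
  show "eventually (\<lambda>u. u \<in> Cc X \<and> pv x u = 0 \<and> aadj CA u = u \<and> (\<forall>b\<in>carrier CA. N (amul CA u b) \<le> N b)) (approx_unit x)"
    unfolding eventually_approx_unit
  proof (intro exI[of _ "{}"] conjI ballI)
    fix u assume "u \<in> unit_set x {}"
    then obtain w :: "'g \<Rightarrow> real" where w: "u = fn (\<lambda>y. of_real (w y))" "cfun (\<lambda>y. of_real (w y))" "\<forall>y\<in>X. \<bar>w y\<bar> \<le> 1" "w x = 0"
      unfolding unit_set_def by blast
    show "u \<in> Cc X" unfolding w(1) by (rule fn_cc[OF w(2)])
    show "pv x u = 0" using pv_fn[OF w(2) x] w(1,4) by simp
    show "aadj CA u = u" unfolding w(1) CA_simps(6) using fn_ops(2)[OF w(2,2)] by simp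
    fix b assume b: "b \<in> carrier CA"
    show "N (amul CA u b) \<le> N b" unfolding w(1) CA_simps(5) by (rule fn_contractive_left[OF cstar_norm w(2) bspec[OF w(3)] b])
  qed simp_all
  interpret I: normed_star_algebra CA N by (rule nsa)
  show "((\<lambda>u. N (vsub CA d (amul CA u d))) \<longlongrightarrow> 0) (approx_unit x)" if d: "d \<in> Cc X" "pv x d = 0" for d
  proof (rule tendstoI)
    fix e :: real assume e: "0 < e"
    obtain k where k: "cfun k" "d = fn k" using d(1) unfolding CcX_iff by (elim exE conjE)
    have "k x = 0" using pv_fn[OF k(1) x] d(2) k(2) by simp
    from approx_unit_fn[OF k(1) this half_gt_zero[OF e]] obtain C where C: "compactin TX C" "x \<notin> C"
      "\<forall>u\<in>unit_set x C. N (vsub CA d (amul CA u d)) \<le> e/2"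
      unfolding k(2) by (elim exE conjE)
    have "dist (N (vsub CA d (amul CA u d))) 0 < e" if u: "u \<in> unit_set x C" for u
    proof -
      have uc: "u \<in> carrier CA" using u fn_CA unfolding unit_set_def by blast
      have dc: "d \<in> carrier CA" by (rule gen_CA[OF bisection_units d(1)])
      have "0 \<le> N (vsub CA d (amul CA u d))" by (intro I.norm_nonneg I.closed uc dc)
      thus ?thesis using bspec[OF C(3) u] e by (simp add: dist_real_def)
    qed
    thus "eventually (\<lambda>u. dist (N (vsub CA d (amul CA u d))) 0 < e) (approx_unit x)"
      unfolding eventually_approx_unit using C(1,2) by blast
  qed
qed

end

section \<open>States over a point\<close>

context fell_groupoid
begin

text \<open>Cut off a continuous local section with a bump function of the source.\<close>

lemma section_through:
  assumes U: "open_bisection G U" and g: "g \<in> U"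
  shows "\<exists>f\<in>Cc U. f g \<noteq> zr g"
proof -
  have Ua: "a \<in> arr" if "a \<in> U" for a using bisection_arr[OF U] that by blast
  note ga = Ua[OF g]
  obtain \<sigma> where \<sigma>: "continuous_map (subtopology T U) TL \<sigma>" "\<forall>a\<in>U. \<sigma> a \<in> fb a" "\<sigma> g \<noteq> zr g"
    using local_section[OF U g] by (elim exE conjE)
  have V: "openin TX (src G ` U)" by (rule src_inverse(3)[OF U])
  have K: "compactin TX {s g}" "{s g} \<subseteq> src G ` U" using src_unit[OF ga] g by (simp_all add: topspace_TX)
  obtain k :: "'g \<Rightarrow> real" and K' where k: "cfun (\<lambda>y. of_real (k y))" "\<forall>y\<in>{s g}. k y = 1"
    and K': "compactin TX K'" "K' \<subseteq> src G ` U" "\<forall>y\<in>X - K'. k y = 0"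
    using bump[OF K(1) V K(2)] by (elim exE conjE)
  define f where "f = (\<lambda>a\<in>arr. if a \<in> U then of_real (k (s a)) \<cdot> \<sigma> a else zr a)"
  have fs: "f \<in> secs" unfolding f_def using \<sigma>(2) by (simp add: fb_smul fb_zero)
  have "f \<in> Cc U"
    unfolding cc_iff[OF U]
  proof (intro conjI fs)
    have kc: "continuous_map TX euclidean (\<lambda>y. complex_of_real (k y))" using k(1) by (simp add: cfun_def)
    have "continuous_map (subtopology T U) euclidean (\<lambda>a. complex_of_real (k (s a)))"
      using continuous_map_compose[OF continuous_map_from_subtopology[OF cont_src] kc] by (simp add: o_def)
    from cont_smul[OF this \<sigma>(1)] show "continuous_map (subtopology T U) TL f"
      by (rule continuous_map_eq) (simp add: f_def topspace_T)
    show "\<exists>K. compactin T K \<and> K \<subseteq> U \<and> (\<forall>a\<in>arr - K. f a = zr a)"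
    proof (intro exI conjI ballI)
      show "compactin T {a \<in> U. s a \<in> K'}" by (rule compact_src_preimage[OF U K'(1,2)])
      fix a assume a: "a \<in> arr - {a \<in> U. s a \<in> K'}"
      have "k (s a) = 0" if "a \<in> U" using K'(3) src_unit[of a] a that by blast
      thus "f a = zr a" using a \<sigma>(2) by (auto simp: f_def fb_zero_smul)
    qed blast
  qed
  moreover have "f g \<noteq> zr g" using g ga k(2) \<sigma>(2,3) by (simp add: f_def fb_smul_one)
  ultimately show ?thesis by blast
qed

lemma unit_function: assumes x: "x \<in> X" shows "\<exists>u. cfun u \<and> (\<forall>y. cmod (u y) \<le> 1) \<and> u x = 1"
proof -
  have V: "compactin TX {x}" "openin TX X" "{x} \<subseteq> X" using x openin_topspace[of TX] by (simp_all add: topspace_TX)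
  obtain k :: "'g \<Rightarrow> real" where k: "cfun (\<lambda>y. of_real (k y))" "\<forall>y. 0 \<le> k y \<and> k y \<le> 1" "\<forall>y\<in>{x}. k y = 1"
    using bump[OF V] by (elim exE conjE)
  have "\<forall>y. cmod (of_real (k y)) \<le> 1" using k(2) by simp
  thus ?thesis using k(1,3) by (intro exI[of _ "\<lambda>y. of_real (k y)"]) simp
qed

text \<open>The vectors \<open>(\<delta>\<^sub>x + c \<delta>\<^sub>\<gamma>)/\<surd>2\<close> with \<open>\<gamma>\<close> in the isotropy group of \<open>x\<close> give functionals that
  agree with the evaluation at \<open>x\<close> on functions; the off-diagonal coefficient at \<open>\<gamma>\<close> tells them apart
  from it for one of \<open>c = 1\<close> and \<open>c = i\<close>.\<close>

lemma isotropy_vector: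
  assumes x: "x \<in> X" and g: "g \<in> isotropy G x" "g \<noteq> x"
  shows "\<exists>h f. f \<in> carrier CA \<and> L2_set (\<lambda>a. cmod (h a)) {x, g} = 1 \<and> vst {x, g} h f \<noteq> pv x f"
proof -
  have ga: "g \<in> arr" "s g = x" "r g = x" using g(1) by (simp_all add: isotropy_def)
  obtain U where U: "open_bisection G U" "g \<in> U" using bisection_through[OF ga(1)] by (elim exE conjE)
  obtain f where f: "f \<in> Cc U" "f g \<noteq> zr g" using section_through[OF U] by (rule bexE)
  note fs = ccD(1)[OF U(1) f(1)] and xx = unitD[OF x]
  have z: "mat f g x \<noteq> 0" using mat_src[OF fs ga(1)] ga(2) crd_eq_0[OF ga(1) secs_fb[OF fs ga(1)]] f(2) by simp
  have d: "mat f g g = pv x f" "mat f x x = pv x f" using mat_diag[OF fs ga(1)] mat_diag[OF fs xx(1)] ga xx by simp_all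
  define h where "h c a = (if a = x then 1 else c) / complex_of_real (sqrt 2)" for c and a :: 'g
  have sq: "complex_of_real (sqrt 2) * complex_of_real (sqrt 2) = 2" by (simp flip: of_real_mult)
  have hh: "cnj (h c a) * (m * h c b) = cnj (if a = x then 1 else c) * m * (if b = x then 1 else c) / 2" for c a b m
    by (simp add: h_def sq)
  have v: "2 * (vst {x, g} (h c) f - pv x f) = c * mat f x g + cnj c * mat f g x" if c: "cnj c * c = 1" for c
  proof -
    have "vst {x, g} (h c) f = (\<Sum>a\<in>{x, g}. \<Sum>b\<in>{x, g}. cnj (h c a) * (mat f a b * h c b))"
      unfolding vst_def sum_distrib_left ..
    also have "\<dots> = (mat f x x + mat f x g * c + (cnj c * mat f g x + (cnj c * c) * mat f g g)) / 2"
      unfolding hh using g(2) by (simp add: add_divide_distrib mult_ac)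
    finally show ?thesis unfolding c d by (simp add: field_simps)
  qed
  have n: "L2_set (\<lambda>a. cmod (h c a)) {x, g} = 1" if "cmod c = 1" for c
    using g(2) that by (simp add: L2_set_def h_def norm_divide power_divide)
  (* If c = 1 fails, the two off-diagonal entries are opposite, and their difference is not zero. *)
  have "\<exists>c. cmod c = 1 \<and> cnj c * c = 1 \<and> c * mat f x g + cnj c * mat f g x \<noteq> 0"
  proof (cases "mat f x g + mat f g x = 0")
    case True
    hence "mat f x g = - mat f g x" by (simp only: add_eq_0_iff2)
    hence eq: "\<i> * mat f x g + cnj \<i> * mat f g x = - 2 * \<i> * mat f g x" by simp
    have "- 2 * \<i> * mat f g x \<noteq> 0" using z by simp
    hence "\<i> * mat f x g + cnj \<i> * mat f g x \<noteq> 0" unfolding eq .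
    thus ?thesis by (intro exI[of _ \<i>] conjI, simp, simp)
  next
    case False
    thus ?thesis by (intro exI[of _ 1]) simp
  qed
  then obtain c where c: "cmod c = 1" "cnj c * c = 1" "c * mat f x g + cnj c * mat f g x \<noteq> 0" by (elim exE conjE)
  have "vst {x, g} (h c) f \<noteq> pv x f" using v[OF c(2)] c(3) by auto
  thus ?thesis using gen_CA[OF U(1) f(1)] n[OF c(1)] by blast
qed

end

context fell_cstar_norm
begin

abbreviation BB where "BB \<equiv> completion CA N"
abbreviation AA where "AA \<equiv> norm_closure BB (completion_embed CA N ` Cc X)"

text \<open>On a function the functional takes the value at the common range \<open>x\<close> of the arrows in \<open>E\<close>, so on \<open>A\<close>
  it agrees with the evaluation.\<close>

lemma vector_state:
  assumes x: "x \<in> X" and ev: "exts (pv x) ev"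
    and E: "finite E" "E \<subseteq> gx x" "\<And>a. a \<in> E \<Longrightarrow> r a = x" and h: "L2_set (\<lambda>a. cmod (h a)) E = 1"
  shows "\<exists>\<psi>. \<psi> \<in> extensional (carrier BB) \<and> is_state BB \<psi> \<and> (\<forall>a\<in>AA. \<psi> a = ev a) \<and>
    (\<forall>f\<in>carrier CA. \<psi> (completion_embed CA N f) = vst E h f)"
proof -
  interpret I: normed_star_algebra CA N by (rule nsa)
  have Ea: "E \<subseteq> arr" using E(2) by (auto simp: gx_iff)
  note vf = vst_fn[OF E(1) Ea E(3) h]
  note b = vst_functional[OF x E(1,2) h]
  define \<psi> where "\<psi> b = lim (\<lambda>n. vst E h (representative b n))" for b
  have ex: "exts (vst E h) \<psi>" unfolding \<psi>_def by (rule I.extension_exists[OF b])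
  obtain u where u: "cfun u" "\<forall>y. cmod (u y) \<le> 1" "u x = 1" using unit_function[OF x] by (elim exE conjE)
  have Nu: "N (fn u) \<le> 1" by (rule fn_norm_le[OF cstar_norm u(1) spec[OF u(2)]]) simp
  have st: "is_state BB (restrict \<psi> (carrier BB))"
  proof (rule I.extends_state[OF ex b _ fn_CA[OF u(1)] Nu])
    show "vst E h (amul CA (aadj CA a) a) \<in> \<real>\<^sub>\<ge>\<^sub>0" if "a \<in> carrier CA" for a
      unfolding CA_simps(5,6) by (rule vst_positive[OF CA_finsec[OF that] E(1)])
    show "vst E h (fn u) = 1" using vf[of u] u(3) by simp
  qed
  have DX: "Cc X \<subseteq> carrier CA" using CcX_subspace by (simp add: lin_subspace_def)
  have "restrict \<psi> (carrier BB) a = ev a" if aA: "a \<in> AA" for a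
  proof -
    obtain d where d: "d \<in> cauchy_seqs CA N" "\<forall>n. d n \<in> Cc X" "a = cauchy_class CA N d"
      using aA unfolding I.closure_emb[OF DX] by (elim bexE conjE)
    have "vst E h (d n) = pv x (d n)" for n
    proof -
      obtain k where k: "cfun k" "d n = fn k" using spec[OF d(2), of n] unfolding CcX_iff by (elim exE conjE)
      show ?thesis unfolding k(2) using vf[of k] pv_fn[OF k(1) x] by simp
    qed
    hence "(\<lambda>n. pv x (d n)) \<longlonglongrightarrow> \<psi> a" using I.extendsD[OF ex d(1)] d(3) by simp
    hence "\<psi> a = ev a" using LIMSEQ_unique I.extendsD[OF ev d(1)] d(3) by blast
    moreover have "a \<in> carrier BB" using aA by (simp add: norm_closure_def)
    ultimately show ?thesis by simp
  qed
  moreover have "restrict \<psi> (carrier BB) (completion_embed CA N f) = vst E h f" if "f \<in> carrier CA" for f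
    using I.extends_linear(4)[OF ex b that] I.emb_closed[OF that] by simp
  ultimately show ?thesis using st by (intro exI[of _ "restrict \<psi> (carrier BB)"]) simp
qed

lemma localized_point_trivial_isotropy:
  assumes x: "x \<in> X" and iso: "isotropy G x = {x}" and ev: "exts (pv x) ev"
  shows "\<exists>e F. localized_point BB AA ev e F"
proof -
  obtain u where u: "cfun u" "\<forall>y. cmod (u y) \<le> 1" "u x = 1" using unit_function[OF x] by (elim exE conjE)
  have "pv x (fn u) = 1" using pv_fn[OF u(1) x] u(3) by simp
  from dense_point.localized_point[OF dense_point_trivial_isotropy[OF x iso fn_cc[OF u(1)] this ev]]
  show ?thesis by blast
qed

text \<open>For trivial isotropy, every state extending the evaluation is the evaluation of \<open>B\<close>. Otherwise a
  vector functional gives a second extension.\<close>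

theorem free_point_iff:
  assumes x: "x \<in> X" and ev: "exts (pv x) (ev x)"
  shows "free_point BB AA ev x \<longleftrightarrow> isotropy G x = {x}"
proof -
  have "\<exists>\<psi>. \<psi> \<in> extensional (carrier BB) \<and> is_state BB \<psi> \<and> (\<forall>a\<in>AA. \<psi> a = ev x a) \<and>
    (\<forall>f\<in>carrier CA. \<psi> (completion_embed CA N f) = vst {x} (\<lambda>_. 1) f)"
    by (rule vector_state[OF x ev _ unit_gx[OF x]]) (use unitD[OF x] in simp_all)
  then obtain \<psi> where \<psi>: "\<psi> \<in> extensional (carrier BB)" "is_state BB \<psi>" "\<forall>a\<in>AA. \<psi> a = ev x a"
    "\<forall>f\<in>carrier CA. \<psi> (completion_embed CA N f) = vst {x} (\<lambda>_. 1) f" by (elim exE conjE)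
  show ?thesis
proof
  assume iso: "isotropy G x = {x}"
  obtain e F where lp: "localized_point BB AA (ev x) e F"
    using localized_point_trivial_isotropy[where ev="ev x", OF x iso ev] by (elim exE)
  have uq: "\<psi>' b = ev x b" if st: "is_state BB \<psi>'" and A: "\<forall>a\<in>AA. \<psi>' a = ev x a" and b: "b \<in> carrier BB" for \<psi>' b
    by (rule localized_point.state_unique[OF lp st bspec[OF A] b])
  show "free_point BB AA ev x"
    unfolding free_point_def
  proof (rule ex1I[of _ \<psi>])
    show "\<psi> \<in> extensional (carrier BB) \<and> is_state BB \<psi> \<and> (\<forall>a\<in>AA. \<psi> a = ev x a)" using \<psi> by simp
    fix \<psi>' assume "\<psi>' \<in> extensional (carrier BB) \<and> is_state BB \<psi>' \<and> (\<forall>a\<in>AA. \<psi>' a = ev x a)"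
    hence H: "\<psi>' \<in> extensional (carrier BB)" "is_state BB \<psi>'" "\<forall>a\<in>AA. \<psi>' a = ev x a" by simp_all
    show "\<psi>' = \<psi>"
      by (rule extensionalityI[OF H(1) \<psi>(1)]) (simp add: uq[OF H(2,3)] uq[OF \<psi>(2,3)])
  qed
next
  assume fr: "free_point BB AA ev x"
  show "isotropy G x = {x}"
  proof (rule ccontr)
    assume "isotropy G x \<noteq> {x}"
    moreover have "x \<in> isotropy G x" using unitD[OF x] by (simp add: isotropy_def)
    ultimately have "\<exists>g. g \<in> isotropy G x \<and> g \<noteq> x" by blast
    then obtain g where g: "g \<in> isotropy G x" "g \<noteq> x" by (elim exE conjE)
    obtain h f where hf: "f \<in> carrier CA" "L2_set (\<lambda>a. cmod (h a)) {x, g} = 1" "vst {x, g} h f \<noteq> pv x f"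
      using isotropy_vector[OF x g] by (elim exE conjE)
    have "\<exists>\<psi>. \<psi> \<in> extensional (carrier BB) \<and> is_state BB \<psi> \<and> (\<forall>a\<in>AA. \<psi> a = ev x a) \<and>
      (\<forall>f\<in>carrier CA. \<psi> (completion_embed CA N f) = vst {x, g} h f)"
      by (rule vector_state[OF x ev _ _ _ hf(2)]) (use unitD[OF x] g(1) in \<open>auto simp: isotropy_def gx_iff\<close>)
    then obtain \<psi>' where \<psi>': "\<psi>' \<in> extensional (carrier BB)" "is_state BB \<psi>'" "\<forall>a\<in>AA. \<psi>' a = ev x a"
      "\<forall>f\<in>carrier CA. \<psi>' (completion_embed CA N f) = vst {x, g} h f" by (elim exE conjE)
    have "\<psi> = \<psi>'" using fr \<psi>(1-3) \<psi>'(1-3) unfolding free_point_def by blast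
    hence "vst {x, g} h f = vst {x} (\<lambda>_. 1) f" using \<psi>(4) \<psi>'(4) hf(1) by metis
    thus False using hf(3) pv_vst[OF x finsec_secs[OF CA_finsec[OF hf(1)]]] by simp
  qed
qed
qed

theorem free_point_localization:
  assumes x: "x \<in> X" and ev: "exts (pv x) (ev x)" and fr: "free_point BB AA ev x" and b: "b \<in> carrier BB"
  shows "scalar_of (loc_alg BB (point_ideal AA ev x)) (localizing_projection BB (point_ideal AA ev x) b) = ev x b"
proof -
  have iso: "isotropy G x = {x}" using free_point_iff[where ev=ev, OF x ev] fr by simp
  obtain e F where lp: "localized_point BB AA (ev x) e F"
    using localized_point_trivial_isotropy[where ev="ev x", OF x iso ev] by (elim exE)
  have J: "localized_point.J AA (ev x) = point_ideal AA ev x"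
    unfolding localized_point.J_def[OF lp] point_ideal_def ..
  show ?thesis using localized_point.localizing_projection_value[OF lp b] unfolding J .
qed

lemma topologically_free_iff:
  assumes ev: "\<And>x. x \<in> X \<Longrightarrow> exts (pv x) (ev x)"
  shows "topologically_free_inclusion TX BB AA ev \<longleftrightarrow> topologically_free_groupoid G"
proof -
  have "{x \<in> topspace TX. free_point BB AA ev x} = {x \<in> X. isotropy G x = {x}}"
    unfolding topspace_TX using free_point_iff[where ev=ev, OF _ ev] by auto
  thus ?thesis unfolding topologically_free_inclusion_def topologically_free_groupoid_def topspace_TX by simp
qed

end

theorem corollary17p7:
  fixes G :: "'g groupoid" and L :: "('g, 'l) fell_bundle"
    and B :: "('g, 'l) completed normed_star_alg"
    and A :: "('g, 'l) completed set"
    and ev :: "'g \<Rightarrow> ('g, 'l) completed \<Rightarrow> complex"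
  assumes "etale_groupoid G" and "fell_line_bundle G L"
    and "(B, A, ev) = (full_cstar G L, full_C0 G L, full_value G L) \<or>
         (B, A, ev) = (red_cstar G L, red_C0 G L, red_value G L)"
  shows
    "(\<forall>x\<in>units G. free_point B A ev x \<longleftrightarrow> isotropy G x = {x}) \<and>
     (topologically_free_inclusion (unit_top G) (full_cstar G L) (full_C0 G L) (full_value G L)
        \<longleftrightarrow> topologically_free_groupoid G) \<and>
     (topologically_free_inclusion (unit_top G) (red_cstar G L) (red_C0 G L) (red_value G L)
        \<longleftrightarrow> topologically_free_groupoid G) \<and>
     (\<forall>x\<in>units G. free_point B A ev x \<longrightarrow>
        (\<forall>b\<in>carrier B.
           scalar_of (loc_alg B (point_ideal A ev x)) (localizing_projection B (point_ideal A ev x) b)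
             = ev x b))"
proof -
  interpret fell_groupoid G L using assms(1,2) by (rule fell_groupoid.intro)
  interpret R: fell_cstar_norm G L "red_norm G L" by (rule fell_cstar_norm_red)
  interpret F: fell_cstar_norm G L "full_norm G L" by (rule fell_cstar_norm_full)
  have i: "free_point B A ev x \<longleftrightarrow> isotropy G x = {x}" if x: "x \<in> units G" for x
    using assms(3) F.free_point_iff[where ev="full_value G L", OF x full_value_extends[OF x]]
      R.free_point_iff[where ev="red_value G L", OF x red_value_extends[OF x]]
    unfolding full_cstar_def full_C0_def red_cstar_def red_C0_def by auto
  have iv: "scalar_of (loc_alg B (point_ideal A ev x)) (localizing_projection B (point_ideal A ev x) b) = ev x b"
    if x: "x \<in> units G" and fr: "free_point B A ev x" and b: "b \<in> carrier B" for x b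
    using assms(3)
  proof
    assume "(B, A, ev) = (full_cstar G L, full_C0 G L, full_value G L)"
    thus ?thesis
      using F.free_point_localization[where ev="full_value G L", OF x full_value_extends[OF x]] fr b
      unfolding full_cstar_def full_C0_def by simp
  next
    assume "(B, A, ev) = (red_cstar G L, red_C0 G L, red_value G L)"
    thus ?thesis
      using R.free_point_localization[where ev="red_value G L", OF x red_value_extends[OF x]] fr b
      unfolding red_cstar_def red_C0_def by simp
  qed
  show ?thesis
    using i iv F.topologically_free_iff[OF full_value_extends] R.topologically_free_iff[OF red_value_extends]
    unfolding full_cstar_def full_C0_def red_cstar_def red_C0_def by blast
qed

end
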